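(* Let $T=\mathbb{C}/\Lambda$, $\Lambda=\mathbb{Z}\omega_1+\mathbb{Z}\omega_2$, be a flat torus with $\mathrm{Im}\,(\omega_2/\omega_1)>0$ and area $|T|=1$. Let $p_1=0$ and let $p_2$ be one of $\frac{\omega_1}{2}$, $\frac{\omega_2}{2}$, $\frac{\omega_1+\omega_2}{2}$. Let $(u_n)$ be a sequence of evenly symmetric solutions (i.e. $u_n(z)=u_n(-z)$) of $$\Delta u_n+\rho_n\left(\frac{e^{u_n}}{\int_T e^{u_n}}-1\right)=0\ \text{ in } T,\qquad \int_T e^{u_n}=1,$$ blowing up at the two points $p_1,p_2$. Then for all sufficiently large $n$ one has $u_n(z)=u_n(z+p_2)$, so that $u_n$ descends to the half torus $T_{1/2}:=\mathbb{C}/(\Lambda+\mathbb{Z}p_2)$ of area $|T_{1/2}|=\frac12$, where it solves the mean field equation $$\Delta u_n+\frac{\rho_n}{2}\left(\frac{e^{u_n}}{\int_{T_{1/2}}e^{u_n}}-\frac{1}{|T_{1/2}|}\right)=0\quad\text{in } T_{1/2},$$ and as a sequence of solutions on $T_{1/2}$ it blows up at exactly one point, the origin.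
   Context: For a flat torus $M$, a sequence $(u_n)$ of solutions of $\Delta u_n+\sigma_n\left(\frac{e^{u_n}}{\int_M e^{u_n}}-\frac1{|M|}\right)=0$ in $M$, normalized so that $\int_M e^{u_n}$ is a fixed positive constant independent of $n$, is said to blow up at the (distinct) points $q_1,\dots,q_m\in M$ if it is not uniformly bounded from above, $\sigma_n\to 8\pi m$, and $\sigma_n\frac{e^{u_n}}{\int_M e^{u_n}}\rightharpoonup 8\pi\sum_{i=1}^m\delta_{q_i}$ weakly in the sense of measures on $M$. *)

theory Defs
  imports "HOL-Analysis.Analysis"
begin

text \<open>Points of a flat torus are represented by complex numbers modulo a lattice,
  and functions on the torus by lattice-periodic functions on the complex plane.\<close>

definition lattice :: "complex \<Rightarrow> complex \<Rightarrow> complex set" where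
  "lattice a b = {of_int m * a + of_int n * b | m n. True}"

definition adjoin :: "complex set \<Rightarrow> complex \<Rightarrow> complex set" where
  "adjoin L p = {l + of_int k * p | l k. l \<in> L}"

definition periodic :: "complex set \<Rightarrow> (complex \<Rightarrow> 'a) \<Rightarrow> bool" where
  "periodic L f \<longleftrightarrow> (\<forall>l\<in>L. \<forall>z. f (z + l) = f z)"

definition parallelogram :: "complex \<Rightarrow> complex \<Rightarrow> complex set" where
  "parallelogram a b = {of_real s * a + of_real t * b | s t. s \<in> {0..<1} \<and> t \<in> {0..<1}}"

text \<open>A fundamental domain of a lattice \<open>L\<close>. The basis is chosen arbitrarily; neither the area nor
  integrals of periodic functions depend on it.\<close>

definition fund_domain :: "complex set \<Rightarrow> complex set" where
  "fund_domain L =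
     (let (a, b) = (SOME (a, b). Im (b / a) > 0 \<and> L = lattice a b) in parallelogram a b)"

definition torus_area :: "complex set \<Rightarrow> real" where
  "torus_area L = measure lborel (fund_domain L)"

definition torus_integral :: "complex set \<Rightarrow> (complex \<Rightarrow> real) \<Rightarrow> real" where
  "torus_integral L f = (LINT z:fund_domain L|lborel. f z)"

definition dir_deriv :: "complex \<Rightarrow> (complex \<Rightarrow> real) \<Rightarrow> complex \<Rightarrow> real" where
  "dir_deriv v f z = deriv (\<lambda>t. f (z + of_real t * v)) 0"

definition laplacian :: "(complex \<Rightarrow> real) \<Rightarrow> complex \<Rightarrow> real" where
  "laplacian f z = dir_deriv 1 (dir_deriv 1 f) z + dir_deriv \<i> (dir_deriv \<i> f) z"

definition C2 :: "(complex \<Rightarrow> real) \<Rightarrow> bool" where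
  "C2 f \<longleftrightarrow> (\<exists>(f' :: complex \<Rightarrow> complex \<Rightarrow>\<^sub>L real) (f'' :: complex \<Rightarrow> complex \<Rightarrow>\<^sub>L complex \<Rightarrow>\<^sub>L real).
     (\<forall>z. (f has_derivative blinfun_apply (f' z)) (at z)) \<and>
     (\<forall>z. (f' has_derivative blinfun_apply (f'' z)) (at z)) \<and>
     continuous_on UNIV f'')"

text \<open>Classical solutions of the mean field equation with parameter \<open>\<sigma>\<close> on the torus
  with period lattice \<open>L\<close>.\<close>

definition mean_field_solution :: "complex set \<Rightarrow> real \<Rightarrow> (complex \<Rightarrow> real) \<Rightarrow> bool" where
  "mean_field_solution L \<sigma> u \<longleftrightarrow> periodic L u \<and> C2 u \<and>
     (\<forall>z. laplacian u z
        + \<sigma> * (exp (u z) / torus_integral L (\<lambda>w. exp (u w)) - 1 / torus_area L) = 0)"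

text \<open>The points \<open>qs\<close> are pairwise distinct on the torus, that is, modulo \<open>L\<close>; weak convergence
  of measures is tested against the continuous functions on the (compact) torus.\<close>

definition blows_up_at ::
  "complex set \<Rightarrow> (nat \<Rightarrow> complex \<Rightarrow> real) \<Rightarrow> (nat \<Rightarrow> real) \<Rightarrow> complex list \<Rightarrow> bool" where
  "blows_up_at L u \<sigma> qs \<longleftrightarrow>
     (\<forall>n. mean_field_solution L (\<sigma> n) (u n)) \<and>
     (\<exists>c>0. \<forall>n. torus_integral L (\<lambda>z. exp (u n z)) = c) \<and>
     sorted_wrt (\<lambda>p q. p - q \<notin> L) qs \<and>
     \<not> (\<exists>C. \<forall>n z. u n z \<le> C) \<and>
     \<sigma> \<longlonglongrightarrow> 8 * pi * real (length qs) \<and>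
     (\<forall>\<phi>. continuous_on UNIV \<phi> \<and> periodic L \<phi> \<longrightarrow>
        (\<lambda>n. torus_integral L
               (\<lambda>z. \<sigma> n * (exp (u n z) / torus_integral L (\<lambda>w. exp (u n w))) * \<phi> z))
          \<longlonglongrightarrow> 8 * pi * (\<Sum>q\<leftarrow>qs. \<phi> q))"

end

theory Submission
  imports Defs
begin

text \<open>Put \<open>w z = u z - u (z + p2)\<close> and \<open>W = max \<bar>w\<bar>\<close>. Away from the two blow-up points the factor \<open>exp u\<close> is
  uniformly small and the oscillation of \<open>u\<close> is bounded, so \<open>w\<close> is almost harmonic there. Since \<open>w\<close> is odd
  under translation by \<open>p2\<close>, the energy of \<open>w\<close> times a power of the exponential of \<open>u z + u (z + p2)\<close>,
  which suppresses the blow-up points, controls its \<open>L\<^sup>2\<close> norm. This gives \<open>\<bar>w\<bar> \<le> \<epsilon> W\<close> outside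
  discs of radius \<open>\<delta>\<close>.

  Inside such a disc the Schwarzian \<open>u\<^sub>z\<^sub>z - u\<^sub>z\<^sup>2/2\<close> is bounded, and it changes by at most a multiple of \<open>W\<close> when \<open>u\<close>
  is replaced by its translate. Along a ray from the centre, \<open>exp (- u / 2)\<close> solves a linear system that
  depends only on \<open>\<rho>\<close> and the Schwarzian; as \<open>u\<close> is even, the initial data depend only on the value of \<open>u\<close> at
  the centre, which is recovered from the boundary circle. Hence \<open>\<bar>w\<bar> \<le> K (\<epsilon> + \<delta>\<^sup>2) W\<close> in the disc, and small
  \<open>\<delta>\<close> and \<open>\<epsilon>\<close> force \<open>W = 0\<close>.\<close>

subsection \<open>Circle means and Wirtinger derivatives\<close>

text \<open>The obstacle is the kernel of the linearised Liouville equation at a bubble. Its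
  translation modes decay away from the centre, so a surrounding circle does not see them; the
  dilation mode survives there. Evenness excludes the former, and the latter corresponds to the
  single free initial value \<open>exp (- u 0 / 2)\<close> of the ray system. Using this system
  instead of rescaled limits keeps all constants uniform: its coefficient stays bounded although
  \<open>u\<close> does not. In place of sequences and compactness, each estimate says that some
  \<open>\<eta> > 0\<close> works for all \<open>concentrated\<close> solutions. The order of
  quantifiers is decisive: the constant of the inner estimate is fixed before
  \<open>\<delta>\<close>, while \<open>\<eta>\<close> may depend on \<open>\<delta>\<close> and
  \<epsilon>. Outside the discs, testing the equation of \<open>w\<close> with \<open>w\<close>
  alone fails, since \<open>exp u\<close> has most of its mass near the blow-up points. The weight
  has a small exponent \<open>1 / H\<close>: it still tends to 0 at those points, stays bounded
  below elsewhere, and its gradient contributes only \<open>16 / H\<close>. The antisymmetry of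
  \<open>w\<close> replaces a mean value condition in the Poincare inequality.\<close>

definition cmean :: "int \<Rightarrow> complex \<Rightarrow> (complex \<Rightarrow> complex) \<Rightarrow> real \<Rightarrow> complex" where
  "cmean k a g r = integral {0..2*pi} (\<lambda>t. cis (of_int k * t) * g (a + of_real r * cis t)) / (2*pi)"

definition rmean :: "complex \<Rightarrow> (complex \<Rightarrow> real) \<Rightarrow> real \<Rightarrow> real" where
  "rmean a f r = integral {0..2*pi} (\<lambda>t. f (a + of_real r * cis t)) / (2*pi)"

text \<open>\<open>\<alpha>\<close> and \<open>\<beta>\<close> are the derivatives of \<open>g\<close> with respect to \<open>z\<close> and its conjugate.\<close>

definition wirt :: "(complex \<Rightarrow> complex) \<Rightarrow> complex \<Rightarrow> complex \<Rightarrow> complex \<Rightarrow> bool" where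
  "wirt g \<alpha> \<beta> z \<longleftrightarrow> (g has_derivative (\<lambda>v. \<alpha> * v + \<beta> * cnj v)) (at z)"

lemma wirt_continuous_on: "(\<And>z. wirt g (\<alpha> z) (\<beta> z) z) \<Longrightarrow> continuous_on S g"
  unfolding wirt_def by (rule continuous_at_imp_continuous_on) (blast intro: has_derivative_continuous)

lemma continuous_circle:
  assumes "continuous_on UNIV (g :: complex \<Rightarrow> 'a::topological_space)" "continuous_on S f" "continuous_on S h"
  shows "continuous_on S (\<lambda>x. g (a + of_real (f x) * cis (h x)))"
  by (rule continuous_on_compose2[OF assms(1)]) (auto intro!: continuous_intros assms)

lemma cmean_integrable:
  assumes "continuous_on UNIV g"
  shows "(\<lambda>t. cis (of_int k * t) * g (a + of_real r * cis t)) integrable_on {c..d}"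
  by (intro integrable_continuous_interval continuous_intros continuous_circle assms)

lemma rmean_integrable:
  assumes "continuous_on UNIV f"
  shows "(\<lambda>t. f (a + of_real r * cis t) :: real) integrable_on {c..d}"
  by (intro integrable_continuous_interval continuous_intros continuous_circle assms)

lemma cmean_diff:
  assumes "continuous_on UNIV f" "continuous_on UNIV g"
  shows "cmean k a (\<lambda>z. f z - g z) r = cmean k a f r - cmean k a g r"
  unfolding cmean_def
  by (simp add: right_diff_distrib Henstock_Kurzweil_Integration.integral_diff[OF cmean_integrable[OF assms(1)] cmean_integrable[OF assms(2)]] diff_divide_distrib)

lemma cmean_cmult:
  shows "cmean k a (\<lambda>z. c * g z) r = c * cmean k a g r"
proof -
  have "(\<lambda>t. cis (of_int k * t) * (c * g (a + of_real r * cis t))) = (\<lambda>t. c * (cis (of_int k * t) * g (a + of_real r * cis t)))"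
    by (auto simp: mult_ac)
  then show ?thesis by (simp add: cmean_def)
qed

lemma rmean_add:
  assumes "continuous_on UNIV f" "continuous_on UNIV g"
  shows "rmean a (\<lambda>z. f z + g z) r = rmean a f r + rmean a g r"
  unfolding rmean_def
  by (simp add: Henstock_Kurzweil_Integration.integral_add[OF rmean_integrable[OF assms(1)] rmean_integrable[OF assms(2)]] add_divide_distrib)

lemma rmean_diff:
  assumes "continuous_on UNIV f" "continuous_on UNIV g"
  shows "rmean a (\<lambda>z. f z - g z) r = rmean a f r - rmean a g r"
  unfolding rmean_def
  by (simp add: Henstock_Kurzweil_Integration.integral_diff[OF rmean_integrable[OF assms(1)] rmean_integrable[OF assms(2)]] diff_divide_distrib)

lemma rmean_cmult: "rmean a (\<lambda>z. c * f z) r = c * rmean a f r"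
  by (simp add: rmean_def)

lemma rmean_const [simp]: "rmean a (\<lambda>z. c) r = c"
  by (simp add: rmean_def)

lemma rmean_mono:
  assumes "continuous_on UNIV f" "continuous_on UNIV g" "\<And>z. dist a z = \<bar>r\<bar> \<Longrightarrow> f z \<le> g z"
  shows "rmean a f r \<le> rmean a g r"
  unfolding rmean_def
  by (intro divide_right_mono integral_le rmean_integrable assms) (auto simp: dist_norm norm_mult)

lemma rmean_le:
  assumes "continuous_on UNIV f" "\<And>z. dist a z = \<bar>r\<bar> \<Longrightarrow> f z \<le> c"
  shows "rmean a f r \<le> c"
  using rmean_mono[of f "\<lambda>_. c" a r] assms by auto

lemma rmean_ge:
  assumes "continuous_on UNIV f" "\<And>z. dist a z = \<bar>r\<bar> \<Longrightarrow> c \<le> f z"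
  shows "c \<le> rmean a f r"
  using rmean_mono[of "\<lambda>_. c" f a r] assms by auto

lemma norm_cmean_le:
  assumes "continuous_on UNIV g"
  shows "norm (cmean k a g r) \<le> rmean a (\<lambda>z. norm (g z)) r"
proof -
  have "norm (integral {0..2*pi} (\<lambda>t. cis (of_int k * t) * g (a + of_real r * cis t)))
     \<le> integral {0..2*pi} (\<lambda>t. norm (g (a + of_real r * cis t)))"
    by (intro integral_norm_bound_integral cmean_integrable assms rmean_integrable continuous_intros)
       (auto simp: norm_mult)
  then show ?thesis
    by (simp add: cmean_def rmean_def norm_divide divide_right_mono)
qed

lemma norm_cmean_bound:
  assumes "continuous_on UNIV g" "\<And>z. dist a z = \<bar>r\<bar> \<Longrightarrow> norm (g z) \<le> c"
  shows "norm (cmean k a g r) \<le> c"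
  by (rule order_trans[OF norm_cmean_le[OF assms(1)] rmean_le]) (auto intro!: continuous_intros continuous_circle assms)

lemma cmean_of_real: 
  assumes "continuous_on UNIV f"
  shows "cmean 0 a (\<lambda>z. of_real (f z)) r = of_real (rmean a f r)"
  unfolding cmean_def rmean_def 
  by (simp add: integral_linear[OF rmean_integrable[OF assms] bounded_linear_of_real, unfolded o_def])

lemma continuous_on_cmean:
  assumes "continuous_on UNIV g"
  shows "continuous_on S (cmean k a g)"
proof -
  have "continuous_on UNIV (\<lambda>r. integral (cbox 0 (2*pi)) (\<lambda>t. cis (of_int k * t) * g (a + of_real r * cis t)))"
    by (rule integral_continuous_on_param) (auto simp: split_def intro!: continuous_intros continuous_circle assms)
  then have "continuous_on UNIV (\<lambda>r. integral {0..2*pi} (\<lambda>t. cis (of_int k * t) * g (a + of_real r * cis t)) / (2*pi))"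
    by (auto intro!: continuous_intros continuous_circle)
  then show ?thesis
    unfolding cmean_def[abs_def] by (rule continuous_on_subset) auto
qed

lemma continuous_on_rmean:
  assumes "continuous_on UNIV f"
  shows "continuous_on S (rmean a f)"
proof -
  have "continuous_on S (\<lambda>r. Re (cmean 0 a (\<lambda>z. of_real (f z)) r))"
    by (intro continuous_intros continuous_on_cmean assms)
  then show ?thesis by (simp add: cmean_of_real[OF assms])
qed

lemma cis_has_vector_derivative:
  "((\<lambda>t. cis (c * t)) has_vector_derivative (\<i> * of_real c * cis (c * t))) (at t within S)"
proof -
  have "((\<lambda>z. exp (\<i> * of_real c * z)) has_field_derivative (\<i> * of_real c * exp (\<i> * of_real c * of_real t))) (at (of_real t))"
    by (auto intro!: derivative_eq_intros)
  from has_vector_derivative_real_field[OF this]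
  show ?thesis by (simp add: cis_conv_exp mult_ac)
qed

lemma integral_cis: "integral {0..2*pi} (\<lambda>t. cis (of_int k * t)) = (if k = 0 then 2*pi else 0)"
proof (cases "k = 0")
  case False
  have "((\<lambda>t. cis (of_int k * t)) has_integral (cis (of_int k * (2*pi)) / (\<i> * of_int k) - cis (of_int k * 0) / (\<i> * of_int k))) {0..2*pi}"
  proof (rule fundamental_theorem_of_calculus)
    fix t :: real
    show "((\<lambda>t. cis (of_int k * t) / (\<i> * of_int k)) has_vector_derivative cis (of_int k * t)) (at t within {0..2*pi})"
      using has_vector_derivative_divide[OF cis_has_vector_derivative[of "of_int k" t "{0..2*pi}"], of "\<i> * of_int k"] False
      by simp
  qed auto
  moreover have "cis (of_int k * (2*pi)) = 1"
    by (metis cis_multiple_2pi Ints_of_int mult.commute)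
  ultimately show ?thesis using False by (simp add: integral_unique)
qed (simp add: scaleR_conv_of_real)

lemma cmean_0: "cmean k a g 0 = (if k = 0 then g a else 0)"
  using integral_cis[of k] by (simp add: cmean_def)

lemma cmean_const: "cmean k a (\<lambda>_. c) r = (if k = 0 then c else 0)"
  using integral_cis[of k] by (simp add: cmean_def)

lemma rmean_0 [simp]: "rmean a f 0 = f a"
  by (simp add: rmean_def)

lemma wirt_radial:
  assumes "wirt g \<alpha> \<beta> (a + of_real r * cis t)"
  shows "((\<lambda>r. g (a + of_real r * cis t)) has_vector_derivative (\<alpha> * cis t + \<beta> * cis (-t))) (at r within S)"
proof -
  have "((\<lambda>r. a + of_real r * cis t) has_derivative (\<lambda>h. of_real h * cis t)) (at r within S)"
    by (auto intro!: derivative_eq_intros)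
  from has_derivative_in_compose[OF this has_derivative_at_withinI[OF assms[unfolded wirt_def]]]
  show ?thesis
    by (auto simp: has_vector_derivative_def scaleR_conv_of_real cis_cnj algebra_simps)
qed

lemma wirt_angular:
  assumes "wirt g \<alpha> \<beta> (a + of_real r * cis t)"
  shows "((\<lambda>t. g (a + of_real r * cis t)) has_vector_derivative (\<i> * r * (\<alpha> * cis t - \<beta> * cis (-t)))) (at t within S)"
proof -
  have "((\<lambda>t. a + of_real r * cis t) has_vector_derivative of_real r * (\<i> * cis t)) (at t within S)"
    using cis_has_vector_derivative[of 1 t S] by (auto intro!: derivative_eq_intros)
  then have "((\<lambda>t. a + of_real r * cis t) has_derivative (\<lambda>h. of_real r * (of_real h * (\<i> * cis t)))) (at t within S)"
    by (simp add: has_vector_derivative_def scaleR_conv_of_real mult_ac)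
  from has_derivative_in_compose[OF this has_derivative_at_withinI[OF assms[unfolded wirt_def]]]
  show ?thesis
    by (auto simp: has_vector_derivative_def scaleR_conv_of_real cis_cnj algebra_simps)
qed

text \<open>In polar coordinates the radial derivative of \<open>g\<close> is
  \<open>\<alpha> * cis t + \<beta> * cis (- t)\<close>, so the two Wirtinger derivatives enter with
  the Fourier index moved up and down by one.\<close>

lemma cmean_has_vector_derivative:
  assumes W: "\<And>z. wirt g (\<alpha> z) (\<beta> z) z" and c: "continuous_on UNIV \<alpha>" "continuous_on UNIV \<beta>"
  shows "(cmean k a g has_vector_derivative (cmean (k+1) a \<alpha> r + cmean (k-1) a \<beta> r)) (at r within S)"
proof -
  have cg: "continuous_on UNIV g" by (rule wirt_continuous_on[OF W])
  have "((\<lambda>r. integral (cbox 0 (2*pi)) (\<lambda>t. cis (of_int k * t) * g (a + of_real r * cis t))) has_vector_derivative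
     integral (cbox 0 (2*pi)) (\<lambda>t. cis (of_int k * t) * (\<alpha> (a + of_real r * cis t) * cis t + \<beta> (a + of_real r * cis t) * cis (-t)))) (at r within UNIV)"
    by (rule leibniz_rule_vector_derivative)
       (auto simp: split_def intro!: continuous_intros continuous_circle c cmean_integrable cg has_vector_derivative_mult_right wirt_radial W)
  also have "(\<lambda>t. cis (of_int k * t) * (\<alpha> (a + of_real r * cis t) * cis t + \<beta> (a + of_real r * cis t) * cis (-t)))
    = (\<lambda>t. cis (of_int (k+1) * t) * \<alpha> (a + of_real r * cis t) + cis (of_int (k-1) * t) * \<beta> (a + of_real r * cis t))"
    by (auto simp: fun_eq_iff distrib_left cis_mult[symmetric] algebra_simps cis_divide[symmetric] divide_inverse)
  also have "integral (cbox 0 (2*pi)) \<dots> = integral {0..2*pi} (\<lambda>t. cis (of_int (k+1) * t) * \<alpha> (a + of_real r * cis t)) + integral {0..2*pi} (\<lambda>t. cis (of_int (k-1) * t) * \<beta> (a + of_real r * cis t))"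
    by (simp only: Henstock_Kurzweil_Integration.integral_add[OF cmean_integrable[OF c(1)] cmean_integrable[OF c(2)]] cbox_interval)
  finally have "((\<lambda>r. integral {0..2*pi} (\<lambda>t. cis (of_int k * t) * g (a + of_real r * cis t)) / (2*pi)) has_vector_derivative 
     (integral {0..2*pi} (\<lambda>t. cis (of_int (k+1) * t) * \<alpha> (a + of_real r * cis t)) + integral {0..2*pi} (\<lambda>t. cis (of_int (k-1) * t) * \<beta> (a + of_real r * cis t))) / (2*pi)) (at r)"
    by (auto simp: intro!: derivative_eq_intros)
  then show ?thesis
    unfolding cmean_def[abs_def] by (auto simp: add_divide_distrib intro: has_vector_derivative_at_within)
qed

text \<open>Integration by parts in the angle. It is a second relation between the two means in the
  radial derivative, so either of them can be eliminated.\<close>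

lemma cmean_parts:
  assumes W: "\<And>z. wirt g (\<alpha> z) (\<beta> z) z" and c: "continuous_on UNIV \<alpha>" "continuous_on UNIV \<beta>"
  shows "r * (cmean (k+1) a \<alpha> r - cmean (k-1) a \<beta> r) = - of_int k * cmean k a g r"
proof -
  have cg: "continuous_on UNIV g" by (rule wirt_continuous_on[OF W])
  let ?G = "\<lambda>t. cis (of_int k * t) * g (a + of_real r * cis t)"
  let ?A = "\<lambda>t. cis (of_int (k+1) * t) * \<alpha> (a + of_real r * cis t)"
  let ?B = "\<lambda>t. cis (of_int (k-1) * t) * \<beta> (a + of_real r * cis t)"
  have "((\<lambda>t. \<i> * of_int k * ?G t + \<i> * r * (?A t - ?B t)) has_integral (?G (2*pi) - ?G 0)) {0..2*pi}"
  proof (rule fundamental_theorem_of_calculus)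
    fix t
    have "((\<lambda>t. cis (of_int k * t)) has_vector_derivative \<i> * of_int k * cis (of_int k * t)) (at t within {0..2*pi})"
      using cis_has_vector_derivative[of "of_int k" t "{0..2*pi}"] by simp
    from has_vector_derivative_mult[OF this wirt_angular[OF W[of "a + of_real r * cis t"], of "{0..2*pi}"]]
    show "(?G has_vector_derivative \<i> * of_int k * ?G t + \<i> * r * (?A t - ?B t)) (at t within {0..2*pi})"
      by (rule has_vector_derivative_eq_rhs)
         (auto simp: distrib_left right_diff_distrib distrib_right left_diff_distrib cis_mult[symmetric] cis_divide[symmetric] divide_inverse)
  qed auto
  moreover have "?G (2*pi) = ?G 0"
    using cis_multiple_2pi[of "of_int k"] cis_multiple_2pi[of 1] by (simp add: mult.commute)
  ultimately have "integral {0..2*pi} (\<lambda>t. \<i> * of_int k * ?G t + \<i> * r * (?A t - ?B t)) = 0"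
    by (simp add: integral_unique)
  also have "integral {0..2*pi} (\<lambda>t. \<i> * of_int k * ?G t + \<i> * r * (?A t - ?B t)) =
     \<i> * of_int k * integral {0..2*pi} ?G + \<i> * r * (integral {0..2*pi} ?A - integral {0..2*pi} ?B)"
  proof -
    have "(\<lambda>t. \<i> * of_int k * ?G t) integrable_on {0..2*pi}" "(\<lambda>t. \<i> * r * (?A t - ?B t)) integrable_on {0..2*pi}"
      by (intro integrable_continuous_interval continuous_intros continuous_circle cg c)+
    from Henstock_Kurzweil_Integration.integral_add[OF this] show ?thesis
      by (simp only: integral_mult_right Henstock_Kurzweil_Integration.integral_diff[OF cmean_integrable[OF c(1)] cmean_integrable[OF c(2)]])
  qed
  finally have "of_int k * integral {0..2*pi} ?G + r * (integral {0..2*pi} ?A - integral {0..2*pi} ?B) = 0"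
    by (metis (no_types, lifting) complex_i_not_zero distrib_left mult.assoc mult_eq_0_iff)
  then show ?thesis
    unfolding cmean_def by (simp add: field_simps eq_neg_iff_add_eq_0 flip: diff_divide_distrib)
qed

text \<open>Only the conjugate derivative is left. For the function \<open>p\<close> of
  \<open>wdata\<close> this is a quarter of the Laplacian, so no bound on the second derivative
  \<open>h\<close> is required.\<close>

lemma cmean_deriv_lower:
  assumes "\<And>z. wirt g (\<alpha> z) (\<beta> z) z" "continuous_on UNIV \<alpha>" "continuous_on UNIV \<beta>" "r \<noteq> 0"
  shows "(cmean k a g has_vector_derivative (2 * cmean (k-1) a \<beta> r - of_int k / r * cmean k a g r)) (at r within S)"
proof -
  have "cmean (k+1) a \<alpha> r = cmean (k-1) a \<beta> r - of_int k / r * cmean k a g r"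
    using cmean_parts[OF assms(1-3), of r k a] assms(4) by (simp add: field_simps)
  then show ?thesis
    by (intro has_vector_derivative_eq_rhs[OF cmean_has_vector_derivative[OF assms(1-3), of k a r S]]) simp
qed

lemma cmean_deriv_upper:
  assumes "\<And>z. wirt g (\<alpha> z) (\<beta> z) z" "continuous_on UNIV \<alpha>" "continuous_on UNIV \<beta>" "r \<noteq> 0"
  shows "(cmean k a g has_vector_derivative (2 * cmean (k+1) a \<alpha> r + of_int k / r * cmean k a g r)) (at r within S)"
proof -
  have "cmean (k-1) a \<beta> r = cmean (k+1) a \<alpha> r + of_int k / r * cmean k a g r"
    using cmean_parts[OF assms(1-3), of r k a] assms(4) by (simp add: field_simps)
  then show ?thesis
    by (intro has_vector_derivative_eq_rhs[OF cmean_has_vector_derivative[OF assms(1-3), of k a r S]]) simp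
qed

text \<open>Here \<open>p = f\<^sub>z\<close>, \<open>h = f\<^sub>z\<^sub>z\<close>, and \<open>g\<close> is the Laplacian of \<open>f\<close>.\<close>

definition wdata :: "(complex \<Rightarrow> real) \<Rightarrow> (complex \<Rightarrow> complex) \<Rightarrow> (complex \<Rightarrow> complex) \<Rightarrow> (complex \<Rightarrow> real) \<Rightarrow> bool" where
  "wdata f p h g \<longleftrightarrow> (\<forall>z. (f has_derivative (\<lambda>v. 2 * Re (p z * v))) (at z)) \<and>
     (\<forall>z. wirt p (h z) (of_real (g z / 4)) z) \<and> continuous_on UNIV h \<and> continuous_on UNIV g"

lemma wdataD:
  assumes "wdata f p h g"
  shows "(f has_derivative (\<lambda>v. 2 * Re (p z * v))) (at z)" "wirt p (h z) (of_real (g z / 4)) z"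
    "continuous_on S h" "continuous_on S g" "continuous_on S p" "continuous_on S f"
    "wirt (\<lambda>z. of_real (f z)) (p z) (cnj (p z)) z"
proof -
  show f: "(f has_derivative (\<lambda>v. 2 * Re (p z * v))) (at z)" for z using assms by (auto simp: wdata_def)
  show p: "wirt p (h z) (of_real (g z / 4)) z" for z using assms by (auto simp: wdata_def)
  show "continuous_on S h" "continuous_on S g" using assms by (auto simp: wdata_def elim: continuous_on_subset)
  show "continuous_on S p" by (rule wirt_continuous_on[OF p])
  show "continuous_on S f"
    by (rule continuous_at_imp_continuous_on) (blast intro: f has_derivative_continuous)
  show "wirt (\<lambda>z. of_real (f z)) (p z) (cnj (p z)) z"
    unfolding wirt_def
    by (rule has_derivative_eq_rhs[OF has_derivative_of_real[OF f]]) (auto simp: complex_eq_iff)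
qed

lemma wdata_diff:
  assumes "wdata f1 p1 h1 g1" "wdata f2 p2 h2 g2"
  shows "wdata (\<lambda>z. f1 z - f2 z) (\<lambda>z. p1 z - p2 z) (\<lambda>z. h1 z - h2 z) (\<lambda>z. g1 z - g2 z)"
  unfolding wdata_def wirt_def
  by (intro conjI allI continuous_intros wdataD[OF assms(1)] wdataD[OF assms(2)]
        has_derivative_eq_rhs[OF has_derivative_diff[OF wdataD(1)[OF assms(1)] wdataD(1)[OF assms(2)]]]
        has_derivative_eq_rhs[OF has_derivative_diff[OF wdataD(2)[OF assms(1), unfolded wirt_def] wdataD(2)[OF assms(2), unfolded wirt_def]]])
    (auto simp: fun_eq_iff algebra_simps diff_divide_distrib)

lemma wdata_add:
  assumes "wdata f1 p1 h1 g1" "wdata f2 p2 h2 g2"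
  shows "wdata (\<lambda>z. f1 z + f2 z) (\<lambda>z. p1 z + p2 z) (\<lambda>z. h1 z + h2 z) (\<lambda>z. g1 z + g2 z)"
  unfolding wdata_def wirt_def
  by (intro conjI allI continuous_intros wdataD[OF assms(1)] wdataD[OF assms(2)]
        has_derivative_eq_rhs[OF has_derivative_add[OF wdataD(1)[OF assms(1)] wdataD(1)[OF assms(2)]]]
        has_derivative_eq_rhs[OF has_derivative_add[OF wdataD(2)[OF assms(1), unfolded wirt_def] wdataD(2)[OF assms(2), unfolded wirt_def]]])
    (auto simp: fun_eq_iff algebra_simps add_divide_distrib)

lemma wdata_scale:
  assumes "wdata f p h g"
  shows "wdata (\<lambda>z. c * f z) (\<lambda>z. of_real c * p z) (\<lambda>z. of_real c * h z) (\<lambda>z. c * g z)"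
  unfolding wdata_def wirt_def
  by (intro conjI allI continuous_intros wdataD[OF assms]
        has_derivative_eq_rhs[OF has_derivative_mult_right[OF wdataD(1)[OF assms]]]
        has_derivative_eq_rhs[OF has_derivative_mult_right[OF wdataD(2)[OF assms, unfolded wirt_def]]])
    (auto simp: fun_eq_iff algebra_simps)

lemma wdata_norm_sq: "wdata (\<lambda>z. (norm (z - a))\<^sup>2) (\<lambda>z. cnj (z - a)) (\<lambda>z. 0) (\<lambda>z. 4)"
proof -
  have "((\<lambda>z. (norm (z - a))\<^sup>2) has_derivative (\<lambda>v. 2 * Re (cnj (z - a) * v))) (at z)" for z
    unfolding power2_norm_eq_inner
    by (auto intro!: derivative_eq_intros simp: inner_complex_def algebra_simps)
  then show ?thesis
    unfolding wdata_def wirt_def by (auto intro!: derivative_eq_intros)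
qed

context
  fixes f p h g assumes d: "wdata f p h g"
begin

lemma rmean_deriv: "(rmean a f has_real_derivative 2 * Re (cmean 1 a p r)) (at r within S)"
proof -
  note D = wdataD[OF d]
  have eq: "rmean a f r = Re (cmean 0 a (\<lambda>z. of_real (f z)) r)" for r by (simp add: cmean_of_real D)
  have "(cmean 0 a (\<lambda>z. of_real (f z)) has_vector_derivative (cmean (0+1) a p r + cmean (0-1) a (\<lambda>z. cnj (p z)) r)) (at r within S)"
    by (rule cmean_has_vector_derivative) (auto intro!: D continuous_intros)
  moreover have "cmean (-1) a (\<lambda>z. cnj (p z)) r = cnj (cmean 1 a p r)"
    by (simp add: cmean_def integral_cnj cis_cnj)
  ultimately have "(cmean 0 a (\<lambda>z. of_real (f z)) has_vector_derivative of_real (2 * Re (cmean 1 a p r))) (at r within S)"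
    by (simp add: complex_add_cnj)
  from bounded_linear.has_vector_derivative[OF bounded_linear_Re, OF this] show ?thesis
    unfolding eq[abs_def] by (simp add: has_real_derivative_iff_has_vector_derivative)
qed

text \<open>The divergence theorem on discs, differentiated in the radius. The mean of
  \<open>h\<close> disappears through the angular integration by parts.\<close>

lemma flux_deriv: "((\<lambda>r. r * (2 * Re (cmean 1 a p r))) has_real_derivative r * rmean a g r) (at r within S)"
proof -
  note D = wdataD[OF d]
  have cg: "cmean 0 a (\<lambda>z. of_real (g z / 4)) r = of_real (rmean a g r / 4)"
  proof -
    have "continuous_on UNIV (\<lambda>z. g z / 4)" by (intro continuous_intros D) auto
    moreover have "rmean a (\<lambda>z. g z / 4) r = rmean a g r / 4" using rmean_cmult[of a "1/4" g r] by simp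
    ultimately show ?thesis by (simp only: cmean_of_real)
  qed
  have cc: "continuous_on UNIV (\<lambda>z. of_real (g z / 4) :: complex)" by (intro continuous_intros D) auto
  have c: "(cmean 1 a p has_vector_derivative (cmean 2 a h r + of_real (rmean a g r / 4))) (at r within S)"
    using cmean_has_vector_derivative[OF D(2) D(3) cc, of 1 a r S] cg by (simp del: of_real_divide)
  have "r * (cmean 2 a h r - of_real (rmean a g r / 4)) = - cmean 1 a p r"
    using cmean_parts[OF D(2) D(3) cc, of r 1 a] cg by (simp del: of_real_divide)
  then have "r * cmean 2 a h r = r * of_real (rmean a g r / 4) - cmean 1 a p r"
    by (simp add: right_diff_distrib diff_eq_eq)
  then have "cmean 1 a p r + r * (cmean 2 a h r + of_real (rmean a g r / 4)) = of_real (r * rmean a g r / 2)"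
    by (simp add: distrib_left)
  then have "((\<lambda>r. of_real r * cmean 1 a p r) has_vector_derivative of_real (r * rmean a g r / 2)) (at r within S)"
    by (intro has_vector_derivative_eq_rhs[OF has_vector_derivative_mult[OF has_vector_derivative_of_real[OF DERIV_ident] c]]) (simp add: add.commute)
  from bounded_linear.has_vector_derivative[OF bounded_linear_Re, OF this]
  have "((\<lambda>r. r * Re (cmean 1 a p r)) has_real_derivative (r * rmean a g r / 2)) (at r within S)"
    by (simp add: has_real_derivative_iff_has_vector_derivative)
  from DERIV_cmult[OF this, of 2] show ?thesis by (simp add: mult_ac)
qed

lemma flux_nonpos:
  assumes "\<And>z. dist a z \<le> R \<Longrightarrow> g z \<le> 0" "0 \<le> r" "r \<le> R"
  shows "Re (cmean 1 a p r) \<le> 0"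
proof (cases "r = 0")
  case False
  have "r * (2 * Re (cmean 1 a p r)) \<le> 0 * (2 * Re (cmean 1 a p 0))"
    by (rule DERIV_nonpos_imp_nonincreasing[OF \<open>0 \<le> r\<close>])
       (use assms in \<open>force intro!: flux_deriv mult_nonneg_nonpos rmean_le wdataD[OF d]\<close>)
  with False assms show ?thesis by (auto simp: mult_le_0_iff)
qed (auto simp: cmean_0)

lemma rmean_antimono:
  assumes "\<And>z. dist a z \<le> R \<Longrightarrow> g z \<le> 0" "0 \<le> s" "s \<le> r" "r \<le> R"
  shows "rmean a f r \<le> rmean a f s"
  by (rule DERIV_nonpos_imp_nonincreasing[OF \<open>s \<le> r\<close>])
     (use assms in \<open>force intro!: rmean_deriv flux_nonpos\<close>)

end

lemma rmean_norm_sq: "rmean a (\<lambda>z. (norm (z - a))\<^sup>2) r = r\<^sup>2"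
  by (simp add: rmean_def norm_mult power_mult_distrib)

text \<open>The Laplacian of \<open>G / 4 * (norm (z - a))\<^sup>2\<close> is the constant
  \<open>G\<close>; after subtracting it the function is superharmonic on the disc and its circle
  means decrease.\<close>

lemma rmean_growth:
  assumes d: "wdata f p h g" and G: "\<And>z. dist a z \<le> r \<Longrightarrow> g z \<le> G" and "0 \<le> s" "s \<le> r"
  shows "rmean a f r \<le> rmean a f s + G / 4 * (r\<^sup>2 - s\<^sup>2)"
proof -
  have c: "continuous_on UNIV (\<lambda>z. G / 4 * (cmod (z - a))\<^sup>2)" by (intro continuous_intros)
  have "rmean a (\<lambda>z. f z - G / 4 * (norm (z - a))\<^sup>2) r \<le> rmean a (\<lambda>z. f z - G / 4 * (norm (z - a))\<^sup>2) s"
    by (rule rmean_antimono[OF wdata_diff[OF d wdata_scale[OF wdata_norm_sq]], where R = r]) (use assms in auto)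
  then show ?thesis
    unfolding rmean_diff[OF wdataD(6)[OF d] c] rmean_cmult rmean_norm_sq by (simp add: algebra_simps)
qed

lemma rmean_upper:
  assumes "wdata f p h g" "\<And>z. dist a z \<le> r \<Longrightarrow> g z \<le> G" "0 \<le> r"
  shows "rmean a f r \<le> f a + G / 4 * r\<^sup>2"
  using rmean_growth[OF assms(1,2), where s=0] assms(3) by auto

lemma rmean_lower:
  assumes "wdata f p h g" "\<And>z. dist a z \<le> r \<Longrightarrow> - G \<le> g z" "0 \<le> r"
  shows "f a \<le> rmean a f r + G / 4 * r\<^sup>2"
proof -
  have "rmean a (\<lambda>z. (-1) * f z) r \<le> (-1) * f a + G / 4 * r\<^sup>2"
    by (rule rmean_upper[OF wdata_scale[OF assms(1)]]) (use assms in force)+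
  then show ?thesis unfolding rmean_cmult by simp
qed

text \<open>Up to a factor, the index -1 mean of \<open>f\<close> on a circle is the integral of
  \<open>p\<close> over the disc. Circle means of \<open>p\<close> move by at most
  \<open>G / 2\<close> per unit of radius, so that integral determines \<open>p a\<close> up to an
  error of order \<open>G * r\<close>.\<close>

lemma gradient_bound:
  assumes d: "wdata f p h g" and G: "\<And>z. dist a z \<le> r \<Longrightarrow> \<bar>g z\<bar> \<le> G" and F: "\<And>z. dist a z = r \<Longrightarrow> \<bar>f z\<bar> \<le> F"
    and r: "0 < r"
  shows "norm (p a) \<le> F / r + G * r"
proof -
  note D = wdataD[OF d]
  have cp: "continuous_on UNIV (\<lambda>z. cnj (p z))" by (intro continuous_intros D)
  have cg: "continuous_on UNIV (\<lambda>z. of_real (g z / 4) :: complex)" by (intro continuous_intros D) auto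
  have p: "norm (cmean 0 a p s - p a) \<le> G / 2 * s" if s: "0 \<le> s" "s \<le> r" for s
  proof (cases "s = 0")
    case False
    have "norm (cmean 0 a p s - cmean 0 a p 0) \<le> G / 2 * s - G / 2 * 0"
    proof (rule differentiable_bound_general)
      show "(cmean 0 a p has_vector_derivative (2 * cmean (-1) a (\<lambda>z. of_real (g z / 4)) t)) (at t)" if "0 < t" "t < s" for t
        using cmean_deriv_lower[OF D(2) D(3) cg, of t 0 a UNIV] that by simp
      show "((\<lambda>s. G / 2 * s) has_vector_derivative G / 2) (at t)" for t
        by (auto intro!: derivative_eq_intros)
      show "norm (2 * cmean (-1) a (\<lambda>z. of_real (g z / 4)) t) \<le> G / 2" if t: "0 < t" "t < s" for t
      proof -
        have "norm (cmean (-1) a (\<lambda>z. of_real (g z / 4)) t) \<le> G / 4"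
          by (rule norm_cmean_bound[OF cg]) (use t s G in force)
        then show ?thesis by (simp add: norm_mult)
      qed
    qed (use s False in \<open>auto intro!: continuous_on_cmean D continuous_intros\<close>)
    then show ?thesis by (simp add: cmean_0)
  qed (simp add: cmean_0)
  have G0: "0 \<le> G" using G[of a] r by force
  \<comment> \<open>The first term has derivative \<open>2 * s * cmean 0 a p s\<close>; the second
    subtracts what it would be if \<open>p\<close> were constantly \<open>p a\<close>.\<close>
  let ?S = "\<lambda>s. of_real s * cmean (-1) a (\<lambda>z. of_real (f z)) s - of_real (s^2) * p a"
  have "norm (?S r - ?S 0) \<le> G * r\<^sup>2 * r - G * r\<^sup>2 * 0"
  proof (rule differentiable_bound_general)
    fix s assume s: "0 < s" "s < r"
    have "(cmean (-1) a (\<lambda>z. of_real (f z)) has_vector_derivative (2 * cmean (-1+1) a p s + of_int (-1) / complex_of_real s * cmean (-1) a (\<lambda>z. of_real (f z)) s)) (at s)"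
      by (rule cmean_deriv_upper[OF D(7) D(5) cp]) (use s in auto)
    then have "((\<lambda>s. of_real s * cmean (-1) a (\<lambda>z. of_real (f z)) s) has_vector_derivative 2 * s * cmean 0 a p s) (at s)"
      by (intro has_vector_derivative_eq_rhs[OF has_vector_derivative_mult[OF has_vector_derivative_of_real[OF DERIV_ident]]])
         (use s in \<open>auto simp: field_simps\<close>)
    moreover have "((\<lambda>s. of_real (s^2) * p a) has_vector_derivative (2 * s * p a)) (at s)"
    proof -
      have "((\<lambda>s. s^2) has_real_derivative 2 * s) (at s)" by (auto intro!: derivative_eq_intros)
      from has_vector_derivative_mult_left[OF has_vector_derivative_of_real[OF this]] show ?thesis by simp
    qed
    ultimately show "(?S has_vector_derivative 2 * s * (cmean 0 a p s - p a)) (at s)"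
      by (auto intro!: has_vector_derivative_eq_rhs[OF has_vector_derivative_diff] simp: algebra_simps)
    show "((\<lambda>s. G * r\<^sup>2 * s) has_vector_derivative G * r\<^sup>2) (at s)"
      by (auto intro!: derivative_eq_intros)
    have "norm (2 * s * (cmean 0 a p s - p a)) \<le> 2 * s * (G / 2 * s)"
      using p[of s] s by (simp add: norm_mult)
    also have "\<dots> = G * s\<^sup>2" by (simp add: power2_eq_square)
    also have "\<dots> \<le> G * r\<^sup>2" using s G0 by (intro mult_left_mono power_mono) auto
    finally show "norm (2 * s * (cmean 0 a p s - p a)) \<le> G * r\<^sup>2" by simp
  qed (use r in \<open>auto intro!: continuous_intros continuous_on_cmean D\<close>)
  then have 1: "norm (of_real r * cmean (-1) a (\<lambda>z. of_real (f z)) r - of_real (r^2) * p a) \<le> G * r ^ 3"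
    by (simp add: power2_eq_square power3_eq_cube)
  have "norm (cmean (-1) a (\<lambda>z. of_real (f z)) r) \<le> F"
    by (rule norm_cmean_bound) (use F r in \<open>auto intro!: continuous_intros D\<close>)
  then have "norm (of_real r * cmean (-1) a (\<lambda>z. of_real (f z)) r) \<le> r * F"
    using r by (simp add: norm_mult)
  with 1 have "norm (of_real (r^2) * p a) \<le> r * F + G * r ^ 3"
    using norm_triangle_ineq4[of "of_real r * cmean (-1) a (\<lambda>z. of_real (f z)) r" "of_real r * cmean (-1) a (\<lambda>z. of_real (f z)) r - of_real (r^2) * p a"]
    by simp
  moreover have "r * F + G * r ^ 3 = r\<^sup>2 * (F / r + G * r)"
    using r by (simp add: power2_eq_square power3_eq_cube field_simps)
  ultimately have "r\<^sup>2 * norm (p a) \<le> r\<^sup>2 * (F / r + G * r)"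
    by (simp add: norm_mult norm_power)
  then show ?thesis using r by (simp only: mult_le_cancel_left_pos zero_less_power)
qed

subsection \<open>The Schwarzian as a circle integral\<close>

text \<open>As \<open>r\<close> tends to \<open>0\<close> this tends to the Schwarzian \<open>h a - (p a)\<^sup>2 / 2\<close>, while its derivative in \<open>r\<close> contains
  only \<open>exp u\<close>. So the Schwarzian at a blow-up point is controlled by data on a distant circle.\<close>

definition Qpot :: "real \<Rightarrow> (complex \<Rightarrow> real) \<Rightarrow> (complex \<Rightarrow> complex) \<Rightarrow> (complex \<Rightarrow> complex) \<Rightarrow> complex \<Rightarrow> real \<Rightarrow> complex" where
  "Qpot \<rho> u p h a r = cmean 0 a h r - cmean 0 a (\<lambda>z. (p z)\<^sup>2) r / 2 + of_real (\<rho> / 4 * r) * cmean (-1) a p r"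

text \<open>\<open>R\<close> is the radius, \<open>P\<close> the parameter \<rho>, and
  \<open>m\<close>, \<open>e\<close>, \<open>X\<close> are the means of \<open>p\<close>,
  \<open>exp u\<close> and \<open>exp u * p\<close>. The point is that \<open>X\<close>, the only
  term with both a gradient and the exponential, cancels.\<close>

lemma Qpot_deriv_algebra: fixes R P m X e :: complex assumes "R\<noteq>0" shows "m * (-1/R\<^sup>2) + (m/R - P/2*e)*(1/R) - P/4*(2*X - 2/R*e) - P*(m-X)/2 + ((P/4*R)*(m/R - P/2*e) + P/4*m) = -(P\<^sup>2/8*R)*e"
proof -
  \<comment> \<open>Writing \<open>m\<close> and \<open>e\<close> as multiples of \<open>R\<close>
    clears the denominators and leaves a polynomial identity.\<close>
  obtain N f where "m = R * (R * N)" "e = R * f" using assms by (metis nonzero_mult_div_cancel_left times_divide_eq_right)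
  then show ?thesis using assms by (simp add: power2_eq_square field_simps)
qed

text \<open>Formally the conjugate derivative of \<open>h - p\<^sup>2 / 2\<close> is
  \<open>- \<rho> / 4 * p\<close>, because the terms with \<open>exp u * p\<close> cancel. The extra
  summand of \<open>Qpot\<close> compensates the linear term in \<open>p\<close> that remains, at
  the cost of one mean of \<open>exp u\<close>.\<close>

lemma Qpot_deriv:
  assumes d: "wdata u p h (\<lambda>z. \<rho> * (1 - exp (u z)))" and r: "r > 0"
  shows "(Qpot \<rho> u p h a has_vector_derivative
     - of_real (\<rho>\<^sup>2 / 8 * r) * cmean (-2) a (\<lambda>z. of_real (exp (u z))) r) (at r)"
proof -
  note D = wdataD[OF d]
  define E where "E z = complex_of_real (exp (u z))" for z
  define m where "m = cmean (-1) a p"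
  define P where "P z = of_real (\<rho> / 4) * (1 - E z)" for z
  have cE: "continuous_on UNIV E" unfolding E_def by (intro continuous_intros D)
  have cP: "continuous_on UNIV P" unfolding P_def by (intro continuous_intros cE)
  have wp: "wirt p (h z) (P z) z" for z
    using D(2)[of z] by (simp add: P_def E_def)
  have mE: "cmean k a P s = of_real (\<rho> / 4) * ((if k = 0 then 1 else 0) - cmean k a E s)" for k s
    unfolding P_def by (simp only: cmean_cmult cmean_diff[OF continuous_on_const cE] cmean_const)
  \<comment> \<open>Since \<open>h\<close> is merely continuous, its mean cannot be differentiated
    under the integral. Angular integration by parts expresses it through \<open>p\<close> and
    \<open>exp u\<close>, which are differentiable.\<close>
  have h: "cmean 0 a h s = m s / of_real s - of_real (\<rho> / 4) * cmean (-2) a E s" if "s \<noteq> 0" for s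
  proof -
    have "s * (cmean 0 a h s - cmean (-2) a P s) = m s"
      using cmean_parts[OF wp D(3) cP, of s "-1" a] by (simp add: m_def)
    then show ?thesis using that mE[of "-2" s] by (simp add: field_simps)
  qed
  have cEp: "continuous_on UNIV (\<lambda>z. E z * p z)" "continuous_on UNIV (\<lambda>z. E z * cnj (p z))" 
    "continuous_on UNIV (\<lambda>z. 2 * p z * h z)" "continuous_on UNIV (\<lambda>z. 2 * p z * P z)"
    by (intro continuous_intros cE cP D)+
  have wE: "wirt E (E z * p z) (E z * cnj (p z)) z" for z
    unfolding wirt_def E_def
    by (rule has_derivative_eq_rhs[OF has_derivative_of_real[OF has_derivative_exp[OF D(1)]]])
       (auto simp: complex_eq_iff algebra_simps)
  have wpp: "wirt (\<lambda>z. (p z)\<^sup>2) (2 * p z * h z) (2 * p z * P z) z" for z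
    unfolding wirt_def
    by (rule has_derivative_eq_rhs[OF has_derivative_power[OF wp[of z, unfolded wirt_def]]])
       (auto simp: algebra_simps)
  have dm: "(m has_vector_derivative (m s / of_real s - of_real \<rho> / 2 * cmean (-2) a E s)) (at s)" if "s > 0" for s
    using cmean_deriv_lower[OF wp D(3) cP, of s "-1" a UNIV] that mE[of "-2" s]
    by (auto simp: m_def intro: has_vector_derivative_eq_rhs)
  have dE: "(cmean (-2) a E has_vector_derivative (2 * cmean (-1) a (\<lambda>z. E z * p z) s - 2 / of_real s * cmean (-2) a E s)) (at s)" if "s > 0" for s
    using cmean_deriv_upper[OF wE cEp(1,2), of s "-2" a UNIV] that
    by (auto intro: has_vector_derivative_eq_rhs)
  have "cmean (-1) a (\<lambda>z. 2 * p z * P z) s = of_real (\<rho> / 2) * (m s - cmean (-1) a (\<lambda>z. E z * p z) s)" for s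
  proof -
    have "(\<lambda>z. 2 * p z * P z) = (\<lambda>z. of_real (\<rho> / 2) * (p z - E z * p z))"
      by (auto simp: P_def fun_eq_iff field_simps)
    then show ?thesis by (simp only: cmean_cmult cmean_diff[OF D(5) cEp(1)] m_def)
  qed
  with cmean_deriv_lower[OF wpp cEp(3,4), of _ 0 a UNIV]
  have dpp: "(cmean 0 a (\<lambda>z. (p z)\<^sup>2) has_vector_derivative (of_real \<rho> * (m s - cmean (-1) a (\<lambda>z. E z * p z) s))) (at s)" if "s > 0" for s
    using that by (fastforce intro: has_vector_derivative_eq_rhs)
  have inv: "((\<lambda>s. 1 / complex_of_real s) has_vector_derivative - 1 / (of_real r)\<^sup>2) (at r)"
  proof -
    have "((\<lambda>s. 1 / s) has_real_derivative - 1 / r\<^sup>2) (at r)"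
      using r by (auto intro!: derivative_eq_intros simp: power2_eq_square)
    then have "((\<lambda>s. complex_of_real (1 / s)) has_vector_derivative of_real (- 1 / r\<^sup>2)) (at r)"
      by (rule has_vector_derivative_of_real)
    then show ?thesis by simp
  qed
  have lin: "((\<lambda>s. of_real \<rho> / 4 * complex_of_real s) has_vector_derivative of_real \<rho> / 4) (at r)"
  proof -
    have "((\<lambda>s. \<rho> / 4 * s) has_real_derivative \<rho> / 4) (at r)" by (auto intro!: derivative_eq_intros)
    then have "((\<lambda>s. complex_of_real (\<rho> / 4 * s)) has_vector_derivative of_real (\<rho> / 4)) (at r)"
      by (rule has_vector_derivative_of_real)
    then show ?thesis by simp
  qed
  let ?F = "\<lambda>s. (m s * (1 / of_real s) - of_real \<rho> / 4 * cmean (-2) a E s) - cmean 0 a (\<lambda>z. (p z)\<^sup>2) s / 2 + of_real \<rho> / 4 * of_real s * m s"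
  have "(?F has_vector_derivative - ((of_real \<rho>)\<^sup>2 / 8 * of_real r) * cmean (-2) a E r) (at r)"
    by (rule has_vector_derivative_eq_rhs, 
        rule has_vector_derivative_add[OF has_vector_derivative_diff[OF has_vector_derivative_diff[OF 
          has_vector_derivative_mult[OF dm[OF r] inv] has_vector_derivative_mult_right[OF dE[OF r]]]
          has_vector_derivative_divide[OF dpp[OF r]]] has_vector_derivative_mult[OF lin dm[OF r]]],
        rule Qpot_deriv_algebra) (use r in simp)
  then have "(?F has_vector_derivative - of_real (\<rho>\<^sup>2 / 8 * r) * cmean (-2) a E r) (at r)"
    by simp
  then have "(?F has_vector_derivative - of_real (\<rho>\<^sup>2 / 8 * r) * cmean (-2) a E r) (at r within {0<..})"
    by (rule has_vector_derivative_at_within)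
  then have "(Qpot \<rho> u p h a has_vector_derivative - of_real (\<rho>\<^sup>2 / 8 * r) * cmean (-2) a E r) (at r within {0<..})"
  proof (rule has_vector_derivative_transform[rotated 2])
    fix s :: real assume "s \<in> {0<..}"
    then show "Qpot \<rho> u p h a s = ?F s"
      unfolding Qpot_def using h[of s] by (simp add: m_def)
  qed (use r in auto)
  then have "(Qpot \<rho> u p h a has_vector_derivative - of_real (\<rho>\<^sup>2 / 8 * r) * cmean (-2) a E r) (at r)"
    by (subst (asm) has_vector_derivative_within_open) (use r in auto)
  moreover have "E = (\<lambda>z. complex_of_real (exp (u z)))" by (simp add: E_def fun_eq_iff)
  ultimately show ?thesis by simp
qed

lemma Qpot_0: "Qpot \<rho> u p h a 0 = h a - (p a)\<^sup>2 / 2"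
  by (simp add: Qpot_def cmean_0)

lemma Qpot_continuous:
  assumes d: "wdata u p h g"
  shows "continuous_on S (Qpot \<rho> u p h a)"
  unfolding Qpot_def[abs_def] by (intro continuous_intros continuous_on_cmean wdataD[OF d]) auto

text \<open>In polar coordinates the right-hand side is a multiple of the integral of
  \<open>\<bar>exp (u1 z) - exp (u2 z)\<bar>\<close> over the disc. It is a bound in the mean, which
  survives concentration, and not one in the maximum norm.\<close>

lemma Qpot_diff_bound:
  assumes d1: "wdata u1 p1 h1 (\<lambda>z. \<rho> * (1 - exp (u1 z)))" and d2: "wdata u2 p2 h2 (\<lambda>z. \<rho> * (1 - exp (u2 z)))"
    and r: "r > 0"
  shows "norm ((Qpot \<rho> u1 p1 h1 a r - Qpot \<rho> u2 p2 h2 a r) - (h1 a - (p1 a)\<^sup>2 / 2 - (h2 a - (p2 a)\<^sup>2 / 2)))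
    \<le> \<rho>\<^sup>2 / 8 * integral {0..r} (\<lambda>s. s * rmean a (\<lambda>z. \<bar>exp (u1 z) - exp (u2 z)\<bar>) s)"
proof -
  let ?e = "\<lambda>z. \<bar>exp (u1 z) - exp (u2 z)\<bar>"
  have ce: "continuous_on S ?e" for S by (intro continuous_intros wdataD[OF d1] wdataD[OF d2])
  let ?i = "\<lambda>s. s * rmean a ?e s"
  have ci: "continuous_on S ?i" for S by (intro continuous_intros continuous_on_rmean ce)
  have "norm ((Qpot \<rho> u1 p1 h1 a r - Qpot \<rho> u2 p2 h2 a r) - (Qpot \<rho> u1 p1 h1 a 0 - Qpot \<rho> u2 p2 h2 a 0))
    \<le> \<rho>\<^sup>2 / 8 * integral {0..r} ?i - \<rho>\<^sup>2 / 8 * integral {0..0} ?i"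
  proof (rule differentiable_bound_general[OF r])
    show "continuous_on {0..r} (\<lambda>s. \<rho>\<^sup>2 / 8 * integral {0..s} ?i)"
      by (intro continuous_intros indefinite_integral_continuous_1 integrable_continuous_interval ci)
    fix s assume s: "0 < s" "s < r"
    show "((\<lambda>s. Qpot \<rho> u1 p1 h1 a s - Qpot \<rho> u2 p2 h2 a s) has_vector_derivative 
      (- of_real (\<rho>\<^sup>2 / 8 * s) * cmean (-2) a (\<lambda>z. of_real (exp (u1 z))) s) - (- of_real (\<rho>\<^sup>2 / 8 * s) * cmean (-2) a (\<lambda>z. of_real (exp (u2 z))) s)) (at s)"
      by (intro has_vector_derivative_diff Qpot_deriv d1 d2 s)
    have "((\<lambda>s. integral {0..s} ?i) has_real_derivative ?i s) (at s within {0..r})"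
      by (rule integral_has_real_derivative) (use s ci in auto)
    then have "((\<lambda>s. integral {0..s} ?i) has_real_derivative ?i s) (at s)"
      using s at_within_Icc_at[of 0 s r] by simp
    from DERIV_cmult[OF this, of "\<rho>\<^sup>2 / 8"]
    show "((\<lambda>s. \<rho>\<^sup>2 / 8 * integral {0..s} ?i) has_vector_derivative \<rho>\<^sup>2 / 8 * ?i s) (at s)"
      by (simp add: has_real_derivative_iff_has_vector_derivative)
    have c: "continuous_on UNIV (\<lambda>z. complex_of_real (exp (u1 z)))" "continuous_on UNIV (\<lambda>z. complex_of_real (exp (u2 z)))" 
      by (intro continuous_intros wdataD[OF d1] wdataD[OF d2])+
    have "norm (- of_real (\<rho>\<^sup>2 / 8 * s) * cmean (-2) a (\<lambda>z. of_real (exp (u1 z))) s - (- of_real (\<rho>\<^sup>2 / 8 * s) * cmean (-2) a (\<lambda>z. of_real (exp (u2 z))) s))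
      = norm (of_real (\<rho>\<^sup>2 / 8 * s) * cmean (-2) a (\<lambda>z. of_real (exp (u1 z)) - of_real (exp (u2 z))) s)"
      unfolding cmean_diff[OF c] by (subst norm_minus_cancel[symmetric]) (simp add: algebra_simps)
    also have "\<dots> \<le> (\<rho>\<^sup>2 / 8 * s) * rmean a (\<lambda>z. norm (of_real (exp (u1 z)) - of_real (exp (u2 z)) :: complex)) s"
      unfolding norm_mult by (rule mult_mono) (use s in \<open>auto intro!: norm_cmean_le continuous_intros c simp del: of_real_mult of_real_divide\<close>)
    also have "(\<lambda>z. norm (of_real (exp (u1 z)) - of_real (exp (u2 z)) :: complex)) = ?e"
      by (simp flip: of_real_diff)
    finally show "norm (- of_real (\<rho>\<^sup>2 / 8 * s) * cmean (-2) a (\<lambda>z. of_real (exp (u1 z))) s - (- of_real (\<rho>\<^sup>2 / 8 * s) * cmean (-2) a (\<lambda>z. of_real (exp (u2 z))) s)) \<le> \<rho>\<^sup>2 / 8 * ?i s"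
      by (simp add: mult.assoc)
  qed (intro continuous_intros Qpot_continuous[OF d1] Qpot_continuous[OF d2])
  then show ?thesis by (simp add: Qpot_0)
qed

lemma Qpot_bound:
  assumes d: "wdata u p h (\<lambda>z. \<rho> * (1 - exp (u z)))"
    and r: "r > 0"
  shows "norm (Qpot \<rho> u p h a r - (h a - (p a)\<^sup>2 / 2))
    \<le> \<rho>\<^sup>2 / 8 * integral {0..r} (\<lambda>s. s * rmean a (\<lambda>z. exp (u z)) s)"
proof -
  let ?e = "\<lambda>z. exp (u z)"
  have ce: "continuous_on S ?e" for S by (intro continuous_intros wdataD[OF d])
  let ?i = "\<lambda>s. s * rmean a ?e s"
  have ci: "continuous_on S ?i" for S by (intro continuous_intros continuous_on_rmean ce)
  have "norm (Qpot \<rho> u p h a r - Qpot \<rho> u p h a 0)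
    \<le> \<rho>\<^sup>2 / 8 * integral {0..r} ?i - \<rho>\<^sup>2 / 8 * integral {0..0} ?i"
  proof (rule differentiable_bound_general[OF r])
    show "continuous_on {0..r} (\<lambda>s. \<rho>\<^sup>2 / 8 * integral {0..s} ?i)"
      by (intro continuous_intros indefinite_integral_continuous_1 integrable_continuous_interval ci)
    fix s assume s: "0 < s" "s < r"
    show "(Qpot \<rho> u p h a has_vector_derivative 
      (- of_real (\<rho>\<^sup>2 / 8 * s) * cmean (-2) a (\<lambda>z. of_real (exp (u z))) s)) (at s)"
      by (intro Qpot_deriv d s)
    have "((\<lambda>s. integral {0..s} ?i) has_real_derivative ?i s) (at s within {0..r})"
      by (rule integral_has_real_derivative) (use s ci in auto)
    then have "((\<lambda>s. integral {0..s} ?i) has_real_derivative ?i s) (at s)"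
      using s at_within_Icc_at[of 0 s r] by simp
    from DERIV_cmult[OF this, of "\<rho>\<^sup>2 / 8"]
    show "((\<lambda>s. \<rho>\<^sup>2 / 8 * integral {0..s} ?i) has_vector_derivative \<rho>\<^sup>2 / 8 * ?i s) (at s)"
      by (simp add: has_real_derivative_iff_has_vector_derivative)
    have c: "continuous_on UNIV (\<lambda>z. complex_of_real (exp (u z)))"
      by (intro continuous_intros wdataD[OF d])+
    have "norm (- of_real (\<rho>\<^sup>2 / 8 * s) * cmean (-2) a (\<lambda>z. of_real (exp (u z))) s) \<le> (\<rho>\<^sup>2 / 8 * s) * rmean a (\<lambda>z. norm (of_real (exp (u z)) :: complex)) s"
      unfolding norm_mult by (rule mult_mono[OF _ norm_cmean_le[OF c]]) (use s in \<open>auto simp: norm_mult norm_power\<close>)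
    then show "norm (- of_real (\<rho>\<^sup>2 / 8 * s) * cmean (-2) a (\<lambda>z. of_real (exp (u z))) s) \<le> \<rho>\<^sup>2 / 8 * ?i s"
      by (simp add: mult.assoc)
  qed (intro continuous_intros Qpot_continuous[OF d])
  then show ?thesis by (simp add: Qpot_0)
qed

subsection \<open>Polar coordinates\<close>

lemma nn_integral_translate:
  fixes f :: "complex \<Rightarrow> ennreal"
  assumes [measurable]: "f \<in> borel_measurable borel"
  shows "(\<integral>\<^sup>+x. f (t + x) \<partial>lborel) = (\<integral>\<^sup>+x. f x \<partial>lborel)"
  by (subst (2) lborel_distr_plus[symmetric, of t]) (simp add: nn_integral_distr)

text \<open>The Fubini argument for the uniqueness of a translation-invariant measure: one double
  integral, evaluated in two orders, equals the volume of the unit ball times the measure of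
  \<open>A\<close>, and the same volume times the rotated measure of \<open>A\<close>. The ball is
  rotation invariant, so the constant of proportionality is 1.\<close>

lemma lborel_distr_unit:
  fixes c :: complex
  assumes c: "norm c = 1"
  shows "distr lborel borel ((*) c) = lborel"
proof (rule measure_eqI)
  fix A :: "complex set" assume "A \<in> sets (distr lborel borel ((*) c))"
  then have A [measurable]: "A \<in> sets borel" by simp
  let ?B = "ball 0 1 :: complex set"
  have c0: "c \<noteq> 0" using c by auto
  define b where "b = emeasure lborel ?B"
  have b: "b \<noteq> 0" "b \<noteq> top"
  proof -
    show "b \<noteq> top" using emeasure_lborel_ball_finite[of "0::complex" 1] unfolding b_def by simp
    show "b \<noteq> 0" unfolding b_def by (subst emeasure_ball) (auto simp: ennreal_eq_0_iff not_le)
  qed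
  have trl: "(\<integral>\<^sup>+x. indicator A (x + y) \<partial>lborel) = emeasure lborel A" for y
    using nn_integral_translate[of "indicator A" y] by (simp add: add.commute)
  have iB: "indicator ?B \<in> borel_measurable (borel :: complex measure)" by (rule borel_measurable_indicator) simp
  have iA: "indicator A \<in> borel_measurable (borel :: complex measure)" by (rule borel_measurable_indicator) simp
  have comp: "(\<lambda>x. indicator D (f x) :: ennreal) \<in> borel_measurable (lborel \<Otimes>\<^sub>M lborel)"
    if "D \<in> sets borel" "continuous_on UNIV f" for D and f :: "complex \<times> complex \<Rightarrow> complex"
    unfolding lborel_prod
    by (rule measurable_compose[OF _ borel_measurable_indicator[OF that(1)]]) (simp add: borel_measurable_continuous_onI that)
  have comp1: "(\<lambda>x. indicator D (f x) :: ennreal) \<in> borel_measurable lborel"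
    if "D \<in> sets borel" "continuous_on UNIV f" for D and f :: "complex \<Rightarrow> complex"
    by (rule measurable_compose[OF _ borel_measurable_indicator[OF that(1)]]) (simp add: borel_measurable_continuous_onI that)
  have "emeasure lborel A * b = (\<integral>\<^sup>+y. indicator ?B (c * y) * (\<integral>\<^sup>+x. indicator A (x + c * y) \<partial>lborel) \<partial>lborel)"
  proof -
    have "(\<integral>\<^sup>+y. indicator ?B (c * y) * (\<integral>\<^sup>+x. indicator A (x + c * y) \<partial>lborel) \<partial>lborel) = (\<integral>\<^sup>+y. indicator ?B y * emeasure lborel A \<partial>lborel)"
      unfolding trl by (intro nn_integral_cong) (simp add: indicator_def norm_mult c)
    also have "\<dots> = (\<integral>\<^sup>+y. indicator ?B y \<partial>lborel) * emeasure lborel A"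
      by (rule nn_integral_multc, rule borel_measurable_indicator) simp
    also have "(\<integral>\<^sup>+y. indicator ?B y \<partial>lborel) = b" unfolding b_def by (rule nn_integral_indicator) auto
    finally show ?thesis by (simp add: mult.commute)
  qed
  also have "\<dots> = (\<integral>\<^sup>+y. (\<integral>\<^sup>+x. indicator ?B (c * y) * indicator A (x + c * y) \<partial>lborel) \<partial>lborel)"
    by (intro nn_integral_cong nn_integral_cmult[symmetric] comp1 continuous_intros) auto
  also have "\<dots> = (\<integral>\<^sup>+x. (\<integral>\<^sup>+y. indicator ?B (c * y) * indicator A (x + c * y) \<partial>lborel) \<partial>lborel)"
    by (rule lborel_pair.Fubini') (auto simp: split_def intro!: borel_measurable_times_ennreal comp continuous_intros)
  also have "\<dots> = (\<integral>\<^sup>+x. (\<integral>\<^sup>+y. indicator ?B (c * y - x) * indicator A (c * y) \<partial>lborel) \<partial>lborel)"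
  proof (rule nn_integral_cong)
    fix x
    have "(\<integral>\<^sup>+y. indicator ?B (c * y - x) * indicator A (c * y) \<partial>lborel) = 
      (\<integral>\<^sup>+y. indicator ?B (c * (x / c + y) - x) * indicator A (c * (x / c + y)) \<partial>lborel)"
      by (rule nn_integral_translate[symmetric]) (use comp1 in \<open>auto intro!: borel_measurable_times_ennreal continuous_intros\<close>)
    also have "\<dots> = (\<integral>\<^sup>+y. indicator ?B (c * y) * indicator A (x + c * y) \<partial>lborel)"
      using c0 by (simp add: distrib_left)
    finally show "(\<integral>\<^sup>+y. indicator ?B (c * y) * indicator A (x + c * y) \<partial>lborel) = (\<integral>\<^sup>+y. indicator ?B (c * y - x) * indicator A (c * y) \<partial>lborel)" by simp
  qed
  also have "\<dots> = (\<integral>\<^sup>+y. (\<integral>\<^sup>+x. indicator ?B (c * y - x) * indicator A (c * y) \<partial>lborel) \<partial>lborel)"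
    by (rule lborel_pair.Fubini') (auto simp: split_def intro!: borel_measurable_times_ennreal comp continuous_intros)
  also have "\<dots> = (\<integral>\<^sup>+y. b * indicator A (c * y) \<partial>lborel)"
  proof (rule nn_integral_cong)
    fix y
    have "(\<integral>\<^sup>+x. indicator ?B (c * y - x) * indicator A (c * y) \<partial>lborel) = (\<integral>\<^sup>+x. indicator ?B (c * y - x) \<partial>lborel) * indicator A (c * y)"
      by (intro nn_integral_multc comp1 continuous_intros) auto
    also have "(\<integral>\<^sup>+x. indicator ?B (c * y - x) \<partial>lborel) = (\<integral>\<^sup>+x. indicator (ball (c * y) 1) x \<partial>lborel)"
      by (intro nn_integral_cong) (simp add: indicator_def dist_norm norm_minus_commute)
    also have "\<dots> = b" by (simp add: b_def emeasure_ball)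
    finally show "(\<integral>\<^sup>+x. indicator ?B (c * y - x) * indicator A (c * y) \<partial>lborel) = b * indicator A (c * y)" .
  qed
  also have "\<dots> = b * (\<integral>\<^sup>+y. indicator A (c * y) \<partial>lborel)"
    by (intro nn_integral_cmult comp1 continuous_intros) auto
  also have "(\<integral>\<^sup>+y. indicator A (c * y) \<partial>lborel) = (\<integral>\<^sup>+y. indicator A y \<partial>distr lborel borel ((*) c))"
    by (subst nn_integral_distr) auto
  also have "\<dots> = emeasure (distr lborel borel ((*) c)) A" by simp
  finally have "b * emeasure lborel A = b * emeasure (distr lborel borel ((*) c)) A"
    by (simp add: mult.commute)
  then show "emeasure (distr lborel borel ((*) c)) A = emeasure lborel A"
    using b by (simp add: ennreal_mult_cancel_left)
qed simp

lemma integral_periodic_shift: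
  fixes g :: "real \<Rightarrow> real"
  assumes c: "continuous_on UNIV g" and p: "\<And>t. g (t + 2*pi) = g t" and \<alpha>: "0 \<le> \<alpha>" "\<alpha> \<le> 2*pi"
  shows "integral {0..2*pi} (\<lambda>t. g (t + \<alpha>)) = integral {0..2*pi} g"
proof -
  have int: "g integrable_on {x..y}" for x y
    by (intro integrable_continuous_interval continuous_on_subset[OF c]) auto
  have "integral {0..2*pi} (\<lambda>t. g (t + \<alpha>)) = integral {\<alpha>..\<alpha> + 2*pi} g"
    using integral_shift_Icc_real[of 0 "2*pi" g \<alpha>] by (simp add: o_def add.commute)
  also have "\<dots> = integral {\<alpha>..2*pi} g + integral {2*pi..\<alpha> + 2*pi} g"
    by (rule Henstock_Kurzweil_Integration.integral_combine[symmetric]) (use \<alpha> int in auto)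
  also have "integral {2*pi..\<alpha> + 2*pi} g = integral {0..\<alpha>} (\<lambda>t. g (t + 2*pi))"
    using integral_shift_Icc_real[of 0 \<alpha> g "2*pi"] by (simp add: o_def add.commute)
  also have "\<dots> = integral {0..\<alpha>} g" by (simp add: p)
  also have "integral {\<alpha>..2*pi} g + integral {0..\<alpha>} g = integral {0..2*pi} g"
    using Henstock_Kurzweil_Integration.integral_combine[of 0 \<alpha> "2*pi" g] \<alpha> int by simp
  finally show ?thesis .
qed

lemma emeasure_cball_complex: "0 \<le> r \<Longrightarrow> emeasure lborel (cball (a::complex) r) = ennreal (pi * r\<^sup>2)"
  by (simp add: emeasure_cball eval_unit_ball_vol)

text \<open>Measures on the line that are finite on the half-lines \<open>{x<..}\<close> are
  determined by them, and there both sides give the area of an annulus.\<close>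

lemma distr_norm_cball:
  "distr (density lborel (indicator (cball (0::complex) R))) borel norm = density lborel (\<lambda>s. ennreal (2 * pi * s) * indicator {0..R} s)"
proof (rule measure_eqI_lessThan)
  fix x :: real
  have m: "emeasure (distr (density lborel (indicator (cball (0::complex) R))) borel norm) {x<..} = emeasure lborel {z\<in>cball (0::complex) R. norm z > x}"
  proof -
    have [measurable]: "norm -` {x<..} \<in> sets (borel :: complex measure)"
      using measurable_sets[of norm "borel :: complex measure" borel "{x<..}"] by simp
    have "emeasure (distr (density lborel (indicator (cball (0::complex) R))) borel norm) {x<..} = emeasure (density lborel (indicator (cball (0::complex) R))) (norm -` {x<..})"
      by (subst emeasure_distr) auto
    also have "\<dots> = (\<integral>\<^sup>+z. indicator (cball (0::complex) R) z * indicator (norm -` {x<..}) z \<partial>lborel)"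
      by (subst emeasure_density, rule borel_measurable_indicator) auto
    also have "\<dots> = (\<integral>\<^sup>+z. indicator (cball (0::complex) R \<inter> norm -` {x<..}) z \<partial>lborel)"
      by (intro nn_integral_cong) (auto simp: indicator_def)
    also have "\<dots> = emeasure lborel (cball (0::complex) R \<inter> norm -` {x<..})" by simp
    also have "cball (0::complex) R \<inter> norm -` {x<..} = {z\<in>cball (0::complex) R. norm z > x}" by auto
    finally show ?thesis .
  qed
  show "emeasure (distr (density lborel (indicator (cball (0::complex) R))) borel norm) {x<..} < \<infinity>"
    unfolding m by (rule order_le_less_trans[OF _ emeasure_lborel_cball_finite[of 0 R]]) (rule emeasure_mono, auto)
  let ?y = "max 0 x"
  have n: "emeasure (density lborel (\<lambda>s. ennreal (2 * pi * s) * indicator {0..R} s)) {x<..} = (\<integral>\<^sup>+s. ennreal (2 * pi * s) * indicator {?y..R} s \<partial>lborel)"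
    by (subst emeasure_density, simp, simp) (rule nn_integral_cong_AE, use AE_lborel_singleton[of x] in \<open>eventually_elim\<close>, auto simp: indicator_def)
  show "emeasure (distr (density lborel (indicator (cball (0::complex) R))) borel norm) {x<..} = emeasure (density lborel (\<lambda>s. ennreal (2 * pi * s) * indicator {0..R} s)) {x<..}"
  proof (cases "?y \<le> R")
    case True
    then have R0: "0 \<le> R" by simp
    have "(\<integral>\<^sup>+s. ennreal (2 * pi * s) * indicator {?y..R} s \<partial>lborel) = ennreal (pi * R\<^sup>2 - pi * ?y\<^sup>2)"
      by (rule nn_integral_FTC_Icc[OF _ _ _ True]) (auto intro!: derivative_eq_intros simp: power2_eq_square)
    moreover have "emeasure lborel {z\<in>cball (0::complex) R. norm z > x} = emeasure lborel (cball (0::complex) R - cball 0 ?y)"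
    proof (cases "x \<ge> 0")
      case False
      have "emeasure lborel (cball (0::complex) R - cball 0 0) = emeasure lborel (cball (0::complex) R)"
        using R0 by (subst emeasure_Diff) auto
      moreover have "{z\<in>cball (0::complex) R. norm z > x} = cball 0 R" using False by (auto intro: less_le_trans[OF _ norm_ge_zero])
      ultimately show ?thesis using False by (simp add: max_def)
    qed (auto intro!: arg_cong[where f="emeasure lborel"])
    moreover have "emeasure lborel (cball (0::complex) R - cball 0 ?y) = ennreal (pi * R\<^sup>2) - ennreal (pi * ?y\<^sup>2)"
      using True R0 by (subst emeasure_Diff) (auto simp: emeasure_cball_complex subset_iff)
    moreover have "\<dots> = ennreal (pi * R\<^sup>2 - pi * ?y\<^sup>2)"
      by (rule ennreal_minus) simp
    ultimately show ?thesis unfolding m n by simp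
  next
    case False
    then have "{z\<in>cball (0::complex) R. norm z > x} = {}" by (auto simp: max_def split: if_splits intro: order_trans[OF norm_ge_zero])
    moreover have "{?y..R} = {}" using False by auto
    ultimately show ?thesis unfolding m n by (simp only: emeasure_empty) simp
  qed
qed simp_all


lemma integral_rotate:
  fixes f :: "complex \<Rightarrow> real"
  assumes [measurable]: "f \<in> borel_measurable borel" and c: "norm c = 1"
  shows "(LINT z|lborel. f (c * z)) = (LINT z|lborel. f z)"
  by (subst (2) lborel_distr_unit[OF c, symmetric]) (simp add: integral_distr)

lemma integral_translate:
  fixes f :: "complex \<Rightarrow> real"
  assumes [measurable]: "f \<in> borel_measurable borel"
  shows "(LINT z|lborel. f (c + z)) = (LINT z|lborel. f z)"
  by (subst (2) lborel_distr_plus[of c, symmetric]) (simp add: integral_distr)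

lemma integral_radial_cball:
  fixes g :: "real \<Rightarrow> real"
  assumes g: "continuous_on UNIV g"
  shows "(LINT z:cball (0::complex) R|lborel. g (norm z)) = integral {0..R} (\<lambda>s. 2 * pi * s * g s)"
proof -
  have [measurable]: "g \<in> borel_measurable borel" by (rule borel_measurable_continuous_onI[OF g])
  have "(LINT z:cball (0::complex) R|lborel. g (norm z)) = (LINT z|density lborel (indicator (cball (0::complex) R)). g (norm z))"
    unfolding set_lebesgue_integral_def
    by (subst integral_density[of _ _ "\<lambda>z. indicator (cball 0 R) z", symmetric])
       (auto simp: ennreal_indicator intro!: borel_measurable_indicator)
  also have "\<dots> = (LINT s|distr (density lborel (indicator (cball (0::complex) R))) borel norm. g s)"
    by (subst integral_distr) auto
  also have "\<dots> = (LINT s|density lborel (\<lambda>s. ennreal (2 * pi * s * indicator {0..R} s)). g s)"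
    unfolding distr_norm_cball by (intro arg_cong2[where f=lebesgue_integral] density_cong) (auto simp: indicator_def)
  also have "\<dots> = (LINT s|lborel. (2 * pi * s * indicator {0..R} s) * g s)"
    by (subst integral_real_density) (auto simp: indicator_def)
  also have "\<dots> = (LINT s:{0..R}|lborel. 2 * pi * s * g s)"
    unfolding set_lebesgue_integral_def by (intro Bochner_Integration.integral_cong) (auto simp: indicator_def)
  also have "\<dots> = integral {0..R} (\<lambda>s. 2 * pi * s * g s)"
    by (rule set_borel_integral_eq_integral) (intro borel_integrable_compact[unfolded set_integrable_def[symmetric]] compact_Icc continuous_intros continuous_on_subset[OF g], auto)
  finally show ?thesis .
qed

lemma set_integrable_continuous_cball:
  fixes f :: "complex \<Rightarrow> real"
  assumes "continuous_on UNIV f" 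
  shows "set_integrable lborel (cball a R) f"
  unfolding set_integrable_def
  by (intro borel_integrable_compact compact_cball continuous_on_subset[OF assms]) auto

text \<open>Rotating \<open>f\<close> about \<open>a\<close> does not change the integral. Averaging
  over all rotations and exchanging the order of integration replaces \<open>f\<close> by a radial
  function, for which the distribution of the norm gives the formula.\<close>

lemma integral_cball_polar:
  fixes f :: "complex \<Rightarrow> real"
  assumes f: "continuous_on UNIV f"
  shows "(LINT z:cball a R|lborel. f z) = 2 * pi * integral {0..R} (\<lambda>s. s * rmean a f s)"
proof -
  have fm [measurable]: "f \<in> borel_measurable borel" by (rule borel_measurable_continuous_onI[OF f])
  have im: "(\<lambda>z. indicator (cball a R) z *\<^sub>R f z) \<in> borel_measurable borel"
    by (intro borel_measurable_scaleR borel_measurable_indicator fm) auto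
  have im2: "(\<lambda>z. indicator (cball a R) (a + z) *\<^sub>R f (a + z)) \<in> borel_measurable borel"
    by (rule measurable_compose[OF _ im]) simp
  define I where "I = (LINT z:cball a R|lborel. f z)"
  have rot: "I = (LINT z:cball 0 R|lborel. f (a + cis t * z))" for t
  proof -
    have "I = (LINT z|lborel. indicator (cball a R) (a + z) *\<^sub>R f (a + z))"
      unfolding I_def set_lebesgue_integral_def by (rule integral_translate[OF im, symmetric])
    also have "\<dots> = (LINT z|lborel. indicator (cball a R) (a + cis t * z) *\<^sub>R f (a + cis t * z))"
      by (rule integral_rotate[OF im2, symmetric]) simp
    also have "\<dots> = (LINT z:cball 0 R|lborel. f (a + cis t * z))"
      unfolding set_lebesgue_integral_def
      by (intro Bochner_Integration.integral_cong) (auto simp: indicator_def dist_norm norm_mult)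
    finally show ?thesis .
  qed
  have ci: "continuous_on S (\<lambda>t. f (a + cis t * z))" for S z
    by (rule continuous_on_compose2[OF f]) (auto intro!: continuous_intros)
  let ?F = "\<lambda>(t, z). indicator ({0..2*pi} \<times> cball 0 R) (t, z) *\<^sub>R f (a + cis t * z)"
  have "integrable (lborel :: (real \<times> complex) measure) (\<lambda>x. indicator ({0..2*pi} \<times> cball 0 R) x *\<^sub>R (\<lambda>(t, z). f (a + cis t * z)) x)"
  proof (rule borel_integrable_compact)
    show "continuous_on ({0..2*pi} \<times> cball 0 R) (\<lambda>(t, z). f (a + cis t * z))"
      unfolding split_def by (rule continuous_on_compose2[OF f]) (auto intro!: continuous_intros)
  qed (intro compact_Times compact_Icc compact_cball)
  then have int: "integrable (lborel \<Otimes>\<^sub>M lborel) ?F"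
    unfolding lborel_prod by (simp add: split_def)
  have "2 * pi * I = (LINT t|lborel. indicator {0..2*pi} t *\<^sub>R I)"
    by simp
  also have "\<dots> = (LINT t|lborel. LINT z|lborel. indicator ({0..2*pi} \<times> cball 0 R) (t, z) *\<^sub>R f (a + cis t * z))"
  proof (rule Bochner_Integration.integral_cong[OF refl])
    fix t :: real
    show "indicator {0..2*pi} t *\<^sub>R I = (LINT z|lborel. indicator ({0..2*pi} \<times> cball 0 R) (t, z) *\<^sub>R f (a + cis t * z))"
    proof (cases "t \<in> {0..2*pi}")
      case True
      then show ?thesis by (simp add: rot[of t] set_lebesgue_integral_def indicator_def)
    next
      case False
      then have "indicator ({0..2*pi} \<times> cball 0 R) (t, z) = (0::real)" for z :: complex
        by (auto simp: indicator_def)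
      then show ?thesis using False by (simp del: atLeastAtMost_iff)
    qed
  qed
  also have "\<dots> = (LINT z|lborel. LINT t|lborel. indicator ({0..2*pi} \<times> cball 0 R) (t, z) *\<^sub>R f (a + cis t * z))"
    using lborel_pair.Fubini_integral[OF int] by simp
  also have "\<dots> = (LINT z:cball (0::complex) R|lborel. 2 * pi * rmean a f (norm z))"
    unfolding set_lebesgue_integral_def
  proof (rule Bochner_Integration.integral_cong[OF refl])
    fix z :: complex
    have "(LINT t|lborel. indicator ({0..2*pi} \<times> cball 0 R) (t, z) *\<^sub>R f (a + cis t * z)) = indicator (cball 0 R) z *\<^sub>R (LINT t:{0..2*pi}|lborel. f (a + cis t * z))"
      unfolding set_lebesgue_integral_def by (cases "z \<in> cball 0 R") (auto simp: indicator_def)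
    also have "(LINT t:{0..2*pi}|lborel. f (a + cis t * z)) = integral {0..2*pi} (\<lambda>t. f (a + cis t * z))"
      by (rule set_borel_integral_eq_integral) (intro borel_integrable_compact[unfolded set_integrable_def[symmetric]] compact_Icc ci)
    also have "\<dots> = integral {0..2*pi} (\<lambda>t. f (a + of_real (norm z) * cis (t + Arg2pi z)))"
    proof -
      have "z = of_real (norm z) * cis (Arg2pi z)"
        using Arg2pi_eq[of z] by (simp add: cis_conv_exp)
      then have "cis t * z = of_real (norm z) * cis (t + Arg2pi z)" for t
        by (metis cis_mult mult.left_commute)
      then show ?thesis by simp
    qed
    \<comment> \<open>The argument of \<open>z\<close> only shifts the angle, which a full period
      absorbs.\<close>
    also have "\<dots> = integral {0..2*pi} (\<lambda>t. f (a + of_real (norm z) * cis t))"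
      by (rule integral_periodic_shift)
         (use Arg2pi_ge_0[of z] Arg2pi_lt_2pi[of z] in \<open>auto intro!: continuous_circle[OF f] continuous_intros simp: cis_mult[symmetric]\<close>)
    also have "\<dots> = 2 * pi * rmean a f (norm z)" by (simp add: rmean_def)
    finally show "(LINT t|lborel. indicator ({0..2*pi} \<times> cball 0 R) (t, z) *\<^sub>R f (a + cis t * z)) = indicator (cball 0 R) z *\<^sub>R (2 * pi * rmean a f (norm z))" .
  qed
  also have "\<dots> = 2 * pi * (LINT z:cball (0::complex) R|lborel. rmean a f (norm z))" by simp
  also have "(LINT z:cball (0::complex) R|lborel. rmean a f (norm z)) = integral {0..R} (\<lambda>s. 2 * pi * s * rmean a f s)"
    by (rule integral_radial_cball[OF continuous_on_rmean[OF f]])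
  also have "\<dots> = 2 * pi * integral {0..R} (\<lambda>s. s * rmean a f s)"
    by (simp add: mult.assoc)
  finally show ?thesis by (simp add: I_def)
qed

subsection \<open>Fundamental domains\<close>

text \<open>Coordinates in the real basis \<open>a\<close>, \<open>b\<close> of the plane.\<close>

definition cs :: "complex \<Rightarrow> complex \<Rightarrow> complex \<Rightarrow> real" where
  "cs a b z = Re (z / a) - Im (z / a) / Im (b / a) * Re (b / a)"

definition ct :: "complex \<Rightarrow> complex \<Rightarrow> complex \<Rightarrow> real" where
  "ct a b z = Im (z / a) / Im (b / a)"

lemma coord_eq:
  assumes "Im (b / a) > 0"
  shows "of_real (cs a b z) * a + of_real (ct a b z) * b = z"
proof -
  have a: "a \<noteq> 0" using assms by auto
  have "of_real (cs a b z) + of_real (ct a b z) * (b / a) = z / a"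
  proof -
    have "of_real (Re x - Im x / Im q * Re q) + of_real (Im x / Im q) * q = x" if "Im q > 0" for x q
      using that by (simp add: complex_eq_iff)
    from this[OF assms] show ?thesis unfolding cs_def ct_def .
  qed
  then have "(of_real (cs a b z) + of_real (ct a b z) * (b / a)) * a = z / a * a" by simp
  then show ?thesis using a by (simp add: distrib_right)
qed

lemma coord_unique:
  assumes "Im (b / a) > 0"
  shows "cs a b (of_real s * a + of_real t * b) = s" "ct a b (of_real s * a + of_real t * b) = t"
proof -
  have a: "a \<noteq> 0" using assms by auto
  have "(of_real s * a + of_real t * b) / a = of_real s + of_real t * (b / a)"
    using a by (simp add: add_divide_distrib)
  then have "Re ((of_real s * a + of_real t * b) / a) = s + t * Re (b / a)" 
    "Im ((of_real s * a + of_real t * b) / a) = t * Im (b / a)"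
    by (simp_all only: plus_complex.sel Re_complex_of_real Im_complex_of_real times_complex.sel)
  then show "cs a b (of_real s * a + of_real t * b) = s" "ct a b (of_real s * a + of_real t * b) = t"
    using assms by (simp_all add: cs_def ct_def)
qed

lemma coord_linear:
  "cs a b (z + w) = cs a b z + cs a b w" "ct a b (z + w) = ct a b z + ct a b w"
  "cs a b (z - w) = cs a b z - cs a b w" "ct a b (z - w) = ct a b z - ct a b w"
  by (simp_all add: cs_def ct_def add_divide_distrib diff_divide_distrib algebra_simps)

lemma coord_bound:
  obtains C where "C > 0" "\<And>z. \<bar>cs a b z\<bar> \<le> C * norm z" "\<And>z. \<bar>ct a b z\<bar> \<le> C * norm z"
proof
  define C1 where "C1 = 1 / norm a / \<bar>Im (b / a)\<bar>"
  define C where "C = 1 + C1 + (1 / norm a + C1 * \<bar>Re (b / a)\<bar>)"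
  have C1: "C1 \<ge> 0" by (simp add: C1_def)
  then show "C > 0" by (simp add: C_def add_pos_nonneg)
  have t: "\<bar>ct a b z\<bar> \<le> C1 * norm z" for z
    using divide_right_mono[OF abs_Im_le_cmod[of "z / a"], of "\<bar>Im (b / a)\<bar>"]
    by (simp add: ct_def C1_def norm_divide)
  show "\<bar>ct a b z\<bar> \<le> C * norm z" for z
    by (rule order_trans[OF t mult_right_mono]) (use C1 in \<open>auto simp: C_def\<close>)
  show "\<bar>cs a b z\<bar> \<le> C * norm z" for z
  proof -
    have "\<bar>cs a b z\<bar> \<le> \<bar>Re (z / a)\<bar> + \<bar>ct a b z\<bar> * \<bar>Re (b / a)\<bar>"
      using abs_triangle_ineq4[of "Re (z / a)" "ct a b z * Re (b / a)"]
      unfolding cs_def ct_def[symmetric] by (simp add: abs_mult)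
    also have "\<dots> \<le> norm (z / a) + (C1 * norm z) * \<bar>Re (b / a)\<bar>"
      by (intro add_mono abs_Re_le_cmod mult_right_mono t) auto
    also have "\<dots> = (1 / norm a + C1 * \<bar>Re (b / a)\<bar>) * norm z"
      by (simp add: norm_divide algebra_simps)
    also have "\<dots> \<le> C * norm z" using C1 by (intro mult_right_mono) (auto simp: C_def)
    finally show ?thesis .
  qed
qed

lemma lattice_coord:
  assumes "Im (b / a) > 0"
  shows "z \<in> lattice a b \<longleftrightarrow> cs a b z \<in> \<int> \<and> ct a b z \<in> \<int>"
proof
  assume "z \<in> lattice a b"
  then obtain m n where "z = of_int m * a + of_int n * b" by (auto simp: lattice_def)
  then show "cs a b z \<in> \<int> \<and> ct a b z \<in> \<int>"
    using coord_unique[OF assms, of "of_int m" "of_int n"] by simp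
next
  assume "cs a b z \<in> \<int> \<and> ct a b z \<in> \<int>"
  then show "z \<in> lattice a b"
    using coord_eq[OF assms, of z] unfolding lattice_def by (metis (mono_tags, lifting) CollectI Ints_cases of_real_of_int_eq)
qed

lemma parallelogram_coord:
  assumes "Im (b / a) > 0"
  shows "z \<in> parallelogram a b \<longleftrightarrow> cs a b z \<in> {0..<1} \<and> ct a b z \<in> {0..<1}"
proof
  assume "z \<in> parallelogram a b"
  then show "cs a b z \<in> {0..<1} \<and> ct a b z \<in> {0..<1}"
    using coord_unique[OF assms] by (auto simp: parallelogram_def)
next
  assume "cs a b z \<in> {0..<1} \<and> ct a b z \<in> {0..<1}"
  then show "z \<in> parallelogram a b"
    using coord_eq[OF assms, of z] unfolding parallelogram_def by (intro CollectI exI[of _ "cs a b z"] exI[of _ "ct a b z"]) auto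
qed

text \<open>A basis-free substitute for a lattice. It applies equally to the group generated by the
  periods and \<open>p2\<close>, for which a basis matters only when \<open>fund_domain\<close> of
  that group is needed.\<close>

definition discrete_subgroup :: "complex set \<Rightarrow> bool" where
  "discrete_subgroup L \<longleftrightarrow> 0 \<in> L \<and> (\<forall>x\<in>L. \<forall>y\<in>L. x - y \<in> L) \<and> (\<forall>r. finite (L \<inter> cball 0 r))"

lemma discrete_subgroupD:
  assumes "discrete_subgroup L"
  shows "0 \<in> L" "x \<in> L \<Longrightarrow> y \<in> L \<Longrightarrow> x - y \<in> L" "x \<in> L \<Longrightarrow> - x \<in> L" "x \<in> L \<Longrightarrow> y \<in> L \<Longrightarrow> x + y \<in> L"
    "finite (L \<inter> cball 0 r)"
proof -
  show 0: "0 \<in> L" and d: "x \<in> L \<Longrightarrow> y \<in> L \<Longrightarrow> x - y \<in> L" and "finite (L \<inter> cball 0 r)" for x y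
    using assms by (auto simp: discrete_subgroup_def)
  show m: "x \<in> L \<Longrightarrow> - x \<in> L" for x using d[OF 0, of x] by simp
  show "x \<in> L \<Longrightarrow> y \<in> L \<Longrightarrow> x + y \<in> L" using d[of x "- y"] m[of y] by simp
qed

text \<open>Representatives are unique everywhere and not just outside a null set, so that
  decompositions of indicator functions hold pointwise.\<close>

definition fundamental_domain :: "complex set \<Rightarrow> complex set \<Rightarrow> bool" where
  "fundamental_domain L D \<longleftrightarrow> D \<in> sets borel \<and> bounded D \<and> (\<forall>z. \<exists>!l. l \<in> L \<and> z - l \<in> D)"

lemma fundamental_domain_obtain:
  assumes "fundamental_domain L D"
  obtains l where "l \<in> L" "z - l \<in> D" "\<And>l'. l' \<in> L \<Longrightarrow> z - l' \<in> D \<Longrightarrow> l' = l"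
proof -
  have "\<exists>!l. l \<in> L \<and> z - l \<in> D" using assms by (simp add: fundamental_domain_def)
  then show ?thesis using that by (elim ex1E) blast
qed

lemma discrete_subgroup_lattice:
  assumes "Im (b / a) > 0"
  shows "discrete_subgroup (lattice a b)"
  unfolding discrete_subgroup_def
proof (intro conjI ballI allI)
  show "0 \<in> lattice a b" by (simp add: lattice_coord[OF assms] cs_def ct_def)
  show "x - y \<in> lattice a b" if "x \<in> lattice a b" "y \<in> lattice a b" for x y
    using that by (simp add: lattice_coord[OF assms] coord_linear)
  fix r :: real
  obtain C where C: "C > 0" "\<And>z. \<bar>cs a b z\<bar> \<le> C * norm z" "\<And>z. \<bar>ct a b z\<bar> \<le> C * norm z"
    using coord_bound by blast
  define K where "K = \<lceil>C * \<bar>r\<bar>\<rceil>"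
  have "lattice a b \<inter> cball 0 r \<subseteq> (\<lambda>(m, n). of_int m * a + of_int n * b) ` ({-K..K} \<times> {-K..K})"
  proof
    fix z assume z: "z \<in> lattice a b \<inter> cball 0 r"
    then obtain m n where mn: "z = of_int m * a + of_int n * b" by (auto simp: lattice_def)
    have "C * norm z \<le> C * \<bar>r\<bar>" using z C by (intro mult_left_mono) auto
    moreover have "\<bar>of_int m\<bar> \<le> C * norm z" "\<bar>of_int n\<bar> \<le> C * norm z"
      using C(2,3)[of z] coord_unique[OF assms, of "of_int m" "of_int n"] by (simp_all add: mn)
    ultimately have "\<bar>of_int m\<bar> \<le> real_of_int K" "\<bar>of_int n\<bar> \<le> real_of_int K"
      unfolding K_def by linarith+
    then have "m \<in> {-K..K}" "n \<in> {-K..K}" by auto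
    then show "z \<in> (\<lambda>(m, n). of_int m * a + of_int n * b) ` ({-K..K} \<times> {-K..K})"
      by (auto simp: mn intro!: image_eqI[where x = "(m, n)"])
  qed
  then show "finite (lattice a b \<inter> cball 0 r)" by (rule finite_subset) auto
qed

lemma fd_parallelogram:
  assumes "Im (b / a) > 0"
  shows "fundamental_domain (lattice a b) (parallelogram a b)"
  unfolding fundamental_domain_def
proof (intro conjI allI)
  have "a \<noteq> 0" using assms by auto
  then have "continuous_on UNIV (cs a b)" "continuous_on UNIV (ct a b)"
    unfolding cs_def[abs_def] ct_def[abs_def] using assms by (auto intro!: continuous_intros)
  then have m: "cs a b \<in> borel_measurable borel" "ct a b \<in> borel_measurable borel"
    by (auto intro: borel_measurable_continuous_onI)
  have "cs a b -` {0..<1} \<inter> ct a b -` {0..<1} \<in> sets borel"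
  proof (rule sets.Int)
    have b: "{0..<1::real} \<in> sets borel" by simp
    show "cs a b -` {0..<1} \<in> sets borel" using measurable_sets[OF m(1) b] by simp
    show "ct a b -` {0..<1} \<in> sets borel" using measurable_sets[OF m(2) b] by simp
  qed
  moreover have "cs a b -` {0..<1} \<inter> ct a b -` {0..<1} = parallelogram a b"
    by (rule set_eqI) (simp only: parallelogram_coord[OF assms] Int_iff vimage_eq)
  ultimately show "parallelogram a b \<in> sets borel" by simp
  show "bounded (parallelogram a b)"
  proof (rule boundedI)
    fix z assume "z \<in> parallelogram a b"
    then obtain s t where st: "z = of_real s * a + of_real t * b" "s \<in> {0..<1}" "t \<in> {0..<1}"
      by (auto simp: parallelogram_def)
    have "norm z \<le> \<bar>s\<bar> * norm a + \<bar>t\<bar> * norm b"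
      unfolding st using norm_triangle_ineq[of "of_real s * a" "of_real t * b"] by (simp add: norm_mult)
    also have "\<dots> \<le> 1 * norm a + 1 * norm b"
      using st by (intro add_mono mult_right_mono) auto
    finally show "norm z \<le> 1 * norm a + 1 * norm b" .
  qed
  fix z
  show "\<exists>!l. l \<in> lattice a b \<and> z - l \<in> parallelogram a b"
  proof (rule ex_ex1I)
    let ?l = "of_int \<lfloor>cs a b z\<rfloor> * a + of_int \<lfloor>ct a b z\<rfloor> * b"
    have l: "cs a b ?l = of_int \<lfloor>cs a b z\<rfloor>" "ct a b ?l = of_int \<lfloor>ct a b z\<rfloor>"
      using coord_unique[OF assms, of "of_int \<lfloor>cs a b z\<rfloor>" "of_int \<lfloor>ct a b z\<rfloor>"] by simp_all
    have "?l \<in> lattice a b" by (auto simp: lattice_def)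
    moreover have "z - ?l \<in> parallelogram a b"
    proof -
      have "cs a b (z - ?l) = cs a b z - of_int \<lfloor>cs a b z\<rfloor>" "ct a b (z - ?l) = ct a b z - of_int \<lfloor>ct a b z\<rfloor>"
        by (simp_all only: coord_linear(3,4) l)
      then show ?thesis unfolding parallelogram_coord[OF assms] atLeastLessThan_iff by linarith
    qed
    ultimately show "\<exists>l. l \<in> lattice a b \<and> z - l \<in> parallelogram a b" by blast
  next
    fix l l' assume l: "l \<in> lattice a b \<and> z - l \<in> parallelogram a b" "l' \<in> lattice a b \<and> z - l' \<in> parallelogram a b"
    have eq: "x = y" if "x \<in> \<int>" "y \<in> \<int>" "0 \<le> c - x" "c - x < 1" "0 \<le> c - y" "c - y < 1" for x y c :: real
      using that by (auto elim!: Ints_cases)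
    have "cs a b l = cs a b l'" 
      by (rule eq[of _ _ "cs a b z"]) (use l in \<open>auto simp: lattice_coord[OF assms] parallelogram_coord[OF assms] coord_linear\<close>)
    moreover have "ct a b l = ct a b l'" 
      by (rule eq[of _ _ "ct a b z"]) (use l in \<open>auto simp: lattice_coord[OF assms] parallelogram_coord[OF assms] coord_linear\<close>)
    ultimately show "l = l'" by (metis coord_eq[OF assms])
  qed
qed

lemma fd_translate:
  assumes "fundamental_domain L D"
  shows "fundamental_domain L ((+) c ` D)"
proof -
  have "(\<lambda>z. z - c) -` D \<in> sets borel"
    using measurable_sets[of "\<lambda>z. z - c" "borel" borel D] assms by (simp add: fundamental_domain_def)
  moreover have "(\<lambda>z. z - c) -` D = (+) c ` D" by (auto simp: image_iff) (metis add.commute diff_add_cancel)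
  ultimately have 1: "(+) c ` D \<in> sets borel" by simp
  have 2: "z - l \<in> (+) c ` D \<longleftrightarrow> (z - c) - l \<in> D" for z l
    by (auto simp: image_iff algebra_simps) (metis add_diff_cancel_left' diff_diff_eq2 diff_add_eq)
  show ?thesis using assms 1 unfolding fundamental_domain_def 2 by (auto intro: bounded_translation)
qed

lemma set_integrable_bounded:
  fixes f :: "complex \<Rightarrow> real"
  assumes "f \<in> borel_measurable borel" "\<And>z. \<bar>f z\<bar> \<le> B" "D \<in> sets borel" "bounded D"
  shows "set_integrable lborel D f"
proof -
  have e: "emeasure lborel D < \<infinity>" using assms(4) by (rule emeasure_bounded_finite)
  have "integrable lborel (\<lambda>z. indicator D z *\<^sub>R B)"
    using e assms(3) by (intro integrable_scaleR_left integrable_real_indicator) auto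
  then show ?thesis unfolding set_integrable_def
  proof (rule Bochner_Integration.integrable_bound)
    show "(\<lambda>x. indicat_real D x *\<^sub>R f x) \<in> borel_measurable lborel"
      using assms by (intro borel_measurable_scaleR borel_measurable_indicator) auto
    have "\<bar>f z\<bar> \<le> \<bar>B\<bar>" for z using assms(2)[of z] by simp
    then show "AE x in lborel. norm (indicat_real D x *\<^sub>R f x) \<le> norm (indicat_real D x *\<^sub>R B)"
      by (auto simp: indicator_def)
  qed
qed

text \<open>Cut \<open>D\<close> along the translates of \<open>D'\<close>, move each piece back by
  its period, and the pieces make up \<open>D'\<close>. Boundedness of both domains and discreteness
  of \<open>L\<close> leave finitely many pieces.\<close>

lemma fd_integral_eq:
  fixes f :: "complex \<Rightarrow> real"
  assumes L: "discrete_subgroup L" and D: "fundamental_domain L D" and D': "fundamental_domain L D'" and f: "f \<in> borel_measurable borel" "\<And>z. \<bar>f z\<bar> \<le> B"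
    and per: "periodic L f"
  shows "(LINT z:D|lborel. f z) = (LINT z:D'|lborel. f z)"
proof -
  note G = discrete_subgroupD[OF L]
  have s: "D \<in> sets borel" "D' \<in> sets borel" and b: "bounded D" "bounded D'" using D D' by (auto simp: fundamental_domain_def)
  define F where "F = {l\<in>L. \<exists>z\<in>D. z - l \<in> D'}"
  have finF: "finite F"
  proof -
    obtain M1 M2 where M: "\<forall>z\<in>D. norm z \<le> M1" "\<forall>z\<in>D'. norm z \<le> M2" using b by (auto simp: bounded_iff)
    have "F \<subseteq> L \<inter> cball 0 (M1 + M2)"
    proof
      fix l assume "l \<in> F"
      then obtain z where z: "l \<in> L" "z \<in> D" "z - l \<in> D'" by (auto simp: F_def)
      have "norm l \<le> norm z + norm (z - l)" using norm_triangle_ineq4[of z "z - l"] by simp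
      also have "\<dots> \<le> M1 + M2" using M z by (intro add_mono) auto
      finally show "l \<in> L \<inter> cball 0 (M1 + M2)" using z by simp
    qed
    then show ?thesis using G(5) by (rule finite_subset)
  qed
  have tr: "(\<lambda>z. z + l) -` S \<in> sets borel" if "S \<in> sets borel" for S and l :: complex
    using measurable_sets[of "\<lambda>z. z + l" borel borel S] that by simp
  have int: "integrable lborel (\<lambda>z. indicator D z * indicator D' (z - l) * f z)" for l
  proof -
    have "set_integrable lborel (D \<inter> (\<lambda>z. z + (- l)) -` D') f"
      by (intro set_integrable_bounded[OF f] sets.Int s tr bounded_Int) (use b in auto)
    moreover have "(\<lambda>z. indicator (D \<inter> (\<lambda>z. z + (- l)) -` D') z *\<^sub>R f z) = (\<lambda>z. indicator D z * indicator D' (z - l) * f z)"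
      by (auto simp: indicator_def)
    ultimately show ?thesis unfolding set_integrable_def by (simp only:)
  qed
  have int2: "integrable lborel (\<lambda>z. indicator D (l + z) * indicator D' z * f z)" for l
  proof -
    have "set_integrable lborel (D' \<inter> (\<lambda>z. z + l) -` D) f"
      by (intro set_integrable_bounded[OF f] sets.Int s tr bounded_Int) (use b in auto)
    moreover have "(\<lambda>z. indicator (D' \<inter> (\<lambda>z. z + l) -` D) z *\<^sub>R f z) = (\<lambda>z. indicator D (l + z) * indicator D' z * f z)"
      by (auto simp: indicator_def add.commute)
    ultimately show ?thesis unfolding set_integrable_def by (simp only:)
  qed
  have one: "indicator D z = (\<Sum>l\<in>F. indicator D z * indicator D' (z - l) :: real)" for z
  proof (cases "z \<in> D")
    case True
    obtain l where l: "l \<in> L" "z - l \<in> D'" "\<And>l'. l' \<in> L \<Longrightarrow> z - l' \<in> D' \<Longrightarrow> l' = l" using fundamental_domain_obtain[OF D', of z] by blast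
    from l(1,2) have "l \<in> F" using True by (auto simp: F_def)
    have "(\<Sum>l\<in>F. indicator D z * indicator D' (z - l) :: real) = (\<Sum>l'\<in>{l}. 1)"
    proof (rule sum.mono_neutral_cong_right)
      show "\<forall>i\<in>F - {l}. indicator D z * indicator D' (z - i) = (0::real)"
        using l(3) by (auto simp: F_def indicator_def)
    qed (use \<open>l \<in> F\<close> finF True l(2) in auto)
    then show ?thesis using True by simp
  qed simp
  have two: "indicator D' z = (\<Sum>l\<in>F. indicator D (l + z) * indicator D' z :: real)" for z
  proof (cases "z \<in> D'")
    case True
    obtain l where l: "l \<in> L" "z - l \<in> D" "\<And>l'. l' \<in> L \<Longrightarrow> z - l' \<in> D \<Longrightarrow> l' = l" using fundamental_domain_obtain[OF D, of z] by blast
    have lF: "- l \<in> F" using True l(1,2) G(3)[of l] by (auto simp: F_def intro!: bexI[of _ "z - l"])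
    have u: "l' = - l" if "l' \<in> L" "l' + z \<in> D" for l'
      using l(3)[of "- l'"] G(3)[of l'] that by (metis add.commute diff_minus_eq_add minus_minus)
    have "(\<Sum>l\<in>F. indicator D (l + z) * indicator D' z :: real) = (\<Sum>l'\<in>{- l}. 1)"
    proof (rule sum.mono_neutral_cong_right)
      show "\<forall>i\<in>F - {- l}. indicator D (i + z) * indicator D' z = (0::real)"
        using u by (auto simp: F_def indicator_def)
    qed (use lF finF True l(2) in auto)
    then show ?thesis using True by simp
  qed simp
  have "(LINT z:D|lborel. f z) = (LINT z|lborel. (\<Sum>l\<in>F. indicator D z * indicator D' (z - l) * f z))"
    unfolding set_lebesgue_integral_def by (intro Bochner_Integration.integral_cong refl) (subst one, simp add: sum_distrib_right)
  also have "\<dots> = (\<Sum>l\<in>F. LINT z|lborel. indicator D z * indicator D' (z - l) * f z)"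
    by (rule Bochner_Integration.integral_sum[OF int])
  also have "\<dots> = (\<Sum>l\<in>F. LINT z|lborel. indicator D (l + z) * indicator D' z * f z)"
  proof (rule sum.cong[OF refl])
    fix l assume "l \<in> F"
    then have "f (l + z) = f z" for z using per by (auto simp: F_def periodic_def add.commute)
    then show "(LINT z|lborel. indicator D z * indicator D' (z - l) * f z) = (LINT z|lborel. indicator D (l + z) * indicator D' z * f z)"
      using integral_translate[OF borel_measurable_integrable[OF int[of l], simplified], of l] by simp
  qed
  also have "\<dots> = (LINT z|lborel. (\<Sum>l\<in>F. indicator D (l + z) * indicator D' z * f z))"
    by (rule Bochner_Integration.integral_sum[OF int2, symmetric])
  also have "\<dots> = (LINT z:D'|lborel. f z)"
    unfolding set_lebesgue_integral_def by (intro Bochner_Integration.integral_cong refl) (subst (2) two, simp add: sum_distrib_right)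
  finally show ?thesis .
qed

text \<open>All that is known of the chosen basis is that it is oriented and generates the same
  lattice; this is enough.\<close>

lemma fund_domain_fd:
  assumes "Im (b / a) > 0"
  shows "fundamental_domain (lattice a b) (fund_domain (lattice a b))"
proof -
  define ab where "ab = (SOME (x, y). Im (y / x) > 0 \<and> lattice a b = lattice x y)"
  obtain x y where xy: "ab = (x, y)" by force
  have "case ab of (x, y) \<Rightarrow> Im (y / x) > 0 \<and> lattice a b = lattice x y"
    unfolding ab_def by (rule someI[of _ "(a, b)"]) (use assms in auto)
  then have "Im (y / x) > 0" "lattice a b = lattice x y" by (auto simp: xy)
  moreover have "fund_domain (lattice a b) = parallelogram x y"
    unfolding fund_domain_def ab_def[symmetric] xy by simp
  ultimately show ?thesis using fd_parallelogram by metis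
qed

subsection \<open>Integration over a torus\<close>

text \<open>One class of integrands for everything below: it contains the continuous periodic
  functions and their truncations by indicator functions, and its members are integrable over every
  fundamental domain.\<close>

definition bounded_borel :: "(complex \<Rightarrow> real) \<Rightarrow> bool" where
  "bounded_borel f \<longleftrightarrow> f \<in> borel_measurable borel \<and> (\<exists>B. \<forall>z. \<bar>f z\<bar> \<le> B)"

text \<open>Kept free of a basis so that it can be interpreted both for the original torus and for
  the half torus.\<close>

locale torus =
  fixes L :: "complex set"
  assumes L: "discrete_subgroup L" and fd: "fundamental_domain L (fund_domain L)"
begin

abbreviation "tint \<equiv> torus_integral L"

lemma fd_borel [measurable]: "fund_domain L \<in> sets borel" and fd_bounded: "bounded (fund_domain L)"
  using fd by (auto simp: fundamental_domain_def)

lemma periodicD: "periodic L f \<Longrightarrow> l \<in> L \<Longrightarrow> f (z + l) = f z"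
  by (auto simp: periodic_def)

lemma periodicD': "periodic L f \<Longrightarrow> l \<in> L \<Longrightarrow> f (z - l) = f z"
  using periodicD[of f "- l" z] discrete_subgroupD(3)[OF L] by auto

lemma reduce: obtains M where "M > 0" "\<And>z. \<exists>l\<in>L. norm (z - l) \<le> M"
proof -
  obtain M where M: "M > 0" "\<And>z. z \<in> fund_domain L \<Longrightarrow> norm z \<le> M" using fd_bounded by (auto simp: bounded_pos)
  have "\<exists>l\<in>L. norm (z - l) \<le> M" for z
  proof -
    obtain l where "l \<in> L" "z - l \<in> fund_domain L" using fundamental_domain_obtain[OF fd, of z] by blast
    then show ?thesis using M by blast
  qed
  with M that show ?thesis by blast
qed

lemma periodic_max:
  fixes f :: "complex \<Rightarrow> real"
  assumes "continuous_on UNIV f" "periodic L f"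
  shows "\<exists>x. \<forall>z. f z \<le> f x"
proof -
  obtain M where M: "M > 0" "\<And>z. \<exists>l\<in>L. norm (z - l) \<le> M" by (rule reduce) blast
  have "\<exists>x\<in>cball 0 M. \<forall>y\<in>cball 0 M. f y \<le> f x"
    by (rule continuous_attains_sup) (use M in \<open>auto intro: continuous_on_subset[OF assms(1)]\<close>)
  then obtain x where x: "\<And>y. norm y \<le> M \<Longrightarrow> f y \<le> f x" unfolding Ball_def Bex_def mem_cball_0 by blast
  have "f z \<le> f x" for z
  proof -
    obtain l where l: "l \<in> L" "norm (z - l) \<le> M" using M(2)[of z] by blast
    show ?thesis using x[OF l(2)] periodicD'[OF assms(2) l(1)] by simp
  qed
  then show ?thesis by blast
qed

lemma periodic_bounded:
  fixes f :: "complex \<Rightarrow> 'a::real_normed_vector"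
  assumes "continuous_on UNIV f" "periodic L f"
  obtains B where "B > 0" "\<And>z. norm (f z) \<le> B"
proof -
  obtain x where x: "\<And>z. norm (f z) \<le> norm (f x)"
    using periodic_max[of "\<lambda>z. norm (f z)"] assms by (auto simp: periodic_def intro: continuous_on_norm)
  show ?thesis by (rule that[of "norm (f x) + 1"]) (use x in \<open>auto intro: add_nonneg_pos order_trans[OF x]\<close>)
qed

lemma bounded_borel_continuous:
  assumes "continuous_on UNIV f" "periodic L f"
  shows "bounded_borel f"
  using periodic_bounded[OF assms] borel_measurable_continuous_onI[OF assms(1)] unfolding bounded_borel_def
  by (metis real_norm_def)

lemma bounded_borel_integrable: "bounded_borel f \<Longrightarrow> set_integrable lborel (fund_domain L) f"
  unfolding bounded_borel_def using set_integrable_bounded[OF _ _ fd_borel fd_bounded] by blast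

lemma tint_add: "bounded_borel f \<Longrightarrow> bounded_borel g \<Longrightarrow> tint (\<lambda>z. f z + g z) = tint f + tint g"
  unfolding torus_integral_def by (intro set_integral_add bounded_borel_integrable)

lemma tint_diff: "bounded_borel f \<Longrightarrow> bounded_borel g \<Longrightarrow> tint (\<lambda>z. f z - g z) = tint f - tint g"
  unfolding torus_integral_def by (intro set_integral_diff bounded_borel_integrable)

lemma tint_cmult: "tint (\<lambda>z. c * f z) = c * tint f"
  unfolding torus_integral_def by simp

lemma tint_mono: "bounded_borel f \<Longrightarrow> bounded_borel g \<Longrightarrow> (\<And>z. f z \<le> g z) \<Longrightarrow> tint f \<le> tint g"
  unfolding torus_integral_def by (intro set_integral_mono bounded_borel_integrable) auto

lemma bounded_borel_const [simp]: "bounded_borel (\<lambda>z. c)"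
  by (auto simp: bounded_borel_def)

lemma tint_const: "tint (\<lambda>z. c) = c * torus_area L"
  unfolding torus_integral_def torus_area_def set_lebesgue_integral_def by simp

lemma bounded_borel_add: "bounded_borel f \<Longrightarrow> bounded_borel g \<Longrightarrow> bounded_borel (\<lambda>z. f z + g z)"
  unfolding bounded_borel_def by (auto intro: order_trans[OF abs_triangle_ineq add_mono] borel_measurable_add)

lemma bounded_borel_mult:
  assumes "bounded_borel f" "bounded_borel g" shows "bounded_borel (\<lambda>z. f z * g z)"
proof -
  obtain A B where "\<And>z. \<bar>f z\<bar> \<le> A" "\<And>z. \<bar>g z\<bar> \<le> B" using assms by (auto simp: bounded_borel_def)
  then have "\<bar>f z * g z\<bar> \<le> A * B" for z unfolding abs_mult by (intro mult_mono) (auto intro: order_trans[OF abs_ge_zero])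
  then show ?thesis using assms by (auto simp: bounded_borel_def intro: borel_measurable_times)
qed

lemma bounded_borel_shift: "bounded_borel f \<Longrightarrow> bounded_borel (\<lambda>z. f (c + z))"
  unfolding bounded_borel_def by (auto intro: measurable_compose[of "\<lambda>z. c + z" borel borel f])

lemma tint_nonneg: "bounded_borel f \<Longrightarrow> (\<And>z. 0 \<le> f z) \<Longrightarrow> 0 \<le> tint f"
  using tint_mono[of "\<lambda>_. 0" f] by (simp add: tint_const)

lemma tint_abs_le: "bounded_borel f \<Longrightarrow> (\<And>z. \<bar>f z\<bar> \<le> B) \<Longrightarrow> \<bar>tint f\<bar> \<le> B * torus_area L"
proof -
  assume f: "bounded_borel f" and B: "\<And>z. \<bar>f z\<bar> \<le> B"
  have "tint f \<le> B * torus_area L"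
    using tint_mono[OF f bounded_borel_const, of B] B by (auto simp: tint_const abs_le_iff)
  moreover have "- B * torus_area L \<le> tint f"
    using tint_mono[OF bounded_borel_const f, of "- B"] B by (auto simp: tint_const abs_le_iff minus_le_iff)
  ultimately show ?thesis by simp
qed

lemma tint_shift:
  assumes "bounded_borel f" "periodic L f"
  shows "tint (\<lambda>z. f (c + z)) = tint f"
proof -
  have fm: "f \<in> borel_measurable borel" using assms by (simp add: bounded_borel_def)
  obtain B where B: "\<And>z. \<bar>f z\<bar> \<le> B" using assms by (auto simp: bounded_borel_def)
  let ?D = "(+) c ` fund_domain L"
  have fd': "fundamental_domain L ?D" by (rule fd_translate[OF fd])
  then have Db: "?D \<in> sets borel" by (simp add: fundamental_domain_def)
  have "tint f = (LINT z|lborel. indicator ?D z *\<^sub>R f z)"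
    using fd_integral_eq[OF L fd fd' fm B assms(2)] unfolding torus_integral_def set_lebesgue_integral_def by simp
  also have "\<dots> = (LINT z|lborel. indicator ?D (c + z) *\<^sub>R f (c + z))"
    by (rule integral_translate[symmetric]) (intro borel_measurable_scaleR borel_measurable_indicator Db fm)
  also have "\<dots> = tint (\<lambda>z. f (c + z))"
    unfolding torus_integral_def set_lebesgue_integral_def
    by (intro Bochner_Integration.integral_cong refl) (auto simp: indicator_def)
  finally show ?thesis by simp
qed

text \<open>\<open>N\<close> bounds the number of translates of the fundamental domain that a disc
  of radius \<open>R\<close> can meet. Its centre may first be moved into a bounded region by a
  period, hence \<open>N\<close> does not depend on \<open>x\<close>.\<close>

lemma integral_cball_le:
  obtains N where "N > 0" "\<And>x f. bounded_borel f \<Longrightarrow> periodic L f \<Longrightarrow> (\<And>z. 0 \<le> f z) \<Longrightarrow> (LINT z:cball x R|lborel. f z) \<le> N * tint f"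
proof -
  obtain M where M: "M > 0" "\<And>z. \<exists>l\<in>L. norm (z - l) \<le> M" by (rule reduce) blast
  obtain K where K: "\<And>z. z \<in> fund_domain L \<Longrightarrow> norm z \<le> K" using fd_bounded by (auto simp: bounded_pos)
  define F where "F = L \<inter> cball 0 (M + R + K)"
  have finF: "finite F" unfolding F_def by (rule discrete_subgroupD(5)[OF L])
  have "(LINT z:cball x R|lborel. f z) \<le> (real (card F) + 1) * tint f"
    if f: "bounded_borel f" and per: "periodic L f" and pos: "\<And>z. 0 \<le> f z" for x f
  proof -
    have fm: "f \<in> borel_measurable borel" using f by (simp add: bounded_borel_def)
    obtain B where B: "\<And>z. \<bar>f z\<bar> \<le> B" using f by (auto simp: bounded_borel_def)
    obtain l where l: "l \<in> L" "norm (x - l) \<le> M" using M by blast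
    have Dl: "(\<lambda>z. z - m) -` fund_domain L \<in> sets borel" for m
      using measurable_sets[of "\<lambda>z. z - m" borel borel "fund_domain L"] by simp
    have eqi: "indicator ((\<lambda>z. z - m) -` fund_domain L) z * f z = indicator (fund_domain L) (z - m) * f z" for m z
      by (simp add: indicator_def)
    have "bounded ((\<lambda>z. z - m) -` fund_domain L)" for m
    proof (rule boundedI)
      fix z assume "z \<in> (\<lambda>z. z - m) -` fund_domain L"
      then show "norm z \<le> K + norm m" using K[of "z - m"] norm_triangle_ineq[of "z - m" m] by simp
    qed
    from set_integrable_bounded[OF fm B Dl this]
    have int: "integrable lborel (\<lambda>z. indicator (fund_domain L) (z - m) * f z)" for m
      unfolding set_integrable_def by (simp add: eqi)
    have int0: "integrable lborel (\<lambda>z. indicator (cball (x - l) R) z *\<^sub>R f z)"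
      using set_integrable_bounded[OF fm B, of "cball (x - l) R"] by (simp add: set_integrable_def)
    have "(LINT z:cball x R|lborel. f z) = (LINT z|lborel. indicator (cball x R) (l + z) *\<^sub>R f (l + z))"
      unfolding set_lebesgue_integral_def
      by (rule integral_translate[symmetric]) (intro borel_measurable_scaleR borel_measurable_indicator fm, simp)
    also have "\<dots> = (LINT z|lborel. indicator (cball (x - l) R) z *\<^sub>R f z)"
      by (intro Bochner_Integration.integral_cong refl)
         (auto simp: indicator_def dist_norm algebra_simps periodicD[OF per l(1)] add.commute[of l])
    also have "\<dots> \<le> (LINT z|lborel. (\<Sum>m\<in>F. indicator (fund_domain L) (z - m) * f z))"
    proof (rule integral_mono[OF int0 Bochner_Integration.integrable_sum[OF int]])
      fix z
      show "indicator (cball (x - l) R) z *\<^sub>R f z \<le> (\<Sum>m\<in>F. indicator (fund_domain L) (z - m) * f z)"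
      proof (cases "z \<in> cball (x - l) R")
        case True
        obtain m where m: "m \<in> L" "z - m \<in> fund_domain L" using fundamental_domain_obtain[OF fd, of z] by blast
        have "norm z \<le> norm (x - l) + norm (z - (x - l))" by (metis add.commute norm_triangle_sub)
        also have "\<dots> \<le> M + R" using True l(2) by (intro add_mono) (auto simp: dist_norm norm_minus_commute)
        finally have "norm m \<le> M + R + K" using K[OF m(2)] norm_triangle_ineq4[of z "z - m"] by simp
        then have "m \<in> F" using m by (simp add: F_def)
        have "f z = indicator (fund_domain L) (z - m) * f z" using m by simp
        also have "\<dots> \<le> (\<Sum>m\<in>F. indicator (fund_domain L) (z - m) * f z)"
          by (rule member_le_sum[OF \<open>m \<in> F\<close> _ finF]) (simp add: pos)
        finally show ?thesis using True by simp
      qed (simp add: sum_nonneg pos)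
    qed
    also have "\<dots> = (\<Sum>m\<in>F. LINT z|lborel. indicator (fund_domain L) (z - m) * f z)"
      by (rule Bochner_Integration.integral_sum[OF int])
    also have "\<dots> = (\<Sum>m\<in>F. tint f)"
    proof (rule sum.cong[OF refl])
      fix m assume "m \<in> F"
      then have m: "m \<in> L" by (simp add: F_def)
      have "(LINT z|lborel. indicator (fund_domain L) (z - m) * f z) = (LINT z|lborel. indicator (fund_domain L) (m + z - m) * f (m + z))"
        using integral_translate[OF borel_measurable_integrable[OF int[of m], simplified], of m] by simp
      also have "\<dots> = tint f"
        unfolding torus_integral_def set_lebesgue_integral_def
        by (intro Bochner_Integration.integral_cong refl) (simp add: periodicD[OF per m] add.commute[of m])
      finally show "(LINT z|lborel. indicator (fund_domain L) (z - m) * f z) = tint f" .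
    qed
    also have "\<dots> \<le> (real (card F) + 1) * tint f"
      using tint_nonneg[OF f pos] by (simp add: distrib_right)
    finally show ?thesis .
  qed
  then show ?thesis using that[of "real (card F) + 1"] by (simp add: add_nonneg_pos)
qed

lemma periodic_uniformly_continuous:
  fixes f :: "complex \<Rightarrow> real"
  assumes c: "continuous_on UNIV f" and per: "periodic L f" and e: "e > 0"
  shows "\<exists>d>0. \<forall>x y. dist x y < d \<longrightarrow> \<bar>f x - f y\<bar> < e"
proof -
  obtain M where M: "M > 0" "\<And>z. \<exists>l\<in>L. norm (z - l) \<le> M" by (rule reduce) blast
  have "uniformly_continuous_on (cball 0 (M + 1)) f"
    by (rule compact_uniformly_continuous[OF continuous_on_subset[OF c]]) auto
  then obtain d where d: "d > 0" "\<And>x y. x \<in> cball 0 (M + 1) \<Longrightarrow> y \<in> cball 0 (M + 1) \<Longrightarrow> dist y x < d \<Longrightarrow> dist (f y) (f x) < e"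
    using e unfolding uniformly_continuous_on_def by metis
  have "\<bar>f x - f y\<bar> < e" if "dist x y < min d 1" for x y
  proof -
    obtain l where l: "l \<in> L" "norm (x - l) \<le> M" using M(2)[of x] by blast
    have "norm (y - l) \<le> norm (x - l) + norm (y - x)" using norm_triangle_ineq[of "x - l" "y - x"] by simp
    also have "\<dots> \<le> M + 1" using l that by (intro add_mono) (auto simp: dist_norm norm_minus_commute)
    finally have "dist (f (x - l)) (f (y - l)) < e" using that l M(1) by (intro d(2)) (auto simp: dist_norm norm_minus_commute)
    then show ?thesis by (simp add: periodicD'[OF per l(1)] dist_real_def)
  qed
  then show ?thesis using d(1) by (intro exI[of _ "min d 1"]) auto
qed

lemma difference_quotient:
  fixes f :: "complex \<Rightarrow> real"
  assumes f: "\<And>z. (f has_derivative f' z) (at z)" and c: "continuous_on UNIV (\<lambda>z. f' z v)" 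
    and per: "periodic L (\<lambda>z. f' z v)" and e: "e > 0"
  shows "\<exists>d>0. \<forall>h z. 0 < h \<and> h < d \<longrightarrow> \<bar>(f (of_real h * v + z) - f z) / h - f' z v\<bar> \<le> e"
proof -
  obtain d where d: "d > 0" "\<And>x y. dist x y < d \<Longrightarrow> \<bar>f' x v - f' y v\<bar> < e"
    using periodic_uniformly_continuous[OF c per e] by blast
  have "\<bar>(f (of_real h * v + z) - f z) / h - f' z v\<bar> \<le> e" if h: "0 < h" "h < d / (norm v + 1)" for h z
  proof -
    have "((\<lambda>t. f (of_real t * v + z)) has_derivative (\<lambda>s. s * f' (of_real t * v + z) v)) (at t)" for t
    proof -
      have "((\<lambda>t. of_real t * v + z) has_derivative (\<lambda>s. s *\<^sub>R v)) (at t)"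
        by (auto intro!: derivative_eq_intros simp: scaleR_conv_of_real)
      from has_derivative_compose[OF this f] show ?thesis
        using linear_scale[OF has_derivative_linear[OF f]] by simp
    qed
    then have "((\<lambda>t. f (of_real t * v + z)) has_real_derivative f' (of_real t * v + z) v) (at t)" for t
      by (simp add: has_field_derivative_def mult_commute_abs)
    then obtain t where t: "0 < t" "t < h" "f (of_real h * v + z) - f (of_real 0 * v + z) = (h - 0) * f' (of_real t * v + z) v"
      using MVT2[OF h(1), of "\<lambda>t. f (of_real t * v + z)" "\<lambda>t. f' (of_real t * v + z) v"] by blast
    have "dist (of_real t * v + z) z = t * norm v" using t by (simp add: dist_norm norm_mult)
    also have "\<dots> \<le> h * (norm v + 1)" using t by (intro mult_mono) auto
    also have "\<dots> < d" using h by (simp only: pos_less_divide_eq[OF add_nonneg_pos[OF norm_ge_zero zero_less_one]])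
    finally have "\<bar>f' (of_real t * v + z) v - f' z v\<bar> < e" by (rule d(2))
    then show ?thesis using t h by simp
  qed
  then show ?thesis using d(1) by (intro exI[of _ "d / (norm v + 1)"]) (auto simp: add_nonneg_pos)
qed

text \<open>By translation invariance every difference quotient of \<open>f\<close> has integral 0,
  and the difference quotients converge uniformly to the directional derivative.\<close>

lemma tint_derivative_zero:
  fixes f :: "complex \<Rightarrow> real"
  assumes f: "\<And>z. (f has_derivative f' z) (at z)" and c: "continuous_on UNIV (\<lambda>z. f' z v)" 
    and per: "periodic L (\<lambda>z. f' z v)" and perf: "periodic L f"
  shows "tint (\<lambda>z. f' z v) = 0"
proof (rule ccontr)
  assume nz: "tint (\<lambda>z. f' z v) \<noteq> 0"
  have cf: "continuous_on UNIV f" by (rule continuous_at_imp_continuous_on) (blast intro: f has_derivative_continuous)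
  have af: "bounded_borel f" by (rule bounded_borel_continuous[OF cf perf])
  have af': "bounded_borel (\<lambda>z. f' z v)" by (rule bounded_borel_continuous[OF c per])
  define e where "e = \<bar>tint (\<lambda>z. f' z v)\<bar> / (2 * (torus_area L + 1))"
  have A: "torus_area L \<ge> 0" by (simp add: torus_area_def)
  have e: "e > 0" using nz A by (simp add: e_def add_nonneg_pos)
  obtain d where d: "d > 0" "\<And>h z. 0 < h \<Longrightarrow> h < d \<Longrightarrow> \<bar>(f (of_real h * v + z) - f z) / h - f' z v\<bar> \<le> e"
    using difference_quotient[OF f c per e] by blast
  define h where "h = d / 2"
  have h: "0 < h" "h < d" using d by (auto simp: h_def)
  have as: "bounded_borel (\<lambda>z. f (of_real h * v + z))" by (rule bounded_borel_shift[OF af])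
  have adq: "bounded_borel (\<lambda>z. 1 / h * f (of_real h * v + z) + (- 1 / h) * f z)"
    by (intro bounded_borel_add bounded_borel_mult as af bounded_borel_const)
  have "tint (\<lambda>z. (1 / h * f (of_real h * v + z) + (- 1 / h) * f z) - f' z v) = 
      (tint (\<lambda>z. 1 / h * f (of_real h * v + z)) + tint (\<lambda>z. (- 1 / h) * f z)) - tint (\<lambda>z. f' z v)"
    by (subst tint_diff[OF adq af'], subst tint_add) (intro bounded_borel_mult as af bounded_borel_const refl)+
  also have "\<dots> = - tint (\<lambda>z. f' z v)"
    unfolding tint_cmult tint_shift[OF af perf] by simp
  finally have "\<bar>tint (\<lambda>z. f' z v)\<bar> = \<bar>tint (\<lambda>z. (1 / h * f (of_real h * v + z) + (- 1 / h) * f z) - f' z v)\<bar>" by simp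
  also have "\<dots> \<le> e * torus_area L"
  proof (rule tint_abs_le)
    show "bounded_borel (\<lambda>z. (1 / h * f (of_real h * v + z) + (- 1 / h) * f z) - f' z v)"
      using bounded_borel_add[OF adq bounded_borel_mult[OF bounded_borel_const[of "-1"] af']] by simp
    show "\<bar>(1 / h * f (of_real h * v + z) + (- 1 / h) * f z) - f' z v\<bar> \<le> e" for z
      using d(2)[OF h, of z] by (simp add: diff_divide_distrib)
  qed
  also have "\<dots> < \<bar>tint (\<lambda>z. f' z v)\<bar>"
  proof -
    have "e * torus_area L \<le> e * (torus_area L + 1)" using e by simp
    also have "\<dots> = \<bar>tint (\<lambda>z. f' z v)\<bar> / 2" using A unfolding e_def by (simp only: times_divide_eq_left) (simp add: field_simps)
    finally show ?thesis using nz by simp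
  qed
  finally show False by simp
qed


text \<open>The source of the Poincare inequality. The difference along \<open>v\<close> is a sum of
  \<open>N\<close> small differences; Cauchy-Schwarz costs a factor \<open>N\<close>, translation
  invariance makes the \<open>N\<close> squared integrals equal, and the resulting
  \<open>N\<^sup>2\<close> turns each into a squared difference quotient.\<close>

lemma tint_sq_difference_le:
  fixes f :: "complex \<Rightarrow> real"
  assumes f: "\<And>z. (f has_derivative f' z) (at z)" and c: "continuous_on UNIV (\<lambda>z. f' z v)" 
    and per: "periodic L (\<lambda>z. f' z v)" and perf: "periodic L f"
  shows "tint (\<lambda>z. (f (v + z) - f z)\<^sup>2) \<le> tint (\<lambda>z. (f' z v)\<^sup>2)"
proof (rule field_le_epsilon)
  fix \<epsilon> :: real assume \<epsilon>: "\<epsilon> > 0"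
  have cf: "continuous_on UNIV f" by (rule continuous_at_imp_continuous_on) (blast intro: f has_derivative_continuous)
  have af: "bounded_borel f" by (rule bounded_borel_continuous[OF cf perf])
  have af': "bounded_borel (\<lambda>z. f' z v)" by (rule bounded_borel_continuous[OF c per])
  obtain B where B: "B > 0" "\<And>z. norm (f' z v) \<le> B" using periodic_bounded[OF c per] by blast
  have A: "torus_area L \<ge> 0" by (simp add: torus_area_def)
  \<comment> \<open>If two numbers differ by at most \<open>e \<le> 1\<close> and one is bounded by
    \<open>B\<close>, their squares differ by at most \<open>e * (2 * B + 1)\<close>; integrated
    over the torus this must stay below \<epsilon>.\<close>
  define e where "e = min 1 (\<epsilon> / ((2 * B + 1) * (torus_area L + 1)))"
  have pos: "(2 * B + 1) * (torus_area L + 1) > 0" using B A by (intro mult_pos_pos) auto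
  have e: "e > 0" "e \<le> 1" "e * ((2 * B + 1) * (torus_area L + 1)) \<le> \<epsilon>"
  proof -
    show "e > 0" "e \<le> 1" using \<epsilon> pos by (simp_all add: e_def)
    have "e \<le> \<epsilon> / ((2 * B + 1) * (torus_area L + 1))" by (simp add: e_def)
    then show "e * ((2 * B + 1) * (torus_area L + 1)) \<le> \<epsilon>" by (simp only: pos_le_divide_eq[OF pos])
  qed
  obtain d where d: "d > 0" "\<And>h z. 0 < h \<Longrightarrow> h < d \<Longrightarrow> \<bar>(f (of_real h * v + z) - f z) / h - f' z v\<bar> \<le> e"
    using difference_quotient[OF f c per e(1)] by blast
  obtain N where N: "N > 0" "1 / real N < d" using d(1) by (metis nat_approx_posE zero_less_Suc of_nat_Suc)
  define h where "h = 1 / real N"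
  have h: "0 < h" "h < d" using N by (auto simp: h_def)
  let ?g = "\<lambda>z. f (of_real h * v + z) - f z"
  have ag: "bounded_borel ?g" using bounded_borel_add[OF bounded_borel_shift[OF af] bounded_borel_mult[OF bounded_borel_const[of "-1"] af]] by simp
  have ag2: "bounded_borel (\<lambda>z. (?g z)\<^sup>2)" using bounded_borel_mult[OF ag ag] by (simp add: power2_eq_square)
  have pg: "periodic L (\<lambda>z. (?g z)\<^sup>2)"
    using perf unfolding periodic_def by (simp add: add.assoc[symmetric])
  have asum: "bounded_borel (\<lambda>z. \<Sum>j<n. (?g (of_real (real j * h) * v + z))\<^sup>2)" for n
    by (induction n) (auto intro!: bounded_borel_add bounded_borel_shift[OF ag2])
  have tsum: "tint (\<lambda>z. \<Sum>j<n. (?g (of_real (real j * h) * v + z))\<^sup>2) = real n * tint (\<lambda>z. (?g z)\<^sup>2)" for n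
  proof (induction n)
    case (Suc n)
    then show ?case
      using tint_add[OF asum[of n] bounded_borel_shift[OF ag2, of "of_real (real n * h) * v"]] tint_shift[OF ag2 pg, of "of_real (real n * h) * v"]
      by (simp add: algebra_simps)
  qed (simp add: tint_const)
  have ad: "bounded_borel (\<lambda>z. (f (v + z) - f z)\<^sup>2)"
    using bounded_borel_mult[OF bounded_borel_add[OF bounded_borel_shift[OF af] bounded_borel_mult[OF bounded_borel_const[of "-1"] af]] bounded_borel_add[OF bounded_borel_shift[OF af] bounded_borel_mult[OF bounded_borel_const[of "-1"] af]], of v v]
    by (simp add: power2_eq_square)
  have "tint (\<lambda>z. (f (v + z) - f z)\<^sup>2) \<le> tint (\<lambda>z. real N * (\<Sum>j<N. (?g (of_real (real j * h) * v + z))\<^sup>2))"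
  proof (rule tint_mono[OF ad bounded_borel_mult[OF bounded_borel_const asum]])
    fix z
    have "f (of_real (real n * h) * v + z) - f z = (\<Sum>j<n. ?g (of_real (real j * h) * v + z))" for n
      by (induction n) (simp_all add: algebra_simps)
    from this[of N] have "f (v + z) - f z = (\<Sum>j<N. ?g (of_real (real j * h) * v + z))" using N by (simp add: h_def)
    also have "(\<Sum>j<N. ?g (of_real (real j * h) * v + z))\<^sup>2 \<le> (\<Sum>j<N. (?g (of_real (real j * h) * v + z))\<^sup>2) * card {..<N}"
      by (rule sum_squared_le_sum_of_squares)
    finally show "(f (v + z) - f z)\<^sup>2 \<le> real N * (\<Sum>j<N. (?g (of_real (real j * h) * v + z))\<^sup>2)" by (simp add: mult.commute)
  qed
  also have "\<dots> = tint (\<lambda>z. (?g z / h)\<^sup>2)"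
  proof -
    have "tint (\<lambda>z. (?g z / h)\<^sup>2) = tint (\<lambda>z. (real N * real N) * (?g z)\<^sup>2)"
      by (simp add: h_def power2_eq_square mult_ac)
    then show ?thesis unfolding tint_cmult tsum by simp
  qed
  also have "\<dots> \<le> tint (\<lambda>z. (f' z v)\<^sup>2 + e * (2 * B + 1))"
  proof (rule tint_mono)
    show "bounded_borel (\<lambda>z. (?g z / h)\<^sup>2)" using bounded_borel_mult[OF bounded_borel_const[of "1 / h\<^sup>2"] ag2] by (simp add: power_divide)
    show "bounded_borel (\<lambda>z. (f' z v)\<^sup>2 + e * (2 * B + 1))" using bounded_borel_add[OF bounded_borel_mult[OF af' af'] bounded_borel_const] by (simp add: power2_eq_square)
    fix z
    define x where "x = ?g z / h" define y where "y = f' z v"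
    have xy: "\<bar>x - y\<bar> \<le> e" "\<bar>y\<bar> \<le> B" using d(2)[OF h, of z] B(2)[of z] by (simp_all add: x_def y_def)
    have "x\<^sup>2 = y\<^sup>2 + 2 * y * (x - y) + (x - y)\<^sup>2" by (simp add: power2_eq_square algebra_simps)
    moreover have "y * (x - y) \<le> B * e" 
      by (rule order_trans[OF abs_ge_self]) (unfold abs_mult, intro mult_mono xy, use B in auto)
    moreover have "(x - y)\<^sup>2 \<le> e * 1"
      using mult_mono[OF xy(1) xy(1)] e by (simp add: power2_eq_square abs_mult[symmetric]) (meson mult_left_le order_trans less_imp_le)
    ultimately have "x\<^sup>2 \<le> y\<^sup>2 + e * (2 * B + 1)" by (simp add: algebra_simps)
    then show "(?g z / h)\<^sup>2 \<le> (f' z v)\<^sup>2 + e * (2 * B + 1)" by (simp add: x_def y_def)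
  qed
  also have "\<dots> = tint (\<lambda>z. (f' z v)\<^sup>2) + e * (2 * B + 1) * torus_area L"
    using tint_add[OF bounded_borel_mult[OF af' af'] bounded_borel_const] by (simp add: power2_eq_square tint_const)
  also have "\<dots> \<le> tint (\<lambda>z. (f' z v)\<^sup>2) + \<epsilon>"
  proof -
    have "e * (2 * B + 1) * torus_area L \<le> e * ((2 * B + 1) * (torus_area L + 1))"
      using e B A by (simp add: mult.assoc mult_left_mono)
    then show ?thesis using e(3) by simp
  qed
  finally show "tint (\<lambda>z. (f (v + z) - f z)\<^sup>2) \<le> tint (\<lambda>z. (f' z v)\<^sup>2) + \<epsilon>" .
qed

end

section \<open>Jensen's inequality, disc averages and epsilon-regularity\<close>

lemma rmean_exp_ge:
  assumes "continuous_on UNIV u"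
  shows "exp (rmean a u r) \<le> rmean a (\<lambda>z. exp (u z)) r"
proof -
  define m where "m = rmean a u r"
  have c: "continuous_on UNIV (\<lambda>z. exp m * u z)" by (intro continuous_intros assms)
  have "rmean a (\<lambda>z. exp m * u z + exp m * (1 - m)) r \<le> rmean a (\<lambda>z. exp (u z)) r"
  proof (rule rmean_mono)
    fix z
    \<comment> \<open>Jensen's inequality through the tangent line of \<open>exp\<close> at the mean
      \<open>m\<close>.\<close>
    have "exp m * (1 + (u z - m)) \<le> exp m * exp (u z - m)" by (intro mult_left_mono exp_ge_add_one_self) auto
    then show "exp m * u z + exp m * (1 - m) \<le> exp (u z)" by (simp add: algebra_simps exp_diff)
  qed (intro continuous_intros assms)+
  also have "rmean a (\<lambda>z. exp m * u z + exp m * (1 - m)) r = exp m"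
    unfolding rmean_add[OF c continuous_on_const] rmean_cmult rmean_const m_def[symmetric] by (simp add: algebra_simps)
  finally show ?thesis by (simp add: m_def)
qed

lemma set_integral_cball_mono:
  fixes f :: "complex \<Rightarrow> real"
  assumes "continuous_on UNIV f" "\<And>z. 0 \<le> f z" "cball x s \<subseteq> cball a r"
  shows "(LINT z:cball x s|lborel. f z) \<le> (LINT z:cball a r|lborel. f z)"
  unfolding set_lebesgue_integral_def
proof (rule integral_mono)
  show "indicator (cball x s) z *\<^sub>R f z \<le> indicator (cball a r) z *\<^sub>R f z" for z
    using assms(2)[of z] subsetD[OF assms(3), of z] by (simp add: indicator_def)
qed (use set_integrable_continuous_cball[OF assms(1)] in \<open>simp_all add: set_integrable_def\<close>)

lemma set_integral_cball_ge:
  fixes f :: "complex \<Rightarrow> real"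
  assumes f: "continuous_on UNIV f" and m: "\<And>s. 0 \<le> s \<Longrightarrow> s \<le> r \<Longrightarrow> m \<le> rmean a f s" and r: "0 \<le> r"
  shows "pi * r\<^sup>2 * m \<le> (LINT z:cball a r|lborel. f z)"
proof -
  have i: "((\<lambda>s. s * m) has_integral (r\<^sup>2 / 2 * m - 0\<^sup>2 / 2 * m)) {0..r}"
    by (rule fundamental_theorem_of_calculus[OF r])
       (auto intro!: derivative_eq_intros simp flip: has_real_derivative_iff_has_vector_derivative)
  have "integral {0..r} (\<lambda>s. s * m) \<le> integral {0..r} (\<lambda>s. s * rmean a f s)"
    by (intro integral_le has_integral_integrable[OF i] integrable_continuous_interval continuous_intros continuous_on_rmean f mult_left_mono m) auto
  then have "r\<^sup>2 / 2 * m \<le> integral {0..r} (\<lambda>s. s * rmean a f s)"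
    unfolding integral_unique[OF i] by simp
  then have "2 * pi * (r\<^sup>2 / 2 * m) \<le> 2 * pi * integral {0..r} (\<lambda>s. s * rmean a f s)"
    by (rule mult_left_mono) simp
  then show ?thesis unfolding integral_cball_polar[OF f] by (simp add: mult_ac)
qed

lemma set_integral_cball_le:
  fixes f :: "complex \<Rightarrow> real"
  assumes f: "continuous_on UNIV f" and m: "\<And>s. 0 \<le> s \<Longrightarrow> s \<le> r \<Longrightarrow> rmean a f s \<le> m" and r: "0 \<le> r"
  shows "(LINT z:cball a r|lborel. f z) \<le> pi * r\<^sup>2 * m"
proof -
  have "continuous_on UNIV (\<lambda>z. - 1 * f z)" by (intro continuous_intros f)
  from set_integral_cball_ge[OF this, of r "- m" a] m r show ?thesis
    unfolding rmean_cmult set_integral_mult_right by simp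
qed

text \<open>The bound comes from the point of the disc that maximises \<open>(r - dist x a)\<^sup>2 * exp (u x)\<close>.\<close>

lemma eps_regularity:
  assumes d: "wdata u p h (\<lambda>z. \<rho> * (1 - exp (u z)))" and \<rho>: "0 \<le> \<rho>" and r: "0 < r"
    and small: "(LINT z:cball a r|lborel. exp (u z)) < pi * exp (- \<rho>)"
  shows "exp (u a) \<le> 4 / r\<^sup>2"
proof (rule ccontr)
  assume "\<not> exp (u a) \<le> 4 / r\<^sup>2"
  then have big: "4 < r\<^sup>2 * exp (u a)" using r by (simp add: field_simps)
  note cu = wdataD(6)[OF d]
  let ?\<phi> = "\<lambda>x. (r - dist x a)\<^sup>2 * exp (u x)"
  have "\<exists>x\<in>cball a r. \<forall>y\<in>cball a r. ?\<phi> y \<le> ?\<phi> x"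
    by (rule continuous_attains_sup) (use r in \<open>auto intro!: continuous_intros cu\<close>)
  then obtain x0 where x0: "x0 \<in> cball a r" "\<And>y. y \<in> cball a r \<Longrightarrow> ?\<phi> y \<le> ?\<phi> x0" by blast
  \<comment> \<open>Half the distance of the maximising point to the boundary: within distance
    \<sigma> of \<open>x0\<close> the weight falls by at most a factor 4, so \<open>exp u\<close>
    rises by at most that factor.\<close>
  define \<sigma> where "\<sigma> = (r - dist x0 a) / 2"
  define E0 where "E0 = exp (u x0)"
  have E0: "E0 > 0" by (simp add: E0_def)
  have "4 < ?\<phi> x0" using x0(2)[of a] big r by simp
  also have "?\<phi> x0 = 4 * (\<sigma>\<^sup>2 * E0)" by (simp add: \<sigma>_def E0_def power_divide)
  finally have \<sigma>1: "1 < \<sigma>\<^sup>2 * E0" by simp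
  have \<sigma>0: "\<sigma> > 0" using x0(1) \<sigma>1 by (cases "\<sigma> = 0") (auto simp: \<sigma>_def dist_commute)
  \<comment> \<open>The natural length scale of a solution of height \<open>E0\<close>. With
    \<open>t\<^sup>2 * E0 = 1\<close> the Laplacian lowers the circle means within radius
    \<open>t\<close> by at most \<rho>, whatever the height.\<close>
  define t where "t = 1 / sqrt E0"
  have t: "0 < t" "t\<^sup>2 * E0 = 1" using E0 by (simp_all add: t_def power_divide)
  have "t\<^sup>2 * E0 < \<sigma>\<^sup>2 * E0" using \<sigma>1 t by simp
  then have "t\<^sup>2 < \<sigma>\<^sup>2" using E0 by simp
  then have t\<sigma>: "t < \<sigma>" using \<sigma>0 by (meson power_less_imp_less_base less_imp_le)
  have sub: "\<sigma> \<le> r - dist y a" if "dist x0 y \<le> t" for y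
    using dist_triangle[of y a x0] that t\<sigma> by (simp add: \<sigma>_def dist_commute field_simps)
  have Ey: "exp (u y) \<le> 4 * E0" if "dist x0 y \<le> t" for y
  proof -
    have y: "\<sigma> \<le> r - dist y a" by (rule sub[OF that])
    have "\<sigma>\<^sup>2 * exp (u y) \<le> ?\<phi> y" using y \<sigma>0 by (intro mult_right_mono power_mono) auto
    also have "\<dots> \<le> ?\<phi> x0" using y \<sigma>0 by (intro x0(2)) (auto simp: dist_commute)
    also have "\<dots> = \<sigma>\<^sup>2 * (4 * E0)" by (simp add: \<sigma>_def E0_def power_divide)
    finally show ?thesis using \<sigma>0 by simp
  qed
  have ce: "continuous_on UNIV (\<lambda>z. exp (u z))" by (intro continuous_intros cu)
  have "pi * t\<^sup>2 * (exp (- \<rho>) * E0) \<le> (LINT z:cball x0 t|lborel. exp (u z))"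
  proof (rule set_integral_cball_ge[OF ce])
    fix s assume s: "0 \<le> s" "s \<le> t"
    have "u x0 \<le> rmean x0 u s + (4 * \<rho> * E0) / 4 * s\<^sup>2"
    proof (rule rmean_lower[OF d])
      fix z assume "dist x0 z \<le> s"
      then have "exp (u z) \<le> 4 * E0" using s by (intro Ey) auto
      then have "\<rho> * exp (u z) \<le> \<rho> * (4 * E0)" using \<rho> by (intro mult_left_mono) auto
      then show "- (4 * \<rho> * E0) \<le> \<rho> * (1 - exp (u z))" using \<rho> by (simp add: algebra_simps)
    qed (use s in auto)
    also have "(4 * \<rho> * E0) / 4 * s\<^sup>2 \<le> \<rho> * E0 * t\<^sup>2"
      using s \<rho> E0 by (auto intro!: mult_left_mono power_mono)
    also have "\<rho> * E0 * t\<^sup>2 = \<rho>" using t by (simp add: mult.assoc mult.commute[of E0])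
    finally have "u x0 - \<rho> \<le> rmean x0 u s" by simp
    then have "exp (u x0 - \<rho>) \<le> exp (rmean x0 u s)" by simp
    also have "\<dots> \<le> rmean x0 (\<lambda>z. exp (u z)) s" by (rule rmean_exp_ge[OF cu])
    finally show "exp (- \<rho>) * E0 \<le> rmean x0 (\<lambda>z. exp (u z)) s" by (simp add: exp_diff exp_minus E0_def field_simps)
  qed (use t in auto)
  also have "\<dots> \<le> (LINT z:cball a r|lborel. exp (u z))"
  proof (rule set_integral_cball_mono[OF ce])
    show "cball x0 t \<subseteq> cball a r"
    proof
      fix y assume "y \<in> cball x0 t"
      then have "\<sigma> \<le> r - dist y a" by (intro sub) auto
      then show "y \<in> cball a r" using \<sigma>0 by (auto simp: dist_commute)
    qed
  qed auto
  also have "\<dots> < pi * exp (- \<rho>)" by (rule small)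
  finally show False using t by (simp add: mult_ac)
qed

subsection \<open>Concentrated solutions\<close>

locale blow = torus +
  fixes p2 :: complex
  assumes p2: "p2 \<notin> L" "p2 + p2 \<in> L" and area: "torus_area L = 1"
begin

text \<open>Both the set of all lifts of the blow-up points and the period group of the half
  torus.\<close>

definition Z :: "complex set" where "Z = {z. z \<in> L \<or> z - p2 \<in> L}"

definition far :: "real \<Rightarrow> complex set" where "far d = {x. \<forall>q\<in>Z. d \<le> dist x q}"

text \<open>Concentration of the mass at scale \<open>\<eta>\<close>: in the limit each of the two points carries mass \<open>1/2\<close> and \<open>\<rho>\<close> is
  \<open>16 * pi\<close>, but weaker bounds suffice.\<close>

definition concentrated :: "real \<Rightarrow> real \<Rightarrow> (complex \<Rightarrow> real) \<Rightarrow> (complex \<Rightarrow> complex) \<Rightarrow> (complex \<Rightarrow> complex) \<Rightarrow> bool" where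
  "concentrated \<eta> \<rho> u p h \<longleftrightarrow> wdata u p h (\<lambda>z. \<rho> * (1 - exp (u z))) \<and> periodic L u \<and> (\<forall>z. u (- z) = u z) \<and>
     tint (\<lambda>z. exp (u z)) = 1 \<and> 8 * pi \<le> \<rho> \<and> \<rho> \<le> 32 * pi \<and>
     tint (\<lambda>z. indicator (far \<eta>) z * exp (u z)) \<le> \<eta> \<and>
     1 / 4 \<le> (LINT z:cball 0 \<eta>|lborel. exp (u z)) \<and> 1 / 4 \<le> (LINT z:cball p2 \<eta>|lborel. exp (u z))"

lemma p2_diff: "z - p2 \<in> L \<longleftrightarrow> z + p2 \<in> L"
  using discrete_subgroupD(4)[OF L, of "z - p2" "p2 + p2"] discrete_subgroupD(2)[OF L, of "z + p2" "p2 + p2"] p2(2) by (auto simp: algebra_simps)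

lemma discrete_subgroup_Z: "discrete_subgroup Z"
  unfolding discrete_subgroup_def
proof (intro conjI ballI allI)
  show "0 \<in> Z" using discrete_subgroupD(1)[OF L] by (simp add: Z_def)
  show "x - y \<in> Z" if "x \<in> Z" "y \<in> Z" for x y
  proof -
    have eq: "x - y - p2 = (x - p2) - y" "x - y = (x - p2) - (y - p2)" "x - y + p2 = x - (y - p2)" by simp_all
    have "x - y \<in> L \<or> x - y + p2 \<in> L"
      using that discrete_subgroupD(2)[OF L, of x y] discrete_subgroupD(2)[OF L, of "x - p2" y] discrete_subgroupD(2)[OF L, of "x - p2" "y - p2"] discrete_subgroupD(2)[OF L, of x "y - p2"]
      unfolding Z_def p2_diff[of "x - y", symmetric] by (auto simp: eq(1,2)[symmetric] eq(3) p2_diff)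
    then show ?thesis unfolding Z_def by (simp add: p2_diff)
  qed
  fix r
  have "Z \<inter> cball 0 r \<subseteq> (L \<inter> cball 0 r) \<union> (+) p2 ` (L \<inter> cball 0 (r + norm p2))"
  proof
    fix z assume z: "z \<in> Z \<inter> cball 0 r"
    show "z \<in> (L \<inter> cball 0 r) \<union> (+) p2 ` (L \<inter> cball 0 (r + norm p2))"
    proof (cases "z \<in> L")
      case False
      then have "z - p2 \<in> L" using z by (simp add: Z_def)
      moreover have "norm (z - p2) \<le> r + norm p2" using norm_triangle_ineq4[of z p2] z by simp
      ultimately show ?thesis by (auto intro!: image_eqI[of _ _ "z - p2"])
    qed (use z in auto)
  qed
  then show "finite (Z \<inter> cball 0 r)" by (rule finite_subset) (auto intro: discrete_subgroupD(5)[OF L])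
qed

lemma L_subset_Z: "L \<subseteq> Z" and p2_Z: "p2 \<in> Z"
  using discrete_subgroupD(1)[OF L] by (auto simp: Z_def)

lemma far_shift: "q \<in> Z \<Longrightarrow> x + q \<in> far d \<longleftrightarrow> x \<in> far d"
proof -
  have *: "x + q \<in> far d" if "q \<in> Z" "x \<in> far d" for x q
    unfolding far_def
  proof (intro CollectI ballI)
    fix y assume "y \<in> Z"
    then have "d \<le> dist x (y - q)" using that discrete_subgroupD(2)[OF discrete_subgroup_Z] by (auto simp: far_def)
    then show "d \<le> dist (x + q) y" by (simp add: dist_norm algebra_simps)
  qed
  show "q \<in> Z \<Longrightarrow> x + q \<in> far d \<longleftrightarrow> x \<in> far d"
    using *[of q x] *[of "- q" "x + q"] discrete_subgroupD(3)[OF discrete_subgroup_Z] by auto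
qed

lemma closed_far: "closed (far d)"
proof -
  have "far d = (\<Inter>q\<in>Z. {x. d \<le> dist x q})" by (auto simp: far_def)
  then show ?thesis by (auto intro!: closed_INT closed_Collect_le continuous_intros)
qed

lemma far_mono: "d \<le> e \<Longrightarrow> far e \<subseteq> far d"
  by (force simp: far_def)

lemma far_ball: "x \<in> far d \<Longrightarrow> dist x y \<le> s \<Longrightarrow> y \<in> far (d - s)"
proof -
  assume x: "x \<in> far d" "dist x y \<le> s"
  show "y \<in> far (d - s)" unfolding far_def
  proof (intro CollectI ballI)
    fix q assume "q \<in> Z"
    then have "d \<le> dist x q" using x by (simp add: far_def)
    also have "\<dots> \<le> dist x y + dist y q" by (rule dist_triangle)
    finally show "d - s \<le> dist y q" using x by simp
  qed
qed

lemma concentratedD: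
  assumes "concentrated \<eta> \<rho> u p h"
  shows "wdata u p h (\<lambda>z. \<rho> * (1 - exp (u z)))" "periodic L u" "u (- z) = u z" "tint (\<lambda>z. exp (u z)) = 1"
    "8 * pi \<le> \<rho>" "\<rho> \<le> 32 * pi" "0 < \<rho>" "\<rho> \<le> 128" "continuous_on S u" "periodic L (\<lambda>z. exp (u z))" "bounded_borel (\<lambda>z. exp (u z))"
    "bounded_borel (\<lambda>z. indicator (far \<eta>) z * exp (u z))" "periodic L (\<lambda>z. indicator (far \<eta>) z * exp (u z))"
proof -
  show w: "wdata u p h (\<lambda>z. \<rho> * (1 - exp (u z)))" and per: "periodic L u" and "u (- z) = u z" "tint (\<lambda>z. exp (u z)) = 1"
    and \<rho>: "8 * pi \<le> \<rho>" "\<rho> \<le> 32 * pi" using assms by (auto simp: concentrated_def)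
  show "0 < \<rho>" using \<rho> pi_gt_zero by linarith
  show "\<rho> \<le> 128" using \<rho> pi_less_4 by linarith
  show c: "continuous_on S u" for S by (rule wdataD(6)[OF w])
  show pe: "periodic L (\<lambda>z. exp (u z))" using per by (simp add: periodic_def)
  show t: "bounded_borel (\<lambda>z. exp (u z))" by (rule bounded_borel_continuous[OF _ pe]) (intro continuous_intros c)
  have "bounded_borel (indicator (far \<eta>))"
    unfolding bounded_borel_def using closed_far by (auto intro!: borel_measurable_indicator exI[of _ 1] simp: indicator_def)
  then show "bounded_borel (\<lambda>z. indicator (far \<eta>) z * exp (u z))" by (rule bounded_borel_mult[OF _ t])
  show "periodic L (\<lambda>z. indicator (far \<eta>) z * exp (u z))"
    using per far_shift L_subset_Z by (auto simp: periodic_def indicator_def)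
qed

lemma concentrated_mono:
  assumes "concentrated \<eta> \<rho> u p h" "\<eta> \<le> \<eta>'"
  shows "concentrated \<eta>' \<rho> u p h"
proof -
  note A = concentratedD[OF assms(1)]
  have ce: "continuous_on UNIV (\<lambda>z. exp (u z))" by (intro continuous_intros A)
  have "bounded_borel (indicator (far \<eta>'))"
    unfolding bounded_borel_def using closed_far by (auto intro!: borel_measurable_indicator exI[of _ 1] simp: indicator_def)
  then have t: "bounded_borel (\<lambda>z. indicator (far \<eta>') z * exp (u z))" by (rule bounded_borel_mult[OF _ A(11)])
  have "tint (\<lambda>z. indicator (far \<eta>') z * exp (u z)) \<le> tint (\<lambda>z. indicator (far \<eta>) z * exp (u z))"
    using far_mono[OF assms(2)] by (intro tint_mono[OF t A(12)]) (auto simp: indicator_def)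
  moreover have "(LINT z:cball q \<eta>|lborel. exp (u z)) \<le> (LINT z:cball q \<eta>'|lborel. exp (u z))" for q
    by (rule set_integral_cball_mono[OF ce]) (use assms in auto)
  ultimately show ?thesis using assms unfolding concentrated_def by (auto intro: order_trans)
qed

lemma u_p2: "periodic L u \<Longrightarrow> u (z + p2 + p2) = u z"
  using p2(2) by (auto simp: periodic_def add.assoc)

lemma wdata_shift:
  assumes "wdata u p h g"
  shows "wdata (\<lambda>z. u (z + c)) (\<lambda>z. p (z + c)) (\<lambda>z. h (z + c)) (\<lambda>z. g (z + c))"
proof -
  note D = wdataD[OF assms]
  have s: "((\<lambda>z. z + c) has_derivative (\<lambda>v. v)) (at z)" for z by (auto intro!: derivative_eq_intros)
  have c: "continuous_on UNIV (\<lambda>z. f (z + c))" if "continuous_on UNIV f" for f :: "complex \<Rightarrow> 'a::topological_space"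
    by (rule continuous_on_compose2[OF that]) (auto intro!: continuous_intros)
  show ?thesis unfolding wdata_def wirt_def
    using has_derivative_compose[OF s D(1)] has_derivative_compose[OF s D(2)[unfolded wirt_def]] c[OF D(3)] c[OF D(4)]
    by auto
qed

text \<open>Translation by \<open>p2\<close> exchanges the two blow-up points modulo
  \<open>L\<close>, because \<open>p2 + p2\<close> is a period; for the same reason the translate is
  again even. Hence every estimate applies to \<open>u\<close> and to its translate with the same
  constants.\<close>

lemma concentrated_shift:
  assumes "concentrated \<eta> \<rho> u p h"
  shows "concentrated \<eta> \<rho> (\<lambda>z. u (z + p2)) (\<lambda>z. p (z + p2)) (\<lambda>z. h (z + p2))"
proof -
  note A = concentratedD[OF assms]
  have per: "periodic L (\<lambda>z. u (z + p2))"
    unfolding periodic_def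
  proof (intro ballI allI)
    fix l z assume "l \<in> L"
    then show "u (z + l + p2) = u (z + p2)" using periodicD[OF A(2), of l "z + p2"] by (simp add: add_ac)
  qed
  have even: "u (- z + p2) = u (z + p2)" for z
    using A(3)[of "z - p2"] u_p2[OF A(2), of "z - p2"] by simp
  have ball: "(LINT z:cball q \<eta>|lborel. exp (u (z + p2))) = (LINT z:cball (p2 + q) \<eta>|lborel. exp (u z))" for q
  proof -
    have ce: "continuous_on UNIV (\<lambda>z. exp (u z))" by (intro continuous_intros A)
    have "(LINT z:cball (p2 + q) \<eta>|lborel. exp (u z)) = (LINT z|lborel. indicator (cball (p2 + q) \<eta>) (p2 + z) *\<^sub>R exp (u (p2 + z)))"
      unfolding set_lebesgue_integral_def
      by (rule integral_translate[symmetric]) (intro borel_measurable_scaleR borel_measurable_indicator borel_measurable_continuous_onI ce, simp)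
    also have "\<dots> = (LINT z:cball q \<eta>|lborel. exp (u (z + p2)))"
      unfolding set_lebesgue_integral_def
      by (intro Bochner_Integration.integral_cong refl) (auto simp: indicator_def dist_norm add.commute)
    finally show ?thesis by simp
  qed
  have "(LINT z:cball (p2 + p2) \<eta>|lborel. exp (u z)) = (LINT z:cball 0 \<eta>|lborel. exp (u z))"
  proof -
    have ce: "continuous_on UNIV (\<lambda>z. exp (u z))" by (intro continuous_intros A)
    have "u (p2 + p2 + w) = u (0 + w)" for w using periodicD[OF A(2) p2(2), of w] by (simp add: add_ac)
    then show ?thesis unfolding integral_cball_polar[OF ce] rmean_def by (simp only:)
  qed
  moreover have "tint (\<lambda>z. exp (u (z + p2))) = 1"
    using tint_shift[OF A(11,10), of p2] A(4) by (simp add: add.commute)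
  moreover have "tint (\<lambda>z. indicator (far \<eta>) z * exp (u (z + p2))) = tint (\<lambda>z. indicator (far \<eta>) z * exp (u z))"
    using tint_shift[OF A(12,13), of p2] far_shift[OF p2_Z] by (simp add: add.commute indicator_def)
  ultimately show ?thesis
    using assms wdata_shift[OF A(1), of p2] per even unfolding concentrated_def ball by auto
qed

section \<open>Uniform bounds away from the blow-up points\<close>

lemma ball_mass:
  assumes "R > 0"
  obtains N where "N > 0" "\<And>\<eta> \<rho> u p h x d. concentrated \<eta> \<rho> u p h \<Longrightarrow> x \<in> far (R + \<eta>) \<Longrightarrow> (LINT z:cball x R|lborel. exp (u z)) \<le> N * \<eta>"
proof -
  obtain N where N: "N > 0" "\<And>x f. bounded_borel f \<Longrightarrow> periodic L f \<Longrightarrow> (\<And>z. 0 \<le> f z) \<Longrightarrow> (LINT z:cball x R|lborel. f z) \<le> N * tint f"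
    using integral_cball_le[of R] by blast
  have "(LINT z:cball x R|lborel. exp (u z)) \<le> N * \<eta>" if a: "concentrated \<eta> \<rho> u p h" and x: "x \<in> far (R + \<eta>)" for \<eta> \<rho> u p h x
  proof -
    have "cball x R \<subseteq> far \<eta>" using far_ball[OF x, of _ R] by auto
    then have "(LINT z:cball x R|lborel. exp (u z)) = (LINT z:cball x R|lborel. indicator (far \<eta>) z * exp (u z))"
      by (intro set_lebesgue_integral_cong) (auto simp: indicator_def)
    also have "\<dots> \<le> N * tint (\<lambda>z. indicator (far \<eta>) z * exp (u z))"
      by (intro N(2) concentratedD[OF a]) auto
    also have "\<dots> \<le> N * \<eta>" using a N(1) by (intro mult_left_mono) (auto simp: concentrated_def)
    finally show ?thesis .
  qed
  with N(1) show ?thesis using that by blast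
qed

lemma ball_mass_total:
  obtains N where "N > 0" "\<And>\<eta> \<rho> u p h x d. concentrated \<eta> \<rho> u p h \<Longrightarrow> (LINT z:cball x R|lborel. exp (u z)) \<le> N"
proof -
  obtain N where N: "N > 0" "\<And>x f. bounded_borel f \<Longrightarrow> periodic L f \<Longrightarrow> (\<And>z. 0 \<le> f z) \<Longrightarrow> (LINT z:cball x R|lborel. f z) \<le> N * tint f"
    using integral_cball_le[of R] by blast
  have "(LINT z:cball x R|lborel. exp (u z)) \<le> N" if a: "concentrated \<eta> \<rho> u p h" for \<eta> \<rho> u p h x
    using N(2)[OF concentratedD(11)[OF a] concentratedD(10)[OF a]] concentratedD(4)[OF a] by simp
  with N(1) show ?thesis using that by blast
qed

text \<open>A disc of radius \<open>d / 2\<close> about a far point carries mass at most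
  \<open>N * \<eta>\<close>, which lies below the threshold of \<open>eps_regularity\<close> once
  \<eta> is small.\<close>

lemma exp_bound_far:
  assumes d: "d > 0"
  shows "\<exists>\<eta>>0. \<forall>\<rho> u p h x. concentrated \<eta> \<rho> u p h \<longrightarrow> x \<in> far d \<longrightarrow> exp (u x) \<le> 16 / d\<^sup>2"
proof -
  obtain N where N: "N > 0" "\<And>\<eta> \<rho> u p h x d'. concentrated \<eta> \<rho> u p h \<Longrightarrow> x \<in> far (d / 2 + \<eta>) \<Longrightarrow> (LINT z:cball x (d / 2)|lborel. exp (u z)) \<le> N * \<eta>"
    using ball_mass[of "d / 2"] d by auto
  \<comment> \<open>As \<open>\<rho> \<le> 128\<close>, the number \<open>pi * exp (- 128)\<close>
    is below the threshold for every admissible \<rho>; the factor 2 makes the inequality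
    strict.\<close>
  define \<eta> where "\<eta> = min (d / 2) (pi * exp (- 128) / (2 * N))"
  have \<eta>: "\<eta> > 0" using d N(1) by (simp add: \<eta>_def)
  have N\<eta>: "N * \<eta> < pi * exp (- 128)"
  proof -
    have "N * \<eta> \<le> N * (pi * exp (- 128) / (2 * N))" using N(1) by (intro mult_left_mono) (auto simp: \<eta>_def)
    also have "\<dots> = pi * exp (-128) / 2" using N(1) by simp
    also have "\<dots> < pi * exp (-128)" by simp
    finally show ?thesis .
  qed
  have "exp (u x) \<le> 16 / d\<^sup>2" if a: "concentrated \<eta> \<rho> u p h" and x: "x \<in> far d" for \<rho> u p h x
  proof -
    have "\<eta> \<le> d / 2" by (simp add: \<eta>_def)
    then have "x \<in> far (d / 2 + \<eta>)" using far_mono[of "d / 2 + \<eta>" d] x by auto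
    from N(2)[OF a this] N\<eta> have "(LINT z:cball x (d / 2)|lborel. exp (u z)) < pi * exp (- 128)" by simp
    also have "\<dots> \<le> pi * exp (- \<rho>)" using concentratedD(8)[OF a] by simp
    finally have "exp (u x) \<le> 4 / (d / 2)\<^sup>2" using d concentratedD(7)[OF a] by (intro eps_regularity[OF concentratedD(1)[OF a]]) auto
    then show ?thesis by (simp add: power_divide)
  qed
  with \<eta> show ?thesis by blast
qed

end

lemma wdata_const: "wdata (\<lambda>z. c) (\<lambda>z. 0) (\<lambda>z. 0) (\<lambda>z. 0)"
  by (auto simp: wdata_def wirt_def)

lemma flux_eq:
  assumes d: "wdata f p h g" and s: "0 \<le> s"
  shows "s * (2 * Re (cmean 1 a p s)) = (LINT z:cball a s|lborel. g z) / (2 * pi)"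
proof -
  have "((\<lambda>r. r * rmean a g r) has_integral (s * (2 * Re (cmean 1 a p s)) - 0 * (2 * Re (cmean 1 a p 0)))) {0..s}"
    by (rule fundamental_theorem_of_calculus[OF s])
       (use flux_deriv[OF d] in \<open>simp flip: has_real_derivative_iff_has_vector_derivative\<close>)
  from integral_unique[OF this] show ?thesis
    unfolding integral_cball_polar[OF wdataD(4)[OF d]] by simp
qed

context blow
begin

lemma far_point: obtains c d where "d > 0" "c \<in> far d"
proof -
  have "infinite (cball (0::complex) 1)" using uncountable_cball[of 1 "0::complex"] countable_finite by auto
  then have "\<not> cball 0 1 \<subseteq> Z \<inter> cball 0 1" using discrete_subgroupD(5)[OF discrete_subgroup_Z, of 1] finite_subset by blast
  then obtain c where c: "c \<notin> Z" by blast
  have "finite (Z \<inter> cball 0 (norm c + 1))" by (rule discrete_subgroupD(5)[OF discrete_subgroup_Z])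
  then obtain d where d: "d > 0" "\<And>x. x \<in> Z \<inter> cball 0 (norm c + 1) \<Longrightarrow> x \<noteq> c \<Longrightarrow> d \<le> dist c x"
    using finite_set_avoid[of _ c] by blast
  have "c \<in> far (min d 1)"
    unfolding far_def
  proof (intro CollectI ballI)
    fix q assume q: "q \<in> Z"
    show "min d 1 \<le> dist c q"
    proof (cases "norm q \<le> norm c + 1")
      case True
      then show ?thesis using d(2)[of q] q c by (auto simp: min_le_iff_disj)
    next
      case False
      then show ?thesis using norm_triangle_ineq3[of c q] by (auto simp: dist_norm min_le_iff_disj)
    qed
  qed
  then show ?thesis using d(1) by (intro that[of "min d 1" c]) auto
qed

lemma separation: obtains d where "d > 0" "\<And>q. q \<in> Z \<Longrightarrow> q \<noteq> 0 \<Longrightarrow> 8 * d \<le> norm q"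
proof -
  have "finite (Z \<inter> cball 0 1)" by (rule discrete_subgroupD(5)[OF discrete_subgroup_Z])
  from finite_set_avoid[OF this, of 0]
  obtain d where d: "d > 0" "\<And>x. x \<in> Z \<inter> cball 0 1 \<Longrightarrow> x \<noteq> 0 \<Longrightarrow> d \<le> dist 0 x"
    by (elim exE conjE) (rule that, auto)
  have "8 * (min d 1 / 8) \<le> norm q" if "q \<in> Z" "q \<noteq> 0" for q
  proof (cases "norm q \<le> 1")
    case True
    then have "d \<le> norm q" using d(2)[of q] that by simp
    then show ?thesis by (simp add: min_le_iff_disj)
  qed (auto simp: min_le_iff_disj)
  then show ?thesis using d(1) that[of "min d 1 / 8"] by simp
qed

lemma u_min: "concentrated \<eta> \<rho> u p h \<Longrightarrow> \<exists>x. \<forall>z. u x \<le> u z"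
  using periodic_max[of "\<lambda>z. - u z"] concentratedD(2)[of \<eta> \<rho> u p h] concentratedD(9)[of \<eta> \<rho> u p h UNIV]
  by (auto simp: periodic_def intro!: continuous_intros)

text \<open>Comparing \<open>u\<close> with its circle means around a minimum point bounds the integral of \<open>u\<close> minus its minimum.\<close>

lemma osc_bound:
  assumes d: "d > 0"
  shows "\<exists>\<eta>>0. \<exists>C\<ge>0. \<forall>\<rho> u p h x z. concentrated \<eta> \<rho> u p h \<longrightarrow> x \<in> far d \<longrightarrow> u x \<le> u z + C"
proof -
  obtain \<eta> where \<eta>: "\<eta> > 0" "\<And>\<rho> u p h x. concentrated \<eta> \<rho> u p h \<Longrightarrow> x \<in> far (d / 2) \<Longrightarrow> exp (u x) \<le> 16 / (d / 2)\<^sup>2"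
    using exp_bound_far[OF half_gt_zero[OF d]] by blast
  obtain M where M: "M > 0" "\<And>z. \<exists>l\<in>L. norm (z - l) \<le> M" by (rule reduce) blast
  define s where "s = d / 2"
  \<comment> \<open>The disc of radius \<open>R\<close> about a minimum point contains the disc of
    radius \<open>s\<close> about a suitable translate of \<open>x\<close>.\<close>
  define R where "R = M + s"
  define G where "G = 128 * (16 / s\<^sup>2)"
  define C where "C = 32 * R\<^sup>2 * R\<^sup>2 / s\<^sup>2 + G / 4 * s\<^sup>2"
  have s: "s > 0" and R: "R > 0" and G: "G \<ge> 0" using d M by (auto simp: s_def R_def G_def)
  have "u x \<le> u z + C" if a: "concentrated \<eta> \<rho> u p h" and x: "x \<in> far d" for \<rho> u p h x z
  proof -
    note A = concentratedD[OF a]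
    obtain x0 where x0: "\<And>z. u x0 \<le> u z" using u_min[OF a] by blast
    obtain l where l: "l \<in> L" "norm (x - x0 - l) \<le> M" using M by blast
    define y where "y = x - l"
    have y: "y \<in> far d" using far_shift[of l y d] l(1) L_subset_Z x by (auto simp: y_def)
    have uy: "u y = u x" using periodicD'[OF A(2) l(1)] by (simp add: y_def)
    have dy: "dist x0 y \<le> M" using l(2) by (simp add: y_def dist_norm norm_minus_commute algebra_simps)
    have cf: "continuous_on UNIV (\<lambda>z. u z - u x0)" by (intro continuous_intros A)
    \<comment> \<open>Only the upper bound \<rho> of the Laplacian is used here, so the
      concentration of \<open>exp u\<close> inside the disc is harmless.\<close>
    have "(LINT z:cball x0 R|lborel. u z - u x0) \<le> pi * R\<^sup>2 * (32 * R\<^sup>2)"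
    proof (rule set_integral_cball_le[OF cf])
      fix t assume t: "0 \<le> t" "t \<le> R"
      have "rmean x0 u t \<le> u x0 + \<rho> / 4 * t\<^sup>2"
        by (rule rmean_upper[OF A(1)]) (use t A(7) in auto)
      also have "\<rho> / 4 * t\<^sup>2 \<le> 32 * R\<^sup>2" using t A(7,8) by (intro mult_mono power_mono) auto
      finally show "rmean x0 (\<lambda>z. u z - u x0) t \<le> 32 * R\<^sup>2"
        by (simp add: rmean_diff[OF A(9) continuous_on_const])
    qed (use R in auto)
    moreover have "pi * s\<^sup>2 * (u y - u x0 - G / 4 * s\<^sup>2) \<le> (LINT z:cball y s|lborel. u z - u x0)"
    proof (rule set_integral_cball_ge[OF cf])
      fix t assume t: "0 \<le> t" "t \<le> s"
      have "u y \<le> rmean y u t + G / 4 * t\<^sup>2"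
      proof (rule rmean_lower[OF A(1)])
        fix z assume "dist y z \<le> t"
        then have "z \<in> far (d / 2)" using far_ball[OF y, of z s] t by (auto simp: s_def)
        from \<eta>(2)[OF a this] have "exp (u z) \<le> 16 / s\<^sup>2" by (simp add: s_def)
        then have "\<rho> * exp (u z) \<le> G" unfolding G_def using A(7,8) by (intro mult_mono) auto
        then show "- G \<le> \<rho> * (1 - exp (u z))" using A(7) by (simp add: algebra_simps)
      qed (use t in auto)
      also have "G / 4 * t\<^sup>2 \<le> G / 4 * s\<^sup>2" using t G by (intro mult_left_mono power_mono) auto
      finally show "u y - u x0 - G / 4 * s\<^sup>2 \<le> rmean y (\<lambda>z. u z - u x0) t"
        by (simp add: rmean_diff[OF A(9) continuous_on_const])
    qed (use s in auto)
    moreover have "(LINT z:cball y s|lborel. u z - u x0) \<le> (LINT z:cball x0 R|lborel. u z - u x0)"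
    proof (rule set_integral_cball_mono[OF cf])
      show "cball y s \<subseteq> cball x0 R"
      proof
        fix z assume "z \<in> cball y s"
        then show "z \<in> cball x0 R" using dist_triangle[of x0 z y] dy by (auto simp: R_def)
      qed
    qed (use x0 in auto)
    ultimately have "pi * s\<^sup>2 * (u y - u x0 - G / 4 * s\<^sup>2) \<le> pi * R\<^sup>2 * (32 * R\<^sup>2)" by linarith
    then have "s\<^sup>2 * (u y - u x0 - G / 4 * s\<^sup>2) \<le> R\<^sup>2 * (32 * R\<^sup>2)" by (simp add: mult.assoc)
    then have "u y - u x0 - G / 4 * s\<^sup>2 \<le> 32 * R\<^sup>2 * R\<^sup>2 / s\<^sup>2"
      using s by (simp add: pos_le_divide_eq mult_ac)
    then show ?thesis using x0[of z] by (simp add: C_def uy)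
  qed
  moreover have "C \<ge> 0" using G by (simp add: C_def)
  ultimately show ?thesis using \<eta>(1) by blast
qed

text \<open>By the oscillation bound, \<open>exp (u x)\<close> is at most \<open>exp C\<close> times
  every value of \<open>exp u\<close>, in particular those on one fixed disc away from
  \<open>Z\<close>, and the mass of that disc is at most \<open>N * \<eta>\<close>.\<close>

lemma exp_small_far:
  assumes d: "d > 0" and e: "e > 0"
  shows "\<exists>\<eta>>0. \<forall>\<rho> u p h x. concentrated \<eta> \<rho> u p h \<longrightarrow> x \<in> far d \<longrightarrow> exp (u x) \<le> e"
proof -
  obtain \<eta>1 C where \<eta>1: "\<eta>1 > 0" "C \<ge> 0" "\<And>\<rho> u p h x z. concentrated \<eta>1 \<rho> u p h \<Longrightarrow> x \<in> far d \<Longrightarrow> u x \<le> u z + C"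
    using osc_bound[OF d] by blast
  obtain c dc where c: "dc > 0" "c \<in> far dc" by (rule far_point)
  obtain N where N: "N > 0" "\<And>\<eta> \<rho> u p h x d'. concentrated \<eta> \<rho> u p h \<Longrightarrow> x \<in> far (dc / 2 + \<eta>) \<Longrightarrow> (LINT z:cball x (dc / 2)|lborel. exp (u z)) \<le> N * \<eta>"
    using ball_mass[of "dc / 2"] c by auto
  define e' where "e' = e * exp (- C) * (pi * (dc / 2)\<^sup>2) / N"
  have e': "e' > 0" using e N(1) c(1) by (simp add: e'_def)
  define \<eta> where "\<eta> = min \<eta>1 (min (dc / 2) e')"
  have \<eta>: "\<eta> > 0" "\<eta> \<le> \<eta>1" "\<eta> \<le> dc / 2" "\<eta> \<le> e'" using \<eta>1 c e' by (auto simp: \<eta>_def)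
  have "exp (u x) \<le> e" if a: "concentrated \<eta> \<rho> u p h" and x: "x \<in> far d" for \<rho> u p h x
  proof -
    have ce: "continuous_on UNIV (\<lambda>z. exp (u z))" by (intro continuous_intros concentratedD[OF a])
    have "pi * (dc / 2)\<^sup>2 * (exp (- C) * exp (u x)) \<le> (LINT z:cball c (dc / 2)|lborel. exp (u z))"
    proof (rule set_integral_cball_ge[OF ce])
      fix s
      have "exp (u x - C) \<le> exp (u z)" for z using \<eta>1(3)[OF concentrated_mono[OF a \<eta>(2)] x, of z] by simp
      then show "exp (- C) * exp (u x) \<le> rmean c (\<lambda>z. exp (u z)) s"
        by (intro rmean_ge[OF ce]) (simp add: exp_diff exp_minus field_simps)
    qed (use c in auto)
    also have "\<dots> \<le> N * \<eta>" using far_mono[of "dc / 2 + \<eta>" dc] \<eta>(3) c by (intro N(2)[OF a]) auto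
    also have "\<dots> \<le> N * e'" using \<eta>(4) N(1) by simp
    also have "\<dots> = pi * (dc / 2)\<^sup>2 * (exp (- C) * e)" using N(1) by (simp add: e'_def)
    finally show ?thesis using c(1) by simp
  qed
  then show ?thesis using \<eta>(1) by blast
qed

text \<open>The gradient estimate is applied to \<open>u - u x\<close>: far from \<open>Z\<close>
  the function \<open>u\<close> itself is very negative, but its oscillation is controlled.\<close>

lemma grad_bound_far:
  assumes d: "d > 0"
  shows "\<exists>\<eta>>0. \<exists>C\<ge>0. \<forall>\<rho> u p h x. concentrated \<eta> \<rho> u p h \<longrightarrow> x \<in> far d \<longrightarrow> norm (p x) \<le> C"
proof -
  obtain \<eta>1 C where \<eta>1: "\<eta>1 > 0" "C \<ge> 0" "\<And>\<rho> u p h x z. concentrated \<eta>1 \<rho> u p h \<Longrightarrow> x \<in> far (d / 2) \<Longrightarrow> u x \<le> u z + C"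
    using osc_bound[OF half_gt_zero[OF d]] by blast
  obtain \<eta>2 where \<eta>2: "\<eta>2 > 0" "\<And>\<rho> u p h x. concentrated \<eta>2 \<rho> u p h \<Longrightarrow> x \<in> far (d / 2) \<Longrightarrow> exp (u x) \<le> 1"
    using exp_small_far[OF half_gt_zero[OF d] zero_less_one] by blast
  define \<eta> where "\<eta> = min \<eta>1 \<eta>2"
  have \<eta>: "\<eta> > 0" "\<eta> \<le> \<eta>1" "\<eta> \<le> \<eta>2" using \<eta>1 \<eta>2 by (auto simp: \<eta>_def)
  define K where "K = C / (d / 2) + 128 * (d / 2)"
  have "norm (p x) \<le> K" if a: "concentrated \<eta> \<rho> u p h" and x: "x \<in> far d" for \<rho> u p h x
  proof -
    note A = concentratedD[OF a]
    have f: "z \<in> far (d / 2)" if "dist x z \<le> d / 2" for z using far_ball[OF x that] by simp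
    have w: "wdata (\<lambda>z. u z - u x) (\<lambda>z. p z - 0) (\<lambda>z. h z - 0) (\<lambda>z. \<rho> * (1 - exp (u z)) - 0)"
      by (rule wdata_diff[OF A(1) wdata_const])
    have "norm (p x - 0) \<le> C / (d / 2) + 128 * (d / 2)"
    proof (rule gradient_bound[OF w])
      show "\<bar>\<rho> * (1 - exp (u z)) - 0\<bar> \<le> 128" if "dist x z \<le> d / 2" for z
      proof -
        have "\<bar>1 - exp (u z)\<bar> \<le> 1" using \<eta>2(2)[OF concentrated_mono[OF a \<eta>(3)] f[OF that]] by simp
        then have "\<rho> * \<bar>1 - exp (u z)\<bar> \<le> 128 * 1" using A(7,8) by (intro mult_mono) auto
        then show ?thesis using A(7) by (simp add: abs_mult)
      qed
      show "\<bar>u z - u x\<bar> \<le> C" if "dist x z = d / 2" for z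
      proof -
        have x2: "x \<in> far (d / 2)" by (rule f) (use d in simp)
        have "u z \<le> u x + C" using that by (intro \<eta>1(3)[OF concentrated_mono[OF a \<eta>(2)] f]) auto
        moreover have "u x \<le> u z + C" by (intro \<eta>1(3)[OF concentrated_mono[OF a \<eta>(2)] x2])
        ultimately show ?thesis by simp
      qed
    qed (use d in auto)
    then show ?thesis by (simp add: K_def)
  qed
  moreover have "K \<ge> 0" using d \<eta>1(2) by (simp add: K_def)
  ultimately show ?thesis using \<eta>(1) by blast
qed

text \<open>The mass in the disc of radius \<open>\<eta>\<close> makes the circle means of \<open>u\<close> decrease logarithmically beyond radius \<open>2 * \<eta>\<close>.\<close>

lemma lower_near_zero:
  assumes \<eta>: "0 < \<eta>" "\<eta> \<le> 1 / 2" and a: "concentrated \<eta> \<rho> u p h" and x: "norm x \<le> \<eta>" and k: "\<And>z. k \<le> u z"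
  shows "k + ln (1 / (2 * \<eta>)) - 32 \<le> u x"
proof -
  note A = concentratedD[OF a]
  have ce: "continuous_on UNIV (\<lambda>z. exp (u z))" by (intro continuous_intros A)
  let ?g = "\<lambda>z. \<rho> * (1 - exp (u z))"
  have fl: "2 * Re (cmean 1 x p s) \<le> \<rho> * s / 2 - \<rho> / (8 * pi) / s" if s: "2 * \<eta> \<le> s" for s
  proof -
    have s0: "s > 0" using s \<eta> by linarith
    have "1 / 4 \<le> (LINT z:cball 0 \<eta>|lborel. exp (u z))" using a by (simp add: concentrated_def)
    also have "\<dots> \<le> (LINT z:cball x s|lborel. exp (u z))"
    proof (rule set_integral_cball_mono[OF ce])
      show "cball (0::complex) \<eta> \<subseteq> cball x s"
      proof
        fix z :: complex assume "z \<in> cball 0 \<eta>"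
        then show "z \<in> cball x s" using norm_triangle_ineq4[of x z] x s by (simp add: dist_norm)
      qed
    qed auto
    finally have m: "1 / 4 \<le> (LINT z:cball x s|lborel. exp (u z))" .
    have one: "(LINT z:cball x s|lborel. 1) \<le> pi * s\<^sup>2 * 1"
      by (rule set_integral_cball_le) (use s0 in auto)
    have "(LINT z:cball x s|lborel. ?g z) = \<rho> * ((LINT z:cball x s|lborel. 1) - (LINT z:cball x s|lborel. exp (u z)))"
      by (simp add: set_integral_diff(2)[OF set_integrable_continuous_cball set_integrable_continuous_cball] ce)
    also have "\<dots> \<le> \<rho> * (pi * s\<^sup>2 - 1 / 4)" using A(7) one m by (intro mult_left_mono) auto
    finally have "s * (2 * Re (cmean 1 x p s)) \<le> \<rho> * (pi * s\<^sup>2 - 1 / 4) / (2 * pi)"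
      using flux_eq[OF A(1), of s x] s0 by (simp add: divide_right_mono)
    also have "\<dots> = s * (\<rho> * s / 2 - \<rho> / (8 * pi) / s)"
      using s0 by (simp add: field_simps power2_eq_square)
    finally show ?thesis using s0 by simp
  qed
  \<comment> \<open>The two added terms are primitives of the bounds in the flux inequality, so the
    sum is nonincreasing in the radius.\<close>
  let ?\<psi> = "\<lambda>s. rmean x u s - \<rho> / 4 * s\<^sup>2 + \<rho> / (8 * pi) * ln s"
  have "?\<psi> 1 \<le> ?\<psi> (2 * \<eta>)"
  proof (rule DERIV_nonpos_imp_nonincreasing[where f = ?\<psi>])
    fix s assume s: "2 * \<eta> \<le> s" "s \<le> 1"
    then have s0: "s > 0" using \<eta> by linarith
    have "(?\<psi> has_real_derivative (2 * Re (cmean 1 x p s) - \<rho> / 4 * (2 * s) + \<rho> / (8 * pi) * (1 / s))) (at s)"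
      using s0 by (auto intro!: derivative_eq_intros rmean_deriv[OF A(1)])
    moreover have "2 * Re (cmean 1 x p s) - \<rho> / 4 * (2 * s) + \<rho> / (8 * pi) * (1 / s) \<le> 0"
      using fl[OF s(1)] by (simp add: field_simps)
    ultimately show "\<exists>y. (?\<psi> has_real_derivative y) (at s) \<and> y \<le> 0" by blast
  qed (use \<eta> in auto)
  then have 1: "rmean x u 1 - \<rho> / 4 \<le> rmean x u (2 * \<eta>) - \<rho> / 4 * (2 * \<eta>)\<^sup>2 + \<rho> / (8 * pi) * ln (2 * \<eta>)" by simp
  have 2: "rmean x u (2 * \<eta>) \<le> u x + \<rho> / 4 * (2 * \<eta>)\<^sup>2"
    by (rule rmean_upper[OF A(1)]) (use \<eta> A(7) in auto)
  have 3: "k \<le> rmean x u 1" by (rule rmean_ge[OF A(9) k])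
  \<comment> \<open>A quarter of the mass, divided by \<open>2 * pi\<close>, gives the logarithm the
    factor \<open>\<rho> / (8 * pi)\<close>. This is where the lower bound
    \<open>8 * pi \<le> \<rho>\<close> is needed: the growth is at least that of one
    logarithm.\<close>
  have "1 \<le> \<rho> / (8 * pi)" using A(5) by simp
  then have "\<rho> / (8 * pi) * ln (2 * \<eta>) \<le> 1 * ln (2 * \<eta>)" using \<eta> by (intro mult_right_mono_neg) auto
  with 1 2 3 A(8) have "k - 32 \<le> u x + ln (2 * \<eta>)" by linarith
  then show ?thesis using \<eta> by (simp add: ln_div)
qed

end

lemma cmean_h:
  assumes d: "wdata f p h g" and r: "r \<noteq> 0"
  shows "cmean 0 a h r = cmean (-1) a p r / of_real r + cmean (-2) a (\<lambda>z. of_real (g z / 4)) r"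
proof -
  note D = wdataD[OF d]
  have c: "continuous_on UNIV (\<lambda>z. of_real (g z / 4) :: complex)" by (intro continuous_intros D) auto
  have "r * (cmean 0 a h r - cmean (-2) a (\<lambda>z. of_real (g z / 4)) r) = cmean (-1) a p r"
    using cmean_parts[OF D(2) D(3) c, of r "-1" a] by simp
  then show ?thesis using r by (simp add: field_simps)
qed

lemma cmean_h_bound:
  assumes d: "wdata f p h g" and r: "r > 0" and P: "\<And>z. dist a z = r \<Longrightarrow> norm (p z) \<le> P" and G: "\<And>z. dist a z = r \<Longrightarrow> \<bar>g z\<bar> \<le> G"
  shows "norm (cmean 0 a h r) \<le> P / r + G / 4"
proof -
  note D = wdataD[OF d]
  have c: "continuous_on UNIV (\<lambda>z. of_real (g z / 4) :: complex)" by (intro continuous_intros D) auto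
  have "norm (cmean (-1) a p r) \<le> P" by (rule norm_cmean_bound[OF D(5)]) (use r P in auto)
  then have 1: "norm (cmean (-1) a p r / of_real r) \<le> P / r" using r by (simp add: norm_divide divide_right_mono)
  have 2: "norm (cmean (-2) a (\<lambda>z. of_real (g z / 4)) r) \<le> G / 4" by (rule norm_cmean_bound[OF c]) (use r G in auto)
  have "cmean 0 a h r = cmean (-1) a p r / of_real r + cmean (-2) a (\<lambda>z. of_real (g z / 4)) r" using cmean_h[OF d] r by simp
  then have "norm (cmean 0 a h r) \<le> norm (cmean (-1) a p r / of_real r) + norm (cmean (-2) a (\<lambda>z. of_real (g z / 4)) r)"
    by (metis norm_triangle_ineq)
  with 1 2 show ?thesis by linarith
qed

lemma exp_diff_le: "\<bar>exp x - exp y\<bar> \<le> (exp x + exp y) * \<bar>x - y\<bar>" for x y :: real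
proof -
  have *: "exp x - exp y \<le> (exp x + exp y) * \<bar>x - y\<bar>" if "y \<le> x" for x y :: real
  proof -
    have "exp x * (1 + (y - x)) \<le> exp x * exp (y - x)" by (intro mult_left_mono exp_ge_add_one_self) auto
    then have "exp x - exp y \<le> exp x * (x - y)" by (simp add: exp_diff algebra_simps)
    also have "\<dots> \<le> (exp x + exp y) * \<bar>x - y\<bar>" using that by (intro mult_mono) auto
    finally show ?thesis .
  qed
  show ?thesis
  proof (cases "y \<le> x")
    case True then show ?thesis using *[OF True] by simp
  next
    case False then show ?thesis using *[of x y] by (simp add: abs_minus_commute add.commute)
  qed
qed

lemma norm_add4: "norm (a - b + c :: complex) \<le> norm a + norm b + norm c"
  by (rule order_trans[OF norm_triangle_ineq add_mono[OF norm_triangle_ineq4 order_refl]])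

lemma norm_le_add_diff: "norm (y :: complex) \<le> norm x + norm (x - y)"
  using norm_triangle_ineq4[of x "x - y"] by simp

subsection \<open>The Schwarzian near a blow-up point\<close>

context blow
begin

text \<open>Chosen once and for all, so that later constants can depend on it. The factor 8 leaves
  room: points with norm up to \<open>4 * d0\<close> are closer to 0 than to the rest of
  \<open>Z\<close>, and circles of radius \<open>2 * d0\<close> with centre in the disc of radius
  \<open>d0\<close> stay away from \<open>Z\<close>.\<close>

definition d0 :: real where "d0 = (SOME d. d > 0 \<and> (\<forall>q\<in>Z. q \<noteq> 0 \<longrightarrow> 8 * d \<le> norm q))"

lemma d0: "d0 > 0" "q \<in> Z \<Longrightarrow> q \<noteq> 0 \<Longrightarrow> 8 * d0 \<le> norm q"
proof -
  obtain d where "d > 0" "\<And>q. q \<in> Z \<Longrightarrow> q \<noteq> 0 \<Longrightarrow> 8 * d \<le> norm q" by (rule separation) blast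
  then have "d > 0 \<and> (\<forall>q\<in>Z. q \<noteq> 0 \<longrightarrow> 8 * d \<le> norm q)" by blast
  then have "d0 > 0 \<and> (\<forall>q\<in>Z. q \<noteq> 0 \<longrightarrow> 8 * d0 \<le> norm q)" unfolding d0_def by (rule someI)
  then show "d0 > 0" "q \<in> Z \<Longrightarrow> q \<noteq> 0 \<Longrightarrow> 8 * d0 \<le> norm q" by auto
qed

lemma far_annulus: "d \<le> norm z \<Longrightarrow> norm z \<le> 4 * d0 \<Longrightarrow> d \<le> d0 \<Longrightarrow> z \<in> far d"
  unfolding far_def
proof (intro CollectI ballI)
  fix q assume *: "d \<le> norm z" "norm z \<le> 4 * d0" "d \<le> d0" "q \<in> Z"
  show "d \<le> dist z q"
  proof (cases "q = 0")
    case False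
    then have "8 * d0 \<le> norm q" using d0 * by blast
    then show ?thesis using norm_triangle_ineq3[of z q] * d0(1) by (auto simp: dist_norm)
  qed (use * in simp)
qed

lemma far_circle: "norm a \<le> d0 \<Longrightarrow> dist a z = 2 * d0 \<Longrightarrow> z \<in> far d0"
  using norm_triangle_ineq3[of a z] norm_triangle_ineq4[of a z] d0(1) by (intro far_annulus) (auto simp: dist_norm)

text \<open>On a circle of radius \<open>2 * d0\<close> about \<open>a\<close> everything in
  \<open>Qpot\<close> is bounded by the far estimates, and passing to radius 0 costs only a multiple
  of the total mass. No information on \<open>u\<close> near the blow-up point is used.\<close>

lemma Q_bound:
  "\<exists>\<eta>>0. \<exists>C\<ge>0. \<forall>\<rho> u p h a. concentrated \<eta> \<rho> u p h \<longrightarrow> norm a \<le> d0 \<longrightarrow> norm (h a - (p a)\<^sup>2 / 2) \<le> C"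
proof -
  obtain \<eta>1 C where \<eta>1: "\<eta>1 > 0" "C \<ge> 0" "\<And>\<rho> u p h x. concentrated \<eta>1 \<rho> u p h \<Longrightarrow> x \<in> far d0 \<Longrightarrow> norm (p x) \<le> C"
    using grad_bound_far[OF d0(1)] by blast
  obtain \<eta>2 where \<eta>2: "\<eta>2 > 0" "\<And>\<rho> u p h x. concentrated \<eta>2 \<rho> u p h \<Longrightarrow> x \<in> far d0 \<Longrightarrow> exp (u x) \<le> 1"
    using exp_small_far[OF d0(1) zero_less_one] by blast
  obtain N where N: "N > 0" "\<And>\<eta> \<rho> u p h x d. concentrated \<eta> \<rho> u p h \<Longrightarrow> (LINT z:cball x (2 * d0)|lborel. exp (u z)) \<le> N"
    using ball_mass_total[of "2 * d0"] by blast
  define \<eta> where "\<eta> = min \<eta>1 \<eta>2"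
  have \<eta>: "\<eta> > 0" "\<eta> \<le> \<eta>1" "\<eta> \<le> \<eta>2" using \<eta>1 \<eta>2 by (auto simp: \<eta>_def)
  define r where "r = 2 * d0"
  have r: "r > 0" using d0 by (simp add: r_def)
  \<comment> \<open>The three terms of \<open>Qpot\<close> on the circle, followed by the integral
    of \<open>Qpot_bound\<close>; \<open>2048\<close> is \<open>128\<^sup>2 / 8\<close>.\<close>
  define K where "K = (C / r + 128 / 4) + C\<^sup>2 / 2 + 32 * r * C + 2048 * (N / (2 * pi))"
  have "norm (h a - (p a)\<^sup>2 / 2) \<le> K" if ad: "concentrated \<eta> \<rho> u p h" and a: "norm a \<le> d0" for \<rho> u p h a
  proof -
    note A = concentratedD[OF ad]
    have P: "norm (p z) \<le> C" and E: "exp (u z) \<le> 1" if "dist a z = r" for z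
      using \<eta>1(3)[OF concentrated_mono[OF ad \<eta>(2)] far_circle[OF a]] \<eta>2(2)[OF concentrated_mono[OF ad \<eta>(3)] far_circle[OF a]] that
      by (auto simp: r_def)
    have "norm (cmean 0 a h r) \<le> C / r + 128 / 4"
    proof (rule cmean_h_bound[OF A(1) r P])
      fix z assume "dist a z = r"
      then have "\<bar>1 - exp (u z)\<bar> \<le> 1" using E[of z] by simp
      then have "\<rho> * \<bar>1 - exp (u z)\<bar> \<le> 128 * 1" using A(7,8) by (intro mult_mono) auto
      then show "\<bar>\<rho> * (1 - exp (u z))\<bar> \<le> 128" using A(7) by (simp add: abs_mult)
    qed
    moreover have "norm (cmean 0 a (\<lambda>z. (p z)\<^sup>2) r / 2) \<le> C\<^sup>2 / 2"
    proof -
      have "norm (cmean 0 a (\<lambda>z. (p z)\<^sup>2) r) \<le> C\<^sup>2"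
        by (rule norm_cmean_bound) (use r P in \<open>auto simp: norm_power intro!: continuous_intros wdataD[OF A(1)] power_mono\<close>)
      then show ?thesis by simp
    qed
    moreover have "norm (of_real (\<rho> / 4 * r) * cmean (-1) a p r) \<le> 32 * r * C"
      unfolding norm_mult by (rule mult_mono[OF _ norm_cmean_bound]) (use r P A(7,8) in \<open>auto simp: norm_mult intro!: wdataD[OF A(1)]\<close>)
    ultimately have 1: "norm (Qpot \<rho> u p h a r) \<le> (C / r + 128 / 4) + C\<^sup>2 / 2 + 32 * r * C"
      unfolding Qpot_def by (intro order_trans[OF norm_add4] add_mono)
    have ce: "continuous_on UNIV (\<lambda>z. exp (u z))" by (intro continuous_intros A)
    have "norm (Qpot \<rho> u p h a r - (h a - (p a)\<^sup>2 / 2)) \<le> \<rho>\<^sup>2 / 8 * integral {0..r} (\<lambda>s. s * rmean a (\<lambda>z. exp (u z)) s)"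
      by (rule Qpot_bound[OF A(1) r])
    also have "integral {0..r} (\<lambda>s. s * rmean a (\<lambda>z. exp (u z)) s) = (LINT z:cball a r|lborel. exp (u z)) / (2 * pi)"
      by (simp add: integral_cball_polar[OF ce])
    also have "\<rho>\<^sup>2 / 8 * ((LINT z:cball a r|lborel. exp (u z)) / (2 * pi)) \<le> 2048 * (N / (2 * pi))"
    proof (rule mult_mono)
      have "\<rho>\<^sup>2 \<le> 128\<^sup>2" using A(7,8) by (intro power_mono) auto
      then show "\<rho>\<^sup>2 / 8 \<le> 2048" by simp
      show "(LINT z:cball a r|lborel. exp (u z)) / (2 * pi) \<le> N / (2 * pi)"
        using N(2)[OF ad, of a] by (intro divide_right_mono) (auto simp: r_def)
      show "0 \<le> (LINT z:cball a r|lborel. exp (u z)) / (2 * pi)"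
        unfolding set_lebesgue_integral_def by (intro divide_nonneg_nonneg Bochner_Integration.integral_nonneg) auto
    qed auto
    finally have 2: "norm (Qpot \<rho> u p h a r - (h a - (p a)\<^sup>2 / 2)) \<le> 2048 * (N / (2 * pi))" .
    have "norm (h a - (p a)\<^sup>2 / 2) \<le> norm (Qpot \<rho> u p h a r) + norm (Qpot \<rho> u p h a r - (h a - (p a)\<^sup>2 / 2))"
      using norm_triangle_ineq4[of "Qpot \<rho> u p h a r" "Qpot \<rho> u p h a r - (h a - (p a)\<^sup>2 / 2)"] by simp
    with 1 2 show ?thesis unfolding K_def by linarith
  qed
  moreover have "K \<ge> 0" using \<eta>1(2) r N(1) by (simp add: K_def)
  ultimately show ?thesis using \<eta>(1) by blast
qed

text \<open>Where both exponentials are at most 1, the Laplacian of the difference is at most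
  \<open>256 * W\<close>, so the gradient estimate is linear in \<open>W\<close>.\<close>

lemma w_grad_far:
  assumes d: "d > 0"
  shows "\<exists>\<eta>>0. \<exists>C\<ge>0. \<forall>\<rho> u p h u' p' h' W x. concentrated \<eta> \<rho> u p h \<longrightarrow> concentrated \<eta> \<rho> u' p' h' \<longrightarrow> (\<forall>z. \<bar>u z - u' z\<bar> \<le> W) \<longrightarrow>
     x \<in> far d \<longrightarrow> norm (p x - p' x) \<le> C * W \<and> \<bar>exp (u x) - exp (u' x)\<bar> \<le> 2 * W \<and> exp (u x) \<le> 1 \<and> exp (u' x) \<le> 1"
proof -
  obtain \<eta> where \<eta>: "\<eta> > 0" "\<And>\<rho> u p h x. concentrated \<eta> \<rho> u p h \<Longrightarrow> x \<in> far (d / 2) \<Longrightarrow> exp (u x) \<le> 1"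
    using exp_small_far[OF half_gt_zero[OF d] zero_less_one] by blast
  define K where "K = 1 / (d / 2) + 256 * (d / 2)"
  have "norm (p x - p' x) \<le> K * W \<and> \<bar>exp (u x) - exp (u' x)\<bar> \<le> 2 * W \<and> exp (u x) \<le> 1 \<and> exp (u' x) \<le> 1"
    if a: "concentrated \<eta> \<rho> u p h" "concentrated \<eta> \<rho> u' p' h'" and W: "\<And>z. \<bar>u z - u' z\<bar> \<le> W" and x: "x \<in> far d" for \<rho> u p h u' p' h' W x
  proof -
    note A = concentratedD[OF a(1)] and A' = concentratedD[OF a(2)]
    have f: "z \<in> far (d / 2)" if "dist x z \<le> d / 2" for z using far_ball[OF x that] by simp
    have E: "exp (u z) \<le> 1" "exp (u' z) \<le> 1" if "dist x z \<le> d / 2" for z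
      using \<eta>(2)[OF a(1) f[OF that]] \<eta>(2)[OF a(2) f[OF that]] by auto
    have dE: "\<bar>exp (u z) - exp (u' z)\<bar> \<le> 2 * W" if "dist x z \<le> d / 2" for z
      using order_trans[OF exp_diff_le mult_mono[of "exp (u z) + exp (u' z)" 2 "\<bar>u z - u' z\<bar>" W]] E[OF that] W[of z] by auto
    have w: "wdata (\<lambda>z. u z - u' z) (\<lambda>z. p z - p' z) (\<lambda>z. h z - h' z) (\<lambda>z. \<rho> * (1 - exp (u z)) - \<rho> * (1 - exp (u' z)))"
      by (rule wdata_diff[OF A(1) A'(1)])
    have "norm (p x - p' x) \<le> W / (d / 2) + (256 * W) * (d / 2)"
    proof (rule gradient_bound[OF w])
      fix z assume "dist x z \<le> d / 2"
      from dE[OF this] have "\<rho> * \<bar>exp (u z) - exp (u' z)\<bar> \<le> 128 * (2 * W)" using A(7,8) by (intro mult_mono) auto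
      moreover have "\<rho> * (1 - exp (u z)) - \<rho> * (1 - exp (u' z)) = - (\<rho> * (exp (u z) - exp (u' z)))" by (simp add: algebra_simps)
      ultimately show "\<bar>\<rho> * (1 - exp (u z)) - \<rho> * (1 - exp (u' z))\<bar> \<le> 256 * W" using A(7) by (simp add: abs_mult)
    qed (use d W in auto)
    also have "\<dots> = K * W" by (simp add: K_def algebra_simps)
    finally show ?thesis using dE[of x] E[of x] d by auto
  qed
  moreover have "K \<ge> 0" using d by (simp add: K_def)
  ultimately show ?thesis using \<eta>(1) by blast
qed

text \<open>The argument for the bound of one Schwarzian, applied to two. The boundary terms are
  linear in \<open>W\<close> by the far estimates, and the interior term because
  \<open>\<bar>exp (u z) - exp (u' z)\<bar>\<close> is at most \<open>W\<close> times the sum of two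
  densities of bounded mass.\<close>

lemma Q_diff_bound:
  "\<exists>\<eta>>0. \<exists>C\<ge>0. \<forall>\<rho> u p h u' p' h' W a. concentrated \<eta> \<rho> u p h \<longrightarrow> concentrated \<eta> \<rho> u' p' h' \<longrightarrow> (\<forall>z. \<bar>u z - u' z\<bar> \<le> W) \<longrightarrow>
     norm a \<le> d0 \<longrightarrow> norm ((h a - (p a)\<^sup>2 / 2) - (h' a - (p' a)\<^sup>2 / 2)) \<le> C * W"
proof -
  obtain \<eta>1 C where \<eta>1: "\<eta>1 > 0" "C \<ge> 0" "\<And>\<rho> u p h x. concentrated \<eta>1 \<rho> u p h \<Longrightarrow> x \<in> far d0 \<Longrightarrow> norm (p x) \<le> C"
    using grad_bound_far[OF d0(1)] by blast
  obtain \<eta>2 C' where \<eta>2: "\<eta>2 > 0" "C' \<ge> 0" "\<And>\<rho> u p h u' p' h' W x. concentrated \<eta>2 \<rho> u p h \<Longrightarrow> concentrated \<eta>2 \<rho> u' p' h' \<Longrightarrow> (\<forall>z. \<bar>u z - u' z\<bar> \<le> W) \<Longrightarrow>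
     x \<in> far d0 \<Longrightarrow> norm (p x - p' x) \<le> C' * W \<and> \<bar>exp (u x) - exp (u' x)\<bar> \<le> 2 * W \<and> exp (u x) \<le> 1 \<and> exp (u' x) \<le> 1"
    using w_grad_far[OF d0(1)] by blast
  obtain N where N: "N > 0" "\<And>\<eta> \<rho> u p h x d. concentrated \<eta> \<rho> u p h \<Longrightarrow> (LINT z:cball x (2 * d0)|lborel. exp (u z)) \<le> N"
    using ball_mass_total[of "2 * d0"] by blast
  define \<eta> where "\<eta> = min \<eta>1 \<eta>2"
  have \<eta>: "\<eta> > 0" "\<eta> \<le> \<eta>1" "\<eta> \<le> \<eta>2" using \<eta>1 \<eta>2 by (auto simp: \<eta>_def)
  define r where "r = 2 * d0"
  have r: "r > 0" using d0 by (simp add: r_def)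
  define K where "K = (C' / r + 256 / 4) + C * C' + 32 * r * C' + 2048 * (2 * N / (2 * pi))"
  have "norm ((h a - (p a)\<^sup>2 / 2) - (h' a - (p' a)\<^sup>2 / 2)) \<le> K * W" 
    if ad: "concentrated \<eta> \<rho> u p h" "concentrated \<eta> \<rho> u' p' h'" and W: "\<And>z. \<bar>u z - u' z\<bar> \<le> W" and a: "norm a \<le> d0" for \<rho> u p h u' p' h' W a
  proof -
    note A = concentratedD[OF ad(1)] and A' = concentratedD[OF ad(2)]
    have W0: "W \<ge> 0" using W[of 0] by simp
    have P: "norm (p z) \<le> C" "norm (p' z) \<le> C" and dP: "norm (p z - p' z) \<le> C' * W" and dE: "\<bar>exp (u z) - exp (u' z)\<bar> \<le> 2 * W" if "dist a z = r" for z
    proof -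
      have z: "z \<in> far d0" using far_circle[OF a] that by (simp add: r_def)
      show "norm (p z) \<le> C" "norm (p' z) \<le> C"
        using \<eta>1(3)[OF concentrated_mono[OF ad(1) \<eta>(2)] z] \<eta>1(3)[OF concentrated_mono[OF ad(2) \<eta>(2)] z] .
      show "norm (p z - p' z) \<le> C' * W" "\<bar>exp (u z) - exp (u' z)\<bar> \<le> 2 * W"
        using \<eta>2(3)[OF concentrated_mono[OF ad(1) \<eta>(3)] concentrated_mono[OF ad(2) \<eta>(3)] _ z] W by auto
    qed
    note D = wdataD[OF A(1)] and D' = wdataD[OF A'(1)]
    have cpp: "continuous_on UNIV (\<lambda>z. (p z)\<^sup>2)" "continuous_on UNIV (\<lambda>z. (p' z)\<^sup>2)" by (intro continuous_intros D D')+
    have w: "wdata (\<lambda>z. u z - u' z) (\<lambda>z. p z - p' z) (\<lambda>z. h z - h' z) (\<lambda>z. \<rho> * (1 - exp (u z)) - \<rho> * (1 - exp (u' z)))"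
      by (rule wdata_diff[OF A(1) A'(1)])
    have "norm (cmean 0 a (\<lambda>z. h z - h' z) r) \<le> (C' * W) / r + (256 * W) / 4"
    proof (rule cmean_h_bound[OF w r dP])
      fix z assume "dist a z = r"
      from dE[OF this] have "\<rho> * \<bar>exp (u z) - exp (u' z)\<bar> \<le> 128 * (2 * W)" using A(7,8) by (intro mult_mono) auto
      moreover have "\<rho> * (1 - exp (u z)) - \<rho> * (1 - exp (u' z)) = - (\<rho> * (exp (u z) - exp (u' z)))" by (simp add: algebra_simps)
      ultimately show "\<bar>\<rho> * (1 - exp (u z)) - \<rho> * (1 - exp (u' z))\<bar> \<le> 256 * W" using A(7) by (simp add: abs_mult)
    qed
    moreover have "norm (cmean 0 a (\<lambda>z. (p z)\<^sup>2 - (p' z)\<^sup>2) r / 2) \<le> C * (C' * W)"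
    proof -
      have "norm (cmean 0 a (\<lambda>z. (p z)\<^sup>2 - (p' z)\<^sup>2) r) \<le> 2 * C * (C' * W)"
      proof (rule norm_cmean_bound)
        fix z assume "dist a z = \<bar>r\<bar>"
        then have z: "dist a z = r" using r by simp
        have "(p z)\<^sup>2 - (p' z)\<^sup>2 = (p z + p' z) * (p z - p' z)" by (simp add: power2_eq_square algebra_simps)
        moreover have "norm (p z + p' z) \<le> 2 * C" using norm_triangle_ineq[of "p z" "p' z"] P[OF z] by linarith
        ultimately show "norm ((p z)\<^sup>2 - (p' z)\<^sup>2) \<le> 2 * C * (C' * W)"
          using dP[OF z] \<eta>1(2) by (simp add: norm_mult mult_mono)
      qed (intro continuous_intros cpp)
      then show ?thesis by simp
    qed
    moreover have "norm (of_real (\<rho> / 4 * r) * cmean (-1) a (\<lambda>z. p z - p' z) r) \<le> 32 * r * (C' * W)"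
      unfolding norm_mult by (rule mult_mono[OF _ norm_cmean_bound]) (use r dP A(7,8) in \<open>auto simp: norm_mult intro!: wdataD[OF w]\<close>)
    ultimately have "norm (cmean 0 a (\<lambda>z. h z - h' z) r - cmean 0 a (\<lambda>z. (p z)\<^sup>2 - (p' z)\<^sup>2) r / 2 + of_real (\<rho> / 4 * r) * cmean (-1) a (\<lambda>z. p z - p' z) r)
        \<le> ((C' * W) / r + (256 * W) / 4) + C * (C' * W) + 32 * r * (C' * W)"
      by (intro order_trans[OF norm_add4] add_mono)
    also have "cmean 0 a (\<lambda>z. h z - h' z) r - cmean 0 a (\<lambda>z. (p z)\<^sup>2 - (p' z)\<^sup>2) r / 2 + of_real (\<rho> / 4 * r) * cmean (-1) a (\<lambda>z. p z - p' z) r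
        = Qpot \<rho> u p h a r - Qpot \<rho> u' p' h' a r"
      unfolding Qpot_def cmean_diff[OF D(3) D'(3)] cmean_diff[OF cpp] cmean_diff[OF D(5) D'(5)] by (simp add: algebra_simps diff_divide_distrib)
    finally have 1: "norm (Qpot \<rho> u p h a r - Qpot \<rho> u' p' h' a r) \<le> ((C' * W) / r + (256 * W) / 4) + C * (C' * W) + 32 * r * (C' * W)" .
    have ce: "continuous_on UNIV (\<lambda>z. exp (u z))" "continuous_on UNIV (\<lambda>z. exp (u' z))" by (intro continuous_intros A A')+
    have ci: "continuous_on UNIV (\<lambda>z. \<bar>exp (u z) - exp (u' z)\<bar>)" by (intro continuous_intros A A')
    have "norm ((Qpot \<rho> u p h a r - Qpot \<rho> u' p' h' a r) - (h a - (p a)\<^sup>2 / 2 - (h' a - (p' a)\<^sup>2 / 2))) \<le> \<rho>\<^sup>2 / 8 * integral {0..r} (\<lambda>s. s * rmean a (\<lambda>z. \<bar>exp (u z) - exp (u' z)\<bar>) s)"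
      by (rule Qpot_diff_bound[OF A(1) A'(1) r])
    also have "integral {0..r} (\<lambda>s. s * rmean a (\<lambda>z. \<bar>exp (u z) - exp (u' z)\<bar>) s) = (LINT z:cball a r|lborel. \<bar>exp (u z) - exp (u' z)\<bar>) / (2 * pi)"
      by (simp add: integral_cball_polar[OF ci])
    also have "(LINT z:cball a r|lborel. \<bar>exp (u z) - exp (u' z)\<bar>) \<le> (LINT z:cball a r|lborel. W * (exp (u z) + exp (u' z)))"
    proof (intro set_integral_mono set_integrable_continuous_cball ci)
      show "continuous_on UNIV (\<lambda>z. W * (exp (u z) + exp (u' z)))" by (intro continuous_intros A A')
      show "\<bar>exp (u z) - exp (u' z)\<bar> \<le> W * (exp (u z) + exp (u' z))" for z
        using exp_diff_le[of "u z" "u' z"] mult_left_mono[OF W[of z], of "exp (u z) + exp (u' z)"] by (simp add: mult.commute)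
    qed
    also have "(LINT z:cball a r|lborel. W * (exp (u z) + exp (u' z))) = W * ((LINT z:cball a r|lborel. exp (u z)) + (LINT z:cball a r|lborel. exp (u' z)))"
      using set_integral_add(2)[OF set_integrable_continuous_cball[OF ce(1)] set_integrable_continuous_cball[OF ce(2)], of a r] by simp
    also have "\<dots> \<le> W * (2 * N)"
      using N(2)[OF ad(1), of a] N(2)[OF ad(2), of a] W0 by (intro mult_left_mono) (auto simp: r_def)
    finally have "norm ((Qpot \<rho> u p h a r - Qpot \<rho> u' p' h' a r) - (h a - (p a)\<^sup>2 / 2 - (h' a - (p' a)\<^sup>2 / 2))) \<le> \<rho>\<^sup>2 / 8 * (W * (2 * N) / (2 * pi))"
      by (simp add: divide_right_mono mult_left_mono)
    also have "\<dots> \<le> 2048 * (W * (2 * N) / (2 * pi))"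
    proof (rule mult_right_mono)
      have "\<rho>\<^sup>2 \<le> 128\<^sup>2" using A(7,8) by (intro power_mono) auto
      then show "\<rho>\<^sup>2 / 8 \<le> 2048" by simp
    qed (use W0 N(1) in auto)
    finally have 2: "norm ((Qpot \<rho> u p h a r - Qpot \<rho> u' p' h' a r) - (h a - (p a)\<^sup>2 / 2 - (h' a - (p' a)\<^sup>2 / 2))) \<le> 2048 * (W * (2 * N) / (2 * pi))" .
    let ?X = "Qpot \<rho> u p h a r - Qpot \<rho> u' p' h' a r" and ?Y = "h a - (p a)\<^sup>2 / 2 - (h' a - (p' a)\<^sup>2 / 2)"
    have "norm ?Y \<le> norm ?X + norm (?X - ?Y)"
      by (rule norm_le_add_diff)
    also have "\<dots> \<le> (((C' * W) / r + (256 * W) / 4) + C * (C' * W) + 32 * r * (C' * W)) + 2048 * (W * (2 * N) / (2 * pi))"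
      using 1 2 by linarith
    also have "\<dots> = K * W" by (simp add: K_def algebra_simps)
    finally show ?thesis .
  qed
  moreover have "K \<ge> 0" using \<eta>1(2) \<eta>2(2) r N(1) by (simp add: K_def)
  ultimately show ?thesis using \<eta>(1) by blast
qed

end

subsection \<open>The linear system along a ray\<close>

lemma increment_bound:
  fixes f :: "real \<Rightarrow> 'a::real_normed_vector"
  assumes f: "\<And>r. 0 \<le> r \<Longrightarrow> r \<le> R \<Longrightarrow> (f has_vector_derivative f' r) (at r)"
    and K: "\<And>r. 0 \<le> r \<Longrightarrow> r \<le> R \<Longrightarrow> norm (f' r) \<le> K" and r: "0 \<le> r" "r \<le> R"
  shows "norm (f r - f 0) \<le> R * K"
proof -
  have K0: "K \<ge> 0" using K[of r] r by (meson norm_ge_zero order_trans)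
  have "norm (f r - f 0) \<le> r * K"
  proof (cases "r = 0")
    case False
    have "norm (f r - f 0) \<le> K * r - K * 0"
    proof (rule differentiable_bound_general[where f' = f'])
      show "continuous_on {0..r} f"
        using r by (intro continuous_at_imp_continuous_on ballI has_vector_derivative_continuous[OF f]) auto
    qed (use f K r False in \<open>auto intro!: derivative_eq_intros continuous_intros\<close>)
    then show ?thesis by (simp add: mult.commute)
  qed simp
  also have "\<dots> \<le> R * K" using r K0 by (intro mult_right_mono)
  finally show ?thesis .
qed

text \<open>Along a ray, \<open>\<phi> = exp (- u / 2)\<close>, the multiple of \<open>\<phi>\<^sub>z\<close> by the direction of the ray, and
  \<open>(\<bar>\<phi>\<^sub>z\<bar>\<^sup>2 + \<rho>/8) / \<phi>\<close> satisfy this system; they are \<open>rphi\<close>, \<open>rX\<close> and \<open>rB\<close> below.\<close>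

lemma ray_system_estimate:
  fixes D B :: "real \<Rightarrow> real" and X b s1 :: "real \<Rightarrow> complex" and s2 :: "real \<Rightarrow> real"
  assumes D: "\<And>r. 0 \<le> r \<Longrightarrow> r \<le> R \<Longrightarrow> (D has_vector_derivative 2 * Re (X r)) (at r)"
    and X: "\<And>r. 0 \<le> r \<Longrightarrow> r \<le> R \<Longrightarrow> (X has_vector_derivative (of_real (B r) + b r * of_real (D r) + s1 r)) (at r)"
    and B: "\<And>r. 0 \<le> r \<Longrightarrow> r \<le> R \<Longrightarrow> (B has_vector_derivative (2 * Re (cnj (X r) * b r) + s2 r)) (at r)"
    and X0: "X 0 = 0"
    and b: "\<And>r. 0 \<le> r \<Longrightarrow> r \<le> R \<Longrightarrow> norm (b r) \<le> C"
    and s1: "\<And>r. 0 \<le> r \<Longrightarrow> r \<le> R \<Longrightarrow> norm (s1 r) \<le> S1"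
    and s2: "\<And>r. 0 \<le> r \<Longrightarrow> r \<le> R \<Longrightarrow> \<bar>s2 r\<bar> \<le> S2"
    and R: "0 \<le> R" "16 * C * R\<^sup>2 \<le> 1"
  shows "\<bar>D R - D 0 - R\<^sup>2 * B 0\<bar> \<le> R\<^sup>2 * (16 * C * R\<^sup>2 * \<bar>B 0\<bar> + 3 * (C * \<bar>D 0\<bar> + S1 + R * S2))"
    and "norm (X R) \<le> 2 * R * (\<bar>B 0\<bar> + C * \<bar>D 0\<bar> + S1 + R * S2)"
proof -
  have C0: "C \<ge> 0" and S10: "S1 \<ge> 0" and S20: "S2 \<ge> 0"
    using b[of 0] s1[of 0] s2[of 0] R norm_ge_zero[of "b 0"] norm_ge_zero[of "s1 0"] by linarith+
  define S where "S = C * \<bar>D 0\<bar> + S1 + R * S2"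
  define T where "T = \<bar>B 0\<bar> + S"
  define \<epsilon> where "\<epsilon> = C * R\<^sup>2"
  have S0: "S \<ge> 0" using C0 S10 S20 R by (simp add: S_def)
  have T0: "T \<ge> 0" using S0 by (simp add: T_def)
  have \<epsilon>: "0 \<le> \<epsilon>" "\<epsilon> \<le> 1 / 16" using R C0 by (auto simp: \<epsilon>_def)
  have "continuous_on {0..R} (\<lambda>r. norm (X r))"
    by (intro continuous_on_norm continuous_at_imp_continuous_on ballI has_vector_derivative_continuous[OF X]) auto
  then obtain r0 where r0: "r0 \<in> {0..R}" "\<And>r. r \<in> {0..R} \<Longrightarrow> norm (X r) \<le> norm (X r0)"
    using continuous_attains_sup[of "{0..R}" "\<lambda>r. norm (X r)"] R by auto
  \<comment> \<open>A bootstrap: the increments of \<open>D\<close> and \<open>B\<close> are bounded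
    in terms of the maximum \<open>m\<close> of \<open>norm (X r)\<close>, which then bounds
    itself.\<close>
  define m where "m = norm (X r0)"
  have m0: "m \<ge> 0" by (simp add: m_def)
  have m: "norm (X r) \<le> m" if "0 \<le> r" "r \<le> R" for r using r0(2)[of r] that by (simp add: m_def)
  have Db: "\<bar>D r - D 0\<bar> \<le> R * (2 * m)" if "0 \<le> r" "r \<le> R" for r
    unfolding real_norm_def[symmetric]
  proof (rule increment_bound[OF D _ that])
    fix r assume "0 \<le> r" "r \<le> R"
    then show "norm (2 * Re (X r)) \<le> 2 * m" using m[of r] abs_Re_le_cmod[of "X r"] by simp
  qed auto
  have Bb: "\<bar>B r - B 0\<bar> \<le> R * (2 * m * C + S2)" if "0 \<le> r" "r \<le> R" for r
    unfolding real_norm_def[symmetric]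
  proof (rule increment_bound[OF B _ that])
    fix r assume r: "0 \<le> r" "r \<le> R"
    have "\<bar>Re (cnj (X r) * b r)\<bar> \<le> norm (X r) * norm (b r)" using abs_Re_le_cmod[of "cnj (X r) * b r"] by (simp add: norm_mult)
    also have "\<dots> \<le> m * C" using m[OF r] b[OF r] m0 by (intro mult_mono) auto
    finally show "norm (2 * Re (cnj (X r) * b r) + s2 r) \<le> 2 * m * C + S2" using s2[OF r] by (simp add: abs_le_iff)
  qed auto
  have bD: "norm (b r * of_real (D r)) \<le> C * (\<bar>D 0\<bar> + R * (2 * m))" if "0 \<le> r" "r \<le> R" for r
    unfolding norm_mult by (rule mult_mono) (use b[OF that] Db[OF that] C0 in auto)
  have X': "norm (of_real (B r) + b r * of_real (D r) + s1 r) \<le> \<bar>B 0\<bar> + R * (2 * m * C + S2) + C * (\<bar>D 0\<bar> + R * (2 * m)) + S1"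
    if r: "0 \<le> r" "r \<le> R" for r
  proof -
    have "norm (of_real (B r) + b r * of_real (D r) + s1 r) \<le> norm (of_real (B r) :: complex) + norm (b r * of_real (D r)) + norm (s1 r)"
      by (intro norm_triangle_le add_mono order_refl norm_triangle_ineq)
    also have "\<dots> \<le> (\<bar>B 0\<bar> + R * (2 * m * C + S2)) + C * (\<bar>D 0\<bar> + R * (2 * m)) + S1"
      using Bb[OF r] bD[OF r] s1[OF r] by (intro add_mono) (auto simp: norm_of_real)
    finally show ?thesis .
  qed
  have "norm (X r0 - X 0) \<le> R * (\<bar>B 0\<bar> + R * (2 * m * C + S2) + C * (\<bar>D 0\<bar> + R * (2 * m)) + S1)"
    by (rule increment_bound[OF X X']) (use r0 in auto)
  \<comment> \<open>The smallness of \<open>C * R\<^sup>2\<close> lets the last term be absorbed on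
    the left.\<close>
  then have "m \<le> R * T + 4 * \<epsilon> * m"
    by (simp add: X0 m_def[symmetric] T_def S_def \<epsilon>_def power2_eq_square algebra_simps)
  also have "4 * \<epsilon> * m \<le> (1 / 4) * m" using \<epsilon> m0 by (intro mult_right_mono) auto
  finally have mT: "m \<le> 2 * R * T" using mult_nonneg_nonneg[OF R(1) T0] m0 by linarith
  show "norm (X R) \<le> 2 * R * (\<bar>B 0\<bar> + C * \<bar>D 0\<bar> + S1 + R * S2)"
    using m[of R] mT R by (simp add: T_def S_def add.assoc)
  have RCm: "R * C * m \<le> 2 * \<epsilon> * T"
  proof -
    have "R * C * m \<le> R * C * (2 * R * T)" using R C0 mT by (intro mult_left_mono) auto
    then show ?thesis by (simp add: \<epsilon>_def power2_eq_square mult_ac)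
  qed
  define E where "E = R * (2 * m * C + S2) + C * (\<bar>D 0\<bar> + R * (2 * m)) + S1"
  have "E \<le> 8 * \<epsilon> * T + S" using RCm by (simp add: E_def S_def algebra_simps)
  also have "8 * \<epsilon> * T = 8 * \<epsilon> * \<bar>B 0\<bar> + 8 * \<epsilon> * S" by (simp add: T_def algebra_simps)
  also have "8 * \<epsilon> * S \<le> (1 / 2) * S" using \<epsilon> S0 by (intro mult_right_mono) auto
  finally have E: "2 * E \<le> 16 * \<epsilon> * \<bar>B 0\<bar> + 3 * S" by simp
  \<comment> \<open>Comparison with the solution \<open>X r = r * B 0\<close>,
    \<open>D r = D 0 + r\<^sup>2 * B 0\<close> for vanishing \<open>b\<close>, \<open>s1\<close> and
    \<open>s2\<close>.\<close>
  have Xlin: "norm (X r - of_real (r * B 0)) \<le> R * E" if r: "0 \<le> r" "r \<le> R" for r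
  proof -
    have "norm ((X r - of_real (r * B 0)) - (X 0 - of_real (0 * B 0))) \<le> R * E"
    proof (rule increment_bound[OF _ _ r])
      fix r assume r: "0 \<le> r" "r \<le> R"
      have "((\<lambda>r. r * B 0) has_real_derivative B 0) (at r)" by (auto intro!: derivative_eq_intros)
      then have "((\<lambda>r. complex_of_real (r * B 0)) has_vector_derivative of_real (B 0)) (at r)" by (rule has_vector_derivative_of_real)
      then show "((\<lambda>r. X r - of_real (r * B 0)) has_vector_derivative (of_real (B r) + b r * of_real (D r) + s1 r - of_real (B 0))) (at r)"
        by (rule has_vector_derivative_diff[OF X[OF r]])
      have "norm (of_real (B r) + b r * of_real (D r) + s1 r - of_real (B 0)) = norm (of_real (B r - B 0) + b r * of_real (D r) + s1 r)"
        by (simp add: algebra_simps)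
      also have "\<dots> \<le> norm (of_real (B r - B 0) :: complex) + norm (b r * of_real (D r)) + norm (s1 r)"
        by (intro norm_triangle_le add_mono order_refl norm_triangle_ineq)
      also have "\<dots> \<le> E" unfolding E_def
        using Bb[OF r] bD[OF r] s1[OF r] by (intro add_mono) (auto simp: norm_of_real simp del: of_real_diff)
      finally show "norm (of_real (B r) + b r * of_real (D r) + s1 r - of_real (B 0)) \<le> E" .
    qed
    then show ?thesis by (simp add: X0)
  qed
  have "norm ((D R - R\<^sup>2 * B 0) - (D 0 - 0\<^sup>2 * B 0)) \<le> R * (2 * (R * E))"
  proof (rule increment_bound[where R = R])
    fix r assume r: "0 \<le> r" "r \<le> R"
    have "((\<lambda>r. r\<^sup>2 * B 0) has_real_derivative 2 * r * B 0) (at r)" by (auto intro!: derivative_eq_intros)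
    then have "((\<lambda>r. r\<^sup>2 * B 0) has_vector_derivative 2 * r * B 0) (at r)" by (simp add: has_real_derivative_iff_has_vector_derivative)
    then show "((\<lambda>r. D r - r\<^sup>2 * B 0) has_vector_derivative (2 * Re (X r) - 2 * r * B 0)) (at r)"
      by (rule has_vector_derivative_diff[OF D[OF r]])
    have "\<bar>Re (X r) - r * B 0\<bar> \<le> R * E"
      using order_trans[OF abs_Re_le_cmod[of "X r - of_real (r * B 0)"] Xlin[OF r]] by simp
    then show "norm (2 * Re (X r) - 2 * r * B 0) \<le> 2 * (R * E)" by (simp add: abs_le_iff)
  qed (use R in auto)
  then have "\<bar>D R - D 0 - R\<^sup>2 * B 0\<bar> \<le> R\<^sup>2 * (2 * E)" by (simp add: power2_eq_square algebra_simps)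
  also have "\<dots> \<le> R\<^sup>2 * (16 * \<epsilon> * \<bar>B 0\<bar> + 3 * S)" using E by (intro mult_left_mono) auto
  finally show "\<bar>D R - D 0 - R\<^sup>2 * B 0\<bar> \<le> R\<^sup>2 * (16 * C * R\<^sup>2 * \<bar>B 0\<bar> + 3 * (C * \<bar>D 0\<bar> + S1 + R * S2))"
    by (simp add: \<epsilon>_def S_def mult_ac)
qed

definition rphi :: "(complex \<Rightarrow> real) \<Rightarrow> real \<Rightarrow> real \<Rightarrow> real" where
  "rphi u t r = exp (- u (of_real r * cis t) / 2)"

definition rX :: "(complex \<Rightarrow> real) \<Rightarrow> (complex \<Rightarrow> complex) \<Rightarrow> real \<Rightarrow> real \<Rightarrow> complex" where
  "rX u p t r = - (cis t * p (of_real r * cis t) / 2) * of_real (rphi u t r)"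

definition rB :: "real \<Rightarrow> (complex \<Rightarrow> real) \<Rightarrow> (complex \<Rightarrow> complex) \<Rightarrow> real \<Rightarrow> real \<Rightarrow> real" where
  "rB \<rho> u p t r = ((norm (rX u p t r))\<^sup>2 + \<rho> / 8) / rphi u t r"

text \<open>The only coefficient of the ray system. The Schwarzian enters because the second
  \<open>z\<close> derivative of \<open>exp (- u / 2)\<close> is minus half the Schwarzian times the
  function itself; \<open>cis (2 * t)\<close> arises from differentiating twice in the direction of
  the ray.\<close>

definition rb :: "real \<Rightarrow> (complex \<Rightarrow> complex) \<Rightarrow> (complex \<Rightarrow> complex) \<Rightarrow> real \<Rightarrow> real \<Rightarrow> complex" where
  "rb \<rho> p h t r = - of_real (\<rho> / 8) - cis (2 * t) * (h (of_real r * cis t) - (p (of_real r * cis t))\<^sup>2 / 2) / 2"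

lemma rphi_pos [simp]: "rphi u t r > 0" by (simp add: rphi_def)

lemma rphi_deriv:
  assumes d: "wdata u p h g"
  shows "(rphi u t has_vector_derivative 2 * Re (rX u p t r)) (at r)"
proof -
  have "((\<lambda>r. of_real r * cis t) has_derivative (\<lambda>s. of_real s * cis t)) (at r)" by (auto intro!: derivative_eq_intros)
  from has_derivative_compose[OF this wdataD(1)[OF d]]
  have "((\<lambda>r. u (of_real r * cis t)) has_real_derivative 2 * Re (p (of_real r * cis t) * cis t)) (at r)"
    unfolding has_field_derivative_def by (rule has_derivative_eq_rhs) (auto simp: fun_eq_iff algebra_simps)
  then have "(rphi u t has_real_derivative (exp (- u (of_real r * cis t) / 2) * (- (2 * Re (p (of_real r * cis t) * cis t)) / 2))) (at r)"
  proof -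
    have "((\<lambda>r. exp (- f r / 2)) has_real_derivative exp (- f r / 2) * (- f' / 2)) (at r)"
      if "(f has_real_derivative f') (at r)" for f f' using that by (auto intro!: derivative_eq_intros)
    then show "((\<lambda>r. u (of_real r * cis t)) has_real_derivative 2 * Re (p (of_real r * cis t) * cis t)) (at r) \<Longrightarrow> ?thesis"
      unfolding rphi_def[abs_def] .
  qed
  moreover have "exp (- u (of_real r * cis t) / 2) * (- (2 * Re (p (of_real r * cis t) * cis t)) / 2) = 2 * Re (rX u p t r)"
    by (simp add: rX_def rphi_def field_simps)
  ultimately show ?thesis by (simp add: has_real_derivative_iff_has_vector_derivative)
qed

text \<open>With \<open>y = cis t * p\<close> and \<open>exp u = 1 / \<phi>\<^sup>2\<close>, the
  nonlinear term of the equation becomes the constant \<open>\<rho> / 8\<close> in the numerator of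
  \<open>rB\<close>. Treating \<open>rB\<close> as an unknown of its own is what makes the system
  linear.\<close>

lemma rX_algebra:
  fixes y :: complex and \<phi> \<rho> :: real
  assumes \<phi>: "\<phi> > 0"
  shows "- ((cis (2*t) * h + of_real (\<rho> / 4 * (1 - 1 / \<phi>\<^sup>2))) / 2) * of_real \<phi> + - (y / 2) * of_real (2 * Re (- (y / 2) * of_real \<phi>))
   = of_real (((norm (- (y / 2) * of_real \<phi>))\<^sup>2 + \<rho> / 8) / \<phi>) + (- of_real (\<rho> / 8) - (cis (2*t) * h - y\<^sup>2 / 2) / 2) * of_real \<phi>"
proof -
  have "of_real ((norm y)\<^sup>2) = y * cnj y" by (rule complex_norm_square)
  moreover have "of_real (2 * Re y) = y + cnj y" by (rule complex_add_cnj[symmetric])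
  ultimately have *: "y * of_real (2 * Re y) = y\<^sup>2 + of_real ((norm y)\<^sup>2)" by (simp add: power2_eq_square algebra_simps)
  have "(norm (- (y / 2) * of_real \<phi>))\<^sup>2 = (norm y)\<^sup>2 * \<phi>\<^sup>2 / 4"
    using \<phi> by (simp add: norm_mult norm_divide power_mult_distrib power_divide)
  then have 1: "((norm (- (y / 2) * of_real \<phi>))\<^sup>2 + \<rho> / 8) / \<phi> = (norm y)\<^sup>2 * \<phi> / 4 + \<rho> / (8 * \<phi>)"
    using \<phi> by (simp add: field_simps power2_eq_square)
  have 2: "- (y / 2) * of_real (2 * Re (- (y / 2) * of_real \<phi>)) = (y * of_real (2 * Re y)) * of_real \<phi> / 4"
    by (simp add: field_simps)
  have "\<rho> / 4 * (1 - 1 / \<phi>\<^sup>2) / 2 * \<phi> = \<rho> / 8 * \<phi> - \<rho> / (8 * \<phi>)" using \<phi> by (simp add: field_simps power2_eq_square)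
  then have "complex_of_real (\<rho> / 4 * (1 - 1 / \<phi>\<^sup>2) / 2 * \<phi>) = of_real (\<rho> / 8 * \<phi> - \<rho> / (8 * \<phi>))" by (simp only:)
  then have 3: "complex_of_real (\<rho> / 4 * (1 - 1 / \<phi>\<^sup>2)) / 2 * of_real \<phi> = of_real (\<rho> / 8) * of_real \<phi> - of_real (\<rho> / (8 * \<phi>))"
    by simp
  have 4: "- ((cis (2*t) * h + of_real (\<rho> / 4 * (1 - 1 / \<phi>\<^sup>2))) / 2) * of_real \<phi> = - (cis (2*t) * h / 2 * of_real \<phi>) - of_real (\<rho> / 4 * (1 - 1 / \<phi>\<^sup>2)) / 2 * of_real \<phi>"
    by (simp add: algebra_simps add_divide_distrib del: of_real_mult of_real_divide of_real_diff)
  show ?thesis unfolding 4 3 1 2 * by (simp add: algebra_simps add_divide_distrib diff_divide_distrib)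
qed

lemma rX_deriv:
  assumes d: "wdata u p h (\<lambda>z. \<rho> * (1 - exp (u z)))"
  shows "(rX u p t has_vector_derivative of_real (rB \<rho> u p t r) + rb \<rho> p h t r * of_real (rphi u t r)) (at r)"
proof -
  let ?z = "of_real r * cis t"
  let ?y = "cis t * p ?z"
  have e: "exp (u ?z) = 1 / (rphi u t r)\<^sup>2"
    by (simp add: rphi_def power2_eq_square flip: exp_add exp_minus) (simp add: exp_minus field_simps)
  have "((\<lambda>r. p (of_real r * cis t)) has_vector_derivative (h ?z * cis t + of_real (\<rho> * (1 - exp (u ?z)) / 4) * cis (- t))) (at r)"
    using wirt_radial[of p "h ?z" "of_real (\<rho> * (1 - exp (u ?z)) / 4)" 0 r t UNIV] wdataD(2)[OF d, of ?z] by simp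
  then have f1: "((\<lambda>r. - (cis t * p (of_real r * cis t) / 2)) has_vector_derivative - (cis t * (h ?z * cis t + of_real (\<rho> * (1 - exp (u ?z)) / 4) * cis (- t)) / 2)) (at r)"
    by (intro has_vector_derivative_minus has_vector_derivative_divide has_vector_derivative_mult_right)
  have eqA: "cis t * (h ?z * cis t + of_real (\<rho> * (1 - exp (u ?z)) / 4) * cis (- t)) = cis (2*t) * h ?z + of_real (\<rho> / 4 * (1 - 1 / (rphi u t r)\<^sup>2))"
  proof -
    have c: "cis t * cis t = cis (2*t)" "cis t * cis (- t) = 1" by (simp_all add: cis_mult)
    have "cis t * (H * cis t + G * cis (- t)) = (cis t * cis t) * H + G * (cis t * cis (- t))" for G H
      by (simp add: algebra_simps)
    from this[of "h ?z" "of_real (\<rho> * (1 - exp (u ?z)) / 4)"] show ?thesis unfolding c unfolding e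
      by (simp only: mult_1_right times_divide_eq_left)
  qed
  have f2: "((\<lambda>r. complex_of_real (rphi u t r)) has_vector_derivative of_real (2 * Re (rX u p t r))) (at r)"
    using rphi_deriv[OF d, of t r] by (intro has_vector_derivative_of_real) (simp add: has_real_derivative_iff_has_vector_derivative)
  have "((\<lambda>r. - (cis t * p (of_real r * cis t) / 2) * of_real (rphi u t r)) has_vector_derivative 
     - (?y / 2) * of_real (2 * Re (rX u p t r)) + - ((cis (2*t) * h ?z + of_real (\<rho> / 4 * (1 - 1 / (rphi u t r)\<^sup>2))) / 2) * of_real (rphi u t r)) (at r)"
    using has_vector_derivative_mult[OF f1 f2] unfolding eqA by (simp only: minus_divide_left[symmetric])
  moreover have "- (?y / 2) * of_real (2 * Re (rX u p t r)) + - ((cis (2*t) * h ?z + of_real (\<rho> / 4 * (1 - 1 / (rphi u t r)\<^sup>2))) / 2) * of_real (rphi u t r)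
     = of_real (rB \<rho> u p t r) + rb \<rho> p h t r * of_real (rphi u t r)"
  proof -
    have "cis (2*t) * (h ?z - (p ?z)\<^sup>2 / 2) = cis (2*t) * h ?z - ?y\<^sup>2 / 2"
      by (simp add: power_mult_distrib power2_eq_square[of "cis t"] cis_mult algebra_simps)
    then show ?thesis
      using rX_algebra[OF rphi_pos[of u t r], of t "h ?z" \<rho> ?y] unfolding rB_def rb_def rX_def by (simp only: add.commute)
  qed
  ultimately show ?thesis unfolding rX_def[abs_def] by simp
qed

text \<open>The system closes here: the part of the derivative of \<open>rX\<close> coming from
  \<open>rB\<close> cancels against the derivative of the denominator, and what remains is linear in
  \<open>rX\<close>.\<close>

lemma rB_deriv:
  assumes d: "wdata u p h (\<lambda>z. \<rho> * (1 - exp (u z)))"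
  shows "(rB \<rho> u p t has_vector_derivative 2 * Re (cnj (rX u p t r) * rb \<rho> p h t r)) (at r)"
proof -
  let ?X = "rX u p t r" and ?\<phi> = "rphi u t r" and ?b = "rb \<rho> p h t r" and ?B = "rB \<rho> u p t r"
  let ?X' = "of_real ?B + ?b * of_real ?\<phi>"
  have p0: "?\<phi> \<noteq> 0" using rphi_pos[of u t r] by linarith
  have dX: "(rX u p t has_derivative (\<lambda>s. s *\<^sub>R ?X')) (at r)" using rX_deriv[OF d, of t r] by (simp add: has_vector_derivative_def)
  have "((\<lambda>r. rX u p t r \<bullet> rX u p t r) has_derivative (\<lambda>s. ?X \<bullet> (s *\<^sub>R ?X') + (s *\<^sub>R ?X') \<bullet> ?X)) (at r)"
    by (rule has_derivative_inner[OF dX dX])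
  then have n: "((\<lambda>r. (norm (rX u p t r))\<^sup>2) has_real_derivative 2 * (?X \<bullet> ?X')) (at r)"
    unfolding power2_norm_eq_inner has_field_derivative_def by (rule has_derivative_eq_rhs) (auto simp: inner_commute)
  have p: "(rphi u t has_real_derivative 2 * Re ?X) (at r)"
    using rphi_deriv[OF d, of t r] by (simp add: has_real_derivative_iff_has_vector_derivative)
  have rB_eq: "rB \<rho> u p t = (\<lambda>r. ((norm (rX u p t r))\<^sup>2 + \<rho> / 8) / rphi u t r)" by (simp add: rB_def fun_eq_iff)
  have "(rB \<rho> u p t has_real_derivative ((2 * (?X \<bullet> ?X')) * ?\<phi> - ((norm ?X)\<^sup>2 + \<rho> / 8) * (2 * Re ?X)) / (?\<phi> * ?\<phi>)) (at r)"
    using DERIV_divide[OF DERIV_add[OF n DERIV_const[of "\<rho> / 8"]] p p0] by (subst rB_eq) (simp only: add_0_right)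
  moreover have "((2 * (?X \<bullet> ?X')) * ?\<phi> - ((norm ?X)\<^sup>2 + \<rho> / 8) * (2 * Re ?X)) / (?\<phi> * ?\<phi>) = 2 * Re (cnj ?X * ?b)"
  proof -
    have "?X \<bullet> ?X' = ?B * Re ?X + ?\<phi> * Re (cnj ?X * ?b)"
      by (simp add: inner_complex_def algebra_simps)
    moreover have "(norm ?X)\<^sup>2 + \<rho> / 8 = ?B * ?\<phi>" using p0 by (simp add: rB_def)
    ultimately show ?thesis using p0 by (simp add: field_simps)
  qed
  ultimately show ?thesis by (simp add: has_real_derivative_iff_has_vector_derivative)
qed

lemma norm_rX_diff_source:
  "\<bar>2 * Re (cnj (x::complex) * b)\<bar> \<le> 2 * (norm x * norm b)"
  using abs_Re_le_cmod[of "cnj x * b"] by (simp add: norm_mult)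

context blow
begin

text \<open>An even function has an odd derivative. This removes the translation modes: the initial
  value of \<open>rX\<close> is 0 for \<open>u\<close> and for its translate.\<close>

lemma p_zero:
  assumes "concentrated \<eta> \<rho> u p h"
  shows "p 0 = 0"
proof -
  note A = concentratedD[OF assms]
  have d: "(u has_derivative (\<lambda>v. 2 * Re (p 0 * v))) (at 0)" by (rule wdataD(1)[OF A(1)])
  have m: "((\<lambda>z::complex. - z) has_derivative (\<lambda>v. - v)) (at 0)" by (auto intro!: derivative_eq_intros)
  have "((\<lambda>z. u (- z)) has_derivative (\<lambda>v. 2 * Re (p 0 * (- v)))) (at 0)"
    using has_derivative_compose[OF m, of u "\<lambda>v. 2 * Re (p 0 * v)"] d by simp
  then have "(u has_derivative (\<lambda>v. 2 * Re (p 0 * (- v)))) (at 0)" by (simp add: A(3))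
  then have "(\<lambda>v. 2 * Re (p 0 * v)) = (\<lambda>v. 2 * Re (p 0 * (- v)))" by (rule has_derivative_unique[OF d])
  then have "Re (p 0 * v) = 0" for v using fun_cong[of _ _ v, OF \<open>(\<lambda>v. 2 * Re (p 0 * v)) = (\<lambda>v. 2 * Re (p 0 * (- v)))\<close>] by (simp add: algebra_simps)
  from this[of 1] this[of \<i>] show ?thesis by (simp add: complex_eq_iff)
qed

text \<open>\<open>Cb\<close>, \<open>d1\<close> and \<open>etaQ\<close> are fixed by choice before
  any solution or radius \<delta> is considered, so that the constant of the inner estimate depends
  on neither.\<close>

definition Cb :: real where
  "Cb = (SOME C. C \<ge> 0 \<and> (\<exists>\<eta>>0. \<forall>\<rho> u p h t r. concentrated \<eta> \<rho> u p h \<longrightarrow> \<bar>r\<bar> \<le> d0 \<longrightarrow> norm (rb \<rho> p h t r) \<le> C))"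

lemma Cb: "Cb \<ge> 0" "\<exists>\<eta>>0. \<forall>\<rho> u p h t r. concentrated \<eta> \<rho> u p h \<longrightarrow> \<bar>r\<bar> \<le> d0 \<longrightarrow> norm (rb \<rho> p h t r) \<le> Cb"
proof -
  obtain \<eta> C where \<eta>: "\<eta> > 0" "C \<ge> 0" "\<And>\<rho> u p h a. concentrated \<eta> \<rho> u p h \<Longrightarrow> norm a \<le> d0 \<Longrightarrow> norm (h a - (p a)\<^sup>2 / 2) \<le> C"
    using Q_bound by blast
  have "norm (rb \<rho> p h t r) \<le> 16 + C / 2" if a: "concentrated \<eta> \<rho> u p h" and r: "\<bar>r\<bar> \<le> d0" for \<rho> u p h t r
  proof -
    let ?z = "of_real r * cis t"
    have "norm (rb \<rho> p h t r) \<le> norm (- of_real (\<rho> / 8) :: complex) + norm (cis (2 * t) * (h ?z - (p ?z)\<^sup>2 / 2) / 2)"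
      unfolding rb_def by (rule norm_triangle_ineq4)
    also have "norm (- of_real (\<rho> / 8) :: complex) = \<rho> / 8" using concentratedD(7)[OF a] by (simp add: norm_divide)
    also have "norm (cis (2 * t) * (h ?z - (p ?z)\<^sup>2 / 2) / 2) = norm (h ?z - (p ?z)\<^sup>2 / 2) / 2" by (simp add: norm_mult norm_divide)
    also have "norm (h ?z - (p ?z)\<^sup>2 / 2) \<le> C" by (rule \<eta>(3)[OF a]) (use r in \<open>simp add: norm_mult\<close>)
    finally show ?thesis using concentratedD(8)[OF a] by simp
  qed
  then have "16 + C / 2 \<ge> 0 \<and> (\<exists>\<eta>>0. \<forall>\<rho> u p h t r. concentrated \<eta> \<rho> u p h \<longrightarrow> \<bar>r\<bar> \<le> d0 \<longrightarrow> norm (rb \<rho> p h t r) \<le> 16 + C / 2)"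
    using \<eta>(1,2) by auto
  then have "Cb \<ge> 0 \<and> (\<exists>\<eta>>0. \<forall>\<rho> u p h t r. concentrated \<eta> \<rho> u p h \<longrightarrow> \<bar>r\<bar> \<le> d0 \<longrightarrow> norm (rb \<rho> p h t r) \<le> Cb)"
    unfolding Cb_def by (rule someI)
  then show "Cb \<ge> 0" "\<exists>\<eta>>0. \<forall>\<rho> u p h t r. concentrated \<eta> \<rho> u p h \<longrightarrow> \<bar>r\<bar> \<le> d0 \<longrightarrow> norm (rb \<rho> p h t r) \<le> Cb" by auto
qed

definition d1 :: real where "d1 = min d0 (1 / sqrt (32 * (Cb + 1)))"

lemma d1: "d1 > 0" "d1 \<le> d0" "0 \<le> r \<Longrightarrow> r \<le> d1 \<Longrightarrow> 32 * Cb * r\<^sup>2 \<le> 1"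
proof -
  show "d1 > 0" using d0 Cb(1) by (simp add: d1_def)
  show "d1 \<le> d0" by (simp add: d1_def)
  assume r: "0 \<le> r" "r \<le> d1"
  have "r \<le> 1 / sqrt (32 * (Cb + 1))" using r by (simp add: d1_def)
  then have "r\<^sup>2 \<le> (1 / sqrt (32 * (Cb + 1)))\<^sup>2" using r by (intro power_mono)
  also have "\<dots> = 1 / (32 * (Cb + 1))" using Cb(1) by (simp add: power_divide)
  finally have "32 * (Cb + 1) * r\<^sup>2 \<le> 1" using Cb(1) by (simp add: field_simps)
  moreover have "32 * Cb * r\<^sup>2 \<le> 32 * (Cb + 1) * r\<^sup>2" by (intro mult_right_mono) auto
  ultimately show "32 * Cb * r\<^sup>2 \<le> 1" by linarith
qed

definition etaQ :: real where
  "etaQ = (SOME \<eta>. \<eta> > 0 \<and> (\<forall>\<rho> u p h t r. concentrated \<eta> \<rho> u p h \<longrightarrow> \<bar>r\<bar> \<le> d0 \<longrightarrow> norm (rb \<rho> p h t r) \<le> Cb))"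

lemma etaQ: "etaQ > 0" "concentrated etaQ \<rho> u p h \<Longrightarrow> \<bar>r\<bar> \<le> d0 \<Longrightarrow> norm (rb \<rho> p h t r) \<le> Cb"
proof -
  have "etaQ > 0 \<and> (\<forall>\<rho> u p h t r. concentrated etaQ \<rho> u p h \<longrightarrow> \<bar>r\<bar> \<le> d0 \<longrightarrow> norm (rb \<rho> p h t r) \<le> Cb)"
    unfolding etaQ_def by (rule someI_ex) (use Cb(2) in blast)
  then show "etaQ > 0" "concentrated etaQ \<rho> u p h \<Longrightarrow> \<bar>r\<bar> \<le> d0 \<Longrightarrow> norm (rb \<rho> p h t r) \<le> Cb" by blast+
qed

lemma ray_initial:
  assumes "concentrated \<eta> \<rho> u p h"
  shows "rphi u t 0 = exp (- u 0 / 2)" "rX u p t 0 = 0" "rB \<rho> u p t 0 = \<rho> / (8 * exp (- u 0 / 2))"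
  by (simp_all add: rphi_def rX_def rB_def p_zero[OF assms])

text \<open>With coefficient 0 the system integrates to \<open>A + \<kappa> * r\<^sup>2\<close>, the
  profile of a Liouville bubble. Up to radius \<open>d1\<close> the bounded coefficient perturbs
  this profile by at most one half of its size.\<close>

lemma ray_phi:
  assumes a: "concentrated etaQ \<rho> u p h" and r: "0 \<le> r" "r \<le> d1"
  defines "A \<equiv> exp (- u 0 / 2)"
  defines "\<kappa> \<equiv> \<rho> / (8 * A)"
  shows "(A + \<kappa> * r\<^sup>2) / 2 \<le> rphi u t r" "rphi u t r \<le> 3 / 2 * (A + \<kappa> * r\<^sup>2)" "norm (rX u p t r) \<le> 2 * r * (\<kappa> + Cb * A)"
proof -
  note W = concentratedD(1)[OF a]
  have A: "A > 0" by (simp add: A_def)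
  have \<kappa>: "\<kappa> > 0" using A concentratedD(7)[OF a] by (simp add: \<kappa>_def)
  have C: "32 * Cb * r\<^sup>2 \<le> 1" by (rule d1(3)[OF r])
  note ini = ray_initial[OF a, of t, folded A_def, folded \<kappa>_def]
  have est: "\<bar>rphi u t r - rphi u t 0 - r\<^sup>2 * rB \<rho> u p t 0\<bar> \<le> r\<^sup>2 * (16 * Cb * r\<^sup>2 * \<bar>rB \<rho> u p t 0\<bar> + 3 * (Cb * \<bar>rphi u t 0\<bar> + 0 + r * 0))"
    "norm (rX u p t r) \<le> 2 * r * (\<bar>rB \<rho> u p t 0\<bar> + Cb * \<bar>rphi u t 0\<bar> + 0 + r * 0)"
  proof -
    have X: "(rX u p t has_vector_derivative of_real (rB \<rho> u p t s) + rb \<rho> p h t s * of_real (rphi u t s) + 0) (at s)" for s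
      using rX_deriv[OF W] by simp
    have B: "(rB \<rho> u p t has_vector_derivative 2 * Re (cnj (rX u p t s) * rb \<rho> p h t s) + 0) (at s)" for s
      using rB_deriv[OF W] by simp
    have b: "norm (rb \<rho> p h t s) \<le> Cb" if "0 \<le> s" "s \<le> r" for s
      using that r d1(2) by (intro etaQ(2)[OF a]) auto
    have C': "16 * Cb * r\<^sup>2 \<le> 1" using C Cb(1) mult_nonneg_nonneg[OF Cb(1) zero_le_power2[of r]] by linarith
    show "\<bar>rphi u t r - rphi u t 0 - r\<^sup>2 * rB \<rho> u p t 0\<bar> \<le> r\<^sup>2 * (16 * Cb * r\<^sup>2 * \<bar>rB \<rho> u p t 0\<bar> + 3 * (Cb * \<bar>rphi u t 0\<bar> + 0 + r * 0))"
      by (rule ray_system_estimate(1)[OF rphi_deriv[OF W] X B ini(2) b _ _ r(1) C']) auto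
    show "norm (rX u p t r) \<le> 2 * r * (\<bar>rB \<rho> u p t 0\<bar> + Cb * \<bar>rphi u t 0\<bar> + 0 + r * 0)"
      by (rule ray_system_estimate(2)[OF rphi_deriv[OF W] X B ini(2) b _ _ r(1) C']) auto
  qed
  show "norm (rX u p t r) \<le> 2 * r * (\<kappa> + Cb * A)" using est(2) A \<kappa> unfolding ini by simp
  have "\<bar>rphi u t r - A - r\<^sup>2 * \<kappa>\<bar> \<le> r\<^sup>2 * (16 * Cb * r\<^sup>2 * \<kappa> + 3 * (Cb * A))" using est(1) A \<kappa> unfolding ini by simp
  also have "\<dots> = 16 * Cb * r\<^sup>2 * (r\<^sup>2 * \<kappa>) + 3 * Cb * r\<^sup>2 * A" by (simp add: algebra_simps)
  also have "\<dots> \<le> 1 / 2 * (r\<^sup>2 * \<kappa>) + 1 / 2 * A"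
  proof -
    have "16 * Cb * r\<^sup>2 \<le> 1 / 2" using C by simp
    moreover have "3 * Cb * r\<^sup>2 \<le> 1 / 2" using C mult_nonneg_nonneg[OF Cb(1) zero_le_power2[of r]] by linarith
    ultimately show ?thesis using A \<kappa> by (intro add_mono mult_right_mono) auto
  qed
  finally have "\<bar>rphi u t r - A - \<kappa> * r\<^sup>2\<bar> \<le> 1 / 2 * (\<kappa> * r\<^sup>2) + 1 / 2 * A"
    unfolding mult.commute[of "r\<^sup>2" \<kappa>] .
  moreover have "(A + q) / 2 \<le> x \<and> x \<le> 3 / 2 * (A + q)" if "\<bar>x - A - q\<bar> \<le> 1 / 2 * q + 1 / 2 * A" for x q
    using that by (auto simp: abs_le_iff)
  ultimately show "(A + \<kappa> * r\<^sup>2) / 2 \<le> rphi u t r" "rphi u t r \<le> 3 / 2 * (A + \<kappa> * r\<^sup>2)"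
    by blast+
qed

text \<open>Small values of \<open>exp u\<close> on the circle of radius \<open>d1\<close> make
  \<open>rphi\<close> large there, which forces \<kappa> to be large because \<open>A < 1\<close>.
  As \<open>\<kappa> * A = \<rho> / 8\<close> is bounded, \<open>A\<close> must be small.\<close>

lemma A_small:
  assumes e: "\<epsilon> > 0"
  shows "\<exists>\<eta>>0. \<forall>\<rho> u p h. concentrated \<eta> \<rho> u p h \<longrightarrow> exp (- u 0 / 2) \<le> \<epsilon>"
proof -
  \<comment> \<open>The profile bound at radius \<open>d1\<close> for \<open>A = 1\<close> and
    \<open>\<kappa> = 16 / \<epsilon>\<close>: if \<open>rphi\<close> reaches this size, \<kappa> is
    at least \<open>16 / \<epsilon>\<close>.\<close>
  define M where "M = 3 / 2 * (1 + 16 * d1\<^sup>2 / \<epsilon>)"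
  have M: "M > 0" using e by (simp add: M_def add_pos_nonneg)
  obtain \<eta>1 where \<eta>1: "\<eta>1 > 0" "\<And>\<rho> u p h x. concentrated \<eta>1 \<rho> u p h \<Longrightarrow> x \<in> far d1 \<Longrightarrow> exp (u x) \<le> 1 / M\<^sup>2"
  proof -
    have "0 < 1 / M\<^sup>2" using M by simp
    from exp_small_far[OF d1(1) this] show ?thesis using that by blast
  qed
  define \<eta> where "\<eta> = min \<eta>1 (min etaQ (min d1 (1 / 10)))"
  have \<eta>: "\<eta> > 0" "\<eta> \<le> \<eta>1" "\<eta> \<le> etaQ" "\<eta> \<le> d1" "\<eta> \<le> 1 / 10" using \<eta>1 etaQ d1 by (auto simp: \<eta>_def)
  have "exp (- u 0 / 2) \<le> \<epsilon>" if a: "concentrated \<eta> \<rho> u p h" for \<rho> u p h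
  proof -
    note aQ = concentrated_mono[OF a \<eta>(3)] and D = concentratedD[OF a]
    define A where "A = exp (- u 0 / 2)"
    define \<kappa> where "\<kappa> = \<rho> / (8 * A)"
    have A0: "A > 0" by (simp add: A_def)
    have \<kappa>: "\<kappa> > 0" "\<kappa> * A \<le> 16" using A0 D(7,8) by (simp_all add: \<kappa>_def)
    note ray = ray_phi[OF aQ, folded A_def, folded \<kappa>_def]
    have A1: "A < 1"
    proof (rule ccontr)
      \<comment> \<open>Without a peak at 0, \<open>exp u\<close> would be at most 4 on the disc of
        radius \<open>\<eta> \<le> 1 / 10\<close>, whose area is too small to hold a quarter of the
        mass.\<close>
      assume "\<not> A < 1"
      then have A1: "A \<ge> 1" by simp
      have ce: "continuous_on UNIV (\<lambda>z. exp (u z))" by (intro continuous_intros D)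
      have "(LINT z:cball 0 \<eta>|lborel. exp (u z)) \<le> pi * \<eta>\<^sup>2 * 4"
      proof (rule set_integral_cball_le[OF ce])
        fix s assume s: "0 \<le> s" "s \<le> \<eta>"
        show "rmean 0 (\<lambda>z. exp (u z)) s \<le> 4"
        proof (rule rmean_le[OF ce])
          fix z :: complex assume z: "dist 0 z = \<bar>s\<bar>"
          have zc: "z = of_real s * cis (Arg z)" using rcis_cmod_Arg[of z] z s by (simp add: rcis_def)
          have "0 \<le> \<kappa> * s\<^sup>2" using \<kappa>(1) by simp
          then have "1 / 2 \<le> rphi u (Arg z) s" using ray(1)[of s "Arg z"] s \<eta>(4) A1 by simp
          then have "1 / 2 \<le> exp (- u z / 2)" using zc by (simp add: rphi_def)
          then have "(1 / 2) * (1 / 2) \<le> exp (- u z / 2) * exp (- u z / 2)" by (intro mult_mono) auto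
          also have "\<dots> = 1 / exp (u z)" by (simp add: exp_minus field_simps flip: exp_add)
          finally show "exp (u z) \<le> 4" by (simp add: field_simps)
        qed
      qed (use \<eta> in auto)
      also have "\<dots> \<le> 4 * (1 / 10)\<^sup>2 * 4" using \<eta> pi_less_4 by (intro mult_mono power_mono) auto
      also have "\<dots> < 1 / 4" by (simp add: power2_eq_square)
      finally show False using a by (simp add: concentrated_def)
    qed
    have "of_real d1 \<in> far d1" by (rule far_annulus) (use d0(1) d1 in auto)
    from \<eta>1(2)[OF concentrated_mono[OF a \<eta>(2)] this] have "exp (u (of_real d1)) \<le> 1 / M\<^sup>2" .
    moreover have "exp (u (of_real d1)) = 1 / (rphi u 0 d1)\<^sup>2"
      by (simp add: rphi_def power2_eq_square exp_minus field_simps flip: exp_add)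
    ultimately have "1 / (rphi u 0 d1)\<^sup>2 \<le> 1 / M\<^sup>2" by simp
    then have "M\<^sup>2 \<le> (rphi u 0 d1)\<^sup>2" using M rphi_pos[of u 0 d1] by (simp add: field_simps)
    then have "M \<le> rphi u 0 d1" using rphi_pos[of u 0 d1] by (meson less_imp_le power2_le_imp_le)
    also have "\<dots> \<le> 3 / 2 * (A + \<kappa> * d1\<^sup>2)" using d1(1) by (intro ray(2)) auto
    also have "\<dots> \<le> 3 / 2 * (1 + \<kappa> * d1\<^sup>2)" using A1 by simp
    finally have "16 * d1\<^sup>2 / \<epsilon> \<le> \<kappa> * d1\<^sup>2" by (simp add: M_def)
    then have "(16 / \<epsilon>) * d1\<^sup>2 \<le> \<kappa> * d1\<^sup>2" by simp
    then have "16 / \<epsilon> \<le> \<kappa>" using d1(1) by (meson mult_le_cancel_right_pos zero_less_power)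
    then have "16 / \<epsilon> * A \<le> \<kappa> * A" using A0 by (intro mult_right_mono) auto
    then have "16 / \<epsilon> * A \<le> 16" using \<kappa>(2) by linarith
    then have "A \<le> \<epsilon>" using e by (simp add: field_simps)
    then show ?thesis unfolding A_def .
  qed
  then show ?thesis using \<eta>(1) by blast
qed

end

lemma ln_le_diff:
  fixes y K :: real
  assumes "y > 0" "1 \<le> K" "1 / K \<le> y"
  shows "\<bar>ln y\<bar> \<le> K * \<bar>y - 1\<bar>"
proof (cases "y \<ge> 1")
  case True
  then have "ln y \<le> 1 * \<bar>y - 1\<bar>" using ln_le_minus_one[OF assms(1)] by simp
  also have "\<dots> \<le> K * \<bar>y - 1\<bar>" using assms by (intro mult_right_mono) auto
  finally show ?thesis using True by simp
next
  case False
  have iy: "1 / y \<le> K" using assms by (simp add: field_simps)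
  have "- ln y = ln (1 / y)" using assms by (simp add: ln_div)
  also have "\<dots> \<le> 1 / y - 1" using assms by (intro ln_le_minus_one) auto
  also have "\<dots> = (1 / y) * (1 - y)" using assms by (simp add: field_simps)
  also have "\<dots> \<le> K * (1 - y)" using iy False by (intro mult_right_mono) auto
  finally show ?thesis using False assms by simp
qed

subsection \<open>The estimate near a blow-up point\<close>

context blow
begin

text \<open>By linearity the difference of the two solutions satisfies the system of
  \<open>u\<close> with sources, each a difference of coefficients times a quantity of
  \<open>u'\<close>. The latter is bounded by \<open>ray_phi\<close>, so the error is measured
  relative to the profile \<open>A' + \<kappa>' * r\<^sup>2\<close>, as needed for taking logarithms
  afterwards.\<close>

lemma inner_ray:
  assumes a: "concentrated etaQ \<rho> u p h" and a': "concentrated etaQ \<rho> u' p' h'" and \<delta>: "0 < \<delta>" "\<delta> \<le> d1"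
    and \<sigma>: "\<And>r. 0 \<le> r \<Longrightarrow> r \<le> \<delta> \<Longrightarrow> norm (rb \<rho> p h t r - rb \<rho> p' h' t r) \<le> \<sigma>"
  defines "A \<equiv> exp (- u 0 / 2)" and "A' \<equiv> exp (- u' 0 / 2)"
  defines "\<kappa> \<equiv> \<rho> / (8 * A)" and "\<kappa>' \<equiv> \<rho> / (8 * A')"
  assumes r: "0 \<le> r" "r \<le> \<delta>"
  shows "\<bar>(rphi u t r - rphi u' t r) - (A - A') - r\<^sup>2 * (\<kappa> - \<kappa>')\<bar> \<le> (\<bar>A - A'\<bar> + r\<^sup>2 * \<bar>\<kappa> - \<kappa>'\<bar>) / 2 + 18 * \<sigma> * \<delta>\<^sup>2 * (A' + \<kappa>' * r\<^sup>2)"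
proof -
  note W = concentratedD(1)[OF a] and W' = concentratedD(1)[OF a']
  have A0: "A' > 0" by (simp add: A'_def)
  have \<kappa>0: "\<kappa>' > 0" using A0 concentratedD(7)[OF a'] by (simp add: \<kappa>'_def)
  have \<sigma>0: "\<sigma> \<ge> 0" using \<sigma>[of 0] \<delta> norm_ge_zero order_trans by (metis less_imp_le order_refl)
  have rd: "r \<le> d1" using r \<delta> by linarith
  have C: "32 * Cb * r\<^sup>2 \<le> 1" by (rule d1(3)[OF r(1) rd])
  note ini = ray_initial[OF a, of t, folded A_def, folded \<kappa>_def] and ini' = ray_initial[OF a', of t, folded A'_def, folded \<kappa>'_def]
  note ray = ray_phi[OF a', folded A'_def, folded \<kappa>'_def]
  let ?D = "\<lambda>r. rphi u t r - rphi u' t r" and ?X = "\<lambda>r. rX u p t r - rX u' p' t r" and ?B = "\<lambda>r. rB \<rho> u p t r - rB \<rho> u' p' t r"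
  let ?s1 = "\<lambda>r. (rb \<rho> p h t r - rb \<rho> p' h' t r) * of_real (rphi u' t r)"
  let ?s2 = "\<lambda>r. 2 * Re (cnj (rX u' p' t r) * (rb \<rho> p h t r - rb \<rho> p' h' t r))"
  define S1 where "S1 = \<sigma> * (3 / 2 * (A' + \<kappa>' * r\<^sup>2))"
  define S2 where "S2 = 2 * ((2 * r * (\<kappa>' + Cb * A')) * \<sigma>)"
  have "\<bar>?D r - ?D 0 - r\<^sup>2 * ?B 0\<bar> \<le> r\<^sup>2 * (16 * Cb * r\<^sup>2 * \<bar>?B 0\<bar> + 3 * (Cb * \<bar>?D 0\<bar> + S1 + r * S2))"
  proof (rule ray_system_estimate(1)[where X = ?X and ?s1.0 = ?s1 and ?s2.0 = ?s2 and b = "rb \<rho> p h t"])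
    fix s assume s: "0 \<le> s" "s \<le> r"
    then have sd: "s \<le> d1" "s \<le> \<delta>" using rd r by linarith+
    show "(?D has_vector_derivative 2 * Re (?X s)) (at s)"
      by (rule has_vector_derivative_eq_rhs[OF has_vector_derivative_diff[OF rphi_deriv[OF W] rphi_deriv[OF W']]]) (simp add: algebra_simps)
    show "(?X has_vector_derivative of_real (?B s) + rb \<rho> p h t s * of_real (?D s) + ?s1 s) (at s)"
      by (rule has_vector_derivative_eq_rhs[OF has_vector_derivative_diff[OF rX_deriv[OF W] rX_deriv[OF W']]]) (simp add: algebra_simps)
    show "(?B has_vector_derivative 2 * Re (cnj (?X s) * rb \<rho> p h t s) + ?s2 s) (at s)"
      by (rule has_vector_derivative_eq_rhs[OF has_vector_derivative_diff[OF rB_deriv[OF W] rB_deriv[OF W']]]) (simp add: algebra_simps)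
    show "norm (rb \<rho> p h t s) \<le> Cb" using s sd d1(2) by (intro etaQ(2)[OF a]) auto
    have mono: "\<kappa>' * s\<^sup>2 \<le> \<kappa>' * r\<^sup>2" using s \<kappa>0 by (intro mult_left_mono power_mono) auto
    have "rphi u' t s \<le> 3 / 2 * (A' + \<kappa>' * r\<^sup>2)"
      by (rule order_trans[OF ray(2)[OF s(1) sd(1), of t]]) (use mono in simp)
    then show "norm (?s1 s) \<le> S1"
      unfolding norm_mult S1_def using \<sigma>[OF s(1) sd(2)] \<sigma>0 less_imp_le[OF rphi_pos[of u' t s]] by (intro mult_mono) auto
    have "norm (rX u' p' t s) \<le> 2 * s * (\<kappa>' + Cb * A')" by (rule ray(3)[OF s(1) sd(1)])
    also have "\<dots> \<le> 2 * r * (\<kappa>' + Cb * A')" using s \<kappa>0 A0 Cb(1) by (intro mult_right_mono) auto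
    finally have "norm (rX u' p' t s) * norm (rb \<rho> p h t s - rb \<rho> p' h' t s) \<le> (2 * r * (\<kappa>' + Cb * A')) * \<sigma>"
      using \<sigma>[OF s(1) sd(2)] r(1) \<kappa>0 A0 Cb(1) by (intro mult_mono) auto
    then show "\<bar>?s2 s\<bar> \<le> S2" unfolding S2_def by (intro order_trans[OF norm_rX_diff_source] mult_left_mono) auto
  qed (use r C Cb(1) ini ini' in auto)
  then have 1: "\<bar>?D r - (A - A') - r\<^sup>2 * (\<kappa> - \<kappa>')\<bar> \<le> r\<^sup>2 * (16 * Cb * r\<^sup>2 * \<bar>\<kappa> - \<kappa>'\<bar> + 3 * (Cb * \<bar>A - A'\<bar> + S1 + r * S2))"
    unfolding ini ini' .
  have "4 * (Cb * r\<^sup>2) * A' \<le> 1 / 8 * A'" using C A0 by (intro mult_right_mono) auto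
  moreover have "r * S2 = \<sigma> * (4 * (\<kappa>' * r\<^sup>2) + 4 * (Cb * r\<^sup>2) * A')" by (simp add: S2_def power2_eq_square algebra_simps)
  ultimately have "r * S2 \<le> \<sigma> * (4 * (\<kappa>' * r\<^sup>2) + 1 / 8 * A')" using \<sigma>0 by (simp add: mult_left_mono)
  then have "S1 + r * S2 \<le> \<sigma> * (3 / 2 * (A' + \<kappa>' * r\<^sup>2)) + \<sigma> * (4 * (\<kappa>' * r\<^sup>2) + 1 / 8 * A')" by (simp add: S1_def)
  also have "\<dots> = \<sigma> * (13 / 8 * A' + 11 / 2 * (\<kappa>' * r\<^sup>2))" by (simp add: algebra_simps)
  also have "\<dots> \<le> \<sigma> * (6 * (A' + \<kappa>' * r\<^sup>2))" 
  proof (rule mult_left_mono[OF _ \<sigma>0])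
    have "13 / 8 * A' + 11 / 2 * q \<le> 6 * (A' + q)" if "0 \<le> q" for q
    proof -
      have "13 / 8 * A' \<le> 6 * A'" "11 / 2 * q \<le> 6 * q" using A0 that by simp_all
      then show ?thesis unfolding distrib_left by (rule add_mono)
    qed
    then show "13 / 8 * A' + 11 / 2 * (\<kappa>' * r\<^sup>2) \<le> 6 * (A' + \<kappa>' * r\<^sup>2)" using \<kappa>0 by simp
  qed
  \<comment> \<open>Together with the factor 3 of the system estimate this 6 gives the 18 of the
    conclusion.\<close>
  finally have S: "S1 + r * S2 \<le> 6 * \<sigma> * (A' + \<kappa>' * r\<^sup>2)" by (simp add: algebra_simps)
  have "r\<^sup>2 * (16 * Cb * r\<^sup>2 * \<bar>\<kappa> - \<kappa>'\<bar> + 3 * (Cb * \<bar>A - A'\<bar> + S1 + r * S2))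
     = (16 * Cb * r\<^sup>2) * (r\<^sup>2 * \<bar>\<kappa> - \<kappa>'\<bar>) + (3 * Cb * r\<^sup>2) * \<bar>A - A'\<bar> + 3 * (r\<^sup>2 * (S1 + r * S2))"
    by (simp add: algebra_simps)
  also have "\<dots> \<le> (1 / 2) * (r\<^sup>2 * \<bar>\<kappa> - \<kappa>'\<bar>) + (1 / 2) * \<bar>A - A'\<bar> + 3 * (\<delta>\<^sup>2 * (6 * \<sigma> * (A' + \<kappa>' * r\<^sup>2)))"
  proof -
    have "16 * Cb * r\<^sup>2 \<le> 1 / 2" using C by simp
    moreover have "3 * Cb * r\<^sup>2 \<le> 1 / 2" using C mult_nonneg_nonneg[OF Cb(1) zero_le_power2[of r]] by linarith
    moreover have "r\<^sup>2 * (S1 + r * S2) \<le> \<delta>\<^sup>2 * (6 * \<sigma> * (A' + \<kappa>' * r\<^sup>2))"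
    proof -
      have "r\<^sup>2 * (S1 + r * S2) \<le> r\<^sup>2 * (6 * \<sigma> * (A' + \<kappa>' * r\<^sup>2))" using S by (intro mult_left_mono) auto
      also have "\<dots> \<le> \<delta>\<^sup>2 * (6 * \<sigma> * (A' + \<kappa>' * r\<^sup>2))" using r \<sigma>0 A0 \<kappa>0 by (intro mult_right_mono power_mono mult_nonneg_nonneg) auto
      finally show ?thesis .
    qed
    ultimately show ?thesis by (intro add_mono mult_right_mono mult_left_mono) auto
  qed
  also have "\<dots> = (\<bar>A - A'\<bar> + r\<^sup>2 * \<bar>\<kappa> - \<kappa>'\<bar>) / 2 + 18 * \<sigma> * \<delta>\<^sup>2 * (A' + \<kappa>' * r\<^sup>2)"
    by (simp add: field_simps)
  finally show ?thesis using 1 by (rule order_trans[rotated])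
qed


text \<open>Since \<open>\<kappa> / \<kappa>'\<close> equals \<open>A' / A\<close>, it suffices to
  compare \<kappa> with \<kappa>'. At radius \<open>d1\<close> the two values of \<open>rphi\<close>
  differ by a factor of at most \<open>exp (C / 2)\<close>, and by the last hypothesis the quadratic
  term dominates the profile of \<open>u'\<close>.\<close>

lemma alpha_bound:
  assumes a: "concentrated etaQ \<rho> u p h" and a': "concentrated etaQ \<rho> u' p' h'"
    and w: "\<bar>u (of_real d1) - u' (of_real d1)\<bar> \<le> C"
    and small: "exp (- u' 0 / 2) \<le> \<rho> / (8 * exp (- u' 0 / 2)) * d1\<^sup>2"
  shows "exp (- u' 0 / 2) / exp (- u 0 / 2) \<le> 6 * exp (C / 2)"
proof -
  define A where "A = exp (- u 0 / 2)"
  define A' where "A' = exp (- u' 0 / 2)"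
  define \<kappa> where "\<kappa> = \<rho> / (8 * A)"
  define \<kappa>' where "\<kappa>' = \<rho> / (8 * A')"
  have A0: "A > 0" "A' > 0" by (simp_all add: A_def A'_def)
  have \<rho>0: "\<rho> > 0" by (rule concentratedD(7)[OF a])
  have \<kappa>0: "\<kappa> > 0" "\<kappa>' > 0" using A0 \<rho>0 by (simp_all add: \<kappa>_def \<kappa>'_def)
  have "(A + \<kappa> * d1\<^sup>2) / 2 \<le> rphi u 0 d1" unfolding A_def \<kappa>_def by (rule ray_phi(1)[OF a]) (use d1(1) in auto)
  also have "rphi u 0 d1 = exp ((u' (of_real d1) - u (of_real d1)) / 2) * rphi u' 0 d1"
    by (simp add: rphi_def field_simps flip: exp_add)
  also have "\<dots> \<le> exp (C / 2) * (3 / 2 * (A' + \<kappa>' * d1\<^sup>2))"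
  proof (rule mult_mono)
    show "rphi u' 0 d1 \<le> 3 / 2 * (A' + \<kappa>' * d1\<^sup>2)" unfolding A'_def \<kappa>'_def by (rule ray_phi(2)[OF a']) (use d1(1) in auto)
  qed (use w less_imp_le[OF rphi_pos[of u' 0 d1]] in auto)
  also have "\<dots> \<le> exp (C / 2) * (3 / 2 * (2 * (\<kappa>' * d1\<^sup>2)))"
    using small unfolding A'_def[symmetric] \<kappa>'_def[symmetric] by (intro mult_left_mono) auto
  finally have "\<kappa> * d1\<^sup>2 \<le> (6 * exp (C / 2) * \<kappa>') * d1\<^sup>2" using A0 by simp
  then have "\<kappa> \<le> 6 * exp (C / 2) * \<kappa>'" using d1(1) by (meson mult_le_cancel_right_pos zero_less_power)
  then have "\<rho> / 8 * (1 / A) \<le> \<rho> / 8 * (6 * exp (C / 2) * (1 / A'))" by (simp add: \<kappa>_def \<kappa>'_def)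
  then have "1 / A \<le> 6 * exp (C / 2) * (1 / A')" using \<rho>0 by (meson mult_le_cancel_left_pos divide_pos_pos zero_less_numeral)
  then have "A' * (1 / A) \<le> A' * (6 * exp (C / 2) * (1 / A'))" using A0 by (intro mult_left_mono) auto
  then have "A' / A \<le> 6 * exp (C / 2)" using A0 by simp
  then show ?thesis unfolding A_def A'_def .
qed


text \<open>The initial data form a one-parameter family, as
  \<open>\<kappa> * A = \<kappa>' * A' = g\<close>. One value of the difference, \<open>Dd\<close>
  at radius \<delta>, therefore determines the discrepancy of the parameters, and this in turn
  bounds the difference \<open>Dr\<close> at every smaller radius.\<close>

lemma inner_algebra:
  fixes A A' \<kappa> \<kappa>' K \<sigma> \<delta> r Dd Dr y\<phi> :: real
  assumes pos: "A > 0" "A' > 0" "g > 0" "\<delta> > 0" "\<sigma> \<ge> 0" "0 \<le> r" "r \<le> \<delta>"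
    and \<kappa>: "\<kappa> = g / A" "\<kappa>' = g / A'"
    and K: "1 \<le> K" "A \<le> K * A'" "A' \<le> K * A"
    and small: "6 * K * A' \<le> \<kappa>' * \<delta>\<^sup>2"
    and Dd: "\<bar>Dd - (A - A') - \<delta>\<^sup>2 * (\<kappa> - \<kappa>')\<bar> \<le> (\<bar>A - A'\<bar> + \<delta>\<^sup>2 * \<bar>\<kappa> - \<kappa>'\<bar>) / 2 + 18 * \<sigma> * \<delta>\<^sup>2 * (A' + \<kappa>' * \<delta>\<^sup>2)"
    and Dr: "\<bar>Dr - (A - A') - r\<^sup>2 * (\<kappa> - \<kappa>')\<bar> \<le> (\<bar>A - A'\<bar> + r\<^sup>2 * \<bar>\<kappa> - \<kappa>'\<bar>) / 2 + 18 * \<sigma> * \<delta>\<^sup>2 * (A' + \<kappa>' * r\<^sup>2)"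
    and y: "\<bar>Dd\<bar> \<le> 3 * (\<kappa>' * \<delta>\<^sup>2) * y"
  shows "\<bar>Dr\<bar> \<le> (A' + \<kappa>' * r\<^sup>2) * (3 / 2 * K * (12 * y + 144 * \<sigma> * \<delta>\<^sup>2) + 18 * \<sigma> * \<delta>\<^sup>2)"
proof -
  \<comment> \<open>The relative discrepancy of the parameter:
    \<open>\<bar>\<kappa> - \<kappa>'\<bar>\<close> equals \<open>\<kappa>' * b\<close>, and
    \<open>\<bar>A - A'\<bar>\<close> equals \<open>A * b\<close>.\<close>
  define b where "b = \<bar>A' / A - 1\<bar>"
  define q where "q = \<kappa>' * \<delta>\<^sup>2"
  define m where "m = \<sigma> * \<delta>\<^sup>2"
  define x where "x = \<kappa>' * r\<^sup>2"
  have \<kappa>0: "\<kappa>' > 0" using pos \<kappa> by simp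
  have b0: "b \<ge> 0" and q0: "q > 0" and m0: "m \<ge> 0" and x0: "x \<ge> 0" using pos \<kappa>0 by (simp_all add: b_def q_def m_def x_def)
  have dk: "\<bar>\<kappa> - \<kappa>'\<bar> = \<kappa>' * b"
  proof -
    have "\<kappa> - \<kappa>' = \<kappa>' * (A' / A - 1)" using pos by (simp add: \<kappa> field_simps)
    then show ?thesis using \<kappa>0 by (simp add: b_def abs_mult)
  qed
  have dA: "\<bar>A - A'\<bar> \<le> K * A' * b"
  proof -
    have "A - A' = - (A * (A' / A - 1))" using pos by (simp add: field_simps)
    then have "\<bar>A - A'\<bar> = A * b" using pos by (simp add: b_def abs_mult)
    also have "\<dots> \<le> K * A' * b" using K b0 by (intro mult_right_mono) auto
    finally show ?thesis .
  qed
  have d\<delta>: "\<delta>\<^sup>2 * \<bar>\<kappa> - \<kappa>'\<bar> = q * b" unfolding dk q_def by simp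
  have dr: "r\<^sup>2 * \<bar>\<kappa> - \<kappa>'\<bar> = x * b" unfolding dk x_def by simp
  have abs\<delta>: "\<bar>\<delta>\<^sup>2 * (\<kappa> - \<kappa>')\<bar> = q * b" using d\<delta> by (simp add: abs_mult)
  have absr: "\<bar>r\<^sup>2 * (\<kappa> - \<kappa>')\<bar> = x * b" using dr by (simp add: abs_mult)
  have A'q: "6 * (K * A') \<le> q" "A' \<le> q"
  proof -
    show 6: "6 * (K * A') \<le> q" using small by (simp add: q_def)
    have "1 * A' \<le> K * A'" using K pos by (intro mult_right_mono) auto
    then show "A' \<le> q" using 6 pos by linarith
  qed
  have T1: "q * b \<le> \<bar>Dd\<bar> + \<bar>A - A'\<bar> + ((\<bar>A - A'\<bar> + q * b) / 2 + 18 * m * (A' + q))"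
  proof -
    have "\<bar>Dd - (A - A') - \<delta>\<^sup>2 * (\<kappa> - \<kappa>')\<bar> \<le> (\<bar>A - A'\<bar> + q * b) / 2 + 18 * m * (A' + q)"
      using Dd unfolding d\<delta> by (simp add: m_def q_def mult.assoc)
    then show ?thesis using abs\<delta> by linarith
  qed
  have T2: "\<bar>A - A'\<bar> \<le> q / 6 * b"
  proof -
    have "K * A' * b \<le> q / 6 * b" using A'q b0 by (intro mult_right_mono) auto
    then show ?thesis using dA by linarith
  qed
  have T3: "18 * m * (A' + q) \<le> 36 * m * q"
  proof -
    have "18 * m * (A' + q) \<le> 18 * m * (q + q)" using A'q m0 by (intro mult_left_mono) auto
    then show ?thesis by simp
  qed
  \<comment> \<open>By T2, the terms with \<open>b\<close> on the right of T1 add up to at most 1/6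
    + 1/12 + 1/2 = 3/4 of \<open>q * b\<close>, so a quarter of it survives.\<close>
  have "q * b \<le> 4 * (\<bar>Dd\<bar> + 36 * m * q)" using T1 T2 T3 by (simp add: field_simps)
  also have "\<dots> \<le> 4 * (3 * q * y + 36 * m * q)" using y by (simp add: q_def mult_ac)
  also have "\<dots> = q * (12 * y + 144 * m)" by (simp add: algebra_simps)
  finally have bb: "b \<le> 12 * y + 144 * m" using q0 by simp
  have "\<bar>Dr - (A - A') - r\<^sup>2 * (\<kappa> - \<kappa>')\<bar> \<le> (\<bar>A - A'\<bar> + x * b) / 2 + 18 * m * (A' + x)"
    using Dr unfolding dr by (simp add: m_def x_def mult.assoc)
  then have "\<bar>Dr\<bar> \<le> \<bar>A - A'\<bar> + x * b + ((\<bar>A - A'\<bar> + x * b) / 2 + 18 * m * (A' + x))"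
    unfolding absr[symmetric] by linarith
  also have "\<dots> = 3 / 2 * (\<bar>A - A'\<bar> + x * b) + 18 * m * (A' + x)" by (simp add: field_simps)
  also have "\<dots> \<le> 3 / 2 * (K * A' * b + K * x * b) + 18 * m * (A' + x)"
  proof -
    have "1 * (x * b) \<le> K * (x * b)" using K x0 b0 by (intro mult_right_mono) auto
    then show ?thesis using dA by (simp add: mult.assoc)
  qed
  also have "\<dots> = (A' + x) * (3 / 2 * K * b + 18 * m)" by (simp add: algebra_simps)
  also have "\<dots> \<le> (A' + x) * (3 / 2 * K * (12 * y + 144 * m) + 18 * m)"
    using bb K x0 pos by (intro mult_left_mono add_mono) auto
  finally show ?thesis by (simp add: x_def m_def mult.assoc)
qed

text \<open>\<open>K\<close> comes before \<delta>, so that \<delta> and \<open>e\<close> can later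
  be taken small against \<open>K\<close>. Only \<eta> depends on \<delta>: the peak must be so
  narrow that the circle of radius \<delta> already lies in the quadratic regime of both
  profiles.\<close>

lemma inner_estimate:
  "\<exists>K\<ge>0. \<forall>\<delta>. 0 < \<delta> \<and> \<delta> \<le> d1 \<longrightarrow> (\<exists>\<eta>>0. \<forall>\<rho> u p h W e. concentrated \<eta> \<rho> u p h \<longrightarrow> (\<forall>z. \<bar>u z - u (z + p2)\<bar> \<le> W) \<longrightarrow>
     (\<forall>z. norm z = \<delta> \<longrightarrow> \<bar>u z - u (z + p2)\<bar> \<le> e * W) \<longrightarrow> (\<forall>z. norm z \<le> \<delta> \<longrightarrow> \<bar>u z - u (z + p2)\<bar> \<le> K * (e + \<delta>\<^sup>2) * W))"
proof -
  obtain \<eta>1 C where \<eta>1: "\<eta>1 > 0" "C \<ge> 0" "\<And>\<rho> u p h x z. concentrated \<eta>1 \<rho> u p h \<Longrightarrow> x \<in> far d1 \<Longrightarrow> u x \<le> u z + C"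
    using osc_bound[OF d1(1)] by blast
  obtain \<eta>2 Cq where \<eta>2: "\<eta>2 > 0" "Cq \<ge> 0" "\<And>\<rho> u p h u' p' h' W a. concentrated \<eta>2 \<rho> u p h \<Longrightarrow> concentrated \<eta>2 \<rho> u' p' h' \<Longrightarrow> (\<forall>z. \<bar>u z - u' z\<bar> \<le> W) \<Longrightarrow>
     norm a \<le> d0 \<Longrightarrow> norm ((h a - (p a)\<^sup>2 / 2) - (h' a - (p' a)\<^sup>2 / 2)) \<le> Cq * W"
    using Q_diff_bound by blast
  define K where "K = 6 * exp (C / 2)"
  have K: "K \<ge> 6" using \<eta>1(2) by (simp add: K_def)
  define K2 where "K2 = 6 * K * (3 * K * (6 * (3 * K + 1)) + (3 * K * 144 + 36) * (Cq / 2))"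
  have K2: "K2 \<ge> 0" using K \<eta>2(2) by (simp add: K2_def)
  have "\<exists>\<eta>>0. \<forall>\<rho> u p h W e. concentrated \<eta> \<rho> u p h \<longrightarrow> (\<forall>z. \<bar>u z - u (z + p2)\<bar> \<le> W) \<longrightarrow>
     (\<forall>z. norm z = \<delta> \<longrightarrow> \<bar>u z - u (z + p2)\<bar> \<le> e * W) \<longrightarrow> (\<forall>z. norm z \<le> \<delta> \<longrightarrow> \<bar>u z - u (z + p2)\<bar> \<le> K2 * (e + \<delta>\<^sup>2) * W)"
    if \<delta>: "0 < \<delta>" "\<delta> \<le> d1" for \<delta>
  proof -
    \<comment> \<open>With \<open>A' \<le> \<epsilon>\<close> one has
      \<open>(6 * K * A')\<^sup>2 \<le> \<delta>\<^sup>2\<close>, and as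
      \<open>\<rho> / 8 \<ge> 1\<close> this implies the hypothesis
      \<open>6 * K * A' \<le> \<kappa>' * \<delta>\<^sup>2\<close> of
      \<open>inner_algebra\<close>.\<close>
    define \<epsilon> where "\<epsilon> = \<delta> / (6 * K)"
    have \<epsilon>: "\<epsilon> > 0" using \<delta> K by (simp add: \<epsilon>_def)
    obtain \<eta>3 where \<eta>3: "\<eta>3 > 0" "\<And>\<rho> u p h. concentrated \<eta>3 \<rho> u p h \<Longrightarrow> exp (- u 0 / 2) \<le> \<epsilon>"
      using A_small[OF \<epsilon>] by blast
    define \<eta> where "\<eta> = min (min \<eta>1 \<eta>2) (min \<eta>3 etaQ)"
    have \<eta>: "\<eta> > 0" "\<eta> \<le> \<eta>1" "\<eta> \<le> \<eta>2" "\<eta> \<le> \<eta>3" "\<eta> \<le> etaQ" using \<eta>1 \<eta>2 \<eta>3 etaQ by (auto simp: \<eta>_def)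
    have "\<bar>u z - u (z + p2)\<bar> \<le> K2 * (e + \<delta>\<^sup>2) * W"
      if ad: "concentrated \<eta> \<rho> u p h" and W: "\<And>z. \<bar>u z - u (z + p2)\<bar> \<le> W"
        and e: "\<And>z. norm z = \<delta> \<Longrightarrow> \<bar>u z - u (z + p2)\<bar> \<le> e * W" and z: "norm z \<le> \<delta>" for \<rho> u p h W e z
    proof -
      define u' where "u' = (\<lambda>z. u (z + p2))"
      define p' where "p' = (\<lambda>z. p (z + p2))"
      define h' where "h' = (\<lambda>z. h (z + p2))"
      have ad': "concentrated \<eta> \<rho> u' p' h'" unfolding u'_def p'_def h'_def by (rule concentrated_shift[OF ad])
      note a = concentrated_mono[OF ad \<eta>(5)] and a' = concentrated_mono[OF ad' \<eta>(5)]
      define A where "A = exp (- u 0 / 2)"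
      define A' where "A' = exp (- u' 0 / 2)"
      define \<kappa> where "\<kappa> = \<rho> / (8 * A)"
      define \<kappa>' where "\<kappa>' = \<rho> / (8 * A')"
      have A0: "A > 0" "A' > 0" by (simp_all add: A_def A'_def)
      have \<rho>0: "\<rho> > 0" "8 * pi \<le> \<rho>" using concentratedD(5,7)[OF a] by auto
      have \<kappa>0: "\<kappa> > 0" "\<kappa>' > 0" using A0 \<rho>0 by (simp_all add: \<kappa>_def \<kappa>'_def)
      have A\<epsilon>: "A \<le> \<epsilon>" "A' \<le> \<epsilon>" using \<eta>3(2)[OF concentrated_mono[OF ad \<eta>(4)]] \<eta>3(2)[OF concentrated_mono[OF ad' \<eta>(4)]] by (simp_all add: A_def A'_def)
      have small: "6 * K * B \<le> \<rho> / (8 * B) * \<delta>\<^sup>2" if "B > 0" "B \<le> \<epsilon>" for B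
      proof -
        have "6 * K * B * B \<le> 6 * K * (6 * K) * (B * B)" using K that by (simp add: mult_left_le)
        also have "\<dots> = (6 * K * B)\<^sup>2" by (simp add: power2_eq_square)
        also have "\<dots> \<le> \<delta>\<^sup>2" using that K by (intro power_mono) (auto simp: \<epsilon>_def field_simps)
        also have "\<dots> \<le> \<rho> / 8 * \<delta>\<^sup>2" using \<rho>0 pi_gt3 by (intro mult_le_cancel_right1[THEN iffD2]) auto
        finally show ?thesis using that by (simp add: field_simps)
      qed
      have small1: "B \<le> \<rho> / (8 * B) * d1\<^sup>2" if "B > 0" "B \<le> \<epsilon>" for B
      proof -
        have "1 * B \<le> 6 * K * B" using K that by (intro mult_right_mono) auto
        also have "\<dots> \<le> \<rho> / (8 * B) * \<delta>\<^sup>2" by (rule small[OF that])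
        also have "\<dots> \<le> \<rho> / (8 * B) * d1\<^sup>2" using \<delta> \<rho>0 that by (intro mult_left_mono power_mono) auto
        finally show ?thesis by simp
      qed
      have fd1: "of_real d1 \<in> far d1" by (rule far_annulus) (use d0(1) d1 in auto)
      have wd1: "\<bar>u (of_real d1) - u' (of_real d1)\<bar> \<le> C"
        using \<eta>1(3)[OF concentrated_mono[OF ad \<eta>(2)] fd1, of "of_real d1 + p2"] 
          \<eta>1(3)[OF concentrated_mono[OF ad \<eta>(2)], of "of_real d1 + p2" "of_real d1"] far_shift[OF p2_Z, of "of_real d1" d1] fd1
        by (auto simp: u'_def abs_le_iff)
      have K1: "A \<le> K * A'" "A' \<le> K * A"
      proof -
        have "A' / A \<le> K" unfolding A_def A'_def K_def
          by (rule alpha_bound[OF a a' wd1]) (use small1[OF A0(2) A\<epsilon>(2)] in \<open>simp add: A'_def\<close>)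
        moreover have "A / A' \<le> K" unfolding A_def A'_def K_def
          by (rule alpha_bound[OF a' a]) (use wd1 small1[OF A0(1) A\<epsilon>(1)] in \<open>simp_all add: A_def abs_minus_commute\<close>)
        ultimately show "A \<le> K * A'" "A' \<le> K * A" using A0 by (simp_all add: field_simps)
      qed
      have kK: "\<kappa> \<le> K * \<kappa>'" "\<kappa>' \<le> K * \<kappa>"
        using K1 A0 \<rho>0 by (simp_all add: \<kappa>_def \<kappa>'_def field_simps)
      define r where "r = norm z"
      define t where "t = Arg z"
      have r: "0 \<le> r" "r \<le> \<delta>" using z by (simp_all add: r_def)
      have zrt: "of_real r * cis t = z" using rcis_cmod_Arg[of z] by (simp add: rcis_def r_def t_def)
      have W0: "W \<ge> 0" using W[of 0] by simp
      define \<sigma> where "\<sigma> = Cq * W / 2"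
      have \<sigma>0: "\<sigma> \<ge> 0" using \<eta>2(2) W0 by (simp add: \<sigma>_def)
      have \<sigma>: "norm (rb \<rho> p h t s - rb \<rho> p' h' t s) \<le> \<sigma>" if "0 \<le> s" "s \<le> \<delta>" for s
      proof -
        let ?s = "of_real s * cis t"
        have "rb \<rho> p h t s - rb \<rho> p' h' t s = - (cis (2 * t) * ((h ?s - (p ?s)\<^sup>2 / 2) - (h' ?s - (p' ?s)\<^sup>2 / 2)) / 2)"
          by (simp add: rb_def algebra_simps diff_divide_distrib add_divide_distrib)
        also have "norm \<dots> = norm ((h ?s - (p ?s)\<^sup>2 / 2) - (h' ?s - (p' ?s)\<^sup>2 / 2)) / 2" by (simp add: norm_mult norm_divide)
        also have "\<dots> \<le> Cq * W / 2"
          using that \<delta> d1(2) W by (intro divide_right_mono \<eta>2(3)[OF concentrated_mono[OF ad \<eta>(3)] concentrated_mono[OF ad' \<eta>(3)]]) (auto simp: norm_mult u'_def)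
        finally show ?thesis by (simp add: \<sigma>_def)
      qed
      \<comment> \<open>Each \<open>rphi\<close> lies between 1/2 and 3/2 of its profile, and the
        profiles are comparable up to \<open>K\<close>.\<close>
      have ratio: "1 / (3 * K) \<le> rphi u t s / rphi u' t s" "rphi u t s / rphi u' t s \<le> 3 * K" if "0 \<le> s" "s \<le> \<delta>" for s
      proof -
        have sd: "s \<le> d1" using that \<delta> by linarith
        note R = ray_phi[OF a that(1) sd, of t, folded A_def, folded \<kappa>_def] and R' = ray_phi[OF a' that(1) sd, of t, folded A'_def, folded \<kappa>'_def]
        have "A + \<kappa> * s\<^sup>2 \<le> K * (A' + \<kappa>' * s\<^sup>2)" using K1(1) mult_right_mono[OF kK(1), of "s\<^sup>2"] by (simp add: distrib_left mult.assoc)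
        then have "3 / 2 * (A + \<kappa> * s\<^sup>2) \<le> 3 / 2 * (K * (A' + \<kappa>' * s\<^sup>2))" by simp
        also have "\<dots> \<le> 3 / 2 * (K * (2 * rphi u' t s))" using R'(1) K by (intro mult_left_mono) auto
        finally have "rphi u t s \<le> 3 * K * rphi u' t s" using R(2) by simp
        then show "rphi u t s / rphi u' t s \<le> 3 * K" by (simp add: pos_divide_le_eq)
        have "A' + \<kappa>' * s\<^sup>2 \<le> K * (A + \<kappa> * s\<^sup>2)" using K1(2) mult_right_mono[OF kK(2), of "s\<^sup>2"] by (simp add: distrib_left mult.assoc)
        then have "3 / 2 * (A' + \<kappa>' * s\<^sup>2) \<le> 3 / 2 * (K * (A + \<kappa> * s\<^sup>2))" by simp
        also have "\<dots> \<le> 3 / 2 * (K * (2 * rphi u t s))" using R(1) K by (intro mult_left_mono) auto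
        finally have "rphi u' t s \<le> 3 * K * rphi u t s" using R'(2) by simp
        then show "1 / (3 * K) \<le> rphi u t s / rphi u' t s" using K by (simp add: field_simps)
      qed
      have yexp: "rphi u t s / rphi u' t s = exp (- (u (of_real s * cis t) - u' (of_real s * cis t)) / 2)" for s
        by (simp add: rphi_def diff_divide_distrib flip: exp_diff)
      \<comment> \<open>A bound for the relative difference of \<open>rphi\<close> on the circle: an
        exponential of size at most \<open>3 * K\<close> turns
        \<open>\<bar>u - u'\<bar> \<le> e * W\<close> into this.\<close>
      define y where "y = (3 * K + 1) / 2 * (e * W)"
      have yd: "\<bar>rphi u t \<delta> / rphi u' t \<delta> - 1\<bar> \<le> y"
      proof -
        let ?x = "- (u (of_real \<delta> * cis t) - u' (of_real \<delta> * cis t)) / 2"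
        have "\<bar>exp ?x - exp 0\<bar> \<le> (exp ?x + exp 0) * \<bar>?x - 0\<bar>" by (rule exp_diff_le)
        also have "\<dots> \<le> (3 * K + 1) * (e * W / 2)"
        proof (rule mult_mono)
          show "exp ?x + exp 0 \<le> 3 * K + 1" using ratio(2)[of \<delta>] \<delta> unfolding yexp by simp
          have "\<bar>u (of_real \<delta> * cis t) - u' (of_real \<delta> * cis t)\<bar> \<le> e * W" unfolding u'_def by (rule e) (use \<delta> in \<open>simp add: norm_mult\<close>)
          then show "\<bar>?x - 0\<bar> \<le> e * W / 2" by simp
        qed (use K in auto)
        finally show ?thesis unfolding yexp by (simp add: y_def)
      qed
      have r\<delta>: "r \<le> d1" using r \<delta> by linarith
      let ?D = "\<lambda>s. rphi u t s - rphi u' t s"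
      have "\<bar>?D r\<bar> \<le> (A' + \<kappa>' * r\<^sup>2) * (3 / 2 * K * (12 * y + 144 * \<sigma> * \<delta>\<^sup>2) + 18 * \<sigma> * \<delta>\<^sup>2)"
      proof (rule inner_algebra[where A = A and g = "\<rho> / 8" and \<kappa> = \<kappa> and Dd = "?D \<delta>"])
        show "\<bar>?D \<delta> - (A - A') - \<delta>\<^sup>2 * (\<kappa> - \<kappa>')\<bar> \<le> (\<bar>A - A'\<bar> + \<delta>\<^sup>2 * \<bar>\<kappa> - \<kappa>'\<bar>) / 2 + 18 * \<sigma> * \<delta>\<^sup>2 * (A' + \<kappa>' * \<delta>\<^sup>2)"
          unfolding A_def A'_def \<kappa>_def \<kappa>'_def by (rule inner_ray[OF a a' \<delta> \<sigma>]) (use \<delta> in auto)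
        show "\<bar>?D r - (A - A') - r\<^sup>2 * (\<kappa> - \<kappa>')\<bar> \<le> (\<bar>A - A'\<bar> + r\<^sup>2 * \<bar>\<kappa> - \<kappa>'\<bar>) / 2 + 18 * \<sigma> * \<delta>\<^sup>2 * (A' + \<kappa>' * r\<^sup>2)"
          unfolding A_def A'_def \<kappa>_def \<kappa>'_def by (rule inner_ray[OF a a' \<delta> \<sigma>]) (use r in auto)
        show sm: "6 * K * A' \<le> \<kappa>' * \<delta>\<^sup>2" unfolding \<kappa>'_def by (rule small[OF A0(2) A\<epsilon>(2)])
        have "1 * A' \<le> 6 * K * A'" using K A0 by (intro mult_right_mono) auto
        then have "A' \<le> \<kappa>' * \<delta>\<^sup>2" using sm by simp
        moreover have "rphi u' t \<delta> \<le> 3 / 2 * (A' + \<kappa>' * \<delta>\<^sup>2)" unfolding A'_def \<kappa>'_def by (rule ray_phi(2)[OF a']) (use \<delta> in auto)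
        ultimately have \<phi>: "rphi u' t \<delta> \<le> 3 * (\<kappa>' * \<delta>\<^sup>2)" by simp
        have "?D \<delta> = rphi u' t \<delta> * (rphi u t \<delta> / rphi u' t \<delta> - 1)" using less_imp_neq[OF rphi_pos[of u' t \<delta>]] by (simp add: right_diff_distrib)
        then have "\<bar>?D \<delta>\<bar> = rphi u' t \<delta> * \<bar>rphi u t \<delta> / rphi u' t \<delta> - 1\<bar>" by (simp only: abs_mult abs_of_pos[OF rphi_pos])
        also have "\<dots> \<le> 3 * (\<kappa>' * \<delta>\<^sup>2) * y" using \<phi> yd \<kappa>0 by (intro mult_mono) auto
        finally show "\<bar>?D \<delta>\<bar> \<le> 3 * (\<kappa>' * \<delta>\<^sup>2) * y" .
      qed (use A0 \<rho>0 \<delta> \<sigma>0 r K K1 in \<open>auto simp: \<kappa>_def \<kappa>'_def\<close>)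
      moreover have "A' + \<kappa>' * r\<^sup>2 \<le> 2 * rphi u' t r"
        using ray_phi(1)[OF a' r(1) r\<delta>, of t, folded A'_def, folded \<kappa>'_def] by simp
      ultimately have "\<bar>?D r\<bar> \<le> (2 * rphi u' t r) * (3 / 2 * K * (12 * y + 144 * \<sigma> * \<delta>\<^sup>2) + 18 * \<sigma> * \<delta>\<^sup>2)"
      proof (rule order_trans[OF _ mult_right_mono])
        have "y \<ge> 0" using yd by linarith
        then show "0 \<le> 3 / 2 * K * (12 * y + 144 * \<sigma> * \<delta>\<^sup>2) + 18 * \<sigma> * \<delta>\<^sup>2" using K \<sigma>0 by simp
      qed
      also have "(2 * rphi u' t r) * (3 / 2 * K * (12 * y + 144 * \<sigma> * \<delta>\<^sup>2) + 18 * \<sigma> * \<delta>\<^sup>2)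
          = (3 * K * (12 * y + 144 * \<sigma> * \<delta>\<^sup>2) + 36 * \<sigma> * \<delta>\<^sup>2) * rphi u' t r" by (simp add: field_simps)
      finally have "\<bar>?D r\<bar> / rphi u' t r \<le> 3 * K * (12 * y + 144 * \<sigma> * \<delta>\<^sup>2) + 36 * \<sigma> * \<delta>\<^sup>2"
        by (simp only: pos_divide_le_eq[OF rphi_pos])
      moreover have "\<bar>rphi u t r / rphi u' t r - 1\<bar> = \<bar>?D r\<bar> / rphi u' t r"
      proof -
        have "rphi u t r / rphi u' t r - 1 = ?D r / rphi u' t r" using less_imp_neq[OF rphi_pos[of u' t r]] by (simp add: diff_divide_distrib)
        then show ?thesis by (simp only: abs_divide abs_of_pos[OF rphi_pos])
      qed
      ultimately have yr: "\<bar>rphi u t r / rphi u' t r - 1\<bar> \<le> 3 * K * (12 * y + 144 * \<sigma> * \<delta>\<^sup>2) + 36 * \<sigma> * \<delta>\<^sup>2" by simp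
      \<comment> \<open>\<open>u - u'\<close> is -2 times the logarithm of the ratio, and the
        logarithm is Lipschitz because the ratio stays above \<open>1 / (3 * K)\<close>.\<close>
      have "\<bar>ln (rphi u t r / rphi u' t r)\<bar> \<le> 3 * K * \<bar>rphi u t r / rphi u' t r - 1\<bar>"
        using ratio[OF r] K by (intro ln_le_diff) auto
      also have "\<dots> \<le> 3 * K * (3 * K * (12 * y + 144 * \<sigma> * \<delta>\<^sup>2) + 36 * \<sigma> * \<delta>\<^sup>2)" using yr K by (intro mult_left_mono) auto
      finally have "\<bar>u z - u' z\<bar> \<le> 6 * K * (3 * K * (12 * y + 144 * \<sigma> * \<delta>\<^sup>2) + 36 * \<sigma> * \<delta>\<^sup>2)"
        unfolding yexp ln_exp zrt by simp
      also have "\<dots> = 6 * K * (3 * K * (6 * (3 * K + 1))) * (e * W) + 6 * K * ((3 * K * 144 + 36) * (Cq / 2)) * (\<delta>\<^sup>2 * W)"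
        by (simp add: y_def \<sigma>_def algebra_simps)
      also have "\<dots> \<le> K2 * (e * W) + K2 * (\<delta>\<^sup>2 * W)"
      proof (rule add_mono; rule mult_right_mono)
        show "0 \<le> e * W" using e[of "of_real \<delta>"] \<delta> by (auto intro: order_trans[OF abs_ge_zero])
        show "0 \<le> \<delta>\<^sup>2 * W" using W0 by simp
        show "6 * K * (3 * K * (6 * (3 * K + 1))) \<le> K2" "6 * K * ((3 * K * 144 + 36) * (Cq / 2)) \<le> K2"
          unfolding K2_def using K \<eta>2(2) by (intro mult_left_mono; simp)+
      qed
      also have "\<dots> = K2 * (e + \<delta>\<^sup>2) * W" by (simp add: algebra_simps)
      finally show ?thesis by (simp add: u'_def)
    qed
    then show ?thesis using \<eta>(1) by blast
  qed
  then show ?thesis using K2 by blast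
qed

end

subsection \<open>The estimate away from the blow-up points\<close>

lemma wirt_mult:
  assumes "wirt f \<alpha> \<beta> z" "wirt g \<gamma> \<delta> z"
  shows "wirt (\<lambda>z. f z * g z) (f z * \<gamma> + \<alpha> * g z) (f z * \<delta> + \<beta> * g z) z"
  using has_derivative_mult[OF assms[unfolded wirt_def]] unfolding wirt_def
  by (rule has_derivative_eq_rhs) (auto simp: algebra_simps)

lemma wirt_unique:
  assumes "wirt f \<alpha> \<beta> z" "wirt f \<alpha>' \<beta>' z"
  shows "\<alpha> = \<alpha>'" "\<beta> = \<beta>'"
proof -
  have eq: "(\<lambda>v. \<alpha> * v + \<beta> * cnj v) = (\<lambda>v. \<alpha>' * v + \<beta>' * cnj v)"
    using assms unfolding wirt_def by (rule has_derivative_unique)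
  have 1: "\<alpha> + \<beta> = \<alpha>' + \<beta>'" using fun_cong[OF eq, of 1] by simp
  have "\<i> * (\<alpha> - \<beta>) = \<i> * (\<alpha>' - \<beta>')" using fun_cong[OF eq, of \<i>] by (simp add: algebra_simps)
  then have 2: "\<alpha> - \<beta> = \<alpha>' - \<beta>'" by simp
  from 1 2 have "(\<alpha> + \<beta>) + (\<alpha> - \<beta>) = (\<alpha>' + \<beta>') + (\<alpha>' - \<beta>')" by simp
  then show "\<alpha> = \<alpha>'" by simp
  with 1 show "\<beta> = \<beta>'" by simp
qed

lemma wirt_shift:
  assumes "wirt f \<alpha> \<beta> (z + c)"
  shows "wirt (\<lambda>z. f (z + c)) \<alpha> \<beta> z"
proof -
  have s: "((\<lambda>z. z + c) has_derivative (\<lambda>v. v)) (at z)" by (auto intro!: derivative_eq_intros)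
  from has_derivative_compose[OF s assms[unfolded wirt_def]] show ?thesis unfolding wirt_def .
qed

lemma wirt_periodic:
  assumes w: "\<And>z. wirt f (\<alpha> z) (\<beta> z) z" and per: "periodic L f"
  shows "periodic L \<alpha>" "periodic L \<beta>"
proof -
  have *: "\<alpha> (z + l) = \<alpha> z \<and> \<beta> (z + l) = \<beta> z" if l: "l \<in> L" for z l
  proof -
    have "wirt (\<lambda>z. f (z + l)) (\<alpha> (z + l)) (\<beta> (z + l)) z" by (rule wirt_shift[OF w])
    moreover have "(\<lambda>z. f (z + l)) = f" using per l by (auto simp: periodic_def)
    ultimately show ?thesis using wirt_unique[OF _ w[of z]] by metis
  qed
  then show "periodic L \<alpha>" "periodic L \<beta>" by (auto simp: periodic_def)
qed

lemma wdata_periodic: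
  assumes d: "wdata f p h g" and per: "periodic L f"
  shows "periodic L p"
  by (rule wirt_periodic(1)[OF wdataD(7)[OF d]]) (use per in \<open>simp add: periodic_def\<close>)

context torus
begin

text \<open>\<open>Re (\<beta> z)\<close> is half of the x-derivative of \<open>Re G\<close> minus
  half of the y-derivative of \<open>Im G\<close>, and derivatives of periodic functions integrate
  to 0. In this form of the divergence theorem a single product rule carries out each integration by
  parts below.\<close>

lemma tint_wirt_zero:
  assumes w: "\<And>z. wirt G (\<alpha> z) (\<beta> z) z" and c: "continuous_on UNIV \<alpha>" "continuous_on UNIV \<beta>" and per: "periodic L G"
  shows "tint (\<lambda>z. Re (\<beta> z)) = 0"
proof -
  note p = wirt_periodic[OF w per]
  have R: "((\<lambda>z. Re (G z)) has_derivative (\<lambda>v. Re (\<alpha> z * v + \<beta> z * cnj v))) (at z)" for z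
    using has_derivative_Re[OF w[unfolded wirt_def]] .
  have I: "((\<lambda>z. Im (G z)) has_derivative (\<lambda>v. Im (\<alpha> z * v + \<beta> z * cnj v))) (at z)" for z
    using has_derivative_Im[OF w[unfolded wirt_def]] .
  have "tint (\<lambda>z. Re (\<alpha> z * 1 + \<beta> z * cnj 1)) = 0"
    by (rule tint_derivative_zero[OF R]) (use c p per in \<open>auto intro!: continuous_intros simp: periodic_def\<close>)
  moreover have "tint (\<lambda>z. Im (\<alpha> z * \<i> + \<beta> z * cnj \<i>)) = 0"
    by (rule tint_derivative_zero[OF I]) (use c p per in \<open>auto intro!: continuous_intros simp: periodic_def\<close>)
  ultimately have e: "tint (\<lambda>z. Re (\<alpha> z) + Re (\<beta> z)) = 0" "tint (\<lambda>z. Re (\<alpha> z) - Re (\<beta> z)) = 0" by simp_all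
  have t: "bounded_borel (\<lambda>z. Re (\<alpha> z))" "bounded_borel (\<lambda>z. Re (\<beta> z))"
    by (rule bounded_borel_continuous; use c p in \<open>auto intro!: continuous_intros simp: periodic_def\<close>)+
  show ?thesis using e unfolding tint_add[OF t] tint_diff[OF t] by simp
qed

end

context blow
begin

text \<open>With \<open>s\<close> the mean of \<open>u\<close> and its translate, the weight is
  \<open>\<theta> = exp (- (s - k) / H)\<close>. Testing the equation of \<open>s\<close> with
  \<open>\<theta>\<^sup>2\<close> bounds the weighted gradient of \<open>s\<close> by
  \<open>16 * H\<close>; testing that of \<open>w\<close> with \<open>\<theta>\<^sup>2 * w\<close>
  gives the energy of \<open>f = \<theta> * w\<close> up to a term with
  \<open>1 / H\<^sup>2\<close>. The outcome is an error \<open>16 / H\<close> from the weight and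
  \<open>32 * m\<close> from the weighted mass.\<close>

lemma energy_bound:
  assumes a: "concentrated \<eta> \<rho> u p h" and W: "\<And>z. \<bar>u z - u (z + p2)\<bar> \<le> W" and k: "\<And>z. k \<le> u z" and H: "H \<ge> 1"
  defines "f \<equiv> \<lambda>z. exp (- ((u z + u (z + p2)) / 2 - k) / H) * (u z - u (z + p2))"
  defines "m \<equiv> tint (\<lambda>z. (exp (- ((u z + u (z + p2)) / 2 - k) / H))\<^sup>2 * (exp (u z) + exp (u (z + p2))))"
  shows "tint (\<lambda>z. (f z)\<^sup>2) \<le> (norm p2)\<^sup>2 * (W\<^sup>2 * (16 / H + 32 * m))"
    and "bounded_borel (\<lambda>z. (f z)\<^sup>2)" "periodic L f"
proof -
  define u' where "u' = (\<lambda>z. u (z + p2))"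
  define p' where "p' = (\<lambda>z. p (z + p2))"
  define h' where "h' = (\<lambda>z. h (z + p2))"
  have a': "concentrated \<eta> \<rho> u' p' h'" unfolding u'_def p'_def h'_def by (rule concentrated_shift[OF a])
  note A = concentratedD[OF a] and A' = concentratedD[OF a']
  have W0: "W \<ge> 0" using W[of 0] by simp
  define s where "s = (\<lambda>z. 1 / 2 * (u z + u' z))"
  define ps where "ps = (\<lambda>z. of_real (1 / 2) * (p z + p' z))"
  define hs where "hs = (\<lambda>z. of_real (1 / 2) * (h z + h' z))"
  define gs where "gs = (\<lambda>z. 1 / 2 * (\<rho> * (1 - exp (u z)) + \<rho> * (1 - exp (u' z))))"
  have ds: "wdata s ps hs gs" unfolding s_def ps_def hs_def gs_def by (rule wdata_scale[OF wdata_add[OF A(1) A'(1)]])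
  define w where "w = (\<lambda>z. u z - u' z)"
  define pw where "pw = (\<lambda>z. p z - p' z)"
  define hw where "hw = (\<lambda>z. h z - h' z)"
  define gw where "gw = (\<lambda>z. \<rho> * (1 - exp (u z)) - \<rho> * (1 - exp (u' z)))"
  have dw: "wdata w pw hw gw" unfolding w_def pw_def hw_def gw_def by (rule wdata_diff[OF A(1) A'(1)])
  note S = wdataD[OF ds] and V = wdataD[OF dw]
  have perS: "periodic L s" "periodic L w" using A(2) A'(2) by (auto simp: s_def w_def periodic_def)
  note perP = wdata_periodic[OF ds perS(1)] wdata_periodic[OF dw perS(2)]
  define \<theta> where "\<theta> = (\<lambda>z. exp (- (s z - k) / H))"
  have sk: "k \<le> s z" for z using k[of z] k[of "z + p2"] by (simp add: s_def u'_def)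
  have \<theta>: "0 < \<theta> z" "\<theta> z \<le> 1" for z using sk[of z] H by (simp_all add: \<theta>_def divide_nonpos_pos)
  have c\<theta>: "continuous_on X \<theta>" for X unfolding \<theta>_def using H by (intro continuous_intros S) auto
  have per\<theta>: "periodic L \<theta>" using perS by (auto simp: \<theta>_def periodic_def)
  have d\<theta>: "(\<theta> has_derivative (\<lambda>v. - (\<theta> z / H) * (2 * Re (ps z * v)))) (at z)" for z
  proof -
    have "((\<lambda>z. - (s z - k) / H) has_derivative (\<lambda>v. - (2 * Re (ps z * v)) / H)) (at z)"
      using H by (auto intro!: derivative_eq_intros S(1))
    from has_derivative_exp[OF this] show ?thesis unfolding \<theta>_def by (rule has_derivative_eq_rhs) (simp add: mult.commute divide_inverse mult.left_commute del: times_complex.sel)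
  qed
  let ?\<theta> = "\<lambda>z. complex_of_real (\<theta> z)"
  have w\<theta>: "wirt ?\<theta> (- (\<theta> z / H) * ps z) (- (\<theta> z / H) * cnj (ps z)) z" for z
  proof -
    have "complex_of_real (- (\<theta> z / H) * (2 * Re (ps z * v))) = - (\<theta> z / H) * ps z * v + - (\<theta> z / H) * cnj (ps z) * cnj v" for v
    proof -
      have "complex_of_real (- (\<theta> z / H) * (2 * Re (ps z * v))) = of_real (- (\<theta> z / H)) * of_real (2 * Re (ps z * v))"
        by (rule of_real_mult)
      also have "complex_of_real (2 * Re (ps z * v)) = ps z * v + cnj (ps z * v)" by (rule complex_add_cnj[symmetric])
      finally show ?thesis by (simp add: algebra_simps)
    qed
    then show ?thesis using has_derivative_of_real[OF d\<theta>[of z], where 'a=complex] unfolding wirt_def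
      by (simp only:)
  qed
  note w\<theta>2 = wirt_mult[OF w\<theta> w\<theta>]
  note cs = c\<theta> S(3-6) V(3-6) A(9) A'(9)
  have cc: "continuous_on UNIV (\<lambda>z. complex_of_real (gs z / 4))" "continuous_on UNIV (\<lambda>z. complex_of_real (gw z / 4))"
    by (intro continuous_intros cs; simp)+
  have Hn: "complex_of_real H \<noteq> 0" using H by simp
  \<comment> \<open>The conjugate derivative of \<open>\<theta>\<^sup>2 * ps\<close>. It equates a
    quarter of the integral of \<open>\<theta>\<^sup>2 * gs\<close> with \<open>2 / H\<close> times
    the weighted gradient energy of \<open>s\<close>.\<close>
  have T1: "tint (\<lambda>z. Re ((?\<theta> z * ?\<theta> z) * of_real (gs z / 4) + (?\<theta> z * (- (\<theta> z / H) * cnj (ps z)) + (- (\<theta> z / H) * cnj (ps z)) * ?\<theta> z) * ps z)) = 0"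
    by (rule tint_wirt_zero[OF wirt_mult[OF w\<theta>2 S(2)]])
       (use per\<theta> perP in \<open>auto intro!: continuous_intros cs cc Hn simp: periodic_def\<close>)
  have tS: "bounded_borel (\<lambda>z. (\<theta> z)\<^sup>2 * gs z)" "bounded_borel (\<lambda>z. (\<theta> z)\<^sup>2 * (norm (ps z))\<^sup>2)"
    "bounded_borel (\<lambda>z. (\<theta> z)\<^sup>2 * (w z)\<^sup>2 * (norm (ps z))\<^sup>2)" "bounded_borel (\<lambda>z. (\<theta> z)\<^sup>2 * (w z * gw z))"
    "bounded_borel (\<lambda>z. (\<theta> z)\<^sup>2 * ((norm (pw z))\<^sup>2 - 2 / H * (w z * Re (pw z * cnj (ps z)))))"
    by (rule bounded_borel_continuous; use H per\<theta> perP perS A(2) A'(2) in \<open>auto intro!: continuous_intros cs simp: periodic_def gs_def gw_def\<close>)+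
  have "tint (\<lambda>z. 1 / 4 * ((\<theta> z)\<^sup>2 * gs z) - 2 / H * ((\<theta> z)\<^sup>2 * (norm (ps z))\<^sup>2)) = 0"
  proof -
    have "Re ((?\<theta> z * ?\<theta> z) * of_real (gs z / 4) + (?\<theta> z * (- (\<theta> z / H) * cnj (ps z)) + (- (\<theta> z / H) * cnj (ps z)) * ?\<theta> z) * ps z)
        = 1 / 4 * ((\<theta> z)\<^sup>2 * gs z) - 2 / H * ((\<theta> z)\<^sup>2 * (norm (ps z))\<^sup>2)" for z
    proof -
      have "(?\<theta> z * ?\<theta> z) * of_real (gs z / 4) + (?\<theta> z * (- (\<theta> z / H) * cnj (ps z)) + (- (\<theta> z / H) * cnj (ps z)) * ?\<theta> z) * ps z
        = of_real (1 / 4 * ((\<theta> z)\<^sup>2 * gs z)) - of_real (2 / H * (\<theta> z)\<^sup>2) * (ps z * cnj (ps z))"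
        by (simp add: power2_eq_square algebra_simps)
      also have "ps z * cnj (ps z) = of_real ((norm (ps z))\<^sup>2)" by (rule complex_norm_square[symmetric])
      finally show ?thesis by (simp add: mult.assoc flip: of_real_mult of_real_diff)
    qed
    with T1 show ?thesis by simp
  qed
  then have "1 / 4 * tint (\<lambda>z. (\<theta> z)\<^sup>2 * gs z) = 2 / H * tint (\<lambda>z. (\<theta> z)\<^sup>2 * (norm (ps z))\<^sup>2)"
    using tint_diff[OF bounded_borel_mult[OF bounded_borel_const tS(1), of "1/4"] bounded_borel_mult[OF bounded_borel_const tS(2), of "2/H"]] unfolding tint_cmult by simp
  moreover have "tint (\<lambda>z. (\<theta> z)\<^sup>2 * gs z) \<le> 128"
  proof -
    have "tint (\<lambda>z. (\<theta> z)\<^sup>2 * gs z) \<le> tint (\<lambda>z. 128)"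
    proof (rule tint_mono[OF tS(1) bounded_borel_const])
      fix z
      have "gs z = \<rho> - \<rho> * (exp (u z) + exp (u' z)) / 2" by (simp add: gs_def algebra_simps)
      then have gs: "gs z \<le> \<rho>" using A(7) by simp
      have "(\<theta> z)\<^sup>2 * gs z \<le> (\<theta> z)\<^sup>2 * \<rho>" using gs by (intro mult_left_mono) auto
      also have "\<dots> \<le> 1 * 128" using \<theta>[of z] A(7,8) by (intro mult_mono power_le_one) auto
      finally show "(\<theta> z)\<^sup>2 * gs z \<le> 128" by simp
    qed
    then show ?thesis by (simp add: tint_const area)
  qed
  moreover have "Y \<le> 16 * H" if "1 / 4 * X = 2 / H * Y" "X \<le> 128" for X Y :: real
  proof -
    from that H have "8 * Y = H * X" by (simp add: field_simps)
    also have "\<dots> \<le> H * 128" using that H by (intro mult_left_mono) auto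
    finally show "Y \<le> 16 * H" by simp
  qed
  ultimately have E1: "tint (\<lambda>z. (\<theta> z)\<^sup>2 * (norm (ps z))\<^sup>2) \<le> 16 * H" by blast
  \<comment> \<open>The conjugate derivative of \<open>\<theta>\<^sup>2 * w * pw\<close>.\<close>
  have T2: "tint (\<lambda>z. Re (((?\<theta> z * ?\<theta> z) * of_real (w z)) * of_real (gw z / 4) + ((?\<theta> z * ?\<theta> z) * cnj (pw z) + (?\<theta> z * (- (\<theta> z / H) * cnj (ps z)) + (- (\<theta> z / H) * cnj (ps z)) * ?\<theta> z) * of_real (w z)) * pw z)) = 0"
    by (rule tint_wirt_zero[OF wirt_mult[OF wirt_mult[OF w\<theta>2 V(7)] V(2)]])
       (use per\<theta> perP perS in \<open>auto intro!: continuous_intros cs cc Hn simp: periodic_def\<close>)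
  have E2: "tint (\<lambda>z. (\<theta> z)\<^sup>2 * ((norm (pw z))\<^sup>2 - 2 / H * (w z * Re (pw z * cnj (ps z))))) = - 1 / 4 * tint (\<lambda>z. (\<theta> z)\<^sup>2 * (w z * gw z))"
  proof -
    have "Re (((?\<theta> z * ?\<theta> z) * of_real (w z)) * of_real (gw z / 4) + ((?\<theta> z * ?\<theta> z) * cnj (pw z) + (?\<theta> z * (- (\<theta> z / H) * cnj (ps z)) + (- (\<theta> z / H) * cnj (ps z)) * ?\<theta> z) * of_real (w z)) * pw z)
        = 1 / 4 * ((\<theta> z)\<^sup>2 * (w z * gw z)) + (\<theta> z)\<^sup>2 * ((norm (pw z))\<^sup>2 - 2 / H * (w z * Re (pw z * cnj (ps z))))" for z
    proof -
      have "((?\<theta> z * ?\<theta> z) * of_real (w z)) * of_real (gw z / 4) + ((?\<theta> z * ?\<theta> z) * cnj (pw z) + (?\<theta> z * (- (\<theta> z / H) * cnj (ps z)) + (- (\<theta> z / H) * cnj (ps z)) * ?\<theta> z) * of_real (w z)) * pw z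
        = of_real (1 / 4 * ((\<theta> z)\<^sup>2 * (w z * gw z))) + of_real ((\<theta> z)\<^sup>2) * (pw z * cnj (pw z)) - of_real ((\<theta> z)\<^sup>2 * (2 / H * w z)) * (pw z * cnj (ps z))"
        by (simp add: power2_eq_square algebra_simps)
      also have "pw z * cnj (pw z) = of_real ((norm (pw z))\<^sup>2)" by (rule complex_norm_square[symmetric])
      finally have "((?\<theta> z * ?\<theta> z) * of_real (w z)) * of_real (gw z / 4) + ((?\<theta> z * ?\<theta> z) * cnj (pw z) + (?\<theta> z * (- (\<theta> z / H) * cnj (ps z)) + (- (\<theta> z / H) * cnj (ps z)) * ?\<theta> z) * of_real (w z)) * pw z
        = of_real (1 / 4 * ((\<theta> z)\<^sup>2 * (w z * gw z)) + (\<theta> z)\<^sup>2 * (norm (pw z))\<^sup>2) - of_real ((\<theta> z)\<^sup>2 * (2 / H * w z)) * (pw z * cnj (ps z))"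
        by (simp only: of_real_add of_real_mult)
      then have "Re (((?\<theta> z * ?\<theta> z) * of_real (w z)) * of_real (gw z / 4) + ((?\<theta> z * ?\<theta> z) * cnj (pw z) + (?\<theta> z * (- (\<theta> z / H) * cnj (ps z)) + (- (\<theta> z / H) * cnj (ps z)) * ?\<theta> z) * of_real (w z)) * pw z)
        = 1 / 4 * ((\<theta> z)\<^sup>2 * (w z * gw z)) + (\<theta> z)\<^sup>2 * (norm (pw z))\<^sup>2 - (\<theta> z)\<^sup>2 * (2 / H * w z) * Re (pw z * cnj (ps z))"
        by (simp only: minus_complex.sel Re_complex_of_real times_complex.sel(1)[of "complex_of_real _"] Im_complex_of_real mult_zero_left diff_zero)
      then show ?thesis by (simp add: right_diff_distrib)
    qed
    with T2 have "tint (\<lambda>z. 1 / 4 * ((\<theta> z)\<^sup>2 * (w z * gw z)) + (\<theta> z)\<^sup>2 * ((norm (pw z))\<^sup>2 - 2 / H * (w z * Re (pw z * cnj (ps z))))) = 0" by simp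
    then show ?thesis using tint_add[OF bounded_borel_mult[OF bounded_borel_const tS(4), of "1/4"] tS(5)] unfolding tint_cmult by simp
  qed
  define fz where "fz = (\<lambda>z. of_real (\<theta> z) * (pw z - of_real (w z / H) * ps z))"
  have fdef: "f = (\<lambda>z. \<theta> z * w z)" by (simp add: f_def \<theta>_def w_def s_def u'_def fun_eq_iff)
  have df: "(f has_derivative (\<lambda>v. 2 * Re (fz z * v))) (at z)" for z
    unfolding fdef by (rule has_derivative_eq_rhs[OF has_derivative_mult[OF d\<theta> V(1)]])
      (use H in \<open>auto simp: fz_def fun_eq_iff field_simps\<close>)
  have cf: "continuous_on X f" "continuous_on X fz" for X
    unfolding fdef fz_def using H by (auto intro!: continuous_intros cs)
  show perf: "periodic L f" using per\<theta> perS by (auto simp: fdef periodic_def)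
  have perfz: "periodic L fz" using per\<theta> perS perP by (auto simp: fz_def periodic_def)
  show tf: "bounded_borel (\<lambda>z. (f z)\<^sup>2)"
    by (rule bounded_borel_continuous) (use perf in \<open>auto intro!: continuous_intros cf simp: periodic_def\<close>)
  have tfz: "bounded_borel (\<lambda>z. (norm (fz z))\<^sup>2)"
    by (rule bounded_borel_continuous) (use perfz in \<open>auto intro!: continuous_intros cf simp: periodic_def\<close>)
  \<comment> \<open>The first summand, cross term included, is exactly the integrand evaluated in
    E2. Hence the cross term requires no estimate, and the only remainder is quadratic in
    \<open>1 / H\<close>.\<close>
  have fz2: "(norm (fz z))\<^sup>2 = (\<theta> z)\<^sup>2 * ((norm (pw z))\<^sup>2 - 2 / H * (w z * Re (pw z * cnj (ps z)))) + 1 / H\<^sup>2 * ((\<theta> z)\<^sup>2 * (w z)\<^sup>2 * (norm (ps z))\<^sup>2)" for z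
  proof -
    have "(norm (pw z - of_real (w z / H) * ps z))\<^sup>2 = (norm (pw z))\<^sup>2 - 2 * (w z / H) * Re (pw z * cnj (ps z)) + (w z / H)\<^sup>2 * (norm (ps z))\<^sup>2"
      unfolding cmod_power2 by (simp add: power2_eq_square algebra_simps)
    moreover have "(norm (fz z))\<^sup>2 = (\<theta> z)\<^sup>2 * (norm (pw z - of_real (w z / H) * ps z))\<^sup>2"
      unfolding fz_def norm_mult power_mult_distrib by simp
    ultimately show ?thesis by (simp only:) (simp add: power_divide distrib_left right_diff_distrib mult_ac del: times_complex.sel)
  qed
  have EW: "\<bar>w z\<bar> \<le> W" for z using W[of z] by (simp add: w_def u'_def)
  have wsq: "(w z)\<^sup>2 \<le> W\<^sup>2" for z using power_mono[OF EW[of z], of 2] by simp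
  have tE: "bounded_borel (\<lambda>z. (\<theta> z)\<^sup>2 * (exp (u z) + exp (u' z)))"
    by (rule bounded_borel_continuous) (use per\<theta> A(2) A'(2) in \<open>auto intro!: continuous_intros c\<theta> A A' simp: periodic_def\<close>)
  have mdef: "m = tint (\<lambda>z. (\<theta> z)\<^sup>2 * (exp (u z) + exp (u' z)))" by (simp add: m_def \<theta>_def s_def u'_def)
  have "tint (\<lambda>z. (norm (fz z))\<^sup>2) = - 1 / 4 * tint (\<lambda>z. (\<theta> z)\<^sup>2 * (w z * gw z)) + 1 / H\<^sup>2 * tint (\<lambda>z. (\<theta> z)\<^sup>2 * (w z)\<^sup>2 * (norm (ps z))\<^sup>2)"
    unfolding fz2 tint_add[OF tS(5) bounded_borel_mult[OF bounded_borel_const tS(3)]] tint_cmult E2 ..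
  also have "- 1 / 4 * tint (\<lambda>z. (\<theta> z)\<^sup>2 * (w z * gw z)) \<le> 1 / 4 * (128 * W\<^sup>2 * m)"
  proof -
    have "tint (\<lambda>z. - 1 * ((\<theta> z)\<^sup>2 * (w z * gw z))) \<le> tint (\<lambda>z. (128 * W\<^sup>2) * ((\<theta> z)\<^sup>2 * (exp (u z) + exp (u' z))))"
    proof (rule tint_mono[OF bounded_borel_mult[OF bounded_borel_const tS(4)] bounded_borel_mult[OF bounded_borel_const tE]])
      fix z
      have "gw z = - (\<rho> * (exp (u z) - exp (u' z)))" by (simp add: gw_def algebra_simps)
      then have "\<bar>gw z\<bar> = \<rho> * \<bar>exp (u z) - exp (u' z)\<bar>" using A(7) by (simp add: abs_mult)
      also have "\<dots> \<le> 128 * ((exp (u z) + exp (u' z)) * W)"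
        by (intro mult_mono order_trans[OF exp_diff_le]) (use A(7,8) EW[of z] W0 in \<open>auto simp: w_def intro!: mult_left_mono mult_nonneg_nonneg add_nonneg_nonneg\<close>)
      finally have g: "\<bar>gw z\<bar> \<le> 128 * ((exp (u z) + exp (u' z)) * W)" .
      have "- (w z * gw z) \<le> \<bar>w z\<bar> * \<bar>gw z\<bar>" by (simp add: abs_mult[symmetric])
      also have "\<dots> \<le> W * (128 * ((exp (u z) + exp (u' z)) * W))" using EW[of z] g W0 by (intro mult_mono) auto
      finally have "(\<theta> z)\<^sup>2 * (- (w z * gw z)) \<le> (\<theta> z)\<^sup>2 * (W * (128 * ((exp (u z) + exp (u' z)) * W)))" by (intro mult_left_mono) auto
      then show "- 1 * ((\<theta> z)\<^sup>2 * (w z * gw z)) \<le> (128 * W\<^sup>2) * ((\<theta> z)\<^sup>2 * (exp (u z) + exp (u' z)))"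
        by (simp add: power2_eq_square mult_ac)
    qed
    then show ?thesis unfolding tint_cmult mdef by simp
  qed
  also have "1 / H\<^sup>2 * tint (\<lambda>z. (\<theta> z)\<^sup>2 * (w z)\<^sup>2 * (norm (ps z))\<^sup>2) \<le> 1 / H\<^sup>2 * (W\<^sup>2 * (16 * H))"
  proof (rule mult_left_mono)
    have "tint (\<lambda>z. (\<theta> z)\<^sup>2 * (w z)\<^sup>2 * (norm (ps z))\<^sup>2) \<le> tint (\<lambda>z. W\<^sup>2 * ((\<theta> z)\<^sup>2 * (norm (ps z))\<^sup>2))"
    proof (rule tint_mono[OF tS(3) bounded_borel_mult[OF bounded_borel_const tS(2)]])
      show "(\<theta> z)\<^sup>2 * (w z)\<^sup>2 * (norm (ps z))\<^sup>2 \<le> W\<^sup>2 * ((\<theta> z)\<^sup>2 * (norm (ps z))\<^sup>2)" for z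
        using mult_right_mono[OF wsq[of z], of "(\<theta> z)\<^sup>2 * (norm (ps z))\<^sup>2"] by (simp add: mult_ac)
    qed
    also have "\<dots> \<le> W\<^sup>2 * (16 * H)" unfolding tint_cmult using E1 by (intro mult_left_mono) auto
    finally show "tint (\<lambda>z. (\<theta> z)\<^sup>2 * (w z)\<^sup>2 * (norm (ps z))\<^sup>2) \<le> W\<^sup>2 * (16 * H)" .
  qed simp
  finally have E3: "tint (\<lambda>z. (norm (fz z))\<^sup>2) \<le> W\<^sup>2 * (16 / H + 32 * m)"
    using H by (simp add: power2_eq_square[of H] algebra_simps)
  have sh: "s (p2 + z) = s z" "w (p2 + z) = - w z" for z
    using u_p2[OF A(2), of z] by (simp_all add: s_def w_def u'_def add.commute[of p2])
  have fsh: "f (p2 + z) = - f z" for z by (simp add: fdef \<theta>_def sh)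
  \<comment> \<open>As \<open>f\<close> changes sign under the half period, its difference along
    \<open>p2\<close> is \<open>- 2 * f z\<close>; this yields the Poincare inequality.\<close>
  have "tint (\<lambda>z. (f (p2 + z) - f z)\<^sup>2) \<le> tint (\<lambda>z. (2 * Re (fz z * p2))\<^sup>2)"
    by (rule tint_sq_difference_le[OF df]) (use perf perfz in \<open>auto intro!: continuous_intros cf simp: periodic_def\<close>)
  moreover have "tint (\<lambda>z. (f (p2 + z) - f z)\<^sup>2) = 4 * tint (\<lambda>z. (f z)\<^sup>2)"
    unfolding fsh tint_cmult[symmetric] by (simp add: power2_eq_square)
  moreover have "tint (\<lambda>z. (2 * Re (fz z * p2))\<^sup>2) \<le> tint (\<lambda>z. 4 * (norm p2)\<^sup>2 * (norm (fz z))\<^sup>2)"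
  proof (rule tint_mono[OF _ bounded_borel_mult[OF bounded_borel_const tfz]])
    show "bounded_borel (\<lambda>z. (2 * Re (fz z * p2))\<^sup>2)"
      by (rule bounded_borel_continuous) (use perfz in \<open>auto intro!: continuous_intros cf simp: periodic_def\<close>)
    fix z
    have "(Re (fz z * p2))\<^sup>2 \<le> (norm (fz z * p2))\<^sup>2" by (rule abs_le_square_iff[THEN iffD1]) (simp only: abs_norm_cancel abs_Re_le_cmod)
    then show "(2 * Re (fz z * p2))\<^sup>2 \<le> 4 * (norm p2)\<^sup>2 * (norm (fz z))\<^sup>2"
      by (simp add: power_mult_distrib norm_mult mult_ac del: times_complex.sel)
  qed
  ultimately have "4 * tint (\<lambda>z. (f z)\<^sup>2) \<le> 4 * (norm p2)\<^sup>2 * tint (\<lambda>z. (norm (fz z))\<^sup>2)"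
    unfolding tint_cmult by linarith
  also have "\<dots> \<le> 4 * (norm p2)\<^sup>2 * (W\<^sup>2 * (16 / H + 32 * m))" using E3 by (intro mult_left_mono) auto
  finally show "tint (\<lambda>z. (f z)\<^sup>2) \<le> (norm p2)\<^sup>2 * (W\<^sup>2 * (16 / H + 32 * m))" by simp
qed

end

text \<open>The mean value inequality for \<open>w\<close>, combined with Young's inequality
  \<open>M * \<bar>f z\<bar> \<le> l / 2 + M\<^sup>2 / (2 * l) * (f z)\<^sup>2\<close>. The free
  parameter \<open>l\<close> avoids square roots; it will be taken proportional to
  \<open>W\<close>.\<close>

lemma mean_square_bound:
  assumes w: "wdata w pw hw gw" and G: "\<And>z. dist x z \<le> s \<Longrightarrow> \<bar>gw z\<bar> \<le> G" and s: "0 < s" and l: "0 < l" and M: "0 < M"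
    and f: "continuous_on UNIV f" "\<And>z. dist x z \<le> s \<Longrightarrow> \<bar>w z\<bar> \<le> M * \<bar>f z\<bar>"
  shows "\<bar>w x\<bar> \<le> G / 4 * s\<^sup>2 + l / 2 + M\<^sup>2 / (2 * l * (pi * s\<^sup>2)) * (LINT z:cball x s|lborel. (f z)\<^sup>2)"
proof -
  let ?I = "LINT z:cball x s|lborel. (f z)\<^sup>2"
  have *: "\<sigma> * w x \<le> G / 4 * s\<^sup>2 + l / 2 + M\<^sup>2 / (2 * l * (pi * s\<^sup>2)) * ?I" if \<sigma>: "\<bar>\<sigma>\<bar> = 1" for \<sigma> :: real
  proof -
    have G0: "G \<ge> 0" using G[of x] s by simp
    have d: "wdata (\<lambda>z. \<sigma> * w z) (\<lambda>z. of_real \<sigma> * pw z) (\<lambda>z. of_real \<sigma> * hw z) (\<lambda>z. \<sigma> * gw z)" by (rule wdata_scale[OF w])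
    have cf: "continuous_on UNIV (\<lambda>z. (f z)\<^sup>2)" by (intro continuous_intros f)
    have "pi * s\<^sup>2 * ((\<sigma> * w x - G / 4 * s\<^sup>2 - l / 2) * (2 * l / M\<^sup>2)) \<le> ?I"
    proof (rule set_integral_cball_ge[OF cf])
      fix t assume t: "0 \<le> t" "t \<le> s"
      have "\<sigma> * w x \<le> rmean x (\<lambda>z. \<sigma> * w z) t + G / 4 * t\<^sup>2"
      proof (rule rmean_lower[OF d _ t(1)])
        fix z assume "dist x z \<le> t"
        then have "\<bar>\<sigma> * gw z\<bar> \<le> G" using G[of z] t \<sigma> by (simp add: abs_mult)
        then show "- G \<le> \<sigma> * gw z" by linarith
      qed
      also have "G / 4 * t\<^sup>2 \<le> G / 4 * s\<^sup>2" using t G0 by (intro mult_left_mono power_mono) auto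
      also have "rmean x (\<lambda>z. \<sigma> * w z) t \<le> rmean x (\<lambda>z. l / 2 + M\<^sup>2 / (2 * l) * (f z)\<^sup>2) t"
      proof (rule rmean_mono[OF wdataD(6)[OF d]])
        show "continuous_on UNIV (\<lambda>z. l / 2 + M\<^sup>2 / (2 * l) * (f z)\<^sup>2)" by (intro continuous_intros cf)
        fix z assume "dist x z = \<bar>t\<bar>"
        then have b: "\<bar>w z\<bar> \<le> M * \<bar>f z\<bar>" using f(2)[of z] t by simp
        have "\<sigma> * w z \<le> \<bar>\<sigma> * w z\<bar>" by simp
        also have "\<dots> \<le> M * \<bar>f z\<bar>" using b \<sigma> by (simp add: abs_mult)
        also have "\<dots> \<le> l / 2 + M\<^sup>2 / (2 * l) * (f z)\<^sup>2"
        proof -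
          have "0 \<le> (l - M * \<bar>f z\<bar>)\<^sup>2 / (2 * l)" using l by simp
          also have "\<dots> = l / 2 + M\<^sup>2 / (2 * l) * (f z)\<^sup>2 - M * \<bar>f z\<bar>"
            using l by (simp add: power2_diff power_mult_distrib field_simps power2_eq_square)
          finally show ?thesis by simp
        qed
        finally show "\<sigma> * w z \<le> l / 2 + M\<^sup>2 / (2 * l) * (f z)\<^sup>2" .
      qed
      also have "\<dots> = l / 2 + M\<^sup>2 / (2 * l) * rmean x (\<lambda>z. (f z)\<^sup>2) t"
        unfolding rmean_cmult[symmetric] by (subst rmean_add) (intro continuous_intros cf rmean_const arg_cong2[where f=plus] refl)+
      finally have "\<sigma> * w x - G / 4 * s\<^sup>2 - l / 2 \<le> M\<^sup>2 / (2 * l) * rmean x (\<lambda>z. (f z)\<^sup>2) t" by simp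
      then have "(\<sigma> * w x - G / 4 * s\<^sup>2 - l / 2) * (2 * l / M\<^sup>2) \<le> (M\<^sup>2 / (2 * l) * rmean x (\<lambda>z. (f z)\<^sup>2) t) * (2 * l / M\<^sup>2)"
        using l by (intro mult_right_mono) auto
      also have "\<dots> = rmean x (\<lambda>z. (f z)\<^sup>2) t" using l M by simp
      finally show "(\<sigma> * w x - G / 4 * s\<^sup>2 - l / 2) * (2 * l / M\<^sup>2) \<le> rmean x (\<lambda>z. (f z)\<^sup>2) t" .
    qed (use s in simp)
    then have "(\<sigma> * w x - G / 4 * s\<^sup>2 - l / 2) * (2 * l / M\<^sup>2 * (pi * s\<^sup>2)) \<le> ?I" by (simp only: mult_ac)
    moreover have "2 * l / M\<^sup>2 * (pi * s\<^sup>2) > 0" using l M s by simp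
    ultimately have "\<sigma> * w x - G / 4 * s\<^sup>2 - l / 2 \<le> ?I / (2 * l / M\<^sup>2 * (pi * s\<^sup>2))" by (rule pos_le_divide_eq[THEN iffD2, rotated])
    also have "\<dots> = M\<^sup>2 / (2 * l * (pi * s\<^sup>2)) * ?I" by simp
    finally show ?thesis by linarith
  qed
  from *[of 1] *[of "-1"] show ?thesis by linarith
qed

context blow
begin

text \<open>On \<open>far \<eta>\<close> the mass is small and the weight at most 1. Within \<eta>
  of \<open>Z\<close> either \<open>u\<close> or its translate exceeds its minimum by about
  \<open>ln (1 / (2 * \<eta>))\<close>, which makes the weight small against a mass of at most 1 for
  each.\<close>

lemma weight_mass_bound:
  assumes a: "concentrated \<eta> \<rho> u p h" and \<eta>: "0 < \<eta>" "\<eta> \<le> 1 / 2" and k: "\<And>z. k \<le> u z" and H: "H \<ge> 1"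
  shows "tint (\<lambda>z. (exp (- ((u z + u (z + p2)) / 2 - k) / H))\<^sup>2 * (exp (u z) + exp (u (z + p2))))
    \<le> 2 * \<eta> + 2 * exp (- (ln (1 / (2 * \<eta>)) - 32) / H)"
proof -
  define u' where "u' = (\<lambda>z. u (z + p2))"
  have a': "concentrated \<eta> \<rho> u' (\<lambda>z. p (z + p2)) (\<lambda>z. h (z + p2))" unfolding u'_def by (rule concentrated_shift[OF a])
  note A = concentratedD[OF a] and A' = concentratedD[OF a']
  let ?l = "ln (1 / (2 * \<eta>)) - 32"
  let ?\<theta> = "\<lambda>z. exp (- ((u z + u' z) / 2 - k) / H)"
  let ?i = "\<lambda>z. indicator (far \<eta>) z :: real"
  have t1: "bounded_borel (\<lambda>z. exp (u z) + exp (u' z))" by (rule bounded_borel_add[OF A(11) A'(11)])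
  have t2: "bounded_borel (\<lambda>z. ?i z * exp (u z) + ?i z * exp (u' z))" by (rule bounded_borel_add[OF A(12) A'(12)])
  have k': "k \<le> u' z" for z unfolding u'_def by (rule k)
  have "tint (\<lambda>z. (?\<theta> z)\<^sup>2 * (exp (u z) + exp (u' z)))
     \<le> tint (\<lambda>z. (?i z * exp (u z) + ?i z * exp (u' z)) + exp (- ?l / H) * (exp (u z) + exp (u' z)))"
  proof (rule tint_mono[OF _ bounded_borel_add[OF t2 bounded_borel_mult[OF bounded_borel_const t1]]])
    show "bounded_borel (\<lambda>z. (?\<theta> z)\<^sup>2 * (exp (u z) + exp (u' z)))"
      by (rule bounded_borel_continuous) (use A(2) A'(2) H in \<open>auto intro!: continuous_intros A A' simp: periodic_def\<close>)
    fix z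
    have sq: "(?\<theta> z)\<^sup>2 = exp (- (u z + u' z - 2 * k) / H)"
      unfolding power2_eq_square exp_add[symmetric] using H by (simp add: field_simps)
    show "(?\<theta> z)\<^sup>2 * (exp (u z) + exp (u' z)) \<le> (?i z * exp (u z) + ?i z * exp (u' z)) + exp (- ?l / H) * (exp (u z) + exp (u' z))"
    proof (cases "z \<in> far \<eta>")
      case True
      have "(?\<theta> z)\<^sup>2 \<le> 1" unfolding sq using k[of z] k'[of z] H by (simp add: divide_nonpos_pos)
      then have "(?\<theta> z)\<^sup>2 * (exp (u z) + exp (u' z)) \<le> 1 * (exp (u z) + exp (u' z))" by (intro mult_right_mono) auto
      moreover have "0 \<le> exp (- ?l / H) * (exp (u z) + exp (u' z))" by (intro mult_nonneg_nonneg) auto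
      moreover have "?i z = 1" using True by simp
      ultimately show ?thesis by (simp only: mult_1_left)
    next
      case False
      then obtain q where q: "q \<in> Z" "dist z q < \<eta>" by (auto simp: far_def not_le)
      have low: "k + ?l \<le> u (z - q)"
        using lower_near_zero[OF \<eta> a _ k, of "z - q"] q by (simp add: dist_norm)
      have "k + ?l \<le> u z \<or> k + ?l \<le> u' z"
      proof (cases "q \<in> L")
        case True
        then have "u z = u (z - q)" using periodicD[OF A(2) True, of "z - q"] by simp
        then show ?thesis using low by simp
      next
        case False
        then have "q - p2 \<in> L" using q(1) by (simp add: Z_def)
        then have "u ((z - q + p2 + p2) + (q - p2)) = u (z - q + p2 + p2)" by (rule periodicD[OF A(2)])
        then have "u' z = u (z - q)" using u_p2[OF A(2), of "z - q"] by (simp add: u'_def add_ac)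
        then show ?thesis using low by simp
      qed
      then have "?l \<le> u z + u' z - 2 * k" using k[of z] k'[of z] by auto
      then have "(?\<theta> z)\<^sup>2 \<le> exp (- ?l / H)" unfolding sq using H by (simp add: divide_right_mono)
      then have "(?\<theta> z)\<^sup>2 * (exp (u z) + exp (u' z)) \<le> exp (- ?l / H) * (exp (u z) + exp (u' z))"
        by (intro mult_right_mono) auto
      then show ?thesis using False by simp
    qed
  qed
  also have "\<dots> = (tint (\<lambda>z. ?i z * exp (u z)) + tint (\<lambda>z. ?i z * exp (u' z))) + exp (- ?l / H) * (tint (\<lambda>z. exp (u z)) + tint (\<lambda>z. exp (u' z)))"
    unfolding tint_add[OF t2 bounded_borel_mult[OF bounded_borel_const t1]] tint_cmult tint_add[OF A(11) A'(11)] tint_add[OF A(12) A'(12)] ..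
  also have "\<dots> \<le> (\<eta> + \<eta>) + exp (- ?l / H) * (1 + 1)"
    using a a' A(4) A'(4) by (auto simp: concentrated_def)
  finally show ?thesis by (simp add: u'_def)
qed

text \<open>The bound \<open>e * W\<close> is spent as follows: a quarter on the Laplacian, a
  quarter on \<open>l / 2\<close>, and half on the energy term, shared equally between
  \<open>1 / H\<close> and the weighted mass. So \<open>H\<close> is chosen large first, and \<eta>
  small afterwards depending on \<open>H\<close>.\<close>

lemma outer_small:
  assumes d: "d > 0" and e: "e > 0"
  shows "\<exists>\<eta>>0. \<forall>\<rho> u p h W x. concentrated \<eta> \<rho> u p h \<longrightarrow> (\<forall>z. \<bar>u z - u (z + p2)\<bar> \<le> W) \<longrightarrow> x \<in> far d \<longrightarrow> \<bar>u x - u (x + p2)\<bar> \<le> e * W"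
proof -
  define s where "s = d / 2"
  have s: "s > 0" using d by (simp add: s_def)
  obtain \<eta>1 C where \<eta>1: "\<eta>1 > 0" "C \<ge> 0" "\<And>\<rho> u p h x z. concentrated \<eta>1 \<rho> u p h \<Longrightarrow> x \<in> far s \<Longrightarrow> u x \<le> u z + C"
    using osc_bound[OF s] by blast
  \<comment> \<open>The Laplacian of \<open>w\<close> is then at most \<open>256 * e1 * W\<close> on
    the disc, which contributes \<open>e * W / 4\<close>.\<close>
  define e1 where "e1 = e / (256 * s\<^sup>2)"
  have e1: "e1 > 0" using e s by (simp add: e1_def)
  obtain \<eta>2 where \<eta>2: "\<eta>2 > 0" "\<And>\<rho> u p h x. concentrated \<eta>2 \<rho> u p h \<Longrightarrow> x \<in> far s \<Longrightarrow> exp (u x) \<le> e1"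
    using exp_small_far[OF s e1] by blast
  obtain N where N: "N > 0" "\<And>x f. bounded_borel f \<Longrightarrow> periodic L f \<Longrightarrow> (\<And>z. 0 \<le> f z) \<Longrightarrow> (LINT z:cball x s|lborel. f z) \<le> N * tint f"
    by (rule integral_cball_le[of s]) blast
  \<comment> \<open>All factors in front of \<open>16 / H + 32 * m\<close>: the comparison of
    weights \<open>exp C\<close>, the covering number \<open>N\<close>, the Poincare constant
    \<open>(norm p2)\<^sup>2\<close>, and the disc average with
    \<open>l = e / 2 * W\<close>.\<close>
  define T where "T = (exp C)\<^sup>2 * N * (norm p2)\<^sup>2 / (e * (pi * s\<^sup>2))"
  have "p2 \<noteq> 0" using p2(1) discrete_subgroupD(1)[OF L] by auto
  then have T: "T > 0" using N(1) e s by (simp add: T_def)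
  define H where "H = max 1 (64 * T / e)"
  have H: "H \<ge> 1" "64 * T / e \<le> H" by (auto simp: H_def)
  define \<mu> where "\<mu> = e / (128 * T)"
  have \<mu>: "\<mu> > 0" using e T by (simp add: \<mu>_def)
  \<comment> \<open>\<open>2 * \<eta> \<le> exp (- B)\<close> makes the exponential term of
    \<open>weight_mass_bound\<close> at most \<open>\<mu> / 4\<close>; together with
    \<open>\<eta> \<le> \<mu> / 4\<close> the weighted mass is at most \<mu>.\<close>
  define B where "B = H * ln (4 / \<mu>) + 32"
  define \<eta> where "\<eta> = min (min \<eta>1 \<eta>2) (min (1 / 2) (min (\<mu> / 4) (exp (- B) / 2)))"
  have \<eta>: "\<eta> > 0" "\<eta> \<le> \<eta>1" "\<eta> \<le> \<eta>2" "\<eta> \<le> 1 / 2" "\<eta> \<le> \<mu> / 4" "\<eta> \<le> exp (- B) / 2"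
    using \<eta>1(1) \<eta>2(1) \<mu> by (auto simp: \<eta>_def)
  have "\<bar>u x - u (x + p2)\<bar> \<le> e * W" if a: "concentrated \<eta> \<rho> u p h" and Wb: "\<forall>z. \<bar>u z - u (z + p2)\<bar> \<le> W" and x: "x \<in> far d" for \<rho> u p h W x
  proof (cases "W = 0")
    case True
    with Wb show ?thesis by (metis mult_zero_right)
  next
    case False
    have "0 \<le> W" using Wb by (meson abs_ge_zero order_trans)
    with False have W: "0 < W" by simp
    have a': "concentrated \<eta> \<rho> (\<lambda>z. u (z + p2)) (\<lambda>z. p (z + p2)) (\<lambda>z. h (z + p2))" by (rule concentrated_shift[OF a])
    note A = concentratedD[OF a] and A' = concentratedD[OF a']
    obtain x0 where x0: "\<And>z. u x0 \<le> u z" using u_min[OF a] by blast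
    define f where "f = (\<lambda>z. exp (- ((u z + u (z + p2)) / 2 - u x0) / H) * (u z - u (z + p2)))"
    define m where "m = tint (\<lambda>z. (exp (- ((u z + u (z + p2)) / 2 - u x0) / H))\<^sup>2 * (exp (u z) + exp (u (z + p2))))"
    have EB: "tint (\<lambda>z. (f z)\<^sup>2) \<le> (norm p2)\<^sup>2 * (W\<^sup>2 * (16 / H + 32 * m))" "bounded_borel (\<lambda>z. (f z)\<^sup>2)" "periodic L f"
      unfolding f_def m_def by (rule energy_bound[OF a Wb[rule_format] x0 H(1)])+
    have m: "m \<le> \<mu>"
    proof -
      have "m \<le> 2 * \<eta> + 2 * exp (- (ln (1 / (2 * \<eta>)) - 32) / H)"
        unfolding m_def by (rule weight_mass_bound[OF a \<eta>(1,4) x0 H(1)])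
      moreover have "exp (- (ln (1 / (2 * \<eta>)) - 32) / H) \<le> \<mu> / 4"
      proof -
        have "ln (2 * \<eta>) \<le> ln (exp (- B))" using \<eta>(1,6) by (subst ln_le_cancel_iff) auto
        then have "B \<le> ln (1 / (2 * \<eta>))" using \<eta>(1) by (simp add: ln_div)
        then have "H * ln (4 / \<mu>) \<le> ln (1 / (2 * \<eta>)) - 32" by (simp add: B_def)
        then have "ln (4 / \<mu>) \<le> (ln (1 / (2 * \<eta>)) - 32) / H" using H by (simp add: pos_le_divide_eq mult.commute)
        then have "exp (- ((ln (1 / (2 * \<eta>)) - 32) / H)) \<le> exp (- ln (4 / \<mu>))" by simp
        also have "\<dots> = \<mu> / 4" using \<mu> by (simp add: exp_minus)
        finally show ?thesis by (simp only: minus_divide_left)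
      qed
      ultimately show ?thesis using \<eta>(5) by linarith
    qed
    have fs: "z \<in> far s" "z + p2 \<in> far s" if "dist x z \<le> s" for z
    proof -
      show "z \<in> far s" using far_ball[OF x that] by (simp add: s_def)
      then show "z + p2 \<in> far s" using far_shift[OF p2_Z] by simp
    qed
    have w: "wdata (\<lambda>z. u z - u (z + p2)) (\<lambda>z. p z - p (z + p2)) (\<lambda>z. h z - h (z + p2)) (\<lambda>z. \<rho> * (1 - exp (u z)) - \<rho> * (1 - exp (u (z + p2))))"
      by (rule wdata_diff[OF A(1) A'(1)])
    have "\<bar>u x - u (x + p2)\<bar> \<le> (256 * e1 * W) / 4 * s\<^sup>2 + (e / 2 * W) / 2 + (exp C)\<^sup>2 / (2 * (e / 2 * W) * (pi * s\<^sup>2)) * (LINT z:cball x s|lborel. (f z)\<^sup>2)"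
    proof (rule mean_square_bound[OF w])
      fix z assume z: "dist x z \<le> s"
      have "\<bar>\<rho> * (1 - exp (u z)) - \<rho> * (1 - exp (u (z + p2)))\<bar> = \<rho> * \<bar>exp (u z) - exp (u (z + p2))\<bar>"
      proof -
        have "\<rho> * (1 - exp (u z)) - \<rho> * (1 - exp (u (z + p2))) = - (\<rho> * (exp (u z) - exp (u (z + p2))))" by (simp add: algebra_simps)
        then show ?thesis using A(7) by (simp add: abs_mult)
      qed
      also have "\<dots> \<le> 128 * ((e1 + e1) * W)"
      proof (rule mult_mono)
        have "\<bar>exp (u z) - exp (u (z + p2))\<bar> \<le> (exp (u z) + exp (u (z + p2))) * \<bar>u z - u (z + p2)\<bar>" by (rule exp_diff_le)
        also have "\<dots> \<le> (e1 + e1) * W"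
          using Wb e1 by (intro mult_mono add_mono \<eta>2(2)[OF concentrated_mono[OF a \<eta>(3)]] fs z) auto
        finally show "\<bar>exp (u z) - exp (u (z + p2))\<bar> \<le> (e1 + e1) * W" .
      qed (use A(8) in auto)
      finally show "\<bar>\<rho> * (1 - exp (u z)) - \<rho> * (1 - exp (u (z + p2)))\<bar> \<le> 256 * e1 * W" by simp
      have half: "(a + a') / 2 - b \<le> c" if "a \<le> b + c" "a' \<le> b + c" for a a' b c :: real using that by (simp add: field_simps)
      \<comment> \<open>Far from \<open>Z\<close> both functions exceed the minimum by at most
        \<open>C\<close>, so the weight is at least \<open>exp (- C)\<close> there, uniformly in
        \<open>H \<ge> 1\<close>.\<close>
      have "(u z + u (z + p2)) / 2 - u x0 \<le> C"
        using \<eta>1(3)[OF concentrated_mono[OF a \<eta>(2)] fs(1)[OF z], of x0] \<eta>1(3)[OF concentrated_mono[OF a \<eta>(2)] fs(2)[OF z], of x0]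
        by (rule half)
      then have "((u z + u (z + p2)) / 2 - u x0) / H \<le> C / H" using H(1) by (intro divide_right_mono) auto
      also have "\<dots> \<le> C / 1" using H(1) \<eta>1(2) by (intro divide_left_mono) auto
      finally have "exp (- C) \<le> exp (- ((u z + u (z + p2)) / 2 - u x0) / H)"
        by (simp only: exp_le_cancel_iff minus_divide_left[symmetric] neg_le_iff_le div_by_1)
      then have "exp (- C) * \<bar>u z - u (z + p2)\<bar> \<le> \<bar>f z\<bar>" by (simp add: f_def abs_mult mult_right_mono)
      then have "exp C * (exp (- C) * \<bar>u z - u (z + p2)\<bar>) \<le> exp C * \<bar>f z\<bar>" by (intro mult_left_mono) auto
      then show "\<bar>u z - u (z + p2)\<bar> \<le> exp C * \<bar>f z\<bar>" by (simp add: mult.assoc[symmetric] exp_minus)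
    next
      show "continuous_on UNIV f" unfolding f_def using H(1) by (intro continuous_intros A(9) A'(9)) auto
    qed (use s e W in auto)
    also have "(exp C)\<^sup>2 / (2 * (e / 2 * W) * (pi * s\<^sup>2)) * (LINT z:cball x s|lborel. (f z)\<^sup>2)
      \<le> (exp C)\<^sup>2 / (2 * (e / 2 * W) * (pi * s\<^sup>2)) * (N * ((norm p2)\<^sup>2 * (W\<^sup>2 * (16 / H + 32 * \<mu>))))"
    proof (rule mult_left_mono)
      have "(LINT z:cball x s|lborel. (f z)\<^sup>2) \<le> N * tint (\<lambda>z. (f z)\<^sup>2)"
        by (rule N(2)[OF EB(2)]) (use EB(3) in \<open>auto simp: periodic_def\<close>)
      also have "\<dots> \<le> N * ((norm p2)\<^sup>2 * (W\<^sup>2 * (16 / H + 32 * m)))" using EB(1) N(1) by (intro mult_left_mono) auto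
      also have "\<dots> \<le> N * ((norm p2)\<^sup>2 * (W\<^sup>2 * (16 / H + 32 * \<mu>)))" using m N(1) by (intro mult_left_mono) auto
      finally show "(LINT z:cball x s|lborel. (f z)\<^sup>2) \<le> N * ((norm p2)\<^sup>2 * (W\<^sup>2 * (16 / H + 32 * \<mu>)))" .
    qed (use W e s in simp)
    also have "(exp C)\<^sup>2 / (2 * (e / 2 * W) * (pi * s\<^sup>2)) * (N * ((norm p2)\<^sup>2 * (W\<^sup>2 * (16 / H + 32 * \<mu>)))) = W * (16 * (T / H) + 32 * (T * \<mu>))"
    proof -
      have "(exp C)\<^sup>2 / (2 * (e / 2 * W) * (pi * s\<^sup>2)) * (N * ((norm p2)\<^sup>2 * (W\<^sup>2 * X))) = W * (T * X)" for X
        using W by (simp add: T_def power2_eq_square[of W])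
      then show ?thesis by (simp add: distrib_left mult.left_commute)
    qed
    also have "\<dots> \<le> W * (16 * (e / 64) + 32 * (e / 128))"
    proof -
      have "T / H \<le> e / 64" using H T e by (simp add: field_simps)
      moreover have "T * \<mu> \<le> e / 128" using T by (simp add: \<mu>_def)
      ultimately show ?thesis using W by (intro mult_left_mono add_mono) auto
    qed
    also have "256 * e1 * W / 4 * s\<^sup>2 = e * W / 4" using s by (simp add: e1_def)
    finally show ?thesis using W e by (simp add: algebra_simps)
  qed
  then show ?thesis using \<eta>(1) by blast
qed

end

section \<open>Combining the two estimates: the half period\<close>

context blow
begin

text \<open>The difference changes only its sign under \<open>p2\<close>, so a neighbourhood of any
  point of \<open>Z\<close> can be moved to the origin, where the inner estimate is stated.\<close>

lemma abs_difference_shift: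
  fixes u :: "complex \<Rightarrow> real"
  assumes per: "periodic L u" and q: "q \<in> Z"
  shows "\<bar>u (z - q) - u (z - q + p2)\<bar> = \<bar>u z - u (z + p2)\<bar>"
proof (cases "q \<in> L")
  case True
  then show ?thesis using periodicD[OF per True, of "z - q"] periodicD[OF per True, of "z - q + p2"] by (simp add: add_ac)
next
  case False
  then have l: "q - p2 \<in> L" using q by (simp add: Z_def)
  have "u ((z - q + p2) + (q - p2)) = u (z - q + p2)" "u ((z - q + p2 + p2) + (q - p2)) = u (z - q + p2 + p2)"
    by (intro periodicD[OF per l])+
  then have "u z = u (z - q + p2)" "u (z + p2) = u (z - q)" using u_p2[OF per, of "z - q"] by (simp_all add: add_ac)
  then show ?thesis by (simp add: abs_minus_commute)
qed

text \<open>At a maximum point of \<open>\<bar>w\<bar>\<close> either the outer or the inner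
  estimate yields \<open>W \<le> W / 2\<close>. The outer one also supplies the boundary values that
  the inner one requires.\<close>

lemma half_period:
  "\<exists>\<eta>>0. \<forall>\<rho> u p h z. concentrated \<eta> \<rho> u p h \<longrightarrow> u (z + p2) = u z"
proof -
  obtain K where K: "K \<ge> 0" and in1: "\<And>\<delta>. 0 < \<delta> \<and> \<delta> \<le> d1 \<Longrightarrow> (\<exists>\<eta>>0. \<forall>\<rho> u p h W e. concentrated \<eta> \<rho> u p h \<longrightarrow> (\<forall>z. \<bar>u z - u (z + p2)\<bar> \<le> W) \<longrightarrow>
     (\<forall>z. norm z = \<delta> \<longrightarrow> \<bar>u z - u (z + p2)\<bar> \<le> e * W) \<longrightarrow> (\<forall>z. norm z \<le> \<delta> \<longrightarrow> \<bar>u z - u (z + p2)\<bar> \<le> K * (e + \<delta>\<^sup>2) * W))"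
    using inner_estimate by blast
  \<comment> \<open>With this \<open>e\<close> and \<open>\<delta> \<le> e \<le> 1\<close> the
    factor \<open>K * (e + \<delta>\<^sup>2)\<close> is at most
    \<open>2 * K * e \<le> 1 / 2\<close>.\<close>
  define e where "e = 1 / (4 * (K + 1))"
  define \<delta> where "\<delta> = min d1 e"
  have e: "e > 0" "e \<le> 1 / 4" "K * e \<le> 1 / 4" using K by (auto simp: e_def field_simps)
  have \<delta>: "\<delta> > 0" "\<delta> \<le> d1" "\<delta> \<le> e" using d1 e by (auto simp: \<delta>_def)
  have "\<delta>\<^sup>2 \<le> e * 1" unfolding power2_eq_square using \<delta> e by (intro mult_mono) auto
  then have "K * (e + \<delta>\<^sup>2) \<le> K * (e + e)" using K by (intro mult_left_mono) auto
  then have Ke: "K * (e + \<delta>\<^sup>2) \<le> 1 / 2" using e by (simp add: distrib_left)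
  obtain \<eta>1 where \<eta>1: "\<eta>1 > 0" "\<And>\<rho> u p h W e z. concentrated \<eta>1 \<rho> u p h \<Longrightarrow> (\<And>z. \<bar>u z - u (z + p2)\<bar> \<le> W) \<Longrightarrow>
     (\<And>z. norm z = \<delta> \<Longrightarrow> \<bar>u z - u (z + p2)\<bar> \<le> e * W) \<Longrightarrow> norm z \<le> \<delta> \<Longrightarrow> \<bar>u z - u (z + p2)\<bar> \<le> K * (e + \<delta>\<^sup>2) * W"
    using in1[OF conjI[OF \<delta>(1,2)]] by blast
  obtain \<eta>2 where \<eta>2: "\<eta>2 > 0" "\<And>\<rho> u p h W x. concentrated \<eta>2 \<rho> u p h \<Longrightarrow> (\<And>z. \<bar>u z - u (z + p2)\<bar> \<le> W) \<Longrightarrow> x \<in> far \<delta> \<Longrightarrow> \<bar>u x - u (x + p2)\<bar> \<le> e * W"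
    using outer_small[OF \<delta>(1) e(1)] by blast
  define \<eta> where "\<eta> = min \<eta>1 \<eta>2"
  have \<eta>: "\<eta> > 0" "\<eta> \<le> \<eta>1" "\<eta> \<le> \<eta>2" using \<eta>1 \<eta>2 by (auto simp: \<eta>_def)
  have "u (z + p2) = u z" if a: "concentrated \<eta> \<rho> u p h" for \<rho> u p h z
  proof -
    note A = concentratedD[OF a] and A' = concentratedD[OF concentrated_shift[OF a]]
    have "continuous_on UNIV (\<lambda>z. \<bar>u z - u (z + p2)\<bar>)" "periodic L (\<lambda>z. \<bar>u z - u (z + p2)\<bar>)"
      using A(2) A'(2) by (auto simp: periodic_def intro!: continuous_intros A(9) A'(9))
    from periodic_max[OF this] obtain x where x: "\<And>z. \<bar>u z - u (z + p2)\<bar> \<le> \<bar>u x - u (x + p2)\<bar>" by blast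
    define W where "W = \<bar>u x - u (x + p2)\<bar>"
    have W: "\<bar>u z - u (z + p2)\<bar> \<le> W" for z unfolding W_def by (rule x)
    have W0: "0 \<le> W" by (simp add: W_def)
    have out: "\<bar>u y - u (y + p2)\<bar> \<le> e * W" if "y \<in> far \<delta>" for y
      by (rule \<eta>2(2)[OF concentrated_mono[OF a \<eta>(3)] W that])
    have inn: "\<bar>u y - u (y + p2)\<bar> \<le> 1 / 2 * W" if y: "norm y \<le> \<delta>" for y
    proof -
      have "\<bar>u y - u (y + p2)\<bar> \<le> K * (e + \<delta>\<^sup>2) * W"
      proof (rule \<eta>1(2)[OF concentrated_mono[OF a \<eta>(2)] W _ y])
        show "\<bar>u z - u (z + p2)\<bar> \<le> e * W" if "norm z = \<delta>" for z
          by (rule out, rule far_annulus) (use that \<delta> d1 d0(1) in auto)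
      qed
      also have "\<dots> \<le> 1 / 2 * W" by (rule mult_right_mono[OF Ke W0])
      finally show ?thesis .
    qed
    have "W \<le> 1 / 2 * W"
    proof (cases "x \<in> far \<delta>")
      case True
      have "W \<le> e * W" using out[OF True] by (simp add: W_def)
      also have "\<dots> \<le> 1 / 2 * W" using e W0 by (intro mult_right_mono) auto
      finally show ?thesis .
    next
      case False
      then obtain q where q: "q \<in> Z" "norm (x - q) \<le> \<delta>" by (auto simp: far_def not_le dist_norm intro: less_imp_le)
      show ?thesis using inn[OF q(2)] unfolding abs_difference_shift[OF A(2) q(1)] W_def .
    qed
    then have "W = 0" using W0 by simp
    then show ?thesis using W[of z] by simp
  qed
  then show ?thesis using \<eta>(1) by blast
qed
end

subsection \<open>Classical solutions and blow-up sequences\<close>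

lemma line_derivative:
  fixes f :: "complex \<Rightarrow> real"
  assumes "\<And>z. (f has_derivative f' z) (at z)"
  shows "((\<lambda>t. f (z + of_real t * v)) has_real_derivative f' (z + of_real t * v) v) (at t)"
proof -
  have s: "((\<lambda>t. z + of_real t * v) has_derivative (\<lambda>t. of_real t * v)) (at t)" by (auto intro!: derivative_eq_intros)
  have l: "linear (f' (z + of_real t * v))" by (rule has_derivative_linear[OF assms])
  have "f' (z + of_real t * v) (of_real h * v) = h * f' (z + of_real t * v) v" for h
    using linear_scale[OF l, of h v] by (simp add: scaleR_conv_of_real)
  then show ?thesis unfolding has_field_derivative_def
    by (intro has_derivative_eq_rhs[OF has_derivative_compose[OF s assms]]) (auto simp: fun_eq_iff)
qed

lemma dir_deriv_eq:
  assumes "\<And>z. (f has_derivative f' z) (at z)"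
  shows "dir_deriv v f = (\<lambda>z. f' z v)"
proof
  show "dir_deriv v f z = f' z v" for z
    unfolding dir_deriv_def using DERIV_imp_deriv[OF line_derivative[OF assms, where t = 0 and z = z and v = v]] by simp
qed

lemma second_difference:
  fixes f :: "complex \<Rightarrow> real"
  assumes f: "\<And>z. (f has_derivative f' z) (at z)" and fa: "\<And>z. ((\<lambda>z. f' z a) has_derivative f'' z) (at z)" and t: "0 < t"
  obtains \<xi> where "dist z \<xi> \<le> t * (norm a + norm b)"
    "f (z + of_real t * a + of_real t * b) - f (z + of_real t * a) - f (z + of_real t * b) + f z = t\<^sup>2 * f'' \<xi> b"
proof -
  let ?g = "\<lambda>s. f ((z + of_real t * b) + of_real s * a) - f (z + of_real s * a)"
  have "(?g has_real_derivative f' ((z + of_real t * b) + of_real s * a) a - f' (z + of_real s * a) a) (at s)" for s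
    by (intro DERIV_diff line_derivative f)
  from MVT2[OF t, of ?g, OF this] obtain s where s: "0 < s" "s < t"
    "?g t - ?g 0 = (t - 0) * (f' ((z + of_real t * b) + of_real s * a) a - f' (z + of_real s * a) a)" by blast
  let ?k = "\<lambda>r. f' ((z + of_real s * a) + of_real r * b) a"
  have "(?k has_real_derivative f'' ((z + of_real s * a) + of_real r * b) b) (at r)" for r
    by (rule line_derivative[OF fa])
  from MVT2[OF t, of ?k, OF this] obtain r where r: "0 < r" "r < t" "?k t - ?k 0 = (t - 0) * f'' ((z + of_real s * a) + of_real r * b) b" by blast
  show ?thesis
  proof (rule that[of "(z + of_real s * a) + of_real r * b"])
    have "norm (of_real s * a + of_real r * b) \<le> s * norm a + r * norm b"
      using norm_triangle_ineq[of "of_real s * a" "of_real r * b"] s r by (simp add: norm_mult)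
    also have "\<dots> \<le> t * norm a + t * norm b" using s r by (intro add_mono mult_right_mono) auto
    finally show "dist z ((z + of_real s * a) + of_real r * b) \<le> t * (norm a + norm b)"
      unfolding dist_commute[of z] by (simp add: dist_norm distrib_left add.assoc)
    have "?g t - ?g 0 = t * (?k t - ?k 0)" using s(3) by (simp add: add_ac)
    then show "f (z + of_real t * a + of_real t * b) - f (z + of_real t * a) - f (z + of_real t * b) + f z = t\<^sup>2 * f'' ((z + of_real s * a) + of_real r * b) b"
      using r(3) by (simp add: power2_eq_square add_ac)
  qed
qed

text \<open>The mixed second difference is symmetric in the two directions. The mean value theorem,
  applied twice in either order, expresses it by one or the other mixed derivative at a point that
  tends to \<open>z\<close>.\<close>

lemma second_derivative_symmetric:
  fixes f :: "complex \<Rightarrow> real"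
  assumes f: "\<And>z. (f has_derivative f' z) (at z)"
    and fa: "\<And>z. ((\<lambda>z. f' z a) has_derivative f''a z) (at z)" and fb: "\<And>z. ((\<lambda>z. f' z b) has_derivative f''b z) (at z)"
    and c: "continuous_on UNIV (\<lambda>z. f''a z b)" "continuous_on UNIV (\<lambda>z. f''b z a)"
  shows "f''a z b = f''b z a"
proof -
  let ?t = "\<lambda>n. 1 / real (Suc n)"
  have "\<exists>x y. dist z x \<le> ?t n * (norm a + norm b) \<and> dist z y \<le> ?t n * (norm b + norm a) \<and> f''a x b = f''b y a" for n
  proof -
    have t: "0 < ?t n" by simp
    obtain x where x: "dist z x \<le> ?t n * (norm a + norm b)"
      "f (z + of_real (?t n) * a + of_real (?t n) * b) - f (z + of_real (?t n) * a) - f (z + of_real (?t n) * b) + f z = (?t n)\<^sup>2 * f''a x b"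
      by (rule second_difference[OF f fa t])
    obtain y where y: "dist z y \<le> ?t n * (norm b + norm a)"
      "f (z + of_real (?t n) * b + of_real (?t n) * a) - f (z + of_real (?t n) * b) - f (z + of_real (?t n) * a) + f z = (?t n)\<^sup>2 * f''b y a"
      by (rule second_difference[OF f fb t])
    have "f (z + of_real (?t n) * b + of_real (?t n) * a) = f (z + of_real (?t n) * a + of_real (?t n) * b)" by (simp only: add_ac)
    with x(2) y(2) have "(?t n)\<^sup>2 * f''a x b = (?t n)\<^sup>2 * f''b y a" by linarith
    then have "f''a x b = f''b y a" using t by simp
    with x(1) y(1) show ?thesis by blast
  qed
  then obtain x y where xy: "\<And>n. dist z (x n) \<le> ?t n * (norm a + norm b)" "\<And>n. dist z (y n) \<le> ?t n * (norm b + norm a)" "\<And>n. f''a (x n) b = f''b (y n) a"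
    by metis
  have lim: "w \<longlonglongrightarrow> z" if "\<And>n. dist z (w n) \<le> ?t n * C" for w :: "nat \<Rightarrow> complex" and C
  proof -
    have "(\<lambda>n. ?t n * C) \<longlonglongrightarrow> 0 * C" by (intro tendsto_mult tendsto_const LIMSEQ_Suc lim_1_over_n)
    then have lim0: "(\<lambda>n. ?t n * C) \<longlonglongrightarrow> 0" by (simp only: mult_zero_left)
    have "\<forall>\<^sub>F n in sequentially. dist (w n) z \<le> ?t n * C" using that by (intro always_eventually allI) (simp only: dist_commute)
    from tendsto_sandwich[OF _ this tendsto_const lim0] have "(\<lambda>n. dist (w n) z) \<longlonglongrightarrow> 0" by simp
    then show ?thesis by (rule tendsto_dist_iff[THEN iffD2])
  qed
  have "(\<lambda>n. f''a (x n) b) \<longlonglongrightarrow> f''a z b" by (rule continuous_on_tendsto_compose[OF c(1) lim[OF xy(1)]]) auto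
  moreover have "(\<lambda>n. f''a (x n) b) \<longlonglongrightarrow> f''b z a"
    unfolding xy(3) by (rule continuous_on_tendsto_compose[OF c(2) lim[OF xy(2)]]) auto
  ultimately show ?thesis by (rule LIMSEQ_unique)
qed

text \<open>The conjugate derivative of \<open>p\<close> has as imaginary part a quarter of the
  difference of the mixed second derivatives. Their symmetry makes it the real number
  \<open>laplacian f z / 4\<close>.\<close>

lemma C2_wdata:
  assumes "C2 f"
  obtains p h where "wdata f p h (laplacian f)"
proof -
  from assms obtain f' :: "complex \<Rightarrow> complex \<Rightarrow>\<^sub>L real" and f'' :: "complex \<Rightarrow> complex \<Rightarrow>\<^sub>L complex \<Rightarrow>\<^sub>L real" where
    f: "\<And>z. (f has_derivative blinfun_apply (f' z)) (at z)" and f': "\<And>z. (f' has_derivative blinfun_apply (f'' z)) (at z)"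
    and c: "continuous_on UNIV f''" unfolding C2_def by blast
  have d: "((\<lambda>z. blinfun_apply (f' z) v) has_derivative (\<lambda>w. blinfun_apply (blinfun_apply (f'' z) w) v)) (at z)" for z v
    by (rule has_derivative_eq_rhs[OF blinfun.FDERIV[OF f' has_derivative_const]]) (auto simp: blinfun.zero_right)
  have cc: "continuous_on UNIV (\<lambda>z. blinfun_apply (blinfun_apply (f'' z) w) v)" for w v by (intro continuous_intros c)
  have sym: "f'' z \<i> 1 = f'' z 1 \<i>" for z
    by (rule second_derivative_symmetric[OF f d d cc cc])
  have lap: "laplacian f z = f'' z 1 1 + f'' z \<i> \<i>" for z
    unfolding laplacian_def dir_deriv_eq[OF f] dir_deriv_eq[OF d] ..
  have ex: "\<And>g :: complex \<Rightarrow>\<^sub>L real. blinfun_apply g v = Re v * g 1 + Im v * g \<i>" "\<And>G :: complex \<Rightarrow>\<^sub>L complex \<Rightarrow>\<^sub>L real. G v = Re v *\<^sub>R G 1 + Im v *\<^sub>R G \<i>" for v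
  proof -
    have v: "v = Re v *\<^sub>R 1 + Im v *\<^sub>R \<i>" by (simp add: complex_eq_iff)
    show "blinfun_apply g v = Re v * g 1 + Im v * g \<i>" for g :: "complex \<Rightarrow>\<^sub>L real"
      by (subst v) (simp only: blinfun.add_right blinfun.scaleR_right real_scaleR_def)
    show "G v = Re v *\<^sub>R G 1 + Im v *\<^sub>R G \<i>" for G :: "complex \<Rightarrow>\<^sub>L complex \<Rightarrow>\<^sub>L real"
      by (subst v) (simp only: blinfun.add_right blinfun.scaleR_right)
  qed
  define p where "p = (\<lambda>z. (of_real (f' z 1) - \<i> * of_real (f' z \<i>)) / 2)"
  define h where "h = (\<lambda>z. (of_real (f'' z 1 1 - f'' z \<i> \<i>) - 2 * \<i> * of_real (f'' z 1 \<i>)) / 4)"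
  have "wdata f p h (laplacian f)"
    unfolding wdata_def
  proof (intro conjI allI)
    show "(f has_derivative (\<lambda>v. 2 * Re (p z * v))) (at z)" for z
    proof -
      have "blinfun_apply (f' z) = (\<lambda>v. 2 * Re (p z * v))"
      proof
        show "f' z v = 2 * Re (p z * v)" for v by (subst ex(1)) (simp add: p_def mult.commute)
      qed
      then show ?thesis using f[of z] by simp
    qed
    show "wirt p (h z) (of_real (laplacian f z / 4)) z" for z
    proof -
      have "(p has_derivative (\<lambda>v. (of_real (f'' z v 1) - \<i> * of_real (f'' z v \<i>)) / 2)) (at z)"
        unfolding p_def by (auto intro!: derivative_eq_intros f' simp: fun_eq_iff field_simps)
      moreover have "(of_real (f'' z v 1) - \<i> * of_real (f'' z v \<i>)) / 2 = h z * v + of_real (laplacian f z / 4) * cnj v" for v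
      proof -
        have "f'' z v 1 = Re v * f'' z 1 1 + Im v * f'' z 1 \<i>" "f'' z v \<i> = Re v * f'' z 1 \<i> + Im v * f'' z \<i> \<i>"
          by (simp_all add: ex(2)[of "f'' z" v] blinfun.add_left blinfun.scaleR_left sym)
        then show ?thesis unfolding h_def lap by (simp add: complex_eq_iff field_simps)
      qed
      ultimately show ?thesis unfolding wirt_def by simp
    qed
    show "continuous_on UNIV h" "continuous_on UNIV (laplacian f)"
      unfolding h_def lap[abs_def] by (intro continuous_intros cc; simp)+
  qed
  then show ?thesis by (rule that)
qed

section \<open>Test functions, and passage from blow-up to concentration\<close>

definition tent :: "complex set \<Rightarrow> real \<Rightarrow> complex \<Rightarrow> real" where
  "tent A r z = max 0 (1 - infdist z A / r)"

lemma tent_continuous: "r > 0 \<Longrightarrow> continuous_on S (tent A r)"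
  unfolding tent_def[abs_def] by (intro continuous_intros) auto

lemma tent_bounds: "r > 0 \<Longrightarrow> 0 \<le> tent A r z" "r > 0 \<Longrightarrow> tent A r z \<le> 1"
  using infdist_nonneg[of z A] by (auto simp: tent_def)

lemma tent_member: "z \<in> A \<Longrightarrow> tent A r z = 1"
  by (simp add: tent_def)

lemma tent_far:
  assumes "\<And>q. q \<in> A \<Longrightarrow> r \<le> dist z q" "A \<noteq> {}" "r > 0"
  shows "tent A r z = 0"
proof -
  have "r \<le> infdist z A" using assms unfolding infdist_notempty[OF assms(2)] by (intro cINF_greatest) auto
  then show ?thesis using assms(3) by (simp add: tent_def)
qed

lemma tent_periodic:
  assumes A: "discrete_subgroup A"
  shows "periodic A (tent A r)"
  unfolding periodic_def
proof (intro ballI allI)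
  have le: "infdist (z + l) A \<le> infdist z A" if l: "l \<in> A" for z l
  proof -
    have ne: "A \<noteq> {}" using l by blast
    show ?thesis unfolding infdist_notempty[OF ne, of z]
    proof (rule cINF_greatest[OF ne])
      fix a assume "a \<in> A"
      then have "infdist (z + l) A \<le> dist (z + l) (a + l)" by (intro infdist_le discrete_subgroupD(4)[OF A] l)
      then show "infdist (z + l) A \<le> dist z a" by simp
    qed
  qed
  fix l z assume l: "l \<in> A"
  have "infdist (z + l) A = infdist z A"
    using le[OF l, of z] le[OF discrete_subgroupD(3)[OF A l], of "z + l"] by simp
  then show "tent A r (z + l) = tent A r z" by (simp add: tent_def)
qed

context torus
begin

text \<open>Replacing the part of the domain that lies in translates of the ball by the ball itself
  keeps representatives unique, since the translates of the ball are disjoint. A function supported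
  near \<open>L\<close> can then be integrated over a single disc.\<close>

lemma fd_through_ball:
  assumes r: "\<And>l. l \<in> L \<Longrightarrow> l \<noteq> 0 \<Longrightarrow> 2 * r \<le> norm l"
  shows "fundamental_domain L (ball 0 r \<union> (fund_domain L - (\<Union>l\<in>L. ball l r)))"
  unfolding fundamental_domain_def
proof (intro conjI allI)
  have "open (\<Union>l\<in>L. ball l r)" by auto
  then show "ball 0 r \<union> (fund_domain L - (\<Union>l\<in>L. ball l r)) \<in> sets borel" by auto
  show "bounded (ball 0 r \<union> (fund_domain L - (\<Union>l\<in>L. ball l r)))" using fd_bounded by (auto intro: bounded_subset)
  fix z
  have inv: "z - l \<in> (\<Union>l\<in>L. ball l r) \<longleftrightarrow> z \<in> (\<Union>l\<in>L. ball l r)" if l: "l \<in> L" for l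
  proof
    assume "z - l \<in> (\<Union>l\<in>L. ball l r)"
    then obtain m where "m \<in> L" "dist m (z - l) < r" by auto
    then have "m + l \<in> L" "dist (m + l) z < r" using discrete_subgroupD(4)[OF L \<open>m \<in> L\<close> l] by (simp_all add: dist_norm algebra_simps)
    then show "z \<in> (\<Union>l\<in>L. ball l r)" by auto
  next
    assume "z \<in> (\<Union>l\<in>L. ball l r)"
    then obtain m where "m \<in> L" "dist m z < r" by auto
    then have "m - l \<in> L" "dist (m - l) (z - l) < r" using discrete_subgroupD(2)[OF L \<open>m \<in> L\<close> l] by (simp_all add: dist_norm)
    then show "z - l \<in> (\<Union>l\<in>L. ball l r)" by (intro UN_I[of "m - l"]) (simp_all only: mem_ball)
  qed
  show "\<exists>!l. l \<in> L \<and> z - l \<in> ball 0 r \<union> (fund_domain L - (\<Union>l\<in>L. ball l r))"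
  proof (cases "z \<in> (\<Union>l\<in>L. ball l r)")
    case True
    then obtain m where m: "m \<in> L" "norm (z - m) < r" by (auto simp: dist_norm norm_minus_commute)
    show ?thesis
    proof (rule ex1I[of _ m])
      show "m \<in> L \<and> z - m \<in> ball 0 r \<union> (fund_domain L - (\<Union>l\<in>L. ball l r))" using m by simp
      fix l assume l: "l \<in> L \<and> z - l \<in> ball 0 r \<union> (fund_domain L - (\<Union>l\<in>L. ball l r))"
      then have "norm (z - l) < r" using inv True by auto
      then have "norm (m - l) < 2 * r" using norm_triangle_ineq4[of "z - l" "z - m"] m(2) by simp
      then show "l = m" using r[OF discrete_subgroupD(2)[OF L m(1), of l]] l by force
    qed
  next
    case False
    have eq: "l \<in> L \<Longrightarrow> z - l \<in> ball 0 r \<union> (fund_domain L - (\<Union>l\<in>L. ball l r)) \<longleftrightarrow> z - l \<in> fund_domain L" for l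
      using inv[of l] False discrete_subgroupD(1)[OF L] by blast
    obtain l where l: "l \<in> L" "z - l \<in> fund_domain L" "\<And>l'. l' \<in> L \<Longrightarrow> z - l' \<in> fund_domain L \<Longrightarrow> l' = l"
      using fundamental_domain_obtain[OF fd, of z] by blast
    show ?thesis
    proof (rule ex1I[of _ l])
      show "l \<in> L \<and> z - l \<in> ball 0 r \<union> (fund_domain L - (\<Union>l\<in>L. ball l r))" using l(1,2) eq[OF l(1)] by (simp only: simp_thms)
      show "m = l" if "m \<in> L \<and> z - m \<in> ball 0 r \<union> (fund_domain L - (\<Union>l\<in>L. ball l r))" for m
        by (rule l(3)) (use that eq[of m] in \<open>simp_all only: simp_thms\<close>)
    qed
  qed
qed

lemma tent_mass_le:
  assumes r: "r > 0" "\<And>l. l \<in> L \<Longrightarrow> l \<noteq> 0 \<Longrightarrow> 2 * r \<le> norm l"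
    and f: "continuous_on UNIV f" "periodic L f" "\<And>z. 0 \<le> f z"
  shows "tint (\<lambda>z. f z * tent L r (z - c)) \<le> (LINT z:cball c r|lborel. f z)"
proof -
  let ?D = "(+) c ` (ball 0 r \<union> (fund_domain L - (\<Union>l\<in>L. ball l r)))"
  have D: "fundamental_domain L ?D" by (rule fd_translate[OF fd_through_ball[OF r(2)]])
  have "continuous_on UNIV (\<lambda>z. tent L r (z - c))"
    by (rule continuous_on_compose2[OF tent_continuous[OF r(1), of UNIV]]) (auto intro!: continuous_intros)
  then have cg: "continuous_on UNIV (\<lambda>z. f z * tent L r (z - c))" by (intro continuous_intros f)
  have pg: "periodic L (\<lambda>z. f z * tent L r (z - c))"
    unfolding periodic_def
  proof (intro ballI allI)
    fix l z assume l: "l \<in> L"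
    show "f (z + l) * tent L r (z + l - c) = f z * tent L r (z - c)"
      using periodicD[OF f(2) l, of z] periodicD[OF tent_periodic[OF L] l, of r "z - c"] by (simp add: algebra_simps)
  qed
  obtain B where B: "\<And>z. \<bar>f z * tent L r (z - c)\<bar> \<le> B" using bounded_borel_continuous[OF cg pg] by (auto simp: bounded_borel_def)
  have "tint (\<lambda>z. f z * tent L r (z - c)) = (LINT z:?D|lborel. f z * tent L r (z - c))"
    unfolding torus_integral_def
    by (rule fd_integral_eq[OF L fd D borel_measurable_continuous_onI[OF cg] B pg])
  also have "\<dots> \<le> (LINT z:cball c r|lborel. f z)"
    unfolding set_lebesgue_integral_def
  proof (rule integral_mono)
    show "integrable lborel (\<lambda>z. indicator ?D z *\<^sub>R (f z * tent L r (z - c)))"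
      using set_integrable_bounded[OF borel_measurable_continuous_onI[OF cg] B, of ?D] D by (simp add: fundamental_domain_def set_integrable_def)
    show "integrable lborel (\<lambda>z. indicator (cball c r) z *\<^sub>R f z)"
      using set_integrable_continuous_cball[OF f(1)] by (simp add: set_integrable_def)
    fix z
    show "indicator ?D z *\<^sub>R (f z * tent L r (z - c)) \<le> indicator (cball c r) z *\<^sub>R f z"
    proof (cases "z \<in> ?D")
      case True
      then have zc: "z - c \<in> ball 0 r \<union> (fund_domain L - (\<Union>l\<in>L. ball l r))" by auto
      show ?thesis
      proof (cases "z - c \<in> ball 0 r")
        case True
        then have "z \<in> cball c r" by (simp add: dist_norm norm_minus_commute)
        moreover have "f z * tent L r (z - c) \<le> f z * 1" using tent_bounds[OF r(1)] by (intro mult_left_mono f(3))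
        ultimately show ?thesis using \<open>z \<in> ?D\<close> by simp
      next
        case False
        have "tent L r (z - c) = 0"
          by (rule tent_far) (use zc False discrete_subgroupD(1)[OF L] r in \<open>auto simp: not_less dist_commute\<close>)
        then show ?thesis using f(3)[of z] by simp
      qed
    qed (use f(3)[of z] in simp)
  qed
  finally show ?thesis .
qed

end

context blow
begin

text \<open>Each bound in \<open>concentrated\<close> follows by testing the weak convergence with
  finitely many tents. Continuous tests cannot be indicator functions, which is why the bounds in
  \<open>concentrated\<close> are weaker than the limiting values.\<close>

lemma eventually_concentrated:
  assumes b: "blows_up_at L u \<rho> [0, p2]" and one: "\<And>n. tint (\<lambda>z. exp (u n z)) = 1" and even: "\<And>n z. u n (- z) = u n z"
    and \<eta>: "\<eta> > 0"
  shows "\<forall>\<^sub>F n in sequentially. \<exists>p h. concentrated \<eta> (\<rho> n) (u n) p h"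
proof -
  define r where "r = min \<eta> d0"
  have r: "r > 0" "r \<le> \<eta>" "r \<le> d0" using \<eta> d0(1) by (auto simp: r_def)
  have r2: "2 * r \<le> norm q" if "q \<in> Z" "q \<noteq> 0" for q using d0(2)[OF that] r d0(1) by linarith
  have sol: "mean_field_solution L (\<rho> n) (u n)" for n using b by (simp add: blows_up_at_def)
  have per: "periodic L (u n)" and C2: "C2 (u n)" for n using sol by (auto simp: mean_field_solution_def)
  have lap: "laplacian (u n) = (\<lambda>z. \<rho> n * (1 - exp (u n z)))" for n
  proof
    fix z
    have "laplacian (u n) z + \<rho> n * (exp (u n z) / 1 - 1 / 1) = 0" using sol[of n] one[of n] area by (simp add: mean_field_solution_def)
    then show "laplacian (u n) z = \<rho> n * (1 - exp (u n z))" by (simp add: algebra_simps)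
  qed
  have ex: "\<exists>p h. wdata (u n) p h (\<lambda>z. \<rho> n * (1 - exp (u n z)))" for n
    using C2_wdata[OF C2] unfolding lap by blast
  have cu: "continuous_on UNIV (u n)" for n using ex[of n] wdataD(6) by blast
  have ce: "continuous_on UNIV (\<lambda>z. exp (u n z))" for n by (intro continuous_intros cu)
  have pe: "periodic L (\<lambda>z. exp (u n z))" for n using per[of n] by (simp add: periodic_def)
  have \<rho>: "\<rho> \<longlonglongrightarrow> 16 * pi" using b by (simp add: blows_up_at_def)
  have test: "(\<lambda>n. \<rho> n * tint (\<lambda>z. exp (u n z) * \<phi> z)) \<longlonglongrightarrow> 8 * pi * (\<phi> 0 + \<phi> p2)"
    if \<phi>: "continuous_on UNIV \<phi>" "periodic L \<phi>" for \<phi>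
  proof -
    have "(\<lambda>n. tint (\<lambda>z. \<rho> n * (exp (u n z) / tint (\<lambda>w. exp (u n w))) * \<phi> z)) \<longlonglongrightarrow> 8 * pi * (\<Sum>q\<leftarrow>[0, p2]. \<phi> q)"
      using b \<phi> by (simp add: blows_up_at_def)
    then show ?thesis by (simp add: one mult.assoc tint_cmult)
  qed
  have ev\<rho>: "\<forall>\<^sub>F n in sequentially. 8 * pi < \<rho> n" "\<forall>\<^sub>F n in sequentially. \<rho> n < 32 * pi"
    by (rule order_tendstoD[OF \<rho>]; simp)+
  have ZL: "periodic Z f \<Longrightarrow> periodic L f" for f :: "complex \<Rightarrow> real" using L_subset_Z by (auto simp: periodic_def)
  \<comment> \<open>The test function vanishes at both blow-up points and equals 1 on
    \<open>far \<eta>\<close>, so the limit is 0.\<close>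
  have evfar: "\<forall>\<^sub>F n in sequentially. \<rho> n * tint (\<lambda>z. exp (u n z) * (1 - tent Z \<eta> z)) < \<eta>"
  proof (rule order_tendstoD(2))
    show "(\<lambda>n. \<rho> n * tint (\<lambda>z. exp (u n z) * (1 - tent Z \<eta> z))) \<longlonglongrightarrow> 8 * pi * ((1 - tent Z \<eta> 0) + (1 - tent Z \<eta> p2))"
      by (rule test) (use ZL[OF tent_periodic[OF discrete_subgroup_Z], of \<eta>] \<eta> in \<open>auto intro!: continuous_intros tent_continuous simp: periodic_def\<close>)
    show "8 * pi * ((1 - tent Z \<eta> 0) + (1 - tent Z \<eta> p2)) < \<eta>"
      using \<eta> by (simp add: tent_member discrete_subgroupD(1)[OF discrete_subgroup_Z] p2_Z)
  qed
  \<comment> \<open>The tent is 1 at \<open>c\<close> and nonnegative at the other blow-up point,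
    hence the limit is at least \<open>8 * pi\<close>; subtracting 1 gives a strict bound.\<close>
  have evball: "\<forall>\<^sub>F n in sequentially. 8 * pi * 1 - 1 < \<rho> n * tint (\<lambda>z. exp (u n z) * tent L r (z - c))" if c: "c = 0 \<or> c = p2" for c
  proof (rule order_tendstoD(1))
    let ?\<phi> = "\<lambda>z. tent L r (z - c)"
    show "(\<lambda>n. \<rho> n * tint (\<lambda>z. exp (u n z) * ?\<phi> z)) \<longlonglongrightarrow> 8 * pi * (?\<phi> 0 + ?\<phi> p2)"
    proof (rule test)
      show "continuous_on UNIV ?\<phi>" by (rule continuous_on_compose2[OF tent_continuous[OF r(1), of UNIV]]) (auto intro!: continuous_intros)
      show "periodic L ?\<phi>" using tent_periodic[OF L, of r] by (auto simp: periodic_def add_diff_eq[symmetric] add_ac diff_add_eq[symmetric])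
    qed
    have "1 \<le> ?\<phi> 0 + ?\<phi> p2"
      using c tent_member[OF discrete_subgroupD(1)[OF L], of r] tent_bounds(1)[OF r(1)] by auto
    then have "8 * pi * 1 \<le> 8 * pi * (?\<phi> 0 + ?\<phi> p2)" by (intro mult_left_mono) auto
    then show "8 * pi * 1 - 1 < 8 * pi * (?\<phi> 0 + ?\<phi> p2)" by linarith
  qed
  have "\<forall>\<^sub>F n in sequentially. 8 * pi < \<rho> n \<and> \<rho> n < 32 * pi \<and> \<rho> n < 17 * pi \<and> \<rho> n * tint (\<lambda>z. exp (u n z) * (1 - tent Z \<eta> z)) < \<eta> \<and>
     8 * pi * 1 - 1 < \<rho> n * tint (\<lambda>z. exp (u n z) * tent L r (z - 0)) \<and> 8 * pi * 1 - 1 < \<rho> n * tint (\<lambda>z. exp (u n z) * tent L r (z - p2))"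
    by (intro eventually_conj ev\<rho> evfar evball order_tendstoD(2)[OF \<rho>]) auto
  then show ?thesis
  proof (rule eventually_mono)
    fix n
    assume *: "8 * pi < \<rho> n \<and> \<rho> n < 32 * pi \<and> \<rho> n < 17 * pi \<and> \<rho> n * tint (\<lambda>z. exp (u n z) * (1 - tent Z \<eta> z)) < \<eta> \<and>
     8 * pi * 1 - 1 < \<rho> n * tint (\<lambda>z. exp (u n z) * tent L r (z - 0)) \<and> 8 * pi * 1 - 1 < \<rho> n * tint (\<lambda>z. exp (u n z) * tent L r (z - p2))"
    obtain p h where ph: "wdata (u n) p h (\<lambda>z. \<rho> n * (1 - exp (u n z)))" using ex by blast
    have far: "tint (\<lambda>z. indicator (far \<eta>) z * exp (u n z)) \<le> \<eta>"
    proof -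
      have cg: "continuous_on UNIV (\<lambda>z. exp (u n z) * (1 - tent Z \<eta> z))" by (intro continuous_intros ce tent_continuous \<eta>)
      have pg: "periodic L (\<lambda>z. exp (u n z) * (1 - tent Z \<eta> z))" using pe[of n] ZL[OF tent_periodic[OF discrete_subgroup_Z], of \<eta>] by (simp add: periodic_def)
      have t: "bounded_borel (\<lambda>z. exp (u n z) * (1 - tent Z \<eta> z))" by (rule bounded_borel_continuous[OF cg pg])
      have "bounded_borel (indicator (far \<eta>))"
        unfolding bounded_borel_def using closed_far by (auto intro!: borel_measurable_indicator exI[of _ 1] simp: indicator_def)
      then have t': "bounded_borel (\<lambda>z. indicator (far \<eta>) z * exp (u n z))" by (rule bounded_borel_mult[OF _ bounded_borel_continuous[OF ce pe]])
      have "tint (\<lambda>z. indicator (far \<eta>) z * exp (u n z)) \<le> tint (\<lambda>z. exp (u n z) * (1 - tent Z \<eta> z))"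
      proof (rule tint_mono[OF t' t])
        fix z
        show "indicator (far \<eta>) z * exp (u n z) \<le> exp (u n z) * (1 - tent Z \<eta> z)"
        proof (cases "z \<in> far \<eta>")
          case True
          then have "tent Z \<eta> z = 0" using discrete_subgroupD(1)[OF discrete_subgroup_Z] \<eta> by (intro tent_far) (auto simp: far_def)
          then show ?thesis using True by simp
        qed (use tent_bounds(2)[OF \<eta>, of Z z] in simp)
      qed
      moreover have "0 \<le> tint (\<lambda>z. exp (u n z) * (1 - tent Z \<eta> z))"
        by (rule tint_nonneg[OF t]) (use tent_bounds(2)[OF \<eta>] in simp)
      moreover have "tint (\<lambda>z. exp (u n z) * (1 - tent Z \<eta> z)) * 1 \<le> tint (\<lambda>z. exp (u n z) * (1 - tent Z \<eta> z)) * \<rho> n"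
        using calculation(2) * pi_gt3 by (intro mult_left_mono) auto
      ultimately show ?thesis using * by (simp add: mult.commute)
    qed
    have ball: "1 / 4 \<le> (LINT z:cball c \<eta>|lborel. exp (u n z))" if c: "8 * pi * 1 - 1 < \<rho> n * tint (\<lambda>z. exp (u n z) * tent L r (z - c))" for c
    proof -
      let ?t = "tint (\<lambda>z. exp (u n z) * tent L r (z - c))"
      \<comment> \<open>Since \<open>\<rho> n < 17 * pi\<close>, a value below 1/4 would give at
        most \<open>17 * pi / 4\<close>, which is less than \<open>8 * pi - 1\<close>.\<close>
      have "1 / 4 \<le> ?t"
      proof (rule ccontr)
        assume "\<not> 1 / 4 \<le> ?t"
        then have "\<rho> n * ?t \<le> \<rho> n * (1 / 4)" using * pi_gt3 by (intro mult_left_mono) auto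
        then show False using c * pi_gt3 by linarith
      qed
      also have "?t \<le> (LINT z:cball c r|lborel. exp (u n z))"
        by (rule tent_mass_le[OF r(1) r2 ce pe]) (use L_subset_Z in auto)
      also have "\<dots> \<le> (LINT z:cball c \<eta>|lborel. exp (u n z))" by (rule set_integral_cball_mono[OF ce]) (use r in auto)
      finally show ?thesis .
    qed
    have "concentrated \<eta> (\<rho> n) (u n) p h"
      unfolding concentrated_def using ph per[of n] even one[of n] far ball[of 0] ball[of p2] * by auto
    then show "\<exists>p h. concentrated \<eta> (\<rho> n) (u n) p h" by blast
  qed
qed

end

subsection \<open>The half torus\<close>

text \<open>An oriented basis of the enlarged lattice must be exhibited, because
  \<open>fund_domain\<close> is meaningful only for sets that have one.\<close>

lemma adjoin_half_period:
  assumes "Im (b / a) > 0" "p \<in> {a / 2, b / 2, (a + b) / 2}"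
  shows "\<exists>a' b'. Im (b' / a') > 0 \<and> adjoin (lattice a b) p = lattice a' b'"
proof -
  have a: "a \<noteq> 0" using assms(1) by auto
  have sc: "Im (of_real c * x) = c * Im x" for c x by simp
  consider "p = a / 2" | "p = b / 2" | "p = (a + b) / 2" using assms(2) by auto
  then show ?thesis
  proof cases
    case 1
    have "of_int m * a + of_int n * b + of_int k * (a / 2) = of_int (2 * m + k) * (a / 2) + of_int n * b" for m n k by (simp add: field_simps)
    moreover have "of_int m * (a / 2) + of_int n * b = of_int 0 * a + of_int n * b + of_int m * (a / 2)" for m n by simp
    ultimately have "adjoin (lattice a b) p = lattice (a / 2) b" unfolding adjoin_def lattice_def 1 by blast
    moreover have "0 < Im (b / (a / 2))" using assms(1) sc[of 2 "b / a"] by (simp add: mult.commute)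
    ultimately show ?thesis by blast
  next
    case 2
    have "of_int m * a + of_int n * b + of_int k * (b / 2) = of_int m * a + of_int (2 * n + k) * (b / 2)" for m n k by (simp add: field_simps)
    moreover have "of_int m * a + of_int n * (b / 2) = of_int m * a + of_int 0 * b + of_int n * (b / 2)" for m n by simp
    ultimately have "adjoin (lattice a b) p = lattice a (b / 2)" unfolding adjoin_def lattice_def 2 by blast
    moreover have "0 < Im (b / 2 / a)" using assms(1) sc[of "1 / 2" "b / a"] by (simp add: mult.commute)
    ultimately show ?thesis by blast
  next
    case 3
    \<comment> \<open>In this case \<open>b\<close> is eliminated as twice the half period minus
      \<open>a\<close>.\<close>
    have "of_int m * a + of_int n * b + of_int k * ((a + b) / 2) = of_int (m - n) * a + of_int (2 * n + k) * ((a + b) / 2)" for m n k by (simp add: field_simps)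
    moreover have "of_int m * a + of_int n * ((a + b) / 2) = of_int m * a + of_int 0 * b + of_int n * ((a + b) / 2)" for m n by simp
    ultimately have "adjoin (lattice a b) p = lattice a ((a + b) / 2)" unfolding adjoin_def lattice_def 3 by blast
    moreover have "(a + b) / 2 / a = of_real (1 / 2) * (1 + b / a)" using a by (simp add: field_simps)
    then have "0 < Im ((a + b) / 2 / a)" using assms(1) by (simp only: sc) simp
    ultimately show ?thesis by blast
  qed
qed

lemma lattice_double_half_period:
  assumes "p \<in> {a / 2, b / 2, (a + b) / 2}"
  shows "p + p \<in> lattice a b"
proof -
  have "p + p = of_int 1 * a + of_int 0 * b \<or> p + p = of_int 0 * a + of_int 1 * b \<or> p + p = of_int 1 * a + of_int 1 * b"
    using assms by (auto simp: field_simps)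
  then show ?thesis unfolding lattice_def by blast
qed

lemma discrete_subgroup_of_int_mult:
  assumes "discrete_subgroup A" "x \<in> A"
  shows "of_int k * x \<in> A"
proof (induction k rule: int_induct[where k = 0])
  case base
  then show ?case using discrete_subgroupD(1)[OF assms(1)] by simp
next
  case (step1 i)
  then show ?case using discrete_subgroupD(4)[OF assms(1) _ assms(2)] by (simp add: distrib_right)
next
  case (step2 i)
  then show ?case using discrete_subgroupD(2)[OF assms(1) _ assms(2)] by (simp add: left_diff_distrib)
qed

context blow
begin

lemma Z_adjoin: "Z = adjoin L p2"
proof
  show "Z \<subseteq> adjoin L p2"
  proof
    fix z assume "z \<in> Z"
    then consider "z \<in> L" | "z - p2 \<in> L" by (auto simp: Z_def)
    then show "z \<in> adjoin L p2"
    proof cases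
      case 1
      then show ?thesis unfolding adjoin_def by (intro CollectI exI[of _ z] exI[of _ 0]) simp
    next
      case 2
      then show ?thesis unfolding adjoin_def by (intro CollectI exI[of _ "z - p2"] exI[of _ 1]) simp
    qed
  qed
  show "adjoin L p2 \<subseteq> Z"
    unfolding adjoin_def using discrete_subgroupD(4)[OF discrete_subgroup_Z] L_subset_Z discrete_subgroup_of_int_mult[OF discrete_subgroup_Z p2_Z] by blast
qed

text \<open>\<open>Z\<close> is the disjoint union of two cosets of \<open>L\<close>. The
  representative of \<open>z\<close> modulo \<open>Z\<close> lies in one of them, and this decides
  whether \<open>D\<close> or its translate contains the representative modulo
  \<open>L\<close>.\<close>

lemma fd_double:
  assumes D: "fundamental_domain Z D"
  shows "fundamental_domain L (D \<union> (+) p2 ` D)" "D \<inter> (+) p2 ` D = {}"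
proof -
  have img: "z \<in> (+) p2 ` D \<longleftrightarrow> z - p2 \<in> D" for z by (auto simp: image_iff intro: bexI[of _ "z - p2"])
  have xor: "\<not> (q \<in> L \<and> q - p2 \<in> L)" for q using discrete_subgroupD(2)[OF L, of q "q - p2"] p2(1) by auto
  show "fundamental_domain L (D \<union> (+) p2 ` D)"
    unfolding fundamental_domain_def
  proof (intro conjI allI)
    show "D \<union> (+) p2 ` D \<in> sets borel" "bounded (D \<union> (+) p2 ` D)"
      using D fd_translate[OF D, of p2] by (auto simp: fundamental_domain_def)
    fix z
    obtain q where q: "q \<in> Z" "z - q \<in> D" "\<And>q'. q' \<in> Z \<Longrightarrow> z - q' \<in> D \<Longrightarrow> q' = q"
      using fundamental_domain_obtain[OF D, of z] by blast
    show "\<exists>!l. l \<in> L \<and> z - l \<in> D \<union> (+) p2 ` D"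
    proof (cases "q \<in> L")
      case True
      show ?thesis
      proof (rule ex1I[of _ q])
        show "q \<in> L \<and> z - q \<in> D \<union> (+) p2 ` D" using True q(2) by simp
        fix l assume l: "l \<in> L \<and> z - l \<in> D \<union> (+) p2 ` D"
        then consider "z - l \<in> D" | "z - (l + p2) \<in> D" by (auto simp: img algebra_simps)
        then show "l = q"
        proof cases
          case 1
          then show ?thesis using q(3) l L_subset_Z by blast
        next
          case 2
          moreover have "l + p2 \<in> Z" using l by (simp add: Z_def)
          ultimately have "l + p2 = q" by (intro q(3))
          then show ?thesis using xor[of q] True l by auto
        qed
      qed
    next
      case False
      then have qp: "q - p2 \<in> L" using q(1) by (simp add: Z_def)
      show ?thesis
      proof (rule ex1I[of _ "q - p2"])
        show "q - p2 \<in> L \<and> z - (q - p2) \<in> D \<union> (+) p2 ` D" using qp q(2) by (simp add: img)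
        fix l assume l: "l \<in> L \<and> z - l \<in> D \<union> (+) p2 ` D"
        then consider "z - l \<in> D" | "z - (l + p2) \<in> D" by (auto simp: img algebra_simps)
        then show "l = q - p2"
        proof cases
          case 1
          then have "l = q" using q(3) l L_subset_Z by blast
          then show ?thesis using False l by blast
        next
          case 2
          moreover have "l + p2 \<in> Z" using l by (simp add: Z_def)
          ultimately have "l + p2 = q" by (intro q(3))
          then show ?thesis by auto
        qed
      qed
    qed
  qed
  show "D \<inter> (+) p2 ` D = {}"
  proof (rule ccontr)
    assume "D \<inter> (+) p2 ` D \<noteq> {}"
    then obtain z where "z \<in> D" "z \<in> (+) p2 ` D" by blast
    then have z: "z - 0 \<in> D" "z - p2 \<in> D" by (simp_all add: img)
    obtain q where q: "\<And>q'. q' \<in> Z \<Longrightarrow> z - q' \<in> D \<Longrightarrow> q' = q" using fundamental_domain_obtain[OF D, of z] by blast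
    have "0 = q" "p2 = q" by (rule q[OF discrete_subgroupD(1)[OF discrete_subgroup_Z] z(1)], rule q[OF p2_Z z(2)])
    then have "p2 = 0" by simp
    then show False using p2(1) discrete_subgroupD(1)[OF L] by simp
  qed
qed

lemma tint_double:
  assumes T: "torus Z" and f: "bounded_borel f" "periodic Z f"
  shows "tint f = 2 * torus_integral Z f"
proof -
  interpret H: torus Z by (rule T)
  let ?D = "fund_domain Z"
  note D = fd_double[OF H.fd]
  have fm: "f \<in> borel_measurable borel" using f by (simp add: bounded_borel_def)
  obtain B where B: "\<And>z. \<bar>f z\<bar> \<le> B" using f by (auto simp: bounded_borel_def)
  have pL: "periodic L f" using f(2) L_subset_Z by (auto simp: periodic_def)
  have si: "set_integrable lborel X f" if "fundamental_domain Z X" for X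
    by (rule set_integrable_bounded[OF fm B]) (use that in \<open>auto simp: fundamental_domain_def\<close>)
  have t: "fundamental_domain Z ((+) p2 ` ?D)" by (rule fd_translate[OF H.fd])
  have "tint f = (LINT z:?D \<union> (+) p2 ` ?D|lborel. f z)"
    unfolding torus_integral_def by (rule fd_integral_eq[OF L fd D(1) fm B pL])
  also have "\<dots> = (LINT z:?D|lborel. f z) + (LINT z:(+) p2 ` ?D|lborel. f z)"
    by (rule set_integral_Un[OF D(2) si[OF H.fd] si[OF t]])
  also have "(LINT z:(+) p2 ` ?D|lborel. f z) = (LINT z:?D|lborel. f z)"
    by (rule fd_integral_eq[OF discrete_subgroup_Z t H.fd fm B f(2)])
  finally show ?thesis by (simp add: torus_integral_def)
qed

end

theorem corollary1p3:
  fixes \<omega>1 \<omega>2 p2 :: complex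
    and \<Lambda> \<Lambda>_half :: "complex set"
    and u :: "nat \<Rightarrow> complex \<Rightarrow> real"
    and \<rho> :: "nat \<Rightarrow> real"
  assumes "Im (\<omega>2 / \<omega>1) > 0"
    and "\<Lambda> = lattice \<omega>1 \<omega>2"
    and "torus_area \<Lambda> = 1"
    and "p2 \<in> {\<omega>1 / 2, \<omega>2 / 2, (\<omega>1 + \<omega>2) / 2}"
    and "\<Lambda>_half = adjoin \<Lambda> p2"
    and "\<And>n. mean_field_solution \<Lambda> (\<rho> n) (u n)"
    and "\<And>n. torus_integral \<Lambda> (\<lambda>z. exp (u n z)) = 1"
    and "\<And>n z. u n z = u n (- z)"
    and "blows_up_at \<Lambda> u \<rho> [0, p2]"
  shows "torus_area \<Lambda>_half = 1 / 2 \<and>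
    (\<exists>N. (\<forall>n\<ge>N. (\<forall>z. u n z = u n (z + p2)) \<and>
                mean_field_solution \<Lambda>_half (\<rho> n / 2) (u n)) \<and>
         blows_up_at \<Lambda>_half (\<lambda>n. u (N + n)) (\<lambda>n. \<rho> (N + n) / 2) [0])"
proof -
  note sol = assms(6) and one = assms(7) and blowup = assms(9)
  have g: "discrete_subgroup \<Lambda>" unfolding assms(2) by (rule discrete_subgroup_lattice[OF assms(1)])
  \<comment> \<open>The distinctness of the two points in the blow-up assumption excludes that
    \<open>p2\<close> is a period.\<close>
  have "0 - p2 \<notin> \<Lambda>" using blowup by (simp add: blows_up_at_def)
  then have p2: "p2 \<notin> \<Lambda>" using discrete_subgroupD(3)[OF g] by auto
  interpret blow \<Lambda> p2
  proof
    show "fundamental_domain \<Lambda> (fund_domain \<Lambda>)" unfolding assms(2) by (rule fund_domain_fd[OF assms(1)])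
    show "p2 + p2 \<in> \<Lambda>" unfolding assms(2) by (rule lattice_double_half_period[OF assms(4)])
  qed (use g p2 assms(3) in auto)
  have half: "\<Lambda>_half = Z" by (simp add: Z_adjoin assms(5))
  obtain a b where "Im (b / a) > 0 \<and> adjoin (lattice \<omega>1 \<omega>2) p2 = lattice a b"
    using adjoin_half_period[OF assms(1,4)] by (elim exE)
  then have ab: "Im (b / a) > 0" and "adjoin \<Lambda> p2 = lattice a b" using assms(2) by simp_all
  from Z_adjoin this(2) have ab2: "Z = lattice a b" by (rule trans)
  have T: "torus Z" unfolding torus_def ab2 using discrete_subgroup_lattice[OF ab] fund_domain_fd[OF ab] by (rule conjI)
  interpret H: torus Z by (rule T)
  have areaZ: "torus_area Z = 1 / 2"
    using tint_double[OF T, of "\<lambda>z. 1"] tint_const[of 1] H.tint_const[of 1] area by (simp add: periodic_def)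
  obtain \<eta> where \<eta>: "\<eta> > 0" "\<And>\<rho> u p h z. concentrated \<eta> \<rho> u p h \<Longrightarrow> u (z + p2) = u z" using half_period by blast
  have "\<forall>\<^sub>F n in sequentially. \<exists>p h. concentrated \<eta> (\<rho> n) (u n) p h"
    by (rule eventually_concentrated[OF blowup one _ \<eta>(1)]) (rule assms(8)[symmetric])
  then obtain N where N: "\<And>n. n \<ge> N \<Longrightarrow> \<exists>p h. concentrated \<eta> (\<rho> n) (u n) p h" by (auto simp: eventually_sequentially)
  have inv: "u n (z + p2) = u n z" if "n \<ge> N" for n z using N[OF that] \<eta>(2) by blast
  have perL: "periodic \<Lambda> (u n)" and C2: "C2 (u n)" for n using sol[of n] by (auto simp: mean_field_solution_def)
  have cont: "continuous_on UNIV (u n)" for n using C2_wdata[OF C2[of n]] wdataD(6) by metis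
  have perZ: "periodic Z (u n)" if n: "n \<ge> N" for n
    unfolding periodic_def
  proof (intro ballI allI)
    fix q z assume "q \<in> Z"
    then consider "q \<in> \<Lambda>" | "q - p2 \<in> \<Lambda>" by (auto simp: Z_def)
    then show "u n (z + q) = u n z"
    proof cases
      case 1
      then show ?thesis by (rule periodicD[OF perL])
    next
      case 2
      then have "u n ((z + p2) + (q - p2)) = u n (z + p2)" by (rule periodicD[OF perL])
      then show ?thesis using inv[OF n] by simp
    qed
  qed
  have halfint: "torus_integral Z (\<lambda>z. exp (u n z)) = 1 / 2" if n: "n \<ge> N" for n
  proof -
    have c: "continuous_on UNIV (\<lambda>z. exp (u n z))" by (intro continuous_intros cont)
    have "periodic Z (\<lambda>z. exp (u n z))" using perZ[OF n] by (simp add: periodic_def)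
    then show ?thesis using tint_double[OF T H.bounded_borel_continuous[OF c]] one[of n] by simp
  qed
  \<comment> \<open>The integral of \<open>exp u\<close> and the area are both halved, which cancels
    the halving of \<rho>: the pointwise equation is unchanged, only the periodicity is new.\<close>
  have solZ: "mean_field_solution Z (\<rho> n / 2) (u n)" if n: "n \<ge> N" for n
    using sol[of n] perZ[OF n] unfolding mean_field_solution_def halfint[OF n] areaZ one area
    by (simp add: algebra_simps)
  have "blows_up_at Z (\<lambda>n. u (N + n)) (\<lambda>n. \<rho> (N + n) / 2) [0]"
    unfolding blows_up_at_def
  proof (intro conjI allI impI)
    show "mean_field_solution Z (\<rho> (N + n) / 2) (u (N + n))" for n by (rule solZ) simp
    show "\<exists>c>0. \<forall>n. torus_integral Z (\<lambda>z. exp (u (N + n) z)) = c" by (intro exI[of _ "1 / 2"]) (simp add: halfint)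
    show "sorted_wrt (\<lambda>p q. p - q \<notin> Z) [0]" by simp
    \<comment> \<open>Dropping the first \<open>N\<close> members cannot create a bound, as each of
      these finitely many functions is bounded above.\<close>
    show "\<not> (\<exists>C. \<forall>n z. u (N + n) z \<le> C)"
    proof
      assume "\<exists>C. \<forall>n z. u (N + n) z \<le> C"
      then obtain C where C: "\<And>n z. u (N + n) z \<le> C" by blast
      have "\<exists>C. \<forall>z. u n z \<le> C" for n using periodic_max[OF cont perL, of n] by blast
      then obtain B where B: "\<And>n z. u n z \<le> B n" by metis
      have "u n z \<le> Max (insert C (B ` {..<N}))" for n z
      proof (cases "n < N")
        case True
        then have "B n \<le> Max (insert C (B ` {..<N}))" by (intro Max_ge) auto
        then show ?thesis using B[of n z] by linarith
      next
        case False
        then have "u n z \<le> C" using C[of "n - N" z] by simp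
        also have "C \<le> Max (insert C (B ` {..<N}))" by (rule Max_ge) auto
        finally show ?thesis .
      qed
      then show False using blowup unfolding blows_up_at_def by blast
    qed
    have "\<rho> \<longlonglongrightarrow> 16 * pi" using blowup by (simp add: blows_up_at_def)
    from tendsto_divide[OF LIMSEQ_ignore_initial_segment[OF this, of N] tendsto_const[of 2]]
    show "(\<lambda>n. \<rho> (N + n) / 2) \<longlonglongrightarrow> 8 * pi * real (length [0 :: complex])" by (simp add: add.commute)
    fix \<phi> :: "complex \<Rightarrow> real" assume \<phi>: "continuous_on UNIV \<phi> \<and> periodic Z \<phi>"
    then have "continuous_on UNIV \<phi> \<and> periodic \<Lambda> \<phi>" using L_subset_Z by (auto simp: periodic_def)
    then have "(\<lambda>n. tint (\<lambda>z. \<rho> n * (exp (u n z) / tint (\<lambda>w. exp (u n w))) * \<phi> z)) \<longlonglongrightarrow> 8 * pi * (\<Sum>q\<leftarrow>[0, p2]. \<phi> q)"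
      using blowup by (simp add: blows_up_at_def)
    from tendsto_divide[OF LIMSEQ_ignore_initial_segment[OF this, of N] tendsto_const[of 2]]
    have lim: "(\<lambda>n. tint (\<lambda>z. \<rho> (N + n) * exp (u (N + n) z) * \<phi> z) / 2) \<longlonglongrightarrow> 8 * pi * (\<phi> 0 + \<phi> p2) / 2"
      by (simp add: add.commute one)
    \<comment> \<open>On the half torus both blow-up points are the origin: the two atoms merge, and
      halving leaves \<open>8 * pi * \<phi> 0\<close>.\<close>
    have "\<phi> p2 = \<phi> 0" using H.periodicD[of \<phi> p2 0] \<phi> p2_Z by simp
    moreover have "tint (\<lambda>z. \<rho> (N + n) * exp (u (N + n) z) * \<phi> z) / 2
        = torus_integral Z (\<lambda>z. \<rho> (N + n) / 2 * (exp (u (N + n) z) / torus_integral Z (\<lambda>w. exp (u (N + n) w))) * \<phi> z)" for n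
    proof -
      have c: "continuous_on UNIV (\<lambda>z. \<rho> (N + n) * exp (u (N + n) z) * \<phi> z)" using \<phi> by (intro continuous_intros cont) auto
      have p: "periodic Z (\<lambda>z. \<rho> (N + n) * exp (u (N + n) z) * \<phi> z)" using \<phi> perZ[of "N + n"] by (simp add: periodic_def)
      show ?thesis using tint_double[OF T H.bounded_borel_continuous[OF c p] p] by (simp add: halfint)
    qed
    ultimately show "(\<lambda>n. torus_integral Z (\<lambda>z. \<rho> (N + n) / 2 * (exp (u (N + n) z) / torus_integral Z (\<lambda>w. exp (u (N + n) w))) * \<phi> z))
      \<longlonglongrightarrow> 8 * pi * (\<Sum>q\<leftarrow>[0]. \<phi> q)"
      using lim by (simp add: mult.assoc)
  qed
  with areaZ inv solZ show ?thesis unfolding half by (intro conjI exI[of _ N]) auto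
qed

end
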